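(* Let $\lambda\in P^+$ and $\tau\in P^+$, and fix a reduced expression $\vec t_\tau=s_1\cdots s_na$ of $t_\tau$ ($s_i\in S$, $a\in\Pi$). Then in the affine Hecke algebra $\mathcal H$ $$C_{w_0t_\lambda}\mathsf s_\tau=C_{w_0t_\lambda}\mathsf h_\tau=\sum_JC_{w_0t_\lambda v_Jt_\tau^J},$$ where the sum is over all $\lambda$-dominant maximal admissible subsets $J\subset\{1,\ldots,n\}$ and $t_\tau^J=\big(\prod_{r=1,\,r\notin J}^ns_r\big)a$.
   Context: Geometry. $V$ is a Euclidean space with scalar product $(\cdot,\cdot)$, $\Phi\subset V$ an irreducible root system with positive roots $\Phi^+$ and simple roots $\Delta=\{\alpha_1,\ldots,\alpha_N\}$; $\langle x,\alpha^\vee\rangle=2(x,\alpha)/(\alpha,\alpha)$. For $\alpha\in\Phi$, $n\in\mathbf Z$ put $H_{\alpha,n}=\{x\in V\mid\langle x,\alpha^\vee\rangle=n\}$; $\mathcal F$ is the set of these hyperplanes. Each $H\in\mathcal F$ is $H_{\alpha,n}$ for a unique $(\alpha,n)\in\Phi^+\times\mathbf Z$; its direction is $\overline H=\alpha$. $W_a$ is the group generated by the orthogonal reflections $s_{\alpha,n}$ in the $H_{\alpha,n}$; $W_0$ is the stabiliser of $0$ (the finite Weyl group, with $s_\alpha=s_{\alpha,0}$) and $w_0$ its longest element. $W_a$ is a Coxeter group with generators $S=\{s_{\alpha_i,0}\mid1\le i\le N\}\cup\{s_{\tilde\alpha,1}\}$, where $\tilde\alpha^\vee$ is the highest root of $\Phi^\vee$.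 Alcoves are the connected components of $V\setminus\bigcup_{H\in\mathcal F}H$; $A_0=\{x\in V\mid0<\langle x,\alpha^\vee\rangle<1\ \forall\alpha\in\Phi^+\}$. A face of $A_0$ has type $s\in S$ if it lies in the fixed hyperplane of $s$; types are extended to all alcoves by the action of $W_a$. Weights. $L:W_a\to\mathbf N$ is a fixed positive weight function: $L(ww')=L(w)+L(w')$ whenever $\ell(ww')=\ell(w)+\ell(w')$, and $L(s)>0$ for $s\in S$. $H\in\mathcal F$ has weight $L(H)=L(s)$ if it contains a face of type $s$ (well defined). For $\alpha\in\Phi^+$, $L(\alpha)=\max_{\overline H=\alpha}L(H)$. For $x\in V$, $L(x)=\sum_{H\in\mathcal F,\,x\in H}L(H)$; $P$ is the set of $x\in V$ where $L(x)$ is maximal ($L$-weights); $P^+=\{\lambda\in P\mid\langle\lambda,\alpha^\vee\rangle\ge0\ \forall\alpha\in\Phi^+\}$. It is assumed that $0\in P$. Extended group. $W_e=W_0\ltimes P$, $t_\lambda$ is the translation by $\lambda\in P$, $\Pi$ is the stabiliser of $A_0$ in $W_e$, $W_e=\Pi\ltimes W_a$, and $A_w=wA_0$ for $w\in W_e$. Length, $L$ and Bruhat order extend to $W_e$: $\ell(aw)=\ell(w)$, $L(aw)=L(w)$, $aw<a'w'$ iff $a=a'$ and $w<w'$ ($a,a'\in\Pi$, $w,w'\in W_a$). $\mathcal C_{\mathrm{id}}=\{x\in V\mid\langle x,\alpha^\vee\rangle>0\ \forall\alpha\in\Phi^+\}$. $X_0=\{x\in W_e\mid\ell(w_0x)=\ell(w_0)+\ell(x)\}$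 is the set of minimal length right coset representatives of $W_0$ in $W_e$; it contains $t_\tau$ for $\tau\in P^+$. Hecke algebra. $\mathcal A=\mathbf C[\mathsf q,\mathsf q^{-1}]$; $\mathcal H$ is the free $\mathcal A$-module with basis $(T_w)_{w\in W_e}$ and multiplication given by $T_uT_v=T_{uv}$ if $\ell(uv)=\ell(u)+\ell(v)$ and $(T_s-\mathsf q^{L(s)})(T_s+\mathsf q^{-L(s)})=0$ for $s\in S$. The bar involution is the ring involution with $\overline{\mathsf q}=\mathsf q^{-1}$ and $\overline{\sum a_wT_w}=\sum\overline{a_w}T_{w^{-1}}^{-1}$. Put $\mathcal H_{<0}=\bigoplus_w\mathsf q^{-1}\mathbf Z[\mathsf q^{-1}]T_w$. $C_w$ is the unique element with $\overline{C_w}=C_w$ and $C_w\equiv T_w\bmod\mathcal H_{<0}$ (the Kazhdan-Lusztig basis); write $C_w=\sum_yP_{y,w}T_y$. For $\tau\in P^+$, $\mathsf h_\tau=\sum_{x'\in X_0}P_{w_0x',w_0t_\tau}T_{x'}$. Weyl characters. For $\lambda\in P$, $e^\lambda=T_{t_\mu}T_{t_\nu}^{-1}$ for any $\mu,\nu\in P^+$ with $\mu-\nu=\lambda$ (independent of the choice). $a_\lambda=\sum_{w\in W_0}(-1)^{\ell(w)}e^{w\lambda}$, $\rho=\frac12\sum_{\alpha\in\Phi^+}\alpha$, and $\mathsf s_\lambda=a_{\lambda+\rho}/a_\rho$ for $\lambda\in P^+$ (the Weyl characters, elements of the center of $\mathcal H$). Admissible subsets. For $\vec t_\tau=s_1\cdots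 s_na$, $J\subset\{1,\ldots,n\}$ and $1\le k<n$, let $\vec t_\tau^{\,J}[1,k]$ be the product of the $s_r$, $1\le r\le k$, $r\notin J$, in increasing order, and $\vec t_\tau^{\,J}[1,n]=t_\tau^J$. For $x\in W_e$, $p_J(x;\vec t_\tau)$ is the sequence of alcoves $\big(A_{x\vec t_\tau^{\,J}[1,k]}\big)_{1\le k\le n}$, contained in a subset of $V$ if all its alcoves are. Let $(\beta_k,N_k)\in\Phi^+\times\mathbf N$ be such that $H_{\beta_k,N_k}$ is the unique hyperplane separating $A_{s_1\cdots s_{k-1}}$ and $A_{s_1\cdots s_k}$. $J=\{i_1<\cdots<i_p\}$ is admissible if $\mathrm{id}<s_{\beta_{i_p}}<s_{\beta_{i_p}}s_{\beta_{i_{p-1}}}<\cdots<s_{\beta_{i_p}}\cdots s_{\beta_{i_1}}$ is a saturated chain in the Bruhat order on $W_0$; then $v_J=s_{\beta_{i_p}}\cdots s_{\beta_{i_1}}$. An admissible $J$ is $\lambda$-dominant if $p_J(t_\lambda v_J;\vec t_\tau)\subset\mathcal C_{\mathrm{id}}$, and maximal if $L(s_{i_\ell})=L(\beta_{i_\ell})$ for all $1\le\ell\le p$.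
   Formalization: If some parallel hyperplanes have different weights, half the sum of the positive roots is not in P, so a_ρ is undefined; there ρ is taken with each root having parallel hyperplanes of unequal weight doubled. In all other cases ρ is the stated half-sum. *)

theory Defs
  imports "HOL-Analysis.Analysis" "HOL-Library.Poly_Mapping"
begin

section \<open>Coxeter generalities for groups of maps\<close>

text \<open>All groups are sets of bijections under composition, so the product \<open>s\<^sub>1 \<dots> s\<^sub>n\<close> is
  \<open>s\<^sub>1 \<circ> \<dots> \<circ> s\<^sub>n\<close>.  The generating sets used below consist of involutions, so that the
  words in them already form a group.\<close>

definition word_prod :: "('v \<Rightarrow> 'v) list \<Rightarrow> 'v \<Rightarrow> 'v" where
  "word_prod ss = foldr (\<circ>) ss id"

definition generated :: "('v \<Rightarrow> 'v) set \<Rightarrow> ('v \<Rightarrow> 'v) set" where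
  "generated S = {word_prod ss | ss. set ss \<subseteq> S}"

definition cox_length :: "('v \<Rightarrow> 'v) set \<Rightarrow> ('v \<Rightarrow> 'v) \<Rightarrow> nat" where
  "cox_length S w = (LEAST n. \<exists>ss. set ss \<subseteq> S \<and> length ss = n \<and> word_prod ss = w)"

definition bruhat_less :: "('v \<Rightarrow> 'v) set \<Rightarrow> ('v \<Rightarrow> 'v) \<Rightarrow> ('v \<Rightarrow> 'v) \<Rightarrow> bool" where
  "bruhat_less S = (\<lambda>x y. x \<in> generated S \<and>
     (\<exists>u\<in>generated S. \<exists>s\<in>S. y = x \<circ> (u \<circ> s \<circ> inv u)) \<and> cox_length S x < cox_length S y)\<^sup>+\<^sup>+"

definition bruhat_covers :: "('v \<Rightarrow> 'v) set \<Rightarrow> ('v \<Rightarrow> 'v) \<Rightarrow> ('v \<Rightarrow> 'v) \<Rightarrow> bool" where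
  "bruhat_covers S x y \<longleftrightarrow> bruhat_less S x y \<and> \<not> (\<exists>z. bruhat_less S x z \<and> bruhat_less S z y)"

section \<open>Root systems and the affine Weyl group\<close>

definition coroot :: "'v::euclidean_space \<Rightarrow> 'v" where
  "coroot \<alpha> = (2 / (\<alpha> \<bullet> \<alpha>)) *\<^sub>R \<alpha>"

definition hyperplane :: "'v::euclidean_space \<Rightarrow> int \<Rightarrow> 'v set" where
  "hyperplane \<alpha> n = {x. x \<bullet> coroot \<alpha> = of_int n}"

definition affine_refl :: "'v::euclidean_space \<Rightarrow> int \<Rightarrow> 'v \<Rightarrow> 'v" where
  "affine_refl \<alpha> n x = x - (x \<bullet> coroot \<alpha> - of_int n) *\<^sub>R \<alpha>"

definition transl :: "'v::euclidean_space \<Rightarrow> 'v \<Rightarrow> 'v" where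
  "transl v x = v + x"

text \<open>Root systems are reduced: otherwise a hyperplane would not determine its direction.\<close>

definition root_system :: "'v::euclidean_space set \<Rightarrow> bool" where
  "root_system \<Phi> \<longleftrightarrow> finite \<Phi> \<and> span \<Phi> = UNIV \<and> 0 \<notin> \<Phi> \<and>
     (\<forall>\<alpha>\<in>\<Phi>. \<forall>\<beta>\<in>\<Phi>. affine_refl \<alpha> 0 \<beta> \<in> \<Phi>) \<and>
     (\<forall>\<alpha>\<in>\<Phi>. \<forall>\<beta>\<in>\<Phi>. \<beta> \<bullet> coroot \<alpha> \<in> \<int>) \<and>
     (\<forall>\<alpha>\<in>\<Phi>. \<forall>c. c *\<^sub>R \<alpha> \<in> \<Phi> \<longrightarrow> c = 1 \<or> c = -1)"

definition irreducible_root_system :: "'v::euclidean_space set \<Rightarrow> bool" where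
  "irreducible_root_system \<Phi> \<longleftrightarrow> root_system \<Phi> \<and> \<Phi> \<noteq> {} \<and>
     \<not> (\<exists>A B. A \<noteq> {} \<and> B \<noteq> {} \<and> A \<inter> B = {} \<and> A \<union> B = \<Phi> \<and> (\<forall>\<alpha>\<in>A. \<forall>\<beta>\<in>B. \<alpha> \<bullet> \<beta> = 0))"

definition nonneg_comb :: "'v::euclidean_space set \<Rightarrow> 'v \<Rightarrow> bool" where
  "nonneg_comb D x \<longleftrightarrow> (\<exists>c :: 'v \<Rightarrow> nat. x = (\<Sum>\<delta>\<in>D. real (c \<delta>) *\<^sub>R \<delta>))"

definition simple_roots :: "'v::euclidean_space set \<Rightarrow> 'v set \<Rightarrow> bool" where
  "simple_roots \<Phi> \<Delta> \<longleftrightarrow> \<Delta> \<subseteq> \<Phi> \<and> independent \<Delta> \<and>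
     (\<forall>\<beta>\<in>\<Phi>. nonneg_comb \<Delta> \<beta> \<or> nonneg_comb \<Delta> (- \<beta>))"

definition pos_roots :: "'v::euclidean_space set \<Rightarrow> 'v set \<Rightarrow> 'v set" where
  "pos_roots \<Phi> \<Delta> = {\<alpha>\<in>\<Phi>. nonneg_comb \<Delta> \<alpha>}"

definition hyperplanes :: "'v::euclidean_space set \<Rightarrow> 'v set set" where
  "hyperplanes \<Phi> = {hyperplane \<alpha> n | \<alpha> n. \<alpha> \<in> \<Phi>}"

definition direction :: "'v::euclidean_space set \<Rightarrow> 'v set \<Rightarrow> 'v set \<Rightarrow> 'v" where
  "direction \<Phi> \<Delta> H = (THE \<alpha>. \<alpha> \<in> pos_roots \<Phi> \<Delta> \<and> (\<exists>n. H = hyperplane \<alpha> n))"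

definition affine_weyl :: "'v::euclidean_space set \<Rightarrow> ('v \<Rightarrow> 'v) set" where
  "affine_weyl \<Phi> = generated {affine_refl \<alpha> n | \<alpha> n. \<alpha> \<in> \<Phi>}"

definition finite_weyl :: "'v::euclidean_space set \<Rightarrow> ('v \<Rightarrow> 'v) set" where
  "finite_weyl \<Phi> = {w \<in> affine_weyl \<Phi>. w 0 = 0}"

text \<open>The root whose coroot is the highest root of the dual root system.\<close>

definition alpha_tilde :: "'v::euclidean_space set \<Rightarrow> 'v set \<Rightarrow> 'v" where
  "alpha_tilde \<Phi> \<Delta> =
     (THE \<alpha>. \<alpha> \<in> \<Phi> \<and> (\<forall>\<beta>\<in>\<Phi>. nonneg_comb (coroot ` \<Delta>) (coroot \<alpha> - coroot \<beta>)))"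

definition finite_gens :: "'v::euclidean_space set \<Rightarrow> ('v \<Rightarrow> 'v) set" where
  "finite_gens \<Delta> = (\<lambda>\<alpha>. affine_refl \<alpha> 0) ` \<Delta>"

definition affine_gens :: "'v::euclidean_space set \<Rightarrow> 'v set \<Rightarrow> ('v \<Rightarrow> 'v) set" where
  "affine_gens \<Phi> \<Delta> = finite_gens \<Delta> \<union> {affine_refl (alpha_tilde \<Phi> \<Delta>) 1}"

definition fund_alcove :: "'v::euclidean_space set \<Rightarrow> 'v set \<Rightarrow> 'v set" where
  "fund_alcove \<Phi> \<Delta> = {x. \<forall>\<alpha>\<in>pos_roots \<Phi> \<Delta>. 0 < x \<bullet> coroot \<alpha> \<and> x \<bullet> coroot \<alpha> < 1}"

definition fund_chamber :: "'v::euclidean_space set \<Rightarrow> 'v set \<Rightarrow> 'v set" where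
  "fund_chamber \<Phi> \<Delta> = {x. \<forall>\<alpha>\<in>pos_roots \<Phi> \<Delta>. 0 < x \<bullet> coroot \<alpha>}"

definition alcove :: "'v::euclidean_space set \<Rightarrow> 'v set \<Rightarrow> ('v \<Rightarrow> 'v) \<Rightarrow> 'v set" where
  "alcove \<Phi> \<Delta> w = w ` fund_alcove \<Phi> \<Delta>"

definition longest_elt :: "'v::euclidean_space set \<Rightarrow> 'v set \<Rightarrow> 'v \<Rightarrow> 'v" where
  "longest_elt \<Phi> \<Delta> = (THE w. w \<in> finite_weyl \<Phi> \<and>
     (\<forall>v\<in>finite_weyl \<Phi>. cox_length (affine_gens \<Phi> \<Delta>) v \<le> cox_length (affine_gens \<Phi> \<Delta>) w))"

section \<open>Weights\<close>

text \<open>A weight function is given on all maps, but only its values on the affine Weyl group are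
  ever constrained or used.\<close>

definition pos_weight_function ::
  "'v::euclidean_space set \<Rightarrow> 'v set \<Rightarrow> (('v \<Rightarrow> 'v) \<Rightarrow> nat) \<Rightarrow> bool" where
  "pos_weight_function \<Phi> \<Delta> L \<longleftrightarrow>
     (\<forall>w\<in>affine_weyl \<Phi>. \<forall>w'\<in>affine_weyl \<Phi>.
        cox_length (affine_gens \<Phi> \<Delta>) (w \<circ> w')
          = cox_length (affine_gens \<Phi> \<Delta>) w + cox_length (affine_gens \<Phi> \<Delta>) w'
        \<longrightarrow> L (w \<circ> w') = L w + L w') \<and>
     (\<forall>s\<in>affine_gens \<Phi> \<Delta>. L s > 0)"

text \<open>The faces that carry a type are those of codimension one.\<close>

definition face_of_type ::
  "'v::euclidean_space set \<Rightarrow> 'v set \<Rightarrow> ('v \<Rightarrow> 'v) \<Rightarrow> 'v set \<Rightarrow> bool" where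
  "face_of_type \<Phi> \<Delta> s F \<longleftrightarrow> s \<in> affine_gens \<Phi> \<Delta> \<and>
     (\<exists>w\<in>affine_weyl \<Phi>. \<exists>F0. F0 facet_of closure (fund_alcove \<Phi> \<Delta>) \<and>
        F0 \<subseteq> {x. s x = x} \<and> F = w ` F0)"

definition hyperplane_weight ::
  "'v::euclidean_space set \<Rightarrow> 'v set \<Rightarrow> (('v \<Rightarrow> 'v) \<Rightarrow> nat) \<Rightarrow> 'v set \<Rightarrow> nat" where
  "hyperplane_weight \<Phi> \<Delta> L H = (THE k. \<exists>s F. face_of_type \<Phi> \<Delta> s F \<and> F \<subseteq> H \<and> k = L s)"

definition root_weight ::
  "'v::euclidean_space set \<Rightarrow> 'v set \<Rightarrow> (('v \<Rightarrow> 'v) \<Rightarrow> nat) \<Rightarrow> 'v \<Rightarrow> nat" where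
  "root_weight \<Phi> \<Delta> L \<alpha> =
     Max {hyperplane_weight \<Phi> \<Delta> L H | H. H \<in> hyperplanes \<Phi> \<and> direction \<Phi> \<Delta> H = \<alpha>}"

definition point_weight ::
  "'v::euclidean_space set \<Rightarrow> 'v set \<Rightarrow> (('v \<Rightarrow> 'v) \<Rightarrow> nat) \<Rightarrow> 'v \<Rightarrow> nat" where
  "point_weight \<Phi> \<Delta> L x = (\<Sum>H | H \<in> hyperplanes \<Phi> \<and> x \<in> H. hyperplane_weight \<Phi> \<Delta> L H)"

definition L_weights ::
  "'v::euclidean_space set \<Rightarrow> 'v set \<Rightarrow> (('v \<Rightarrow> 'v) \<Rightarrow> nat) \<Rightarrow> 'v set" where
  "L_weights \<Phi> \<Delta> L = {x. \<forall>y. point_weight \<Phi> \<Delta> L y \<le> point_weight \<Phi> \<Delta> L x}"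

definition dom_weights ::
  "'v::euclidean_space set \<Rightarrow> 'v set \<Rightarrow> (('v \<Rightarrow> 'v) \<Rightarrow> nat) \<Rightarrow> 'v set" where
  "dom_weights \<Phi> \<Delta> L = {x \<in> L_weights \<Phi> \<Delta> L. \<forall>\<alpha>\<in>pos_roots \<Phi> \<Delta>. 0 \<le> x \<bullet> coroot \<alpha>}"

section \<open>The extended affine Weyl group\<close>

definition ext_weyl ::
  "'v::euclidean_space set \<Rightarrow> 'v set \<Rightarrow> (('v \<Rightarrow> 'v) \<Rightarrow> nat) \<Rightarrow> ('v \<Rightarrow> 'v) set" where
  "ext_weyl \<Phi> \<Delta> L = {transl \<nu> \<circ> w | \<nu> w. \<nu> \<in> L_weights \<Phi> \<Delta> L \<and> w \<in> finite_weyl \<Phi>}"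

definition alcove_stab ::
  "'v::euclidean_space set \<Rightarrow> 'v set \<Rightarrow> (('v \<Rightarrow> 'v) \<Rightarrow> nat) \<Rightarrow> ('v \<Rightarrow> 'v) set" where
  "alcove_stab \<Phi> \<Delta> L = {x \<in> ext_weyl \<Phi> \<Delta> L. x ` fund_alcove \<Phi> \<Delta> = fund_alcove \<Phi> \<Delta>}"

definition ext_length ::
  "'v::euclidean_space set \<Rightarrow> 'v set \<Rightarrow> (('v \<Rightarrow> 'v) \<Rightarrow> nat) \<Rightarrow> ('v \<Rightarrow> 'v) \<Rightarrow> nat" where
  "ext_length \<Phi> \<Delta> L x = (THE n. \<exists>a\<in>alcove_stab \<Phi> \<Delta> L. \<exists>w\<in>affine_weyl \<Phi>.
     x = a \<circ> w \<and> n = cox_length (affine_gens \<Phi> \<Delta>) w)"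

definition min_coset_reps ::
  "'v::euclidean_space set \<Rightarrow> 'v set \<Rightarrow> (('v \<Rightarrow> 'v) \<Rightarrow> nat) \<Rightarrow> ('v \<Rightarrow> 'v) set" where
  "min_coset_reps \<Phi> \<Delta> L = {x \<in> ext_weyl \<Phi> \<Delta> L.
     ext_length \<Phi> \<Delta> L (longest_elt \<Phi> \<Delta> \<circ> x)
       = ext_length \<Phi> \<Delta> L (longest_elt \<Phi> \<Delta>) + ext_length \<Phi> \<Delta> L x}"

section \<open>The affine Hecke algebra and its Kazhdan-Lusztig basis\<close>

text \<open>Laurent polynomials are finitely supported functions on the exponents, with convolution
  as product.\<close>

type_synonym laurent = "int \<Rightarrow>\<^sub>0 complex"
type_synonym 'v hecke = "('v \<Rightarrow> 'v) \<Rightarrow>\<^sub>0 laurent"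

definition q_pow :: "int \<Rightarrow> laurent" where
  "q_pow n = Poly_Mapping.single n 1"

definition laurent_bar :: "laurent \<Rightarrow> laurent" where
  "laurent_bar p = Poly_Mapping.map_key uminus p"

definition hscale :: "laurent \<Rightarrow> 'v hecke \<Rightarrow> 'v hecke" where
  "hscale c h = Poly_Mapping.map (\<lambda>d. c * d) h"

definition hT :: "('v \<Rightarrow> 'v) \<Rightarrow> 'v hecke" where
  "hT w = Poly_Mapping.single w 1"

definition hecke_carrier ::
  "'v::euclidean_space set \<Rightarrow> 'v set \<Rightarrow> (('v \<Rightarrow> 'v) \<Rightarrow> nat) \<Rightarrow> 'v hecke set" where
  "hecke_carrier \<Phi> \<Delta> L = {h. Poly_Mapping.keys h \<subseteq> ext_weyl \<Phi> \<Delta> L}"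

text \<open>The operation \<open>m\<close> is the multiplication of the affine Hecke algebra on the free module
  with basis \<open>hT w\<close>.  These conditions determine \<open>m\<close> on the carrier; the unit is \<open>hT id\<close>.\<close>

definition hecke_mult ::
  "'v::euclidean_space set \<Rightarrow> 'v set \<Rightarrow> (('v \<Rightarrow> 'v) \<Rightarrow> nat) \<Rightarrow>
   ('v hecke \<Rightarrow> 'v hecke \<Rightarrow> 'v hecke) \<Rightarrow> bool" where
  "hecke_mult \<Phi> \<Delta> L m \<longleftrightarrow> (let H = hecke_carrier \<Phi> \<Delta> L; W = ext_weyl \<Phi> \<Delta> L in
     (\<forall>x\<in>H. \<forall>y\<in>H. m x y \<in> H) \<and>
     (\<forall>x\<in>H. \<forall>y\<in>H. \<forall>z\<in>H. m (x + y) z = m x z + m y z \<and> m z (x + y) = m z x + m z y) \<and>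
     (\<forall>x\<in>H. \<forall>y\<in>H. \<forall>c. m (hscale c x) y = hscale c (m x y) \<and> m x (hscale c y) = hscale c (m x y)) \<and>
     (\<forall>x\<in>H. \<forall>y\<in>H. \<forall>z\<in>H. m (m x y) z = m x (m y z)) \<and>
     (\<forall>u\<in>W. \<forall>v\<in>W. ext_length \<Phi> \<Delta> L (u \<circ> v) = ext_length \<Phi> \<Delta> L u + ext_length \<Phi> \<Delta> L v
        \<longrightarrow> m (hT u) (hT v) = hT (u \<circ> v)) \<and>
     (\<forall>s\<in>affine_gens \<Phi> \<Delta>.
        m (hT s - hscale (q_pow (int (L s))) (hT id)) (hT s + hscale (q_pow (- int (L s))) (hT id)) = 0))"

definition hinv ::
  "'v::euclidean_space set \<Rightarrow> 'v set \<Rightarrow> (('v \<Rightarrow> 'v) \<Rightarrow> nat) \<Rightarrow>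
   ('v hecke \<Rightarrow> 'v hecke \<Rightarrow> 'v hecke) \<Rightarrow> 'v hecke \<Rightarrow> 'v hecke" where
  "hinv \<Phi> \<Delta> L m x = (THE y. y \<in> hecke_carrier \<Phi> \<Delta> L \<and> m x y = hT id \<and> m y x = hT id)"

definition hecke_bar ::
  "'v::euclidean_space set \<Rightarrow> 'v set \<Rightarrow> (('v \<Rightarrow> 'v) \<Rightarrow> nat) \<Rightarrow>
   ('v hecke \<Rightarrow> 'v hecke \<Rightarrow> 'v hecke) \<Rightarrow> 'v hecke \<Rightarrow> 'v hecke" where
  "hecke_bar \<Phi> \<Delta> L m h = (\<Sum>w\<in>Poly_Mapping.keys h.
     hscale (laurent_bar (Poly_Mapping.lookup h w)) (hinv \<Phi> \<Delta> L m (hT (inv w))))"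

definition hecke_neg ::
  "'v::euclidean_space set \<Rightarrow> 'v set \<Rightarrow> (('v \<Rightarrow> 'v) \<Rightarrow> nat) \<Rightarrow> 'v hecke set" where
  "hecke_neg \<Phi> \<Delta> L = {h \<in> hecke_carrier \<Phi> \<Delta> L. \<forall>w n.
     Poly_Mapping.lookup (Poly_Mapping.lookup h w) n \<in> \<int> \<and>
     (n \<ge> 0 \<longrightarrow> Poly_Mapping.lookup (Poly_Mapping.lookup h w) n = 0)}"

definition KL_basis ::
  "'v::euclidean_space set \<Rightarrow> 'v set \<Rightarrow> (('v \<Rightarrow> 'v) \<Rightarrow> nat) \<Rightarrow>
   ('v hecke \<Rightarrow> 'v hecke \<Rightarrow> 'v hecke) \<Rightarrow> ('v \<Rightarrow> 'v) \<Rightarrow> 'v hecke" where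
  "KL_basis \<Phi> \<Delta> L m w = (THE C. C \<in> hecke_carrier \<Phi> \<Delta> L \<and>
     hecke_bar \<Phi> \<Delta> L m C = C \<and> C - hT w \<in> hecke_neg \<Phi> \<Delta> L)"

definition KL_coeff ::
  "'v::euclidean_space set \<Rightarrow> 'v set \<Rightarrow> (('v \<Rightarrow> 'v) \<Rightarrow> nat) \<Rightarrow>
   ('v hecke \<Rightarrow> 'v hecke \<Rightarrow> 'v hecke) \<Rightarrow> ('v \<Rightarrow> 'v) \<Rightarrow> ('v \<Rightarrow> 'v) \<Rightarrow> laurent" where
  "KL_coeff \<Phi> \<Delta> L m y w = Poly_Mapping.lookup (KL_basis \<Phi> \<Delta> L m w) y"

text \<open>The sum over all minimal coset representatives, restricted to its finitely many nonzero
  terms.\<close>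

definition h_elt ::
  "'v::euclidean_space set \<Rightarrow> 'v set \<Rightarrow> (('v \<Rightarrow> 'v) \<Rightarrow> nat) \<Rightarrow>
   ('v hecke \<Rightarrow> 'v hecke \<Rightarrow> 'v hecke) \<Rightarrow> 'v \<Rightarrow> 'v hecke" where
  "h_elt \<Phi> \<Delta> L m \<tau> = (let P = (\<lambda>x. KL_coeff \<Phi> \<Delta> L m (longest_elt \<Phi> \<Delta> \<circ> x)
                                         (longest_elt \<Phi> \<Delta> \<circ> transl \<tau>))
     in \<Sum>x | x \<in> min_coset_reps \<Phi> \<Delta> L \<and> P x \<noteq> 0. hscale (P x) (hT x))"

section \<open>Weyl characters\<close>

definition e_elt ::
  "'v::euclidean_space set \<Rightarrow> 'v set \<Rightarrow> (('v \<Rightarrow> 'v) \<Rightarrow> nat) \<Rightarrow>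
   ('v hecke \<Rightarrow> 'v hecke \<Rightarrow> 'v hecke) \<Rightarrow> 'v \<Rightarrow> 'v hecke" where
  "e_elt \<Phi> \<Delta> L m \<kappa> = (THE h. \<exists>\<mu>\<in>dom_weights \<Phi> \<Delta> L. \<exists>\<nu>\<in>dom_weights \<Phi> \<Delta> L.
     \<mu> - \<nu> = \<kappa> \<and> h = m (hT (transl \<mu>)) (hinv \<Phi> \<Delta> L m (hT (transl \<nu>))))"

definition a_elt ::
  "'v::euclidean_space set \<Rightarrow> 'v set \<Rightarrow> (('v \<Rightarrow> 'v) \<Rightarrow> nat) \<Rightarrow>
   ('v hecke \<Rightarrow> 'v hecke \<Rightarrow> 'v hecke) \<Rightarrow> 'v \<Rightarrow> 'v hecke" where
  "a_elt \<Phi> \<Delta> L m \<kappa> = (\<Sum>w\<in>finite_weyl \<Phi>.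
     hscale ((-1) ^ cox_length (affine_gens \<Phi> \<Delta>) w) (e_elt \<Phi> \<Delta> L m (w \<kappa>)))"

text \<open>If parallel hyperplanes have equal weights, then \<open>rho\<close> is half the sum of the positive
  roots.  Otherwise (type \<open>A\<^sub>1\<close> or \<open>B\<^sub>r\<close>, with two weights for the hyperplanes of direction a
  short root) half that sum is not an \<open>L\<close>-weight, so that \<open>a_elt\<close> is not defined at it.  The
  hyperplanes of maximal weight are then those of the root system (\<open>A\<^sub>1\<close> or \<open>C\<^sub>r\<close>) in which the
  roots having parallel hyperplanes of different weights are doubled, and \<open>L_weights\<close> is the
  weight lattice of that system, whose half-sum of positive roots has to be used.\<close>

definition rho :: "'v::euclidean_space set \<Rightarrow> 'v set \<Rightarrow> (('v \<Rightarrow> 'v) \<Rightarrow> nat) \<Rightarrow> 'v" where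
  "rho \<Phi> \<Delta> L = (1/2) *\<^sub>R (\<Sum>\<alpha>\<in>pos_roots \<Phi> \<Delta>.
     if \<forall>n. hyperplane_weight \<Phi> \<Delta> L (hyperplane \<alpha> n) = root_weight \<Phi> \<Delta> L \<alpha>
     then \<alpha> else 2 *\<^sub>R \<alpha>)"

lemma rho_eq_half_sum:
  assumes "\<And>\<alpha> n. \<alpha> \<in> pos_roots \<Phi> \<Delta> \<Longrightarrow>
             hyperplane_weight \<Phi> \<Delta> L (hyperplane \<alpha> n) = root_weight \<Phi> \<Delta> L \<alpha>"
  shows "rho \<Phi> \<Delta> L = (1/2) *\<^sub>R \<Sum>(pos_roots \<Phi> \<Delta>)"
  unfolding rho_def using assms by (simp cong: sum.cong)

text \<open>The quotient defining a Weyl character is taken in the commutative subalgebra spanned by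
  the \<open>e_elt\<close>, which is the group algebra of \<open>L_weights\<close> and hence an integral domain.\<close>

definition lattice_algebra ::
  "'v::euclidean_space set \<Rightarrow> 'v set \<Rightarrow> (('v \<Rightarrow> 'v) \<Rightarrow> nat) \<Rightarrow>
   ('v hecke \<Rightarrow> 'v hecke \<Rightarrow> 'v hecke) \<Rightarrow> 'v hecke set" where
  "lattice_algebra \<Phi> \<Delta> L m =
     {\<Sum>\<mu>\<in>M. hscale (c \<mu>) (e_elt \<Phi> \<Delta> L m \<mu>) | M c. finite M \<and> M \<subseteq> L_weights \<Phi> \<Delta> L}"

definition weyl_character ::
  "'v::euclidean_space set \<Rightarrow> 'v set \<Rightarrow> (('v \<Rightarrow> 'v) \<Rightarrow> nat) \<Rightarrow>
   ('v hecke \<Rightarrow> 'v hecke \<Rightarrow> 'v hecke) \<Rightarrow> 'v \<Rightarrow> 'v hecke" where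
  "weyl_character \<Phi> \<Delta> L m \<kappa> = (THE h. h \<in> lattice_algebra \<Phi> \<Delta> L m \<and>
     m h (a_elt \<Phi> \<Delta> L m (rho \<Phi> \<Delta> L)) = a_elt \<Phi> \<Delta> L m (\<kappa> + rho \<Phi> \<Delta> L))"

section \<open>Admissible subsets\<close>

text \<open>An expression \<open>s\<^sub>1 \<dots> s\<^sub>n a\<close> is given by the list \<open>ss = [s\<^sub>1, \<dots>, s\<^sub>n]\<close> and by \<open>a\<close>.  Positions are
  counted from 1, so that \<open>s\<^sub>r\<close> is \<open>ss ! (r - 1)\<close>.\<close>

definition reduced_expr ::
  "'v::euclidean_space set \<Rightarrow> 'v set \<Rightarrow> (('v \<Rightarrow> 'v) \<Rightarrow> nat) \<Rightarrow>
   ('v \<Rightarrow> 'v) \<Rightarrow> ('v \<Rightarrow> 'v) list \<Rightarrow> ('v \<Rightarrow> 'v) \<Rightarrow> bool" where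
  "reduced_expr \<Phi> \<Delta> L x ss a \<longleftrightarrow> set ss \<subseteq> affine_gens \<Phi> \<Delta> \<and> a \<in> alcove_stab \<Phi> \<Delta> L \<and>
     x = word_prod ss \<circ> a \<and> length ss = ext_length \<Phi> \<Delta> L x"

definition subexpr_prefix ::
  "('v \<Rightarrow> 'v) list \<Rightarrow> ('v \<Rightarrow> 'v) \<Rightarrow> nat set \<Rightarrow> nat \<Rightarrow> 'v \<Rightarrow> 'v" where
  "subexpr_prefix ss a J k =
     word_prod (map (\<lambda>r. ss ! (r - 1)) (filter (\<lambda>r. r \<notin> J) [1..<Suc k]))
       \<circ> (if k < length ss then id else a)"

definition subexpr :: "('v \<Rightarrow> 'v) list \<Rightarrow> ('v \<Rightarrow> 'v) \<Rightarrow> nat set \<Rightarrow> 'v \<Rightarrow> 'v" where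
  "subexpr ss a J = subexpr_prefix ss a J (length ss)"

definition separates :: "'v::euclidean_space \<Rightarrow> int \<Rightarrow> 'v set \<Rightarrow> 'v set \<Rightarrow> bool" where
  "separates \<alpha> n A B \<longleftrightarrow>
     (\<forall>x\<in>A. \<forall>y\<in>B. x \<bullet> coroot \<alpha> < of_int n \<and> of_int n < y \<bullet> coroot \<alpha>) \<or>
     (\<forall>x\<in>A. \<forall>y\<in>B. y \<bullet> coroot \<alpha> < of_int n \<and> of_int n < x \<bullet> coroot \<alpha>)"

definition crossing ::
  "'v::euclidean_space set \<Rightarrow> 'v set \<Rightarrow> ('v \<Rightarrow> 'v) list \<Rightarrow> nat \<Rightarrow> 'v \<times> nat" where
  "crossing \<Phi> \<Delta> ss k = (THE p. fst p \<in> pos_roots \<Phi> \<Delta> \<and>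
     separates (fst p) (int (snd p)) (alcove \<Phi> \<Delta> (word_prod (take (k - 1) ss)))
                                     (alcove \<Phi> \<Delta> (word_prod (take k ss))))"

definition beta_root ::
  "'v::euclidean_space set \<Rightarrow> 'v set \<Rightarrow> ('v \<Rightarrow> 'v) list \<Rightarrow> nat \<Rightarrow> 'v" where
  "beta_root \<Phi> \<Delta> ss k = fst (crossing \<Phi> \<Delta> ss k)"

text \<open>For \<open>J = {i\<^sub>1 < \<dots> < i\<^sub>p}\<close>, the reflections in the roots of the positions \<open>i\<^sub>p, \<dots>, i\<^sub>1\<close>, in
  this order.\<close>

definition J_refls ::
  "'v::euclidean_space set \<Rightarrow> 'v set \<Rightarrow> ('v \<Rightarrow> 'v) list \<Rightarrow> nat set \<Rightarrow> ('v \<Rightarrow> 'v) list" where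
  "J_refls \<Phi> \<Delta> ss J =
     map (\<lambda>i. affine_refl (beta_root \<Phi> \<Delta> ss i) 0) (rev (sorted_list_of_set J))"

definition v_elt ::
  "'v::euclidean_space set \<Rightarrow> 'v set \<Rightarrow> ('v \<Rightarrow> 'v) list \<Rightarrow> nat set \<Rightarrow> 'v \<Rightarrow> 'v" where
  "v_elt \<Phi> \<Delta> ss J = word_prod (J_refls \<Phi> \<Delta> ss J)"

definition admissible ::
  "'v::euclidean_space set \<Rightarrow> 'v set \<Rightarrow> ('v \<Rightarrow> 'v) list \<Rightarrow> nat set \<Rightarrow> bool" where
  "admissible \<Phi> \<Delta> ss J \<longleftrightarrow> J \<subseteq> {1..length ss} \<and>
     (\<forall>k < card J. bruhat_covers (finite_gens \<Delta>)
        (word_prod (take k (J_refls \<Phi> \<Delta> ss J))) (word_prod (take (Suc k) (J_refls \<Phi> \<Delta> ss J))))"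

definition path_in ::
  "'v::euclidean_space set \<Rightarrow> 'v set \<Rightarrow> ('v \<Rightarrow> 'v) list \<Rightarrow> ('v \<Rightarrow> 'v) \<Rightarrow> nat set \<Rightarrow>
   ('v \<Rightarrow> 'v) \<Rightarrow> 'v set \<Rightarrow> bool" where
  "path_in \<Phi> \<Delta> ss a J x U \<longleftrightarrow>
     (\<forall>k\<in>{1..length ss}. alcove \<Phi> \<Delta> (x \<circ> subexpr_prefix ss a J k) \<subseteq> U)"

definition dominant_subset ::
  "'v::euclidean_space set \<Rightarrow> 'v set \<Rightarrow> ('v \<Rightarrow> 'v) list \<Rightarrow> ('v \<Rightarrow> 'v) \<Rightarrow> 'v \<Rightarrow> nat set \<Rightarrow> bool" where
  "dominant_subset \<Phi> \<Delta> ss a \<kappa> J \<longleftrightarrow>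
     path_in \<Phi> \<Delta> ss a J (transl \<kappa> \<circ> v_elt \<Phi> \<Delta> ss J) (fund_chamber \<Phi> \<Delta>)"

definition maximal_subset ::
  "'v::euclidean_space set \<Rightarrow> 'v set \<Rightarrow> (('v \<Rightarrow> 'v) \<Rightarrow> nat) \<Rightarrow> ('v \<Rightarrow> 'v) list \<Rightarrow> nat set \<Rightarrow> bool" where
  "maximal_subset \<Phi> \<Delta> L ss J \<longleftrightarrow>
     (\<forall>i\<in>J. L (ss ! (i - 1)) = root_weight \<Phi> \<Delta> L (beta_root \<Phi> \<Delta> ss i))"

end

theory Submission
  imports Defs
begin

text \<open>The spherical module \<open>C0 \<star> HH\<close>, where \<open>C0\<close> is the Kazhdan-Lusztig element of \<open>w0\<close>, has the basis
  \<open>C0 \<star> T z\<close> with \<open>z\<close> dominant, and the coefficient of \<open>T (w0 o z)\<close> reads off the coordinates. Right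
  multiplication by a generator either moves an alcove or folds the gallery, and every fold changes the
  degree in \<open>q\<close> by at most the drop of the weighted length of a finite direction, with equality exactly at a
  Bruhat cover and a hyperplane of maximal weight.

  Modulo negative powers of \<open>q\<close>, normalised right multiplication by \<open>T s\<close> acts on the span of the
  \<open>C0 \<star> E \<nu>\<close> as a Demazure operator. Applied to \<open>E \<tau>\<close> along a reduced word of \<open>w0\<close>, these operators
  give the Weyl character of \<open>\<tau>\<close>, which is central and bar invariant; hence its product with \<open>C0\<close> is the
  Kazhdan-Lusztig element of \<open>w0 o transl \<tau>\<close>, and both products in the theorem agree and are bar invariant.
  Counting the surviving folded galleries computes the product modulo negative powers of \<open>q\<close>, and a bar
  invariant element with coefficients of negative degree vanishes.\<close>

section \<open>Reflections\<close>

text \<open>Alcoves are rarely handled as point sets: an element is recorded by the integers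
  \<open>lev x a\<close>, the levels of one base point in all root directions, and length, dominance
  and wall crossings are bookkeeping with them. The obstacle is that parallel hyperplanes may differ
  in weight. Since 0 is an \<open>L\<close>-weight, the hyperplane through 0 is the heaviest of its
  direction; those equally heavy are spaced by \<open>dd a\<close>, which is 1 or 2, and this
  spacing survives in the Demazure operators and in \<open>rho\<close>. The elements
  \<open>v_J\<close> come from the left factor. Its coefficient at
  \<open>w0 o transl \<kappa> o v\<close> has leading part \<open>q_pow (- Lw v)\<close> whenever
  \<open>transl \<kappa> o v\<close> is dominant, so a gallery may start in any such direction
  \<open>v\<close>, with that deficit. A fold recovers at most the drop of \<open>Lw\<close>; degree
  0 is reached exactly if every fold is lossless and the final direction is \<open>id\<close>, that
  is, if \<open>v\<close> is the product of the reflections of \<open>J\<close> in reverse order.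
  The end point is then a translation, whose Kazhdan-Lusztig element is known to be
  \<open>C0\<close> times a character, so the sum over galleries is already a sum of Kazhdan-Lusztig
  elements.\<close>

abbreviation reflect :: "'v::euclidean_space => 'v => 'v" where
  "reflect a \<equiv> affine_refl a 0"

abbreviation pairing :: "'v::euclidean_space => 'v => real" (infix "\<cdot>" 70) where
  "x \<cdot> a \<equiv> x \<bullet> coroot a"

lemma inner_coroot: "x \<cdot> a = 2 * (x \<bullet> a) / (a \<bullet> a)" by (simp add: coroot_def)

lemma coroot_sign:
  assumes "b \<noteq> 0" "d \<noteq> 0"
  shows "d \<cdot> b < 0 \<longleftrightarrow> b \<cdot> d < 0" and "d \<cdot> b = 0 \<longleftrightarrow> b \<cdot> d = 0"
proof -
  have "b \<bullet> b > 0" "d \<bullet> d > 0" using assms by auto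
  with assms show "d \<cdot> b < 0 \<longleftrightarrow> b \<cdot> d < 0" "d \<cdot> b = 0 \<longleftrightarrow> b \<cdot> d = 0"
    unfolding inner_coroot using inner_commute[of d b]
    by (simp_all add: divide_less_0_iff mult_less_0_iff leD[OF inner_ge_zero])
qed

lemma coroot_uminus: "coroot (- a) = - coroot a" by (simp add: coroot_def)

lemma inner_coroot_self: "a \<noteq> 0 ==> a \<cdot> a = 2" by (simp add: inner_coroot)

lemma coroot_eq_0_iff [simp]: "coroot a = 0 \<longleftrightarrow> a = 0" by (simp add: coroot_def)

lemma coroot_inj: "coroot r = coroot b \<longleftrightarrow> r = b"
proof
  assume eq: "coroot r = coroot b"
  show "r = b"
  proof (cases "r = 0 \<or> b = 0")
    case True
    then show ?thesis using eq coroot_eq_0_iff by metis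
  next
    case False
    have "coroot (coroot c) = c" if "c \<noteq> 0" for c :: 'a using that by (simp add: coroot_def)
    then show ?thesis using eq False by metis
  qed
qed simp

lemma refl_eq: "reflect a x = x - (x \<cdot> a) *\<^sub>R a" by (simp add: affine_refl_def)

lemma affine_refl_uminus: "affine_refl (- a) (- n) = affine_refl a n"
  by (rule ext) (simp add: affine_refl_def coroot_uminus algebra_simps)

lemma linear_refl: "linear (reflect a)"
  by (rule linearI) (simp_all add: refl_eq inner_left_distrib algebra_simps)

lemma affine_refl_invol: "a \<noteq> 0 ==> affine_refl a n (affine_refl a n x) = x"
  by (simp add: affine_refl_def inner_diff_left inner_coroot_self algebra_simps)

lemma refl_self: "a \<noteq> 0 ==> reflect a a = - a" by (simp add: refl_eq inner_coroot_self scaleR_2)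

lemma orthogonal_transformation_refl: "orthogonal_transformation (reflect a)"
proof (cases "a = 0")
  case True
  then have "reflect a = (\<lambda>x. x)" by (auto simp: refl_eq)
  then show ?thesis by (simp add: orthogonal_transformation_def)
next
  case False
  have "reflect a x \<bullet> reflect a y = x \<bullet> y" for x y
  proof -
    have "coroot a = (2 / (a \<bullet> a)) *\<^sub>R a" by (simp add: coroot_def)
    then show ?thesis using False by (simp add: refl_eq inner_diff_left inner_diff_right inner_commute[of y a])
  qed
  then show ?thesis by (simp add: orthogonal_transformation_def linear_refl)
qed

lemma coroot_orthogonal:
  assumes "orthogonal_transformation w"
  shows "coroot (w a) = w (coroot a)"
proof -
  have "w (c *\<^sub>R a) = c *\<^sub>R w a" for c using assms by (simp add: orthogonal_transformation_def linear_scale)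
  moreover have "w a \<bullet> w a = a \<bullet> a" using assms by (simp add: orthogonal_transformation_def)
  ultimately show ?thesis by (simp add: coroot_def)
qed

lemma orthogonal_inner: "orthogonal_transformation w ==> w x \<bullet> w y = x \<bullet> y"
  by (simp add: orthogonal_transformation_def)

lemma orthogonal_inner_coroot:
  "orthogonal_transformation w ==> w x \<cdot> (w a) = x \<cdot> a" by (simp add: coroot_orthogonal orthogonal_inner)

lemma coroot_refl: "coroot (reflect a b) = reflect a (coroot b)"
  by (rule coroot_orthogonal[OF orthogonal_transformation_refl])

lemma inner_refl_left: "a \<noteq> 0 ==> reflect a x \<bullet> y = x \<bullet> reflect a y"
  using orthogonal_inner[OF orthogonal_transformation_refl, of a x "reflect a y"]
  by (simp add: affine_refl_invol)

text \<open>Prescribed values on independent vectors extend to a linear functional, and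
  \<open>adjoint g 1\<close> is the vector representing it. This supplies the basis dual to the
  simple roots.\<close>

lemma exists_inner_eq:
  fixes D :: "'v::euclidean_space set"
  assumes "independent D"
  shows "\<exists>h. \<forall>d\<in>D. d \<bullet> h = f d"
proof -
  obtain g :: "'v => real" where g: "linear g" "\<forall>x\<in>D. g x = f x"
    using linear_independent_extend[OF assms] by blast
  have "d \<bullet> adjoint g 1 = f d" if "d \<in> D" for d using adjoint_works[OF g(1), of d 1] g(2) that by simp
  then show ?thesis by blast
qed

locale based_root_system =
  fixes \<Phi> \<Delta> :: "'v::euclidean_space set"
  assumes irreducible: "irreducible_root_system \<Phi>" and simple: "simple_roots \<Phi> \<Delta>"
begin

abbreviation "Pos \<equiv> pos_roots \<Phi> \<Delta>"

lemma root_system: "root_system \<Phi>" using irreducible by (simp add: irreducible_root_system_def)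

lemma finite_roots: "finite \<Phi>" and span_roots: "span \<Phi> = UNIV" and zero_not_root: "0 \<notin> \<Phi>"
  using root_system by (auto simp: root_system_def)

lemma root_neq_0: "a \<in> \<Phi> ==> a \<noteq> 0" using zero_not_root by auto

lemma refl_root: "a \<in> \<Phi> ==> b \<in> \<Phi> ==> reflect a b \<in> \<Phi>" using root_system by (auto simp: root_system_def)

lemma inner_coroot_Ints: "a \<in> \<Phi> ==> b \<in> \<Phi> ==> b \<cdot> a \<in> \<int>" using root_system by (auto simp: root_system_def)

lemma root_scaled: "a \<in> \<Phi> ==> c *\<^sub>R a \<in> \<Phi> ==> c = 1 \<or> c = -1" using root_system by (auto simp: root_system_def)

lemma uminus_root: "a \<in> \<Phi> ==> - a \<in> \<Phi>" using refl_root[of a a] refl_self root_neq_0 by metis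

lemma simple_subset: "\<Delta> \<subseteq> \<Phi>" and independent_simple: "independent \<Delta>"
  using simple by (auto simp: simple_roots_def)

lemma finite_simple: "finite \<Delta>" using finite_roots simple_subset finite_subset by blast

lemma pos_subset: "Pos \<subseteq> \<Phi>" by (auto simp: pos_roots_def)

lemma finite_pos: "finite Pos" using finite_roots pos_subset finite_subset by blast

definition cowt :: "'v => 'v" where
  "cowt d = (SOME h. \<forall>c\<in>\<Delta>. c \<bullet> h = (if c = d then 1 else 0))"

text \<open>The half-sum of positive coroots in another guise: pairing with it is the height, so
  positivity of a root becomes the sign of a single number.\<close>

definition htvec :: 'v where "htvec = (\<Sum>d\<in>\<Delta>. cowt d)"

lemma inner_cowt: "c \<in> \<Delta> ==> c \<bullet> cowt d = (if c = d then 1 else 0)"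
  using someI_ex[OF exists_inner_eq[OF independent_simple, of "\<lambda>c. if c = d then 1 else 0"]]
  unfolding cowt_def by blast

lemma inner_htvec: "x \<bullet> htvec = (\<Sum>d\<in>\<Delta>. x \<bullet> cowt d)" by (simp add: htvec_def inner_sum_right)

lemma inner_htvec_simple: "d \<in> \<Delta> ==> d \<bullet> htvec = 1" using finite_simple by (simp add: inner_htvec inner_cowt)

lemma nonneg_comb_coord:
  assumes "nonneg_comb \<Delta> x"
  obtains c :: "'v => nat" where "\<And>d. d \<in> \<Delta> ==> x \<bullet> cowt d = real (c d)" "x = (\<Sum>d\<in>\<Delta>. real (c d) *\<^sub>R d)"
proof -
  obtain c :: "'v => nat" where c: "x = (\<Sum>d\<in>\<Delta>. real (c d) *\<^sub>R d)" using assms unfolding nonneg_comb_def by blast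
  have "x \<bullet> cowt d = real (c d)" if "d \<in> \<Delta>" for d
  proof -
    have "x \<bullet> cowt d = (\<Sum>\<epsilon>\<in>\<Delta>. real (c \<epsilon>) * (if \<epsilon> = d then 1 else 0))"
      unfolding c inner_sum_left by (intro sum.cong) (simp_all add: inner_cowt)
    also have "\<dots> = real (c d)" using that finite_simple by (simp add: if_distrib cong: if_cong)
    finally show ?thesis .
  qed
  then show ?thesis using c that by blast
qed

lemma root_cases: "b \<in> \<Phi> ==> nonneg_comb \<Delta> b \<or> nonneg_comb \<Delta> (- b)"
  using simple by (auto simp: simple_roots_def)

lemma span_simple: "span \<Delta> = UNIV"
proof -
  have "x \<in> span \<Delta>" if nc: "nonneg_comb \<Delta> x" for x
  proof -
    obtain c :: "'v => nat" where "x = (\<Sum>d\<in>\<Delta>. real (c d) *\<^sub>R d)" using nc unfolding nonneg_comb_def by blast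
    then show ?thesis by (simp add: span_sum span_scale span_base)
  qed
  then have "\<Phi> \<subseteq> span \<Delta>" using root_cases span_neg by fastforce
  then show ?thesis using span_roots by (metis span_mono span_span top.extremum_uniqueI)
qed

lemma expand_simple: "x = (\<Sum>d\<in>\<Delta>. (x \<bullet> cowt d) *\<^sub>R d)"
proof -
  obtain u where u: "x = (\<Sum>d\<in>\<Delta>. u d *\<^sub>R d)"
    using span_simple span_finite[OF finite_simple] by (metis (no_types, lifting) UNIV_I imageE)
  have "x \<bullet> cowt d = u d" if "d \<in> \<Delta>" for d
  proof -
    have "x \<bullet> cowt d = (\<Sum>c\<in>\<Delta>. u c * (if c = d then 1 else 0))"
      unfolding u inner_sum_left by (intro sum.cong) (simp_all add: inner_cowt)
    also have "\<dots> = u d" using that finite_simple by (simp add: if_distrib cong: if_cong)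
    finally show ?thesis .
  qed
  then show ?thesis using u by (simp cong: sum.cong)
qed

lemma coord_root:
  assumes "b \<in> \<Phi>"
  shows "(\<forall>d\<in>\<Delta>. b \<bullet> cowt d \<in> \<int>) \<and>
    (if b \<in> Pos then (\<forall>d\<in>\<Delta>. b \<bullet> cowt d \<ge> 0) \<and> b \<bullet> htvec \<ge> 1
     else (\<forall>d\<in>\<Delta>. b \<bullet> cowt d \<le> 0) \<and> b \<bullet> htvec \<le> -1)"
proof -
  have *: "(\<forall>d\<in>\<Delta>. g \<bullet> cowt d \<in> \<int>) \<and> (\<forall>d\<in>\<Delta>. g \<bullet> cowt d \<ge> 0) \<and> g \<bullet> htvec \<ge> 1"
    if nc: "nonneg_comb \<Delta> g" and g: "g \<in> \<Phi>" for g
  proof -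
    obtain c :: "'v => nat" where c: "\<And>d. d \<in> \<Delta> ==> g \<bullet> cowt d = real (c d)"
      using nonneg_comb_coord[OF nc] by metis
    have "g \<bullet> htvec = real (\<Sum>d\<in>\<Delta>. c d)" by (simp add: inner_htvec c)
    moreover have "(\<Sum>d\<in>\<Delta>. c d) \<noteq> 0"
    proof
      assume "(\<Sum>d\<in>\<Delta>. c d) = 0"
      then have "g \<bullet> cowt d = 0" if "d \<in> \<Delta>" for d using that c finite_simple by simp
      then have "g = 0" using expand_simple[of g] by simp
      then show False using g zero_not_root by simp
    qed
    ultimately have "g \<bullet> htvec \<ge> 1" by (metis One_nat_def Suc_leI neq0_conv of_nat_1 of_nat_mono)
    then show ?thesis using c by auto
  qed
  show ?thesis
  proof (cases "b \<in> Pos")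
    case True
    then have "nonneg_comb \<Delta> b" by (simp add: pos_roots_def)
    from *[OF this assms] show ?thesis using True by auto
  next
    case False
    then have "nonneg_comb \<Delta> (- b)" using assms root_cases by (auto simp: pos_roots_def)
    from *[OF this uminus_root[OF assms]] show ?thesis using False by auto
  qed
qed

lemma pos_iff: "b \<in> \<Phi> ==> b \<in> Pos \<longleftrightarrow> b \<bullet> htvec > 0" using coord_root[of b] by (auto split: if_splits)

lemma pos_if_coord: "b \<in> \<Phi> ==> d \<in> \<Delta> ==> b \<bullet> cowt d > 0 ==> b \<in> Pos"
  using coord_root[of b] by (fastforce split: if_splits)

lemma uminus_pos_iff: "b \<in> \<Phi> ==> - b \<in> Pos \<longleftrightarrow> b \<notin> Pos"
  using pos_iff[of "- b"] uminus_root[of b] coord_root[of b] pos_iff[of b] by (auto split: if_splits)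

lemma simple_pos: "\<Delta> \<subseteq> Pos" using simple_subset pos_iff inner_htvec_simple by force

text \<open>Only the coordinate at \<open>d\<close> changes. A positive root without another
  positive coordinate would be a multiple of \<open>d\<close>, hence \<open>d\<close> itself because
  the system is reduced.\<close>

lemma refl_pos:
  assumes "b \<in> Pos" "d \<in> \<Delta>" "b \<noteq> d"
  shows "reflect d b \<in> Pos"
proof -
  have b: "b \<in> \<Phi>" using assms(1) pos_subset by blast
  have d: "d \<in> \<Phi>" using assms(2) simple_subset by blast
  have "\<exists>c\<in>\<Delta>. c \<noteq> d \<and> b \<bullet> cowt c > 0"
  proof (rule ccontr)
    assume "\<not> ?thesis"
    then have "b \<bullet> cowt c = 0" if "c \<in> \<Delta>" "c \<noteq> d" for c using that coord_root[OF b] assms(1) by force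
    then have "(\<Sum>c\<in>\<Delta>. (b \<bullet> cowt c) *\<^sub>R c) = (\<Sum>c\<in>\<Delta>. if c = d then (b \<bullet> cowt d) *\<^sub>R d else 0)"
      by (intro sum.cong) auto
    then have eq: "b = (b \<bullet> cowt d) *\<^sub>R d" using expand_simple[of b] finite_simple assms(2) by simp
    then have "b \<bullet> cowt d = 1 \<or> b \<bullet> cowt d = -1" using root_scaled[OF d] b by metis
    moreover have "b \<bullet> cowt d \<ge> 0" using coord_root[OF b] assms by auto
    ultimately show False using eq assms(3) by auto
  qed
  then obtain c where c: "c \<in> \<Delta>" "c \<noteq> d" "b \<bullet> cowt c > 0" by blast
  have "reflect d b \<bullet> cowt c = b \<bullet> cowt c" using c assms(2) by (simp add: refl_eq inner_diff_left inner_cowt)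
  then show ?thesis using pos_if_coord[OF refl_root[OF d b] c(1)] c(3) by simp
qed

lemma simple_obtuse:
  assumes "d \<in> \<Delta>" "c \<in> \<Delta>" "d \<noteq> c"
  shows "d \<bullet> c \<le> 0"
proof -
  have r: "reflect c d \<in> Pos" using refl_pos assms simple_pos by blast
  then have "reflect c d \<bullet> cowt c \<ge> 0" using coord_root[of "reflect c d"] pos_subset assms(2) by auto
  then have "d \<cdot> c \<le> 0" using assms by (simp add: refl_eq inner_diff_left inner_cowt)
  moreover have "c \<bullet> c > 0" using assms simple_subset root_neq_0 by auto
  ultimately show ?thesis by (simp add: inner_coroot field_simps zero_less_mult_iff)
qed

text \<open>Induction on height. A positive root has positive norm, so some simple \<open>d\<close>
  in its support pairs positively with it; reflecting in \<open>d\<close> lowers the height and,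
  unless the root is simple, keeps it positive. The step is stated upwards, hence the sign in
  \<open>b \<cdot> d < 0\<close>.\<close>

lemma pos_induct [consumes 1, case_names simple step]:
  assumes "b \<in> Pos"
    and simple: "\<And>d. d \<in> \<Delta> ==> Q d"
    and step: "\<And>b d. b \<in> Pos ==> d \<in> \<Delta> ==> b \<cdot> d < 0 ==> reflect d b \<in> Pos ==> Q b ==> Q (reflect d b)"
  shows "Q b" using assms(1)
proof (induction "nat \<lfloor>b \<bullet> htvec\<rfloor>" arbitrary: b rule: less_induct)
  case less
  have b: "b \<in> \<Phi>" using less.prems pos_subset by blast
  show ?case
  proof (cases "b \<in> \<Delta>")
    case True
    then show ?thesis by (rule simple)
  next
    case False
    have "b \<bullet> b = (\<Sum>d\<in>\<Delta>. (b \<bullet> cowt d) * (d \<bullet> b))"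
      using arg_cong[OF expand_simple[of b], of "\<lambda>x. x \<bullet> b"] by (simp add: inner_sum_left)
    moreover have "b \<bullet> b > 0" using b root_neq_0 by auto
    ultimately obtain d where d: "d \<in> \<Delta>" "(b \<bullet> cowt d) * (d \<bullet> b) > 0"
      by (metis (no_types, lifting) linorder_not_less sum_nonpos)
    have "b \<bullet> cowt d \<ge> 0" using coord_root[OF b] less.prems d(1) by auto
    then have pos: "d \<bullet> b > 0" using d(2) by (simp add: zero_less_mult_iff)
    have d\<Phi>: "d \<in> \<Phi>" "d \<noteq> 0" using d(1) simple_subset root_neq_0 by auto
    have k: "b \<cdot> d > 0" using pos d\<Phi> by (simp add: inner_coroot inner_commute)
    let ?c = "reflect d b"
    have c: "?c \<in> Pos" using refl_pos less.prems d(1) False by blast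
    have ht: "?c \<bullet> htvec = b \<bullet> htvec - b \<cdot> d"
      using d(1) by (simp add: refl_eq inner_diff_left inner_htvec_simple)
    have int: "b \<cdot> d \<in> \<int>" using inner_coroot_Ints[OF d\<Phi>(1) b] .
    then have "b \<cdot> d \<ge> 1" using k by (metis Ints_cases of_int_0_less_iff of_int_1_le_iff zless_imp_add1_zle add_0)
    then have "nat \<lfloor>?c \<bullet> htvec\<rfloor> < nat \<lfloor>b \<bullet> htvec\<rfloor>"
      using ht coord_root[of ?c] c pos_subset by (auto split: if_splits) linarith
    then have Q: "Q ?c" using less.hyps c by blast
    have "?c \<cdot> d = - (b \<cdot> d)" using d\<Phi> by (simp add: refl_eq inner_diff_left inner_coroot_self)
    moreover have "reflect d ?c = b" using d\<Phi> by (simp add: affine_refl_invol)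
    ultimately show ?thesis using step[OF c d(1) _ _ Q] k less.prems by simp
  qed
qed

text \<open>The simple coroots are simple for the dual system. In each upward reflection the coroot
  gains \<open>- (d \<cdot> b)\<close> times \<open>coroot d\<close>, a natural number because the
  two Cartan integers of a pair have the same sign.\<close>

lemma coroot_nonneg_comb:
  assumes "b \<in> Pos"
  shows "\<exists>c :: 'v => nat. coroot b = (\<Sum>d\<in>\<Delta>. real (c d) *\<^sub>R coroot d)" using assms
proof (induction rule: pos_induct)
  case (simple d)
  show ?case by (rule exI[of _ "\<lambda>\<epsilon>. if \<epsilon> = d then 1 else 0"])
      (use simple finite_simple in \<open>simp add: if_distrib if_distribR cong: if_cong\<close>)
next
  case (step b d)
  obtain c :: "'v => nat" where c: "coroot b = (\<Sum>d\<in>\<Delta>. real (c d) *\<^sub>R coroot d)" using step by blast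
  have d: "d \<in> \<Phi>" "d \<noteq> 0" using step(2) simple_subset root_neq_0 by auto
  have b: "b \<in> \<Phi>" "b \<noteq> 0" using step(1) pos_subset root_neq_0 by auto
  have "d \<cdot> b \<in> \<int>" using inner_coroot_Ints b(1) d(1) by blast
  moreover have "d \<cdot> b < 0" using step(3) coroot_sign(1)[OF b(2) d(2)] by simp
  ultimately obtain k :: nat where k: "d \<cdot> b = - real k"
    by (metis Ints_cases less_eq_real_def minus_minus of_int_minus of_int_of_nat_eq of_nat_nat
        neg_0_le_iff_le of_int_le_0_iff)
  have "(coroot b \<cdot> d) *\<^sub>R d = (coroot b \<bullet> d) *\<^sub>R coroot d" by (simp add: coroot_def)
  then have "coroot (affine_refl d 0 b) = coroot b + real k *\<^sub>R coroot d"
    using k by (simp add: coroot_refl refl_eq[of d "coroot b"] inner_commute)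
  also have "real k *\<^sub>R coroot d = (\<Sum>\<epsilon>\<in>\<Delta>. if \<epsilon> = d then real k *\<^sub>R coroot d else 0)"
    using finite_simple step(2) by simp
  also have "coroot b + \<dots> = (\<Sum>\<epsilon>\<in>\<Delta>. real (c \<epsilon> + (if \<epsilon> = d then k else 0)) *\<^sub>R coroot \<epsilon>)"
    unfolding c sum.distrib[symmetric] by (intro sum.cong) (auto simp: scaleR_left_distrib)
  finally show ?case by (intro exI[of _ "\<lambda>\<epsilon>. c \<epsilon> + (if \<epsilon> = d then k else 0)"])
qed

end

section \<open>Words and generated groups\<close>

lemma word_prod_Nil [simp]: "word_prod [] = id"
  and word_prod_Cons [simp]: "word_prod (s # ss) = s o word_prod ss" by (simp_all add: word_prod_def)

lemma word_prod_append: "word_prod (xs @ ys) = word_prod xs o word_prod ys"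
  by (induction xs) (simp_all add: comp_assoc)

lemma word_prod_snoc [simp]: "word_prod (xs @ [s]) = word_prod xs o s"
  unfolding word_prod_append by (simp add: fun_eq_iff)

lemma generatedI: "set ss \<subseteq> S ==> word_prod ss \<in> generated S" by (auto simp: generated_def)

lemma generatedE:
  assumes "w \<in> generated S" obtains ss where "set ss \<subseteq> S" "w = word_prod ss"
  using assms by (auto simp: generated_def)

lemma id_generated: "id \<in> generated S" using generatedI[of "[]"] by simp

lemma gen_generated: "s \<in> S ==> s \<in> generated S" using generatedI[of "[s]"] by simp

lemma comp_generated:
  assumes "v \<in> generated S" "w \<in> generated S" shows "v o w \<in> generated S"
proof -
  obtain xs ys where "set xs \<subseteq> S" "v = word_prod xs" "set ys \<subseteq> S" "w = word_prod ys"
    using assms by (meson generatedE)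
  then show ?thesis using generatedI[of "xs @ ys" S] by (simp add: word_prod_append)
qed

lemma generated_induct [consumes 1, case_names id step]:
  assumes "w \<in> generated S" "Q id" "\<And>s w. s \<in> S ==> w \<in> generated S ==> Q w ==> Q (s o w)"
  shows "Q w"
proof -
  obtain ss where "set ss \<subseteq> S" "w = word_prod ss" using assms(1) by (rule generatedE)
  moreover have "set ss \<subseteq> S ==> Q (word_prod ss)" for ss by (induction ss) (use assms generatedI in auto)
  ultimately show ?thesis by blast
qed

lemma generated_induct_right [consumes 1, case_names id step]:
  assumes "w \<in> generated S" "Q id" "\<And>s w. s \<in> S ==> w \<in> generated S ==> Q w ==> Q (w o s)"
  shows "Q w"
proof -
  obtain ss where "set ss \<subseteq> S" "w = word_prod ss" using assms(1) by (rule generatedE)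
  moreover have "set ss \<subseteq> S ==> Q (word_prod ss)" for ss
  proof (induction ss rule: rev_induct)
    case (snoc s ss)
    have "Q (word_prod ss o s)" using snoc generatedI[of ss S] by (intro assms(3)) auto
    then show ?case unfolding word_prod_snoc .
  qed (use assms in simp)
  ultimately show ?thesis by blast
qed

lemma generated_mono: "S \<subseteq> generated T ==> generated S \<subseteq> generated T"
proof
  fix w assume "S \<subseteq> generated T" "w \<in> generated S"
  from this(2,1) show "w \<in> generated T"
    by (induction rule: generated_induct) (auto intro: id_generated comp_generated)
qed

lemma generated_inverse:
  assumes invol: "\<And>s. s \<in> S ==> s o s = id" and "w \<in> generated S"
  shows "bij w \<and> inv w \<in> generated S" using assms(2)
proof (induction rule: generated_induct)
  case id
  then show ?case using id_generated[of S] bij_id by (simp add: id_def)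
next
  case (step s w)
  have s: "bij s" "inv s = s" using invol[OF step(1)] by (auto intro: o_bij inv_unique_comp)
  have "inv (s o w) = inv w o s" using o_inv_distrib s step by metis
  moreover have "inv w o s \<in> generated S" using step by (blast intro: comp_generated gen_generated)
  ultimately show ?case using bij_comp[of w s] step s by metis
qed

text \<open>Characterises the least word length by local behaviour: growth by at most one bounds
  every word from below, and repeated descent to \<open>id\<close> produces a word that attains the
  bound. It is applied to the count of separating hyperplanes, for the affine and for the finite
  generators.\<close>

lemma cox_length_eqI:
  assumes "\<And>s w. s \<in> S ==> w \<in> generated S ==> f (w o s) \<le> Suc (f w)"
    and "\<And>w. w \<in> generated S ==> f w > 0 ==> \<exists>s\<in>S. f (w o s) < f w"
    and "\<And>s. s \<in> S ==> s o s = id"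
    and "\<And>w. w \<in> generated S ==> f w = 0 ==> w = id" and "f id = 0"
    and "w \<in> generated S"
  shows "cox_length S w = f w"
proof -
  have *: "\<exists>ss. set ss \<subseteq> S \<and> length ss = f w \<and> word_prod ss = w" if "w \<in> generated S" for w using that
  proof (induction "f w" arbitrary: w rule: less_induct)
    case less
    show ?case
    proof (cases "f w = 0")
      case True
      then have "w = id" using assms(4) less.prems by blast
      then show ?thesis using True by (intro exI[of _ "[]"]) simp
    next
      case False
      then obtain s where s: "s \<in> S" "f (w o s) < f w" using assms(2) less.prems by blast
      have ws: "w o s \<in> generated S" using less.prems s by (simp add: comp_generated gen_generated)
      then obtain ss where ss: "set ss \<subseteq> S" "length ss = f (w o s)" "word_prod ss = w o s"
        using less.hyps s by blast
      have eq: "w o s o s = w" using assms(3)[OF s(1)] by (simp add: comp_assoc)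
      then have "f w \<le> Suc (f (w o s))" using assms(1)[OF s(1) ws] by simp
      then show ?thesis using ss s eq by (intro exI[of _ "ss @ [s]"]) auto
    qed
  qed
  have len: "f (word_prod ss) \<le> length ss" if "set ss \<subseteq> S" for ss using that
  proof (induction ss rule: rev_induct)
    case (snoc s ss)
    then have "f (word_prod ss o s) \<le> Suc (f (word_prod ss))" by (intro assms(1)) (auto intro: generatedI)
    moreover have "f (word_prod ss) \<le> length ss" using snoc by simp
    ultimately show ?case by (metis word_prod_snoc length_append_singleton le_trans Suc_le_mono)
  qed (simp add: assms)
  show ?thesis unfolding cox_length_def
  proof (rule Least_equality)
    show "\<exists>ss. set ss \<subseteq> S \<and> length ss = f w \<and> word_prod ss = w" using * assms by blast
  qed (use len in blast)
qed

section \<open>The highest coroot\<close>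

context based_root_system
begin

lemma coroot_reflect: "coroot (reflect a b) = coroot b - (a \<cdot> b) *\<^sub>R coroot a"
proof -
  have "(coroot b \<cdot> a) *\<^sub>R a = (coroot b \<bullet> a) *\<^sub>R coroot a" by (simp add: coroot_def)
  then show ?thesis by (simp add: coroot_refl refl_eq[of a "coroot b"] inner_commute)
qed

text \<open>Cauchy-Schwarz is strict here, since proportional roots agree up to sign.\<close>

lemma root_product_bound:
  assumes "a \<in> \<Phi>" "b \<in> \<Phi>" "a \<noteq> b" "a \<noteq> - b"
  shows "(a \<cdot> b) * (b \<cdot> a) < 4" "(a \<cdot> b) * (b \<cdot> a) \<ge> 0"
proof -
  have nz: "a \<bullet> a > 0" "b \<bullet> b > 0" using assms root_neq_0 by auto
  have eq: "(a \<cdot> b) * (b \<cdot> a) = 4 * (a \<bullet> b)\<^sup>2 / ((a \<bullet> a) * (b \<bullet> b))"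
    by (simp add: inner_coroot inner_commute[of b a] power2_eq_square)
  show "(a \<cdot> b) * (b \<cdot> a) \<ge> 0" unfolding eq using nz by simp
  have "(a \<bullet> b)\<^sup>2 \<noteq> (a \<bullet> a) * (b \<bullet> b)"
  proof
    assume "(a \<bullet> b)\<^sup>2 = (a \<bullet> a) * (b \<bullet> b)"
    then have "\<bar>a \<bullet> b\<bar>\<^sup>2 = (norm a * norm b)\<^sup>2" by (simp add: power_mult_distrib power2_norm_eq_inner)
    then have "\<bar>a \<bullet> b\<bar> = norm a * norm b" by (rule power2_eq_imp_eq) auto
    then obtain d where d: "norm a *\<^sub>R b = d *\<^sub>R a" using norm_cauchy_schwarz_abs_eq[of a b] by blast
    have "(1 / norm a) *\<^sub>R (norm a *\<^sub>R b) = (d / norm a) *\<^sub>R a" unfolding d by simp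
    then have c: "b = (d / norm a) *\<^sub>R a" using nz by simp
    then have "d / norm a = 1 \<or> d / norm a = -1" using root_scaled assms by metis
    then show False using c assms by auto
  qed
  moreover have "(a \<bullet> b)\<^sup>2 \<le> (a \<bullet> a) * (b \<bullet> b)" by (rule Cauchy_Schwarz_ineq)
  ultimately have "(a \<bullet> b)\<^sup>2 < (a \<bullet> a) * (b \<bullet> b)" by linarith
  then show "(a \<cdot> b) * (b \<cdot> a) < 4" unfolding eq using nz by (simp add: divide_less_eq)
qed

text \<open>Coordinates with respect to the simple coroots; the factor
  \<open>d \<bullet> d / 2\<close> converts from those with respect to the simple roots.\<close>

definition crd :: "'v => 'v => real" where
  "crd v d = (d \<bullet> d / 2) * (v \<bullet> cowt d)"

lemma crd_coroot: "c \<in> \<Delta> ==> d \<in> \<Delta> ==> crd (coroot c) d = (if c = d then 1 else 0)"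
  using simple_subset root_neq_0 by (auto simp: crd_def coroot_def inner_cowt)

lemma crd_linear: "crd (u + v) d = crd u d + crd v d" "crd (u - v) d = crd u d - crd v d"
    "crd (a *\<^sub>R v) d = a * crd v d" "crd (sum f A) d = (\<Sum>x\<in>A. crd (f x) d)" "crd (- v) d = - crd v d"
  by (simp_all add: crd_def inner_left_distrib inner_diff_left inner_sum_left algebra_simps sum_distrib_left)

lemma expand_crd: "v = (\<Sum>d\<in>\<Delta>. crd v d *\<^sub>R coroot d)"
proof -
  have "(v \<bullet> cowt d) *\<^sub>R d = crd v d *\<^sub>R coroot d" if "d \<in> \<Delta>" for d
    using that simple_subset root_neq_0 by (auto simp: crd_def coroot_def)
  then show ?thesis using expand_simple[of v] by (simp cong: sum.cong)
qed

lemma inner_crd: "v \<bullet> x = (\<Sum>d\<in>\<Delta>. crd v d * (coroot d \<bullet> x))"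
  using arg_cong[OF expand_crd[of v], of "\<lambda>u. u \<bullet> x"] by (simp add: inner_sum_left)

lemma Nats_nonneg: "x \<in> \<nat> ==> 0 \<le> (x::real)" by (auto elim: Nats_cases)

lemma crd_pos_coroot:
  assumes "b \<in> Pos" "d \<in> \<Delta>" shows "crd (coroot b) d \<in> \<nat>"
proof -
  obtain c :: "'v => nat" where c: "coroot b = (\<Sum>d\<in>\<Delta>. real (c d) *\<^sub>R coroot d)"
    using coroot_nonneg_comb[OF assms(1)] by blast
  have "crd (coroot b) d = (\<Sum>\<epsilon>\<in>\<Delta>. real (c \<epsilon>) * (if \<epsilon> = d then 1 else 0))"
    unfolding c crd_linear by (intro sum.cong) (use assms in \<open>auto simp: crd_coroot\<close>)
  also have "\<dots> = real (c d)" using assms finite_simple by (simp add: if_distrib cong: if_cong)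
  finally show ?thesis by simp
qed

lemma crd_coroot_Ints: "b \<in> \<Phi> ==> d \<in> \<Delta> ==> crd (coroot b) d \<in> \<int>"
proof (cases "b \<in> Pos")
  case True
  then show "d \<in> \<Delta> ==> ?thesis" using crd_pos_coroot Nats_subset_Ints by blast
next
  case False
  assume "b \<in> \<Phi>" "d \<in> \<Delta>"
  then have "crd (coroot (- b)) d \<in> \<nat>" using False crd_pos_coroot uminus_pos_iff by blast
  then show ?thesis using Nats_subset_Ints by (force simp: coroot_uminus crd_linear)
qed

lemma nonneg_comb_coroots: "nonneg_comb (coroot ` \<Delta>) x \<longleftrightarrow> (\<forall>z\<in>\<Delta>. crd x z \<in> \<nat>)"
proof -
  have inj: "inj_on coroot \<Delta>" by (simp add: inj_on_def coroot_inj)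
  show ?thesis
  proof
    assume "nonneg_comb (coroot ` \<Delta>) x"
    then obtain c :: "'v => nat" where "x = (\<Sum>d\<in>coroot ` \<Delta>. real (c d) *\<^sub>R d)"
      unfolding nonneg_comb_def by blast
    then have x: "x = (\<Sum>z\<in>\<Delta>. real (c (coroot z)) *\<^sub>R coroot z)" by (simp add: sum.reindex[OF inj])
    show "\<forall>z\<in>\<Delta>. crd x z \<in> \<nat>"
    proof
      fix z assume z: "z \<in> \<Delta>"
      have "crd x z = (\<Sum>\<epsilon>\<in>\<Delta>. real (c (coroot \<epsilon>)) * (if \<epsilon> = z then 1 else 0))"
        unfolding x crd_linear by (intro sum.cong) (use z in \<open>auto simp: crd_coroot\<close>)
      also have "\<dots> = real (c (coroot z))" using z finite_simple by (simp add: if_distrib cong: if_cong)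
      finally show "crd x z \<in> \<nat>" by simp
    qed
  next
    assume *: "\<forall>z\<in>\<Delta>. crd x z \<in> \<nat>"
    let ?c = "\<lambda>d. nat \<lfloor>crd x (inv_into \<Delta> coroot d)\<rfloor>"
    have "real (?c (coroot z)) = crd x z" if "z \<in> \<Delta>" for z
    proof -
      have "crd x z \<in> \<nat>" using * that by blast
      then show ?thesis by (auto simp: inv_into_f_f[OF inj that] elim!: Nats_cases)
    qed
    then have "x = (\<Sum>z\<in>\<Delta>. real (?c (coroot z)) *\<^sub>R coroot z)" using expand_crd[of x] by (simp cong: sum.cong)
    then have "x = (\<Sum>d\<in>coroot ` \<Delta>. real (?c d) *\<^sub>R d)" by (simp add: sum.reindex[OF inj])
    then show "nonneg_comb (coroot ` \<Delta>) x" unfolding nonneg_comb_def by (intro exI[of _ ?c])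
  qed
qed

definition maximal_root :: "'v => bool" where
  "maximal_root p \<longleftrightarrow> p \<in> \<Phi> \<and>
    (\<forall>c\<in>\<Phi>. (\<forall>d\<in>\<Delta>. crd (coroot p) d \<le> crd (coroot c) d) \<longrightarrow> c = p)"

lemma exists_maximal_root:
  assumes "b \<in> \<Phi>"
  shows "\<exists>p. maximal_root p \<and> (\<forall>d\<in>\<Delta>. crd (coroot b) d \<le> crd (coroot p) d)"
proof -
  let ?A = "{c\<in>\<Phi>. \<forall>d\<in>\<Delta>. crd (coroot b) d \<le> crd (coroot c) d}"
  let ?h = "\<lambda>c. \<Sum>d\<in>\<Delta>. crd (coroot c) d"
  have fin: "finite (?h ` ?A)" "?h ` ?A \<noteq> {}" using finite_roots assms by auto
  obtain p where p0: "p \<in> ?A" "?h p = Max (?h ` ?A)" using Max_in[OF fin] by auto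
  have p: "p \<in> ?A" "\<And>c. c \<in> ?A ==> ?h c \<le> ?h p" using p0 fin by auto
  have "c = p" if c: "c \<in> \<Phi>" "\<forall>d\<in>\<Delta>. crd (coroot p) d \<le> crd (coroot c) d" for c
  proof -
    have "?h c \<le> ?h p" using p c by (intro p(2)) force
    then have "crd (coroot p) d = crd (coroot c) d" if "d \<in> \<Delta>" for d using c(2) that finite_simple
      by (metis (no_types, lifting) order_antisym sum_mono sum_mono_inv)
    then have "coroot p = coroot c"
      using expand_crd[of "coroot p"] expand_crd[of "coroot c"] by (simp cong: sum.cong)
    then show ?thesis by (simp add: coroot_inj)
  qed
  then show ?thesis using p(1) unfolding maximal_root_def by blast
qed

text \<open>Otherwise reflecting in \<open>d\<close> would enlarge the coroot.\<close>

lemma maximal_root_dominant: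
  assumes "maximal_root p" "d \<in> \<Delta>" shows "p \<cdot> d \<ge> 0"
proof (rule ccontr)
  assume "\<not> ?thesis"
  moreover have p: "p \<in> \<Phi>" and d: "d \<in> \<Phi>" using assms simple_subset by (auto simp: maximal_root_def)
  ultimately have neg: "d \<cdot> p < 0" using coroot_sign(1)[of p d] root_neq_0 by simp
  have "crd (coroot p) c \<le> crd (coroot (reflect d p)) c" if "c \<in> \<Delta>" for c
    using neg that assms(2) by (auto simp: coroot_reflect crd_linear crd_coroot)
  then have "reflect d p = p" using assms refl_root p d by (auto simp: maximal_root_def)
  then have "p \<cdot> d = 0" using root_neq_0[OF d] by (simp add: refl_eq)
  then show False using neg coroot_sign(2)[of p d] p d root_neq_0 by simp
qed

lemma maximal_root_pos:
  assumes "maximal_root p" shows "p \<in> Pos"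
proof (rule ccontr)
  assume "p \<notin> Pos"
  moreover have p: "p \<in> \<Phi>" using assms by (simp add: maximal_root_def)
  ultimately have m: "- p \<in> Pos" by (simp add: uminus_pos_iff)
  have "crd (coroot p) d \<le> crd (coroot (- p)) d" if "d \<in> \<Delta>" for d
    using crd_pos_coroot[OF m that] by (auto simp: coroot_uminus crd_linear elim!: Nats_cases)
  then have "- p = p" using assms uminus_root[OF p] by (simp add: maximal_root_def)
  then have "p + p = 0" by (metis add.left_inverse)
  then have "2 *\<^sub>R p = 0" by (simp add: scaleR_2)
  then show False using root_neq_0[OF p] by simp
qed

text \<open>Irreducibility enters here: simple roots missing from the coroot would be orthogonal to
  those occurring in it, and every root would lie in one of the two orthogonal spans.\<close>

lemma maximal_root_full:
  assumes "maximal_root p" "d \<in> \<Delta>" shows "crd (coroot p) d > 0"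
proof (rule ccontr)
  assume not: "\<not> ?thesis"
  have p: "p \<in> \<Phi>" "p \<noteq> 0" using assms root_neq_0 by (auto simp: maximal_root_def)
  define D0 where "D0 = {d\<in>\<Delta>. crd (coroot p) d = 0}"
  define D1 where "D1 = {d\<in>\<Delta>. crd (coroot p) d > 0}"
  have ge: "crd (coroot p) d \<ge> 0" if "d \<in> \<Delta>" for d
    using crd_pos_coroot[OF maximal_root_pos[OF assms(1)] that] by (auto elim!: Nats_cases)
  have \<Delta>: "\<Delta> = D0 \<union> D1" using ge by (force simp: D0_def D1_def)
  have "D0 \<noteq> {}" using not ge[OF assms(2)] assms(2) by (auto simp: D0_def)
  have "D1 \<noteq> {}"
  proof
    assume "D1 = {}"
    then have "(\<Sum>d\<in>\<Delta>. crd (coroot p) d *\<^sub>R coroot d) = 0" using \<Delta> by (auto simp: D0_def intro!: sum.neutral)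
    then have "coroot p = 0" using expand_crd[of "coroot p"] by simp
    then show False using p by simp
  qed
  have sgn: "coroot \<epsilon> \<bullet> d \<le> 0" if "d \<in> \<Delta>" "\<epsilon> \<in> \<Delta>" "\<epsilon> \<noteq> d" for d \<epsilon>
    using simple_obtuse[OF that(2,1,3)] inner_ge_zero[of \<epsilon>] by (simp add: coroot_def divide_nonpos_nonneg mult_nonneg_nonpos)
  \<comment> \<open>Dominance makes the pairing of the coroot with \<open>d\<close> nonnegative,
    while each term of its expansion is nonpositive; so every term vanishes.\<close>
  have orth: "\<epsilon> \<bullet> d = 0" if "d \<in> D0" "\<epsilon> \<in> D1" for d \<epsilon>
  proof -
    have d: "d \<in> \<Delta>" "crd (coroot p) d = 0" and \<epsilon>: "\<epsilon> \<in> \<Delta>" "crd (coroot p) \<epsilon> > 0"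
      using that by (auto simp: D0_def D1_def)
    have d0: "d \<in> \<Phi>" "d \<noteq> 0" "\<epsilon> \<noteq> 0" using d \<epsilon> simple_subset root_neq_0 by auto
    have le: "crd (coroot p) c * (coroot c \<bullet> d) \<le> 0" if "c \<in> \<Delta>" for c
    proof (cases "c = d")
      case False
      then show ?thesis using ge that sgn[OF d(1) that] by (simp add: mult_nonneg_nonpos)
    qed (use d in simp)
    have "d \<cdot> p \<ge> 0" using maximal_root_dominant[OF assms(1) d(1)] coroot_sign(1)[of p d] p d0 by linarith
    then have "(\<Sum>c\<in>\<Delta>. crd (coroot p) c * (coroot c \<bullet> d)) \<ge> 0"
      using inner_crd[of "coroot p" d] by (simp add: inner_commute)
    then have "(\<Sum>c\<in>\<Delta>. crd (coroot p) c * (coroot c \<bullet> d)) = 0" using le by (intro antisym sum_nonpos) auto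
    then have "crd (coroot p) \<epsilon> * (coroot \<epsilon> \<bullet> d) = 0"
      using le \<epsilon>(1) sum_nonneg_eq_0_iff[OF finite_simple, of "\<lambda>c. - (crd (coroot p) c * (coroot c \<bullet> d))"]
      by (auto simp: sum_negf)
    then show ?thesis using \<epsilon>(2) d0 by (simp add: coroot_def)
  qed
  have orth': "x \<bullet> y = 0" if "x \<in> span D1" "y \<in> span D0" for x y
  proof -
    have "orthogonal d x" if "d \<in> D0" for d
      by (rule orthogonal_to_span[OF \<open>x \<in> span D1\<close>]) (use orth[OF that] in \<open>auto simp: orthogonal_def inner_commute\<close>)
    then have "orthogonal x y" by (intro orthogonal_to_span[OF \<open>y \<in> span D0\<close>]) (auto simp: orthogonal_commute)
    then show ?thesis by (simp add: orthogonal_def)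
  qed
  have pos: "b \<in> span D0 \<or> b \<in> span D1" if "b \<in> Pos" for b using that
  proof (induction rule: pos_induct)
    case (simple d)
    then show ?case using \<Delta> by (auto intro: span_base)
  next
    case (step b d)
    have nz: "b \<bullet> d \<noteq> 0" using step(3) by (auto simp: inner_coroot)
    have "d \<in> D0 \<longleftrightarrow> b \<in> span D0" "d \<in> D1 \<longleftrightarrow> b \<in> span D1"
      using nz step(5,2) \<Delta> orth'[of b d] orth'[of d b] span_base[of d D0] span_base[of d D1]
      by (auto simp: inner_commute)
    moreover have "d \<in> D ==> b \<in> span D ==> reflect d b \<in> span D" for D
      by (simp add: refl_eq span_diff span_scale span_base)
    ultimately show ?case using step(5) by blast
  qed
  have all: "b \<in> span D0 \<or> b \<in> span D1" if "b \<in> \<Phi>" for b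
    using pos[of b] pos[of "- b"] uminus_pos_iff[OF that] span_neg[of "- b"] by auto
  have "\<exists>A B. A \<noteq> {} \<and> B \<noteq> {} \<and> A \<inter> B = {} \<and> A \<union> B = \<Phi> \<and> (\<forall>a\<in>A. \<forall>b\<in>B. a \<bullet> b = 0)"
  proof (rule exI[of _ "\<Phi> \<inter> span D1"], rule exI[of _ "\<Phi> \<inter> span D0"], intro conjI ballI)
    show "\<Phi> \<inter> span D1 \<noteq> {}" "\<Phi> \<inter> span D0 \<noteq> {}" using \<open>D0 \<noteq> {}\<close> \<open>D1 \<noteq> {}\<close> \<Delta> simple_subset span_base by blast+
    show "\<Phi> \<inter> span D1 \<inter> (\<Phi> \<inter> span D0) = {}"
      using orth' root_neq_0 by (auto simp: inner_eq_zero_iff) (metis inner_eq_zero_iff)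
    show "\<Phi> \<inter> span D1 \<union> \<Phi> \<inter> span D0 = \<Phi>" using all by auto
  qed (use orth' in auto)
  then show False using irreducible unfolding irreducible_root_system_def by blast
qed

text \<open>Full support and dominance make two maximal coroots pair positively. The product of the
  two Cartan integers is below 4, so one of them is 1; the difference of the coroots is then itself
  a coroot, and its sign makes one of the maximal coroots exceed the other.\<close>

lemma maximal_root_unique:
  assumes "maximal_root p" "maximal_root \<psi>" shows "p = \<psi>"
proof (rule ccontr)
  assume ne: "p \<noteq> \<psi>"
  have \<Phi>: "p \<in> \<Phi>" "\<psi> \<in> \<Phi>" using assms by (auto simp: maximal_root_def)
  have pos: "p \<in> Pos" "\<psi> \<in> Pos" using assms maximal_root_pos by auto
  have nm: "p \<noteq> - \<psi>" using pos uminus_pos_iff[OF \<Phi>(2)] by auto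
  have dom: "coroot d \<bullet> p \<ge> 0" if "d \<in> \<Delta>" for d
    using maximal_root_dominant[OF assms(1) that] by (simp add: inner_commute)
  have "\<exists>d\<in>\<Delta>. coroot d \<bullet> p > 0"
  proof (rule ccontr)
    assume "\<not> ?thesis"
    then have "coroot d \<bullet> p = 0" if "d \<in> \<Delta>" for d using dom that by force
    then have "p \<bullet> p = 0" using inner_crd[of p p] by simp
    then show False using root_neq_0 \<Phi> by simp
  qed
  then obtain d where d: "d \<in> \<Delta>" "coroot d \<bullet> p > 0" by blast
  have "coroot \<psi> \<bullet> p > 0" unfolding inner_crd[of "coroot \<psi>"] by (rule sum_pos2[OF finite_simple d(1)])
      (use d maximal_root_full[OF assms(2)] dom in \<open>auto simp: less_imp_le\<close>)
  then have a: "p \<cdot> \<psi> > 0" by (simp add: inner_commute)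
  then have b: "\<psi> \<cdot> p > 0" using root_neq_0[OF \<Phi>(1)] root_neq_0[OF \<Phi>(2)] coroot_sign[of p \<psi>] by linarith
  have ints: "p \<cdot> \<psi> \<in> \<int>" "\<psi> \<cdot> p \<in> \<int>" using inner_coroot_Ints \<Phi> by auto
  then obtain i j :: int where ij: "p \<cdot> \<psi> = of_int i" "\<psi> \<cdot> p = of_int j" by (metis Ints_cases)
  have "real_of_int (i * j) < 4" using root_product_bound(1)[OF \<Phi> ne nm] ij by simp
  then have "i * j < 4" by (simp only: of_int_less_numeral_iff)
  have "i > 0" "j > 0" using a b ij by auto
  have "i = 1 \<or> j = 1"
  proof (rule ccontr)
    assume "\<not> ?thesis"
    then have "2 * 2 \<le> i * j" using \<open>i > 0\<close> \<open>j > 0\<close> by (intro mult_mono) auto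
    then show False using \<open>i * j < 4\<close> by simp
  qed
  have *: False if "maximal_root p" "maximal_root \<psi>" "p \<cdot> \<psi> = 1" "p \<noteq> \<psi>" "p \<in> \<Phi>" "\<psi> \<in> \<Phi>" for p \<psi>
  proof -
    let ?g = "reflect p \<psi>"
    have g: "?g \<in> \<Phi>" using that refl_root by blast
    have c: "coroot ?g = coroot \<psi> - coroot p" using that by (simp add: coroot_reflect)
    show False
    proof (cases "?g \<in> Pos")
      case True
      have "crd (coroot p) d \<le> crd (coroot \<psi>) d" if "d \<in> \<Delta>" for d
        using crd_pos_coroot[OF True that] unfolding c crd_linear by (auto elim!: Nats_cases)
      then show False using that by (auto simp: maximal_root_def)
    next
      case False
      then have m: "- ?g \<in> Pos" using g uminus_pos_iff by blast
      have "crd (coroot \<psi>) d \<le> crd (coroot p) d" if "d \<in> \<Delta>" for d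
        using crd_pos_coroot[OF m that] unfolding coroot_uminus c crd_linear by (auto elim!: Nats_cases)
      then show False using that by (auto simp: maximal_root_def)
    qed
  qed
  show False using \<open>i = 1 \<or> j = 1\<close> *[of p \<psi>] *[of \<psi> p] assms ne \<Phi> ij by auto
qed

abbreviation "\<alpha>t \<equiv> alpha_tilde \<Phi> \<Delta>"

lemma Nats_of_int_diff: "(x::real) \<in> \<int> ==> y \<in> \<int> ==> x \<le> y ==> y - x \<in> \<nat>"
  by (auto elim!: Ints_cases simp flip: of_int_diff simp: Nats_altdef1)

lemma alpha_tilde: "maximal_root \<alpha>t" "b \<in> \<Phi> ==> d \<in> \<Delta> ==> crd (coroot b) d \<le> crd (coroot \<alpha>t) d"
proof -
  have "\<Phi> \<noteq> {}" using irreducible by (simp add: irreducible_root_system_def)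
  then obtain p where p: "maximal_root p" using exists_maximal_root by blast
  then have p\<Phi>: "p \<in> \<Phi>" by (simp add: maximal_root_def)
  have le: "crd (coroot b) d \<le> crd (coroot p) d" if "b \<in> \<Phi>" "d \<in> \<Delta>" for b d
    using exists_maximal_root[OF that(1)] maximal_root_unique[OF p] that(2) by blast
  have "\<alpha>t = p" unfolding alpha_tilde_def nonneg_comb_coroots
  proof (rule the_equality)
    show "p \<in> \<Phi> \<and> (\<forall>b\<in>\<Phi>. \<forall>d\<in>\<Delta>. crd (coroot p - coroot b) d \<in> \<nat>)"
      using p\<Phi> le crd_coroot_Ints by (auto simp: crd_linear intro!: Nats_of_int_diff)
    fix a assume a: "a \<in> \<Phi> \<and> (\<forall>b\<in>\<Phi>. \<forall>d\<in>\<Delta>. crd (coroot a - coroot b) d \<in> \<nat>)"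
    have "crd (coroot p) d \<le> crd (coroot a) d" if "d \<in> \<Delta>" for d
    proof -
      have "crd (coroot a - coroot p) d \<in> \<nat>" using a p\<Phi> that by blast
      then show ?thesis by (auto simp: crd_linear elim!: Nats_cases)
    qed
    then show "a = p" using p a by (auto simp: maximal_root_def)
  qed
  then show "maximal_root \<alpha>t" "b \<in> \<Phi> ==> d \<in> \<Delta> ==> crd (coroot b) d \<le> crd (coroot \<alpha>t) d" using p le by auto
qed

lemma alpha_tilde_pos: "\<alpha>t \<in> Pos" and alpha_tilde_root: "\<alpha>t \<in> \<Phi>"
  using alpha_tilde(1) maximal_root_pos pos_subset by auto

text \<open>With a pairing \<open>k \<ge> 2\<close>, the negative of the reflected root would have
  as coroot \<open>k\<close> times the highest one minus \<open>coroot b\<close>; being bounded by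
  the highest coroot, this forces \<open>coroot b\<close> to dominate it. The bound ensures that the
  reflection in the affine wall disturbs no other level.\<close>

lemma inner_alpha_tilde:
  assumes "b \<in> Pos" "b \<noteq> \<alpha>t"
  shows "\<alpha>t \<cdot> b = 0 \<or> \<alpha>t \<cdot> b = 1"
proof -
  have b: "b \<in> \<Phi>" using assms pos_subset by blast
  have "coroot b \<bullet> \<alpha>t \<ge> 0" unfolding inner_crd[of "coroot b"]
    using crd_pos_coroot[OF assms(1)] maximal_root_dominant[OF alpha_tilde(1)]
    by (intro sum_nonneg mult_nonneg_nonneg) (auto simp: inner_commute intro: Nats_nonneg)
  moreover have "\<alpha>t \<cdot> b \<in> \<int>" using inner_coroot_Ints b alpha_tilde_root by blast
  ultimately obtain k :: int where k: "\<alpha>t \<cdot> b = of_int k" "k \<ge> 0"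
    by (auto elim!: Ints_cases simp: inner_commute)
  have "k < 2"
  proof (rule ccontr)
    assume k2: "\<not> k < 2"
    let ?g = "- reflect \<alpha>t b"
    have g: "?g \<in> \<Phi>" using refl_root alpha_tilde_root b uminus_root by blast
    have c: "coroot ?g = of_int k *\<^sub>R coroot \<alpha>t - coroot b" using k by (simp add: coroot_uminus coroot_reflect)
    have "crd (coroot \<alpha>t) d \<le> crd (coroot b) d" if "d \<in> \<Delta>" for d
    proof -
      have "of_int k * crd (coroot \<alpha>t) d - crd (coroot b) d \<le> crd (coroot \<alpha>t) d"
        using alpha_tilde(2)[OF g that] unfolding c crd_linear .
      moreover have "of_int k * crd (coroot \<alpha>t) d \<ge> 2 * crd (coroot \<alpha>t) d"
        using maximal_root_full[OF alpha_tilde(1) that] k2 by (intro mult_right_mono) auto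
      ultimately show ?thesis by linarith
    qed
    then show False using alpha_tilde(1) b assms(2) by (auto simp: maximal_root_def)
  qed
  then show ?thesis using k by (cases "k = 0") auto
qed

end

section \<open>Affine maps, levels and lengths\<close>

definition lin :: "('v::real_vector => 'v) => 'v => 'v" where
  "lin x = (\<lambda>y. x y - x 0)"

lemma lin_apply: "x y = lin x y + x 0" by (simp add: lin_def)

lemma lin_eq: "w 0 = 0 ==> lin w = w" by (simp add: lin_def)

lemma lin_comp: "linear (lin x) ==> lin (x o y) = lin x o lin y"
proof (rule ext)
  fix z assume "linear (lin x)"
  then have "lin x (y z - y 0) = lin x (y z) - lin x (y 0)" by (rule linear_diff)
  then show "lin (x o y) z = (lin x o lin y) z" by (simp add: lin_def)
qed

lemma lin_transl: "linear w ==> lin (transl v o w) = w" by (simp add: lin_def transl_def linear_0)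

lemma transl_lin: "transl (x 0) o lin x = x" by (simp add: lin_def transl_def fun_eq_iff)

lemma lin_transl_id: "lin (transl v) = id" by (simp add: lin_def transl_def fun_eq_iff)

lemma lin_affine_refl: "lin (affine_refl a k) = reflect a"
  by (simp add: lin_def affine_refl_def fun_eq_iff algebra_simps)

lemma transl_0 [simp]: "transl 0 = id" by (simp add: transl_def fun_eq_iff)

lemma transl_comp: "transl u o transl v = transl (u + v)" by (simp add: transl_def fun_eq_iff)

context based_root_system
begin

definition weyl :: "('v => 'v) set" where "weyl = generated (reflect ` \<Phi>)"

definition intwt :: "'v => bool" where "intwt v \<longleftrightarrow> (\<forall>a\<in>\<Phi>. v \<cdot> a \<in> \<int>)"

text \<open>Large enough to contain the affine Weyl group and, for every weight function, the
  extended group; so levels, crossings and lengths are treated once, before weights appear.\<close>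

definition aff :: "('v => 'v) set" where "aff = {x. lin x \<in> weyl \<and> intwt (x 0)}"

lemma reflect_comp: "a \<in> \<Phi> ==> affine_refl a k o affine_refl a k = id"
  by (rule ext) (simp add: affine_refl_invol root_neq_0)

lemma weyl_orthogonal: "w \<in> weyl ==> orthogonal_transformation w" unfolding weyl_def
proof (induction rule: generated_induct)
  case id
  then show ?case by (simp add: orthogonal_transformation_def)
next
  case (step s w)
  then show ?case using orthogonal_transformation_compose orthogonal_transformation_refl by blast
qed

lemma weyl_linear: "w \<in> weyl ==> linear w" using weyl_orthogonal by (auto simp: orthogonal_transformation_def)

lemma weyl_0 [simp]: "w \<in> weyl ==> w 0 = 0" using weyl_linear linear_0 by blast

lemma weyl_root: "w \<in> weyl ==> a \<in> \<Phi> ==> w a \<in> \<Phi>" unfolding weyl_def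
  by (induction rule: generated_induct) (auto intro: refl_root)

lemma weyl_inverse: assumes "w \<in> weyl" shows "bij w" "inv w \<in> weyl"
proof -
  have "bij w \<and> inv w \<in> generated (reflect ` \<Phi>)"
    using assms unfolding weyl_def by (intro generated_inverse) (auto simp: reflect_comp)
  then show "bij w" "inv w \<in> weyl" by (auto simp: weyl_def)
qed

lemma weyl_inv_apply [simp]:
  assumes "w \<in> weyl" shows "inv w (w x) = x" "w (inv w x) = x"
  using weyl_inverse(1)[OF assms] by (auto simp: bij_def surj_f_inv_f)

lemma weyl_comp: "v \<in> weyl ==> w \<in> weyl ==> v o w \<in> weyl" unfolding weyl_def by (rule comp_generated)

lemma weyl_id [simp]: "id \<in> weyl" unfolding weyl_def by (rule id_generated)

lemma reflect_weyl: "a \<in> \<Phi> ==> reflect a \<in> weyl" unfolding weyl_def by (rule gen_generated) auto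

lemma weyl_inner: "w \<in> weyl ==> w x \<cdot> (w a) = x \<cdot> a" using orthogonal_inner_coroot weyl_orthogonal by blast

lemma weyl_uminus: "w \<in> weyl ==> w (- x) = - w x" using weyl_linear linear_neg by blast

lemma intwt_weyl: assumes "intwt v" "w \<in> weyl" shows "intwt (w v)" unfolding intwt_def
proof
  fix a assume "a \<in> \<Phi>"
  then have "v \<cdot> (inv w a) \<in> \<int>" using assms weyl_root weyl_inverse unfolding intwt_def by blast
  moreover have "w v \<cdot> a = v \<cdot> (inv w a)" using weyl_inner[OF assms(2), of v "inv w a"] assms(2) by simp
  ultimately show "w v \<cdot> a \<in> \<int>" by simp
qed

lemma intwt_simps: "intwt 0" "intwt u ==> intwt v ==> intwt (u + v)"
    "intwt v ==> intwt (- v)" "intwt u ==> intwt v ==> intwt (u - v)"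
    "intwt v ==> intwt (of_int k *\<^sub>R v)" by (auto simp: intwt_def inner_left_distrib inner_diff_left)

lemma intwt_root: "a \<in> \<Phi> ==> intwt a" by (simp add: intwt_def inner_coroot_Ints)

lemma affD: assumes "x \<in> aff" shows "lin x \<in> weyl" "intwt (x 0)" "linear (lin x)"
  using assms weyl_linear by (auto simp: aff_def)

lemma aff_comp: assumes "x \<in> aff" "y \<in> aff" shows "x o y \<in> aff"
proof -
  have "(x o y) 0 = lin x (y 0) + x 0" by (simp add: lin_def)
  moreover have "intwt (lin x (y 0) + x 0)"
    using intwt_simps(2)[OF intwt_weyl[OF affD(2)[OF assms(2)] affD(1)[OF assms(1)]] affD(2)[OF assms(1)]] .
  ultimately show ?thesis using affD[OF assms(1)] affD(1)[OF assms(2)] by (simp add: aff_def lin_comp weyl_comp)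
qed

lemma weyl_subset_aff: "weyl \<subseteq> aff" by (auto simp: aff_def lin_eq intwt_simps)

lemma id_aff [simp]: "id \<in> aff" using weyl_subset_aff weyl_id by blast

lemma transl_aff: "intwt v ==> transl v \<in> aff"
  using weyl_id by (simp add: aff_def lin_transl_id) (simp add: transl_def)

lemma affine_refl_aff: "a \<in> \<Phi> ==> affine_refl a k \<in> aff" by (auto simp: aff_def lin_affine_refl reflect_weyl)
    (simp add: affine_refl_def intwt_simps intwt_root)

lemma aff_inverse:
  assumes "x \<in> aff" shows "bij x" "inv x \<in> aff" "lin (inv x) = inv (lin x)"
proof -
  let ?w = "inv (lin x)"
  let ?y = "\<lambda>z. ?w (z - x 0)"
  have w: "lin x \<in> weyl" "?w \<in> weyl" using affD[OF assms] weyl_inverse by auto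
  have "?y o x = id"
  proof
    fix z
    have "?w (x z - x 0) = ?w (lin x z)" by (simp add: lin_def)
    then show "(?y o x) z = id z" using w by simp
  qed
  moreover have "x o ?y = id"
  proof
    fix z
    have "x (?w (z - x 0)) = lin x (?w (z - x 0)) + x 0" by (rule lin_apply)
    then show "(x o ?y) z = id z" using w by simp
  qed
  ultimately have "?y o x = id" "x o ?y = id" by blast+
  then show b: "bij x" and "inv x \<in> aff" "lin (inv x) = inv (lin x)"
  proof -
    assume a: "?y o x = id" "x o ?y = id"
    show "bij x" using a o_bij by blast
    have i: "inv x = ?y" using a inv_unique_comp by blast
    have "lin ?y = ?w" using weyl_linear[OF w(2)] by (simp add: lin_def linear_diff linear_0 fun_eq_iff)
    moreover have "intwt (?y 0)" using intwt_weyl[OF intwt_simps(3)[OF affD(2)[OF assms]] w(2)] by simp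
    ultimately show "inv x \<in> aff" "lin (inv x) = inv (lin x)" using w i by (auto simp: aff_def)
  qed
qed

lemma aff_inv_comp [simp]:
  assumes "x \<in> aff" shows "inv x o x = id" "x o inv x = id"
  using aff_inverse(1)[OF assms] by (auto simp: bij_def surj_iff)

lemma affine_weyl_subset: "affine_weyl \<Phi> \<subseteq> aff"
proof
  fix w assume "w \<in> affine_weyl \<Phi>"
  then show "w \<in> aff" unfolding affine_weyl_def
  proof (induction rule: generated_induct)
    case id
    show ?case by (rule id_aff)
  next
    case (step s w)
    then obtain a n where "s = affine_refl a n" "a \<in> \<Phi>" by blast
    then show ?case using aff_comp[OF affine_refl_aff step(3)] by blast
  qed
qed

lemma finite_weyl_eq: "finite_weyl \<Phi> = weyl"
proof
  show "finite_weyl \<Phi> \<subseteq> weyl"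
  proof
    fix w assume "w \<in> finite_weyl \<Phi>"
    then have "w \<in> aff" "w 0 = 0" using affine_weyl_subset by (auto simp: finite_weyl_def)
    then show "w \<in> weyl" using affD(1) lin_eq by metis
  qed
  have "reflect ` \<Phi> \<subseteq> generated {affine_refl a n |a n. a \<in> \<Phi>}" by (blast intro: gen_generated)
  then have "weyl \<subseteq> affine_weyl \<Phi>" unfolding weyl_def affine_weyl_def by (rule generated_mono)
  then show "weyl \<subseteq> finite_weyl \<Phi>" using weyl_0 by (auto simp: finite_weyl_def)
qed

lemma finite_weyl': "finite weyl"
proof -
  have "inj_on (\<lambda>w. restrict w \<Phi>) weyl"
  proof (rule inj_onI)
    fix v w assume vw: "v \<in> weyl" "w \<in> weyl" "restrict v \<Phi> = restrict w \<Phi>"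
    have "v x = w x" if "x \<in> \<Phi>" for x using vw(3) that by (metis restrict_apply')
    then show "v = w"
      using linear_eq_on_span[OF weyl_linear[OF vw(1)] weyl_linear[OF vw(2)], of \<Phi>] span_roots by auto
  qed
  moreover have "(\<lambda>w. restrict w \<Phi>) ` weyl \<subseteq> (\<Phi> \<rightarrow>\<^sub>E \<Phi>)" using weyl_root by auto
  ultimately show ?thesis
    using finite_PiE[OF finite_roots, of "\<lambda>_. \<Phi>"] finite_roots finite_subset finite_imageD by metis
qed

lemma reflect_conj:
  assumes "w \<in> weyl" shows "reflect (w a) = w o reflect a o inv w"
proof
  fix x
  have "w (inv w x - (inv w x \<cdot> a) *\<^sub>R a) = x - (inv w x \<cdot> a) *\<^sub>R w a"
    using weyl_linear[OF assms] assms by (simp add: linear_diff linear_scale)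
  moreover have "inv w x \<cdot> a = x \<cdot> (w a)" using weyl_inner[OF assms, of "inv w x" a] assms by simp
  ultimately show "reflect (w a) x = (w o reflect a o inv w) x" by (simp add: refl_eq)
qed

lemma finite_gens_involution: "s \<in> finite_gens \<Delta> ==> s o s = id"
  using simple_subset by (auto simp: finite_gens_def reflect_comp)

lemma finite_gens_subset: "generated (finite_gens \<Delta>) \<subseteq> weyl" unfolding weyl_def using simple_subset
  by (intro generated_mono) (auto simp: finite_gens_def intro!: gen_generated)

lemma root_conj_simple:
  assumes "a \<in> \<Phi>" obtains w d where "w \<in> generated (finite_gens \<Delta>)" "d \<in> \<Delta>" "a = w d"
proof -
  have *: "\<exists>w\<in>generated (finite_gens \<Delta>). \<exists>d\<in>\<Delta>. a = w d" if "a \<in> Pos" for a using that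
  proof (induction rule: pos_induct)
    case (simple d)
    then show ?case using id_generated by (metis id_apply)
  next
    case (step b d)
    then obtain w c where "w \<in> generated (finite_gens \<Delta>)" "c \<in> \<Delta>" "b = w c" by blast
    then show ?case using step(2) by (intro bexI[of _ "reflect d o w"] bexI[of _ c])
        (auto simp: finite_gens_def intro: comp_generated gen_generated)
  qed
  show ?thesis
  proof (cases "a \<in> Pos")
    case True
    then show ?thesis using * that by blast
  next
    case False
    then obtain w d where w: "w \<in> generated (finite_gens \<Delta>)" "d \<in> \<Delta>" "- a = w d"
      using * uminus_pos_iff[OF assms] by blast
    have "a = (w o reflect d) d" using w finite_gens_subset simple_subset root_neq_0
      by (auto simp: refl_self weyl_uminus subset_iff) (metis minus_minus)
    moreover have "w o reflect d \<in> generated (finite_gens \<Delta>)"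
      using comp_generated[OF w(1) gen_generated] w(2) by (auto simp: finite_gens_def)
    ultimately show ?thesis using that w(2) by blast
  qed
qed

lemma weyl_eq: "weyl = generated (finite_gens \<Delta>)"
proof
  show "weyl \<subseteq> generated (finite_gens \<Delta>)" unfolding weyl_def
  proof (rule generated_mono, rule image_subsetI)
    fix a assume "a \<in> \<Phi>"
    then obtain w d where w: "w \<in> generated (finite_gens \<Delta>)" "d \<in> \<Delta>" "a = w d" by (rule root_conj_simple)
    have "inv w \<in> generated (finite_gens \<Delta>)" using generated_inverse[OF finite_gens_involution w(1)] by blast
    moreover have "reflect d \<in> generated (finite_gens \<Delta>)"
      using w(2) by (intro gen_generated) (auto simp: finite_gens_def)
    moreover have "reflect a = w o reflect d o inv w" using reflect_conj[of w d] w finite_gens_subset by blast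
    ultimately show "reflect a \<in> generated (finite_gens \<Delta>)" using w(1) by (simp add: comp_generated)
  qed
qed (rule finite_gens_subset)

text \<open>A point of the fundamental alcove: a positive multiple of \<open>htvec\<close>, whose
  denominator exceeds every pairing of \<open>htvec\<close> with a coroot.\<close>

definition basept :: 'v where
  "basept = (1 / (1 + (\<Sum>a\<in>\<Phi>. \<bar>htvec \<cdot> a\<bar>))) *\<^sub>R htvec"

lemma basept_pos:
  assumes "a \<in> Pos" shows "0 < basept \<cdot> a" "basept \<cdot> a < 1"
proof -
  have a: "a \<in> \<Phi>" "a \<noteq> 0" using assms pos_subset root_neq_0 by auto
  have "htvec \<bullet> a > 0" using pos_iff[OF a(1)] assms by (simp add: inner_commute)
  then have p: "htvec \<cdot> a > 0" using a by (simp add: inner_coroot)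
  have s: "(\<Sum>a\<in>\<Phi>. \<bar>htvec \<cdot> a\<bar>) \<ge> \<bar>htvec \<cdot> a\<bar>" by (rule member_le_sum[OF a(1) _ finite_roots]) auto
  then show "0 < basept \<cdot> a" using p by (simp add: basept_def)
  show "basept \<cdot> a < 1" using p s by (simp add: basept_def divide_less_eq)
qed

text \<open>The alcove of \<open>x\<close> lies in the strip of direction \<open>a\<close> between
  the levels \<open>lev x a\<close> and \<open>lev x a + 1\<close>. Negative roots are included,
  with \<open>lev x (- a) = - lev x a - 1\<close>.\<close>

definition lev :: "('v => 'v) => 'v => int" where
  "lev x a = \<lfloor>x basept \<cdot> a\<rfloor>"

lemma basept_lev_id:
  assumes "a \<in> \<Phi>"
  shows "lev id a = (if a \<in> Pos then 0 else -1)"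
    "of_int (lev id a) < basept \<cdot> a" "basept \<cdot> a < of_int (lev id a) + 1"
proof -
  have "lev id a = (if a \<in> Pos then 0 else -1) \<and>
    of_int (lev id a) < basept \<cdot> a \<and> basept \<cdot> a < of_int (lev id a) + 1"
  proof (cases "a \<in> Pos")
    case True
    then have "lev id a = 0" using basept_pos[OF True] by (simp add: lev_def floor_eq_iff)
    then show ?thesis using basept_pos[OF True] True by simp
  next
    case False
    then have p: "- a \<in> Pos" using uminus_pos_iff[OF assms] by blast
    have "lev id a = -1" using basept_pos[OF p] by (simp add: lev_def floor_eq_iff coroot_uminus)
    then show ?thesis using basept_pos[OF p] False by (simp add: coroot_uminus)
  qed
  then show "lev id a = (if a \<in> Pos then 0 else -1)"
    "of_int (lev id a) < basept \<cdot> a" "basept \<cdot> a < of_int (lev id a) + 1" by auto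
qed

lemma inner_comp:
  assumes "x \<in> aff" "b \<in> \<Phi>"
  shows "x y \<cdot> (lin x b) = y \<cdot> b + x 0 \<cdot> (lin x b)"
proof -
  have "x y \<cdot> (lin x b) = lin x y \<cdot> (lin x b) + x 0 \<cdot> (lin x b)"
    using lin_apply[of x y] by (simp add: inner_left_distrib)
  then show ?thesis using weyl_inner affD(1)[OF assms(1)] by simp
qed

text \<open>Left multiplication permutes the directions by \<open>lin x\<close> and shifts the
  levels of each by a constant; differences of levels are therefore merely transported, as
  \<open>lev_diff\<close> records.\<close>

lemma lev_comp:
  assumes "x \<in> aff" "b \<in> \<Phi>"
  shows "of_int (lev (x o y) (lin x b)) = of_int (lev y b) + x 0 \<cdot> (lin x b)"
proof -
  have "x 0 \<cdot> (lin x b) \<in> \<int>" using affD[OF assms(1)] weyl_root assms(2) by (auto simp: intwt_def)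
  then obtain k :: int where k: "x 0 \<cdot> (lin x b) = of_int k" by (auto elim: Ints_cases)
  then show ?thesis using inner_comp[OF assms, of "y basept"] by (simp add: lev_def)
qed

lemma lev_lin:
  assumes "x \<in> aff" "b \<in> \<Phi>"
  shows "of_int (lev x (lin x b)) = of_int (lev id b) + x 0 \<cdot> (lin x b)" using lev_comp[OF assms, of id] by simp

lemma lev_diff:
  assumes "x \<in> aff" "b \<in> \<Phi>"
  shows "lev (x o y) (lin x b) - lev (x o z) (lin x b) = lev y b - lev z b"
  using lev_comp[OF assms, of y] lev_comp[OF assms, of z] by (simp flip: of_int_eq_iff)

lemma root_lin_cases: "x \<in> aff ==> a \<in> \<Phi> ==> \<exists>b\<in>\<Phi>. a = lin x b"
  by (rule bexI[of _ "inv (lin x) a"]) (use affD weyl_inverse weyl_root in auto)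

lemma lev_strict:
  assumes "x \<in> aff" "a \<in> \<Phi>"
  shows "of_int (lev x a) < x basept \<cdot> a" "x basept \<cdot> a < of_int (lev x a) + 1"
proof -
  obtain b where b: "b \<in> \<Phi>" "a = lin x b" using root_lin_cases[OF assms] by blast
  note * = lev_lin[OF assms(1) b(1)] inner_comp[OF assms(1) b(1), of basept]
      basept_lev_id(2,3)[OF b(1)]
  show "of_int (lev x a) < x basept \<cdot> a" unfolding b(2) using * by linarith
  show "x basept \<cdot> a < of_int (lev x a) + 1" unfolding b(2) using * by linarith
qed

lemma lev_uminus:
  assumes "x \<in> aff" "a \<in> \<Phi>" shows "lev x (- a) = - lev x a - 1"
  using lev_strict[OF assms] by (simp add: lev_def[of x "- a"] coroot_uminus floor_eq_iff)

lemma lev_transl: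
  assumes "intwt v" "a \<in> \<Phi>"
  shows "of_int (lev (transl v o x) a) = of_int (lev x a) + v \<cdot> a"
  using lev_comp[OF transl_aff[OF assms(1)] assms(2), of x] by (simp add: lin_transl_id) (simp add: transl_def)

lemma lev_weyl: "w \<in> weyl ==> b \<in> \<Phi> ==> lev (w o x) (w b) = lev x b"
  using lev_comp[of w b x] weyl_subset_aff by (auto simp: lin_eq)

text \<open>Outer normals of the fundamental alcove. With this orientation each wall lies at level
  \<open>lev id t + 1\<close>, which is 0 for \<open>- d\<close> and 1 for \<open>\<alpha>t\<close>,
  so that simple and affine generators are treated alike.\<close>

definition walls :: "'v set" where "walls = uminus ` \<Delta> \<union> {\<alpha>t}"

abbreviation "gens \<equiv> affine_gens \<Phi> \<Delta>"

lemma walls_subset: "walls \<subseteq> \<Phi>" using simple_subset uminus_root alpha_tilde_root by (auto simp: walls_def)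

lemma lev_id_walls: "d \<in> \<Delta> ==> lev id (- d) = -1" "lev id \<alpha>t = 0"
  using basept_lev_id(1)[of "- d"] basept_lev_id(1)[of \<alpha>t] subsetD[OF simple_pos, of d]
    subsetD[OF simple_subset, of d] alpha_tilde_pos
    uminus_pos_iff[of d] uminus_root alpha_tilde_root by auto

lemma gens_eq: "gens = (\<lambda>t. affine_refl t (lev id t + 1)) ` walls"
proof -
  have "affine_refl (- d) (lev id (- d) + 1) = reflect d" if "d \<in> \<Delta>" for d
    using affine_refl_uminus[of d 0] lev_id_walls(1)[OF that] by simp
  then have "(\<lambda>t. affine_refl t (lev id t + 1)) ` uminus ` \<Delta> = finite_gens \<Delta>"
    unfolding finite_gens_def image_image by (intro image_cong) auto
  then show ?thesis using lev_id_walls(2) by (simp add: affine_gens_def walls_def image_Un)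
qed

lemma gens_aff: "s \<in> gens ==> s \<in> aff" using gens_eq affine_refl_aff walls_subset by auto

lemma gens_involution: "s \<in> gens ==> s o s = id" using gens_eq reflect_comp walls_subset by auto

text \<open>Only the wall itself separates the two alcoves. For a simple wall this is
  \<open>refl_pos\<close>; for the affine wall it rests on \<open>inner_alpha_tilde\<close> and on
  the maximality of the coroot of \<open>\<alpha>t\<close>.\<close>

lemma lev_wall:
  assumes "\<theta> \<in> walls"
  defines "s \<equiv> affine_refl \<theta> (lev id \<theta> + 1)"
  shows "lev s \<theta> = lev id \<theta> + 1" "a \<in> \<Phi> ==> a \<noteq> \<theta> ==> a \<noteq> - \<theta> ==> lev s a = lev id a"
proof -
  have \<theta>: "\<theta> \<in> \<Phi>" "\<theta> \<noteq> 0" using assms walls_subset root_neq_0 by auto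
  let ?k = "lev id \<theta> + 1"
  have s: "s basept = basept + (of_int ?k - basept \<cdot> \<theta>) *\<^sub>R \<theta>"
    by (simp add: s_def affine_refl_def algebra_simps)
  have "s basept \<cdot> \<theta> = 2 * of_int ?k - basept \<cdot> \<theta>"
    using \<theta> by (simp add: s inner_left_distrib inner_coroot_self algebra_simps)
  then show "lev s \<theta> = lev id \<theta> + 1"
    using basept_lev_id(2,3)[OF \<theta>(1)] unfolding lev_def[of s] by (simp add: floor_eq_iff)
  have pos: "lev s a = lev id a" if a: "a \<in> Pos" "a \<noteq> \<theta>" "a \<noteq> - \<theta>" for a
  proof (cases "\<exists>d\<in>\<Delta>. \<theta> = - d")
    case True
    then obtain d where d: "d \<in> \<Delta>" "\<theta> = - d" by blast
    have "s = reflect d" using affine_refl_uminus[of d 0] lev_id_walls(1)[OF d(1)] d by (simp add: s_def)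
    moreover have p: "reflect d a \<in> Pos" using refl_pos a(1) d a(3) by auto
    moreover have "reflect d basept \<cdot> a = basept \<cdot> (reflect d a)"
      using inner_refl_left[of d basept "coroot a"] d \<theta> by (simp add: coroot_refl)
    ultimately show ?thesis using basept_lev_id(1)[of a] a(1) subsetD[OF pos_subset a(1)] basept_pos[OF p]
      by (simp add: lev_def[of "reflect d"] floor_eq_iff)
  next
    case False
    then have t: "\<theta> = \<alpha>t" using assms(1) by (auto simp: walls_def)
    have a': "a \<in> \<Phi>" using a pos_subset by blast
    have k: "lev id \<theta> = 0" using lev_id_walls(2) t by simp
    have eq: "s basept \<cdot> a = basept \<cdot> a + (1 - basept \<cdot> \<alpha>t) * (\<alpha>t \<cdot> a)"
      using k t by (simp add: s inner_left_distrib)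
    have "0 < s basept \<cdot> a \<and> s basept \<cdot> a < 1"
    proof (cases "\<alpha>t \<cdot> a = 0")
      case True
      then show ?thesis using basept_pos[OF a(1)] eq by simp
    next
      case False
      then have 1: "\<alpha>t \<cdot> a = 1" using inner_alpha_tilde[OF a(1)] a t by blast
      \<comment> \<open>The mirrored point pairs with the coroot of \<open>a\<close> to
        \<open>1 + basept \<cdot> a - basept \<cdot> \<alpha>t\<close>; this stays below 1 because
        \<open>coroot a\<close> is strictly smaller than the highest coroot in some
        coordinate.\<close>
      have "basept \<cdot> a < basept \<cdot> \<alpha>t"
      proof -
        have bp: "coroot d \<bullet> basept > 0" if "d \<in> \<Delta>" for d
          using basept_pos[of d] that simple_pos by (auto simp: inner_commute)
        have "\<exists>d\<in>\<Delta>. crd (coroot a) d < crd (coroot \<alpha>t) d"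
        proof (rule ccontr)
          assume "\<not> ?thesis"
          then have "\<forall>d\<in>\<Delta>. crd (coroot \<alpha>t) d \<le> crd (coroot a) d" by auto
          then show False using alpha_tilde(1) a' a(2) t by (auto simp: maximal_root_def)
        qed
        then obtain d where "d \<in> \<Delta>" "crd (coroot a) d < crd (coroot \<alpha>t) d" by blast
        then have "(\<Sum>d\<in>\<Delta>. crd (coroot a) d * (coroot d \<bullet> basept)) <
            (\<Sum>d\<in>\<Delta>. crd (coroot \<alpha>t) d * (coroot d \<bullet> basept))" using bp alpha_tilde(2)[OF a']
          by (intro sum_strict_mono_ex1[OF finite_simple]) (auto intro!: mult_right_mono mult_strict_right_mono less_imp_le)
        then show ?thesis
          using inner_crd[of "coroot a" basept] inner_crd[of "coroot \<alpha>t" basept] by (simp add: inner_commute)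
      qed
      then show ?thesis using eq 1 basept_pos[OF a(1)] basept_pos[OF alpha_tilde_pos] by simp
    qed
    then have "lev s a = 0" by (simp add: lev_def floor_eq_iff)
    then show ?thesis using basept_lev_id(1)[OF a'] a(1) by simp
  qed
  show "lev s a = lev id a" if a: "a \<in> \<Phi>" "a \<noteq> \<theta>" "a \<noteq> - \<theta>"
  proof (cases "a \<in> Pos")
    case False
    have "lev s (- a) = lev id (- a)" using pos[of "- a"] a False uminus_pos_iff by (metis minus_equation_iff)
    then show ?thesis
      using lev_uminus[OF affine_refl_aff[OF \<theta>(1)] a(1)] lev_uminus[OF id_aff a(1)] by (simp add: s_def)
  qed (use pos a in blast)
qed

lemma affine_refl_conj:
  assumes "x \<in> aff" "t \<in> \<Phi>"
  shows "x o affine_refl t (lev id t + 1) = affine_refl (lin x t) (lev x (lin x t) + 1) o x"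
proof
  fix y
  let ?k = "lev id t + 1"
  have "lin x (y - (y \<cdot> t - of_int ?k) *\<^sub>R t) = lin x y - (y \<cdot> t - of_int ?k) *\<^sub>R lin x t"
    using affD(3)[OF assms(1)] by (simp only: linear_diff linear_scale)
  then have "x (affine_refl t ?k y) = x y - (y \<cdot> t - of_int ?k) *\<^sub>R lin x t"
    using lin_apply[of x y] lin_apply[of x "affine_refl t ?k y"] by (simp add: affine_refl_def algebra_simps)
  also have "y \<cdot> t - of_int ?k = x y \<cdot> (lin x t) - of_int (lev x (lin x t) + 1)"
    using inner_comp[OF assms, of y] lev_lin[OF assms] by simp
  finally show "(x o affine_refl t ?k) y = (affine_refl (lin x t) (lev x (lin x t) + 1) o x) y"
    by (simp only: o_apply affine_refl_def[of "lin x t"])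
qed

text \<open>The root whose hyperplane is crossed between the alcoves of \<open>x\<close> and
  \<open>x o s\<close>, oriented so that the level rises. Its sign tells steps to the positive side
  from steps to the negative side, which later decides between \<open>T s\<close> and its
  inverse.\<close>

definition cr :: "('v => 'v) => ('v => 'v) => 'v" where
  "cr x s = (THE b. b \<in> \<Phi> \<and> lev (x o s) b = lev x b + 1)"

lemma cr_eq:
  assumes "x \<in> aff" "t \<in> walls" "s = affine_refl t (lev id t + 1)"
  shows "cr x s = lin x t" "lev (x o s) (lin x t) = lev x (lin x t) + 1"
    "a \<in> \<Phi> ==> a \<noteq> lin x t ==> a \<noteq> - lin x t ==> lev (x o s) a = lev x a"
proof -
  have t: "t \<in> \<Phi>" using assms(2) walls_subset by blast
  show 1: "lev (x o s) (lin x t) = lev x (lin x t) + 1"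
    using lev_diff[OF assms(1) t, of s id] lev_wall(1)[OF assms(2)] assms(3) by simp
  show 2: "lev (x o s) a = lev x a" if a: "a \<in> \<Phi>" "a \<noteq> lin x t" "a \<noteq> - lin x t" for a
  proof -
    obtain b where b: "b \<in> \<Phi>" "a = lin x b" using root_lin_cases[OF assms(1) a(1)] by blast
    have "b \<noteq> t" "b \<noteq> - t" using a b affD(3)[OF assms(1)] by (auto simp: linear_neg)
    then show ?thesis
      using lev_diff[OF assms(1) b(1), of s id] lev_wall(2)[OF assms(2) b(1)] assms(3) b(2) by simp
  qed
  have lt: "lin x t \<in> \<Phi>" using weyl_root affD(1)[OF assms(1)] t by blast
  have xs: "x o s \<in> aff" using aff_comp assms(1) affine_refl_aff[OF t] assms(3) by simp
  show "cr x s = lin x t" unfolding cr_def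
  proof (rule the_equality)
    fix b assume b: "b \<in> \<Phi> \<and> lev (x o s) b = lev x b + 1"
    then have "b = lin x t \<or> b = - lin x t" using 2[of b] by auto
    moreover have "b \<noteq> - lin x t"
    proof
      assume "b = - lin x t"
      then show False using b 1 lev_uminus[OF assms(1) lt] lev_uminus[OF xs lt] by simp
    qed
    ultimately show "b = lin x t" by blast
  qed (use 1 lt in blast)
qed

lemma cr:
  assumes "x \<in> aff" "s \<in> gens"
  shows "cr x s \<in> \<Phi>" "lev (x o s) (cr x s) = lev x (cr x s) + 1"
    "\<And>a. a \<in> \<Phi> ==> a \<noteq> cr x s ==> a \<noteq> - cr x s ==> lev (x o s) a = lev x a"
    "x o s = affine_refl (cr x s) (lev x (cr x s) + 1) o x"
    "\<And>g. g \<in> aff ==> cr (g o x) s = lin g (cr x s)"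
proof -
  obtain t where t: "t \<in> walls" "s = affine_refl t (lev id t + 1)" using assms(2) gens_eq by auto
  have "t \<in> \<Phi>" using t walls_subset by blast
  then show "cr x s \<in> \<Phi>" using cr_eq(1)[OF assms(1) t] weyl_root affD(1)[OF assms(1)] by simp
  show "lev (x o s) (cr x s) = lev x (cr x s) + 1"
    "\<And>a. a \<in> \<Phi> ==> a \<noteq> cr x s ==> a \<noteq> - cr x s ==> lev (x o s) a = lev x a" using cr_eq[OF assms(1) t] by auto
  show "x o s = affine_refl (cr x s) (lev x (cr x s) + 1) o x"
    using affine_refl_conj[OF assms(1) \<open>t \<in> \<Phi>\<close>] cr_eq(1)[OF assms(1) t] t(2) by simp
  show "cr (g o x) s = lin g (cr x s)" if "g \<in> aff" for g
    using cr_eq(1)[OF aff_comp[OF that assms(1)] t] cr_eq(1)[OF assms(1) t] lin_comp[OF affD(3)[OF that]]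
    by simp
qed

end

section \<open>The length function\<close>

context based_root_system
begin

text \<open>Counts the hyperplanes separating the alcove of \<open>x\<close> from the fundamental
  one, all of whose positive levels are 0. On \<open>aff\<close>, length 0 means that the
  fundamental alcove is preserved.\<close>

definition len :: "('v => 'v) => nat" where "len x = (\<Sum>a\<in>Pos. nat \<bar>lev x a\<bar>)"

lemma roots_split: "\<Phi> = Pos \<union> uminus ` Pos" "Pos \<inter> uminus ` Pos = {}"
proof -
  show "\<Phi> = Pos \<union> uminus ` Pos"
  proof (intro equalityI subsetI)
    fix x assume "x \<in> \<Phi>"
    then have "x \<in> Pos \<or> - x \<in> Pos" using uminus_pos_iff by blast
    then show "x \<in> Pos \<union> uminus ` Pos" by (metis UnI1 UnI2 image_eqI minus_minus)
  qed (use pos_subset uminus_root in auto)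
  show "Pos \<inter> uminus ` Pos = {}" using uminus_pos_iff subsetD[OF pos_subset] by auto
qed

lemma sum_roots: "sum f \<Phi> = (\<Sum>a\<in>Pos. f a + f (- a))"
proof -
  have "sum f \<Phi> = sum f Pos + sum f (uminus ` Pos)"
    using roots_split finite_pos by (metis finite_imageI sum.union_disjoint)
  also have "sum f (uminus ` Pos) = (\<Sum>a\<in>Pos. f (- a))" by (simp add: sum.reindex)
  finally show ?thesis by (simp add: sum.distrib)
qed

text \<open>Summing over all roots counts each hyperplane twice, but allows reindexing by any
  element of the finite group. This yields invariance of the length under inversion and under left
  factors of length 0.\<close>

lemma len_sym: assumes "x \<in> aff" shows "2 * len x = (\<Sum>b\<in>\<Phi>. nat \<bar>lev x b - lev id b\<bar>)"
proof -
  have "(\<Sum>b\<in>\<Phi>. nat \<bar>lev x b - lev id b\<bar>) = (\<Sum>a\<in>Pos. 2 * nat \<bar>lev x a\<bar>)" unfolding sum_roots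
  proof (rule sum.cong)
    fix a assume a: "a \<in> Pos"
    then have \<Phi>: "a \<in> \<Phi>" using pos_subset by blast
    then show "nat \<bar>lev x a - lev id a\<bar> + nat \<bar>lev x (- a) - lev id (- a)\<bar> = 2 * nat \<bar>lev x a\<bar>"
      using a basept_lev_id(1)[OF \<Phi>] lev_uminus[OF assms \<Phi>] lev_uminus[OF id_aff \<Phi>] by simp
  qed simp
  then show ?thesis by (simp add: len_def sum_distrib_left)
qed

lemma weyl_bij_betw: "w \<in> weyl ==> bij_betw w \<Phi> \<Phi>"
  by (rule bij_betwI[where g = "inv w"]) (auto simp: weyl_root weyl_inverse)

lemma sum_weyl: "w \<in> weyl ==> (\<Sum>b\<in>\<Phi>. f (w b)) = sum f \<Phi>" by (rule sum.reindex_bij_betw[OF weyl_bij_betw])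

lemma len_id [simp]: "len id = 0" by (simp add: len_def basept_lev_id(1) subsetD[OF pos_subset])

lemma len_0D: "x \<in> aff ==> len x = 0 ==> b \<in> \<Phi> ==> lev x b = lev id b"
  using len_sym[of x] finite_roots by (simp add: sum_eq_0_iff)

lemma len_0I:
  assumes "\<And>a. a \<in> Pos ==> lev x a = 0" shows "len x = 0" using assms by (simp add: len_def)

lemma len_inverse: assumes "x \<in> aff" shows "len (inv x) = len x"
proof -
  have "2 * len (inv x) = (\<Sum>b\<in>\<Phi>. nat \<bar>lev (inv x) b - lev id b\<bar>)" by (rule len_sym[OF aff_inverse(2)[OF assms]])
  also have "\<dots> = (\<Sum>b\<in>\<Phi>. nat \<bar>lev x (lin x b) - lev id (lin x b)\<bar>)"
  proof (rule sum.cong)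
    fix b assume "b \<in> \<Phi>"
    then have "lev id (lin x b) - lev x (lin x b) = lev (inv x) b - lev id b"
      using lev_diff[OF assms, of b "inv x" id] assms by (simp only: aff_inv_comp comp_id)
    then show "nat \<bar>lev (inv x) b - lev id b\<bar> = nat \<bar>lev x (lin x b) - lev id (lin x b)\<bar>" by linarith
  qed simp
  also have "\<dots> = 2 * len x" using sum_weyl[OF affD(1)[OF assms]] len_sym[OF assms] by simp
  finally show ?thesis by simp
qed

lemma len_comp_left: assumes "a \<in> aff" "x \<in> aff" "len a = 0" shows "len (a o x) = len x"
proof -
  have "2 * len (a o x) = (\<Sum>b\<in>\<Phi>. nat \<bar>lev (a o x) (lin a b) - lev id (lin a b)\<bar>)"
    using len_sym[OF aff_comp[OF assms(1,2)]]
      sum_weyl[OF affD(1)[OF assms(1)], of "\<lambda>b. nat \<bar>lev (a o x) b - lev id b\<bar>"] by simp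
  also have "\<dots> = (\<Sum>b\<in>\<Phi>. nat \<bar>lev x b - lev id b\<bar>)"
  proof (rule sum.cong)
    fix b assume b: "b \<in> \<Phi>"
    then have "lev a (lin a b) = lev id (lin a b)"
      using len_0D[OF assms(1,3)] weyl_root affD(1)[OF assms(1)] by blast
    then show "nat \<bar>lev (a o x) (lin a b) - lev id (lin a b)\<bar> = nat \<bar>lev x b - lev id b\<bar>"
      using lev_diff[OF assms(1) b, of x id] by simp
  qed simp
  finally show ?thesis using len_sym[OF assms(2)] by simp
qed

lemma lev_comp_right:
  assumes "x \<in> aff" "a \<in> aff" "len a = 0" "r \<in> \<Phi>" shows "lev (x o a) r = lev x r"
proof -
  obtain b where b: "b \<in> \<Phi>" "r = lin x b" using root_lin_cases[OF assms(1,4)] by blast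
  then show ?thesis using lev_diff[OF assms(1) b(1), of a id] len_0D[OF assms(2,3) b(1)] by simp
qed

lemma len_comp_right: "x \<in> aff ==> a \<in> aff ==> len a = 0 ==> len (x o a) = len x"
  using lev_comp_right[of x a] subsetD[OF pos_subset] unfolding len_def[of x] len_def[of "x o a"]
  by (intro sum.cong) simp_all

lemma len_step:
  assumes "x \<in> aff" "s \<in> gens"
  shows "lev x (cr x s) \<ge> lev id (cr x s) ==> len (x o s) = len x + 1"
    "lev x (cr x s) < lev id (cr x s) ==> len x = len (x o s) + 1"
proof -
  let ?b = "cr x s"
  define c where "c = (if ?b \<in> Pos then ?b else - ?b)"
  have b: "?b \<in> \<Phi>" using cr(1)[OF assms] .
  have c: "c \<in> Pos" using uminus_pos_iff[OF b] by (simp add: c_def)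
  have xs: "x o s \<in> aff" using aff_comp assms gens_aff by blast
  have same: "(\<Sum>a\<in>Pos - {c}. nat \<bar>lev (x o s) a\<bar>) = (\<Sum>a\<in>Pos - {c}. nat \<bar>lev x a\<bar>)"
  proof (rule sum.cong)
    fix a assume a: "a \<in> Pos - {c}"
    then have "a \<in> \<Phi>" using pos_subset by blast
    moreover have "a \<noteq> ?b \<and> a \<noteq> - ?b" using a uminus_pos_iff[OF b] by (auto simp: c_def split: if_splits)
    ultimately have "lev (x o s) a = lev x a" using cr(3)[OF assms] by blast
    then show "nat \<bar>lev (x o s) a\<bar> = nat \<bar>lev x a\<bar>" by simp
  qed simp
  have len: "len y = nat \<bar>lev y c\<bar> + (\<Sum>a\<in>Pos - {c}. nat \<bar>lev y a\<bar>)" for y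
    unfolding len_def by (rule sum.remove[OF finite_pos c])
  have lev: "if ?b \<in> Pos then lev (x o s) c = lev x c + 1 \<and> lev x c = lev x ?b \<and> lev id ?b = 0
     else lev (x o s) c = lev x c - 1 \<and> lev x c = - lev x ?b - 1 \<and> lev id ?b = -1"
    using cr(2)[OF assms] lev_uminus[OF assms(1) b] lev_uminus[OF xs b] basept_lev_id(1)[OF b]
    by (simp add: c_def)
  show "len (x o s) = len x + 1" if "lev x ?b \<ge> lev id ?b"
    using lev that unfolding len[of x] len[of "x o s"] same by (auto split: if_splits)
  show "len x = len (x o s) + 1" if "lev x ?b < lev id ?b"
    using lev that unfolding len[of x] len[of "x o s"] same by (auto split: if_splits)
qed

lemma len_le_Suc: "x \<in> aff ==> s \<in> gens ==> len (x o s) \<le> Suc (len x)" using len_step[of x s] by linarith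

text \<open>The wall inequalities imply all others: a positive coroot is a nonnegative combination
  of simple coroots and is bounded by the highest coroot.\<close>

lemma alcove_eqI:
  assumes "z \<in> aff" "\<And>\<theta>. \<theta> \<in> walls ==> lev z \<theta> \<le> lev id \<theta>" "a \<in> Pos"
  shows "lev z a = 0"
proof -
  let ?y = "z basept"
  have nn: "coroot d \<bullet> ?y \<ge> 0" if "d \<in> \<Delta>" for d
  proof -
    have d: "d \<in> \<Phi>" using that simple_subset by blast
    have "lev z (- d) \<le> -1" using assms(2)[of "- d"] that lev_id_walls(1)[OF that] by (auto simp: walls_def)
    then have "lev z d \<ge> 0" using lev_uminus[OF assms(1) d] by linarith
    then have "real_of_int (lev z d) \<ge> 0" by simp
    then show ?thesis using lev_strict(1)[OF assms(1) d] inner_commute[of ?y "coroot d"] by linarith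
  qed
  have "lev z \<alpha>t \<le> 0" using assms(2)[of \<alpha>t] lev_id_walls(2) by (simp add: walls_def)
  then have "real_of_int (lev z \<alpha>t) \<le> 0" by simp
  then have t: "coroot \<alpha>t \<bullet> ?y < 1"
    using lev_strict(2)[OF assms(1) alpha_tilde_root] inner_commute[of ?y "coroot \<alpha>t"] by linarith
  have c: "crd (coroot a) d \<ge> 0" if "d \<in> \<Delta>" for d using crd_pos_coroot[OF assms(3) that] Nats_nonneg by blast
  have "coroot a \<bullet> ?y \<ge> 0" unfolding inner_crd[of "coroot a"]
    using nn c by (intro sum_nonneg mult_nonneg_nonneg) auto
  moreover have "coroot a \<bullet> ?y \<le> coroot \<alpha>t \<bullet> ?y" unfolding inner_crd[of "coroot a"] inner_crd[of "coroot \<alpha>t"]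
    using nn alpha_tilde(2) assms(3) pos_subset by (intro sum_mono mult_right_mono) auto
  ultimately show ?thesis using t by (simp add: lev_def floor_eq_iff inner_commute)
qed

text \<open>If the alcove of \<open>inv x\<close> were on the inner side of every wall, it would be
  fundamental and the length would be 0. A wall separating it from the fundamental alcove gives a
  right descent of \<open>x\<close>.\<close>

lemma exists_descent:
  assumes "x \<in> aff" "len x > 0" shows "\<exists>s\<in>gens. len x = len (x o s) + 1"
proof -
  have z: "inv x \<in> aff" using aff_inverse assms by blast
  have "\<not> (\<forall>t\<in>walls. lev (inv x) t \<le> lev id t)"
    using alcove_eqI[OF z] len_0I[of "inv x"] len_inverse[OF assms(1)] assms(2) by auto
  then obtain t where t: "t \<in> walls" "lev (inv x) t > lev id t" by auto
  let ?s = "affine_refl t (lev id t + 1)"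
  have t\<Phi>: "t \<in> \<Phi>" using t walls_subset by blast
  have s: "?s \<in> gens" using t gens_eq by blast
  have "lev id (lin x t) - lev x (lin x t) = lev (inv x) t - lev id t"
    using lev_diff[OF assms(1) t\<Phi>, of "inv x" id] assms(1) by (simp only: aff_inv_comp comp_id)
  then have "lev x (cr x ?s) < lev id (cr x ?s)" using t(2) cr_eq(1)[OF assms(1) t(1) HOL.refl] by simp
  then show ?thesis using len_step(2)[OF assms(1) s] s by blast
qed

section \<open>Words as galleries: generation by the walls and free action on alcoves\<close>

lemma word_aff: "set ss \<subseteq> gens ==> word_prod ss \<in> aff"
proof (induction ss)
  case (Cons s ss)
  then have "s o word_prod ss \<in> aff" using aff_comp[OF gens_aff] by auto
  then show ?case unfolding word_prod_Cons .
qed simp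

lemma word_rev: "set ss \<subseteq> gens ==> inv (word_prod ss) = word_prod (rev ss)"
proof (induction ss)
  case (Cons s ss)
  have s: "s \<in> aff" "s o s = id" using Cons gens_aff gens_involution by auto
  have "inv (s o word_prod ss) = inv (word_prod ss) o inv s"
    using aff_inverse(1) s word_aff[of ss] Cons by (intro o_inv_distrib) auto
  moreover have "inv s = s" using s(2) inv_unique_comp by blast
  moreover have "inv (word_prod ss) = word_prod (rev ss)" using Cons by auto
  ultimately have "inv (word_prod (s # ss)) = word_prod (rev (s # ss))"
    by (simp only: word_prod_Cons rev.simps word_prod_snoc)
  then show ?case .
next
  case Nil
  have "inv (word_prod []) = word_prod (rev [])" by (simp add: inv_id)
  then show ?case .
qed

lemma decompose:
  assumes "x \<in> aff"
  obtains a ss where "a \<in> aff" "len a = 0" "set ss \<subseteq> gens" "length ss = len x" "x = a o word_prod ss"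
proof -
  have "\<exists>a ss. a \<in> aff \<and> len a = 0 \<and> set ss \<subseteq> gens \<and> length ss = len x \<and> x = a o word_prod ss" using assms
  proof (induction "len x" arbitrary: x)
    case 0
    then show ?case by (intro exI[of _ x] exI[of _ "[]"]) simp
  next
    case (Suc n)
    then obtain s where s: "s \<in> gens" "len x = len (x o s) + 1" using exists_descent by fastforce
    then have "n = len (x o s)" "x o s \<in> aff" using Suc gens_aff aff_comp by auto
    then obtain a ss where a: "a \<in> aff" "len a = 0" "set ss \<subseteq> gens" "length ss = len (x o s)"
      "x o s = a o word_prod ss" using Suc(1) by blast
    have "x = x o (s o s)" using gens_involution[OF s(1)] by simp
    also have "\<dots> = a o word_prod (ss @ [s])" using a(5) by (simp flip: comp_assoc)
    finally show ?case using a s by (intro exI[of _ a] exI[of _ "ss @ [s]"]) auto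
  qed
  then show ?thesis using that by blast
qed

lemma decompose_left:
  assumes "x \<in> aff"
  obtains a ss where "a \<in> aff" "len a = 0" "set ss \<subseteq> gens" "length ss = len x" "x = word_prod ss o a"
proof -
  obtain a ss where a: "a \<in> aff" "len a = 0" "set ss \<subseteq> gens" "length ss = len (inv x)"
    "inv x = a o word_prod ss" using decompose[OF aff_inverse(2)[OF assms]] by blast
  have "x = inv (inv x)" using aff_inverse(1)[OF assms] by (simp add: inv_inv_eq)
  also have "\<dots> = inv (word_prod ss) o inv a"
    unfolding a(5) using aff_inverse(1) a(1) word_aff[OF a(3)] by (intro o_inv_distrib) auto
  also have "\<dots> = word_prod (rev ss) o inv a" using word_rev[OF a(3)] by simp
  finally have x: "x = word_prod (rev ss) o inv a" .
  have "set (rev ss) \<subseteq> gens" "length (rev ss) = len x" using a(3,4) len_inverse[OF assms] by auto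
  then show ?thesis using that[OF aff_inverse(2)[OF a(1)] _ _ _ x] len_inverse[OF a(1)] a(2) by simp
qed

text \<open>A discrete intermediate value argument: a level changes by at most one per letter, so a
  gallery rising past \<open>k\<close> crosses the hyperplane of that level upwards at some
  letter.\<close>

lemma crossing_step:
  assumes "x \<in> aff" "set ss \<subseteq> gens" "b \<in> \<Phi>" "lev x b < k" "k \<le> lev (x o word_prod ss) b"
  shows "\<exists>us s vs. ss = us @ s # vs \<and> cr (x o word_prod us) s = b \<and> lev (x o word_prod us) b = k - 1"
proof -
  define P where "P ss \<longleftrightarrow> (\<exists>us s vs. ss = us @ s # vs \<and> cr (x o word_prod us) s = b \<and>
    lev (x o word_prod us) b = k - 1)" for ss
  define R where "R ss \<longleftrightarrow> k \<le> lev (x o word_prod ss) b" for ss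
  have "P ss" if "set ss \<subseteq> gens" "R ss" using that
proof (induction ss rule: rev_induct)
  case Nil
  then show ?case using assms(4) by (simp add: R_def)
next
  case (snoc s ss)
  have snocR: "k \<le> lev (x o word_prod (ss @ [s])) b" using snoc(3) unfolding R_def .
  show ?case
  proof (cases "R ss")
    case True
    then have "P ss" using snoc by simp
    then obtain us t vs where "ss = us @ t # vs" "cr (x o word_prod us) t = b"
      "lev (x o word_prod us) b = k - 1" unfolding P_def by blast
    then show ?thesis unfolding P_def by (intro exI[of _ us] exI[of _ t] exI[of _ "vs @ [s]"]) simp
  next
    case notR: False
    then have False: "\<not> k \<le> lev (x o word_prod ss) b" unfolding R_def .
    let ?y = "x o word_prod ss"
    have y: "?y \<in> aff" using aff_comp assms(1) word_aff[of ss] snoc(2) by simp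
    have s: "s \<in> gens" using snoc by simp
    have ys: "?y o s \<in> aff" using aff_comp[OF y gens_aff[OF s]] .
    have k: "k \<le> lev (?y o s) b" using snocR unfolding word_prod_snoc by (simp only: comp_assoc)
    then have "lev (?y o s) b \<noteq> lev ?y b" using False by linarith
    then have "b = cr ?y s \<or> b = - cr ?y s" using cr(3)[OF y s assms(3)] by blast
    moreover have "b \<noteq> - cr ?y s"
    proof
      assume eq: "b = - cr ?y s"
      have "lev (?y o s) b = lev ?y b - 1"
        unfolding eq using cr(1,2)[OF y s] lev_uminus[OF y cr(1)[OF y s]] lev_uminus[OF ys cr(1)[OF y s]]
        by linarith
      then show False using False k by linarith
    qed
    ultimately have eq: "cr ?y s = b" by simp
    then have "lev ?y b = k - 1" using cr(2)[OF y s] k False by simp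
    then show ?thesis unfolding P_def using eq by (intro exI[of _ ss] exI[of _ s] exI[of _ "[]"]) simp
  qed
qed
  then show ?thesis using assms(2,5) unfolding P_def R_def by blast
qed

lemma affine_refl_generated:
  assumes "b \<in> \<Phi>"
  shows "\<exists>us s. set us \<subseteq> gens \<and> s \<in> gens \<and>
    affine_refl b k = word_prod us o s o inv (word_prod us)"
proof -
  have *: "\<exists>us s. set us \<subseteq> gens \<and> s \<in> gens \<and> affine_refl b k = word_prod us o s o inv (word_prod us)"
    if b: "b \<in> \<Phi>" and k: "lev id b < k" for b k
  proof -
    \<comment> \<open>A multiple of \<open>b\<close> large enough to bring the level in direction
      \<open>b\<close> to at least \<open>k\<close>. A gallery to its translation must cross the
      hyperplane, and the crossing letter exhibits the reflection as a conjugate of a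
      generator.\<close>
    let ?v = "of_int (\<bar>k\<bar> + 1) *\<^sub>R b"
    have v: "intwt ?v" by (rule intwt_simps(5)[OF intwt_root[OF b]])
    obtain a ss where a: "a \<in> aff" "len a = 0" "set ss \<subseteq> gens" "transl ?v = word_prod ss o a"
      using decompose_left[OF transl_aff[OF v]] by metis
    have "of_int (lev (transl ?v o id) b) = of_int (lev id b) + (2::real) * of_int (\<bar>k\<bar> + 1)"
      using lev_transl[OF v b, of id] root_neq_0[OF b] by (simp add: inner_coroot_self)
    then have "lev (transl ?v) b = lev id b + 2 * (\<bar>k\<bar> + 1)" by (simp flip: of_int_eq_iff)
    moreover have "lev id b \<ge> -1" using basept_lev_id(1)[OF b] by simp
    ultimately have "k \<le> lev (transl ?v) b" by simp
    moreover have "lev (transl ?v) b = lev (word_prod ss) b"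
      unfolding a(4) using lev_comp_right[OF word_aff[OF a(3)] a(1,2) b] .
    ultimately obtain us s vs where us: "ss = us @ s # vs" "cr (word_prod us) s = b"
      "lev (word_prod us) b = k - 1" using crossing_step[OF id_aff a(3) b k] by auto
    have m: "set us \<subseteq> gens" "s \<in> gens" using us(1) a(3) by auto
    have w: "word_prod us \<in> aff" using word_aff m by blast
    have "word_prod us o s = affine_refl b k o word_prod us" using cr(4)[OF w m(2)] us by simp
    then have "word_prod us o s o inv (word_prod us) = affine_refl b k o (word_prod us o inv (word_prod us))"
      by (simp add: comp_assoc)
    then show ?thesis using m w by (metis aff_inv_comp(2) comp_id)
  qed
  show ?thesis
  proof (cases "lev id b < k")
    case False
    then have "lev id (- b) < - k" using lev_uminus[OF id_aff assms] by simp
    then show ?thesis using *[OF uminus_root[OF assms]] affine_refl_uminus by metis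
  qed (use * assms in blast)
qed

lemma affine_weyl_eq: "affine_weyl \<Phi> = generated gens"
proof
  show "affine_weyl \<Phi> \<subseteq> generated gens" unfolding affine_weyl_def
  proof (rule generated_mono, rule subsetI)
    fix r assume "r \<in> {affine_refl a n |a n. a \<in> \<Phi>}"
    then obtain us s where "set us \<subseteq> gens" "s \<in> gens" "r = word_prod us o s o inv (word_prod us)"
      using affine_refl_generated by blast
    then show "r \<in> generated gens" by (simp add: word_rev comp_generated gen_generated generatedI)
  qed
  have "gens \<subseteq> {affine_refl a n |a n. a \<in> \<Phi>}" using gens_eq walls_subset by auto
  then show "generated gens \<subseteq> affine_weyl \<Phi>" unfolding affine_weyl_def
    by (intro generated_mono) (blast intro: gen_generated)
qed

text \<open>Deletion: a word that ends in the fundamental alcove must recross the hyperplane of its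
  first letter, and dropping both letters leaves the product unchanged. Hence the affine Weyl group
  acts freely on alcoves.\<close>

lemma word_len_0: "set ss \<subseteq> gens ==> len (word_prod ss) = 0 ==> word_prod ss = id"
proof (induction "length ss" arbitrary: ss rule: less_induct)
  case less
  show ?case
  proof (cases ss)
    case (Cons s ts)
    have s: "s \<in> gens" "s \<in> aff" and ts: "set ts \<subseteq> gens" using less.prems Cons gens_aff by auto
    let ?b = "cr id s"
    have b: "?b \<in> \<Phi>" "- ?b \<in> \<Phi>" using cr(1)[OF id_aff s(1)] uminus_root by auto
    have sb: "lev s ?b = lev id ?b + 1" "s = affine_refl ?b (lev id ?b + 1)"
      using cr(2,4)[OF id_aff s(1)] by auto
    have fin: "lev (s o word_prod ts) (- ?b) = lev id (- ?b)"
      using len_0D[OF word_aff[OF less.prems(1)] less.prems(2) b(2)] Cons by simp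
    have "lev s (- ?b) < lev id (- ?b)" using lev_uminus[OF s(2) b(1)] lev_uminus[OF id_aff b(1)] sb(1) by simp
    then obtain us t vs where us: "ts = us @ t # vs" "cr (s o word_prod us) t = - ?b"
      "lev (s o word_prod us) (- ?b) = lev id (- ?b) - 1"
      using crossing_step[OF s(2) ts b(2), of "lev id (- ?b)"] fin by auto
    have m: "set us \<subseteq> gens" "t \<in> gens" "set vs \<subseteq> gens" using us(1) ts by auto
    have su: "s o word_prod us \<in> aff" using aff_comp s word_aff m by blast
    have "affine_refl (- ?b) (lev id (- ?b)) = s"
      using affine_refl_uminus[of ?b "lev id ?b + 1"] lev_uminus[OF id_aff b(1)] sb(2) by simp
    then have "s o word_prod us o t = s o (s o word_prod us)" using cr(4)[OF su m(2)] us by simp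
    also have "\<dots> = word_prod us" using gens_involution[OF s(1)] by (simp flip: comp_assoc)
    finally have "word_prod ss = word_prod (us @ vs)"
      using Cons us(1) by (simp add: word_prod_append flip: comp_assoc)
    then show ?thesis using less.hyps[of "us @ vs"] less.prems Cons us(1) m by simp
  qed simp
qed

lemma affine_weyl_aff: "w \<in> affine_weyl \<Phi> ==> w \<in> aff" using affine_weyl_subset by blast

lemma affine_weyl_len_0: "w \<in> affine_weyl \<Phi> ==> len w = 0 ==> w = id"
  unfolding affine_weyl_eq using word_len_0 by (metis generatedE)

lemma cox_length_affine: assumes "w \<in> affine_weyl \<Phi>" shows "cox_length gens w = len w"
proof (rule cox_length_eqI[where f = len])
  note aw = affine_weyl_eq[symmetric]
  show "w \<in> generated gens" using assms affine_weyl_eq by simp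
  show "len (w o s) \<le> Suc (len w)" if "s \<in> gens" "w \<in> generated gens" for s w
    using that len_le_Suc affine_weyl_aff unfolding aw by blast
  show "\<exists>s\<in>gens. len (w o s) < len w" if "w \<in> generated gens" "len w > 0" for w
    using that exists_descent[of w] affine_weyl_aff unfolding aw by fastforce
  show "w = id" if "w \<in> generated gens" "len w = 0" for w using that affine_weyl_len_0 unfolding aw by blast
qed (use gens_involution in auto)

lemma weyl_affine: "w \<in> weyl ==> w \<in> affine_weyl \<Phi>" using finite_weyl_eq by (auto simp: finite_weyl_def)

lemma finite_gens_subset_gens: "finite_gens \<Delta> \<subseteq> gens" by (auto simp: affine_gens_def)

lemma weyl_aff: "w \<in> weyl ==> w \<in> aff" using weyl_subset_aff by blast

lemma lev_weyl_id: "w \<in> weyl ==> b \<in> \<Phi> ==> lev w (w b) = lev id b" using lev_weyl[of w b id] by simp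

lemma cr_simple:
  assumes "x \<in> aff" "d \<in> \<Delta>" shows "cr x (reflect d) = - lin x d"
proof -
  have "cr x (reflect d) = lin x (- d)" using assms affine_refl_uminus[of d 0] lev_id_walls(1)[OF assms(2)]
    by (intro cr_eq(1)[OF assms(1)]) (auto simp: walls_def)
  then show ?thesis using affD(3)[OF assms(1)] by (simp add: linear_neg)
qed

lemma reflect_gens: "d \<in> \<Delta> ==> reflect d \<in> gens" by (auto simp: affine_gens_def finite_gens_def)

lemma len_reflect:
  assumes "w \<in> weyl" "d \<in> \<Delta>"
  shows "w d \<in> Pos ==> len (w o reflect d) = len w + 1"
    "w d \<notin> Pos ==> len w = len (w o reflect d) + 1"
proof -
  have d: "d \<in> \<Phi>" using assms simple_subset by blast
  have c: "cr w (reflect d) = - w d" using cr_simple[OF weyl_aff[OF assms(1)] assms(2)] assms by (simp add: lin_eq)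
  have l: "lev w (- w d) = -1"
    using lev_weyl_id[OF assms(1) uminus_root[OF d]] lev_id_walls(1)[OF assms(2)] weyl_uminus[OF assms(1)] by simp
  have wd: "- w d \<in> \<Phi>" "w d \<in> \<Phi>" using weyl_root assms d uminus_root by auto
  note * = len_step[OF weyl_aff[OF assms(1)] reflect_gens[OF assms(2)]]
  show "len (w o reflect d) = len w + 1" if "w d \<in> Pos"
    using * that c l basept_lev_id(1)[OF wd(1)] uminus_pos_iff[OF wd(2)] by simp
  show "len w = len (w o reflect d) + 1" if "w d \<notin> Pos"
    using * that c l basept_lev_id(1)[OF wd(1)] uminus_pos_iff[OF wd(2)] by simp
qed

lemma exists_descent_weyl:
  assumes "w \<in> weyl" "len w > 0" shows "\<exists>d\<in>\<Delta>. w d \<notin> Pos"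
proof -
  obtain s where s: "s \<in> gens" "len w = len (w o s) + 1" using exists_descent weyl_aff assms by blast
  obtain t where t: "t \<in> walls" "s = affine_refl t (lev id t + 1)" using s gens_eq by auto
  have t\<Phi>: "t \<in> \<Phi>" using t walls_subset by blast
  have c: "cr w s = w t" using cr_eq(1)[OF weyl_aff[OF assms(1)] t] assms by (simp add: lin_eq)
  have neg: "lev id t < lev id (w t)"
    using len_step(1)[OF weyl_aff[OF assms(1)] s(1)] s(2) c lev_weyl_id[OF assms(1) t\<Phi>] by force
  \<comment> \<open>\<open>lev id\<close> takes only the values 0 and -1 on roots, so
    \<open>neg\<close> requires a wall direction of level -1; this excludes the affine wall.\<close>
  have "t \<noteq> \<alpha>t" using neg lev_id_walls(2) basept_lev_id(1)[OF weyl_root[OF assms(1) t\<Phi>]] by (auto split: if_splits)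
  then obtain d where d: "d \<in> \<Delta>" "t = - d" using t by (auto simp: walls_def)
  have "- w d \<in> Pos"
    using neg d lev_id_walls(1)[OF d(1)] basept_lev_id(1)[OF weyl_root[OF assms(1) t\<Phi>]] weyl_uminus[OF assms(1)]
    by (auto split: if_splits)
  then show ?thesis using d(1) uminus_pos_iff weyl_root assms(1) simple_subset by blast
qed

lemma cox_length_finite: assumes "w \<in> weyl" shows "cox_length (finite_gens \<Delta>) w = len w"
proof (rule cox_length_eqI[where f = len])
  note aw = weyl_eq[symmetric]
  show "w \<in> generated (finite_gens \<Delta>)" using assms weyl_eq by simp
  show "len (w o s) \<le> Suc (len w)" if "s \<in> finite_gens \<Delta>" "w \<in> generated (finite_gens \<Delta>)" for s w
    using that len_le_Suc finite_gens_subset_gens weyl_aff unfolding aw by blast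
  show "\<exists>s\<in>finite_gens \<Delta>. len (w o s) < len w" if "w \<in> generated (finite_gens \<Delta>)" "len w > 0" for w
    using that exists_descent_weyl[of w] len_reflect(2)[of w] unfolding aw by (fastforce simp: finite_gens_def)
  show "w = id" if "w \<in> generated (finite_gens \<Delta>)" "len w = 0" for w
    using that affine_weyl_len_0 weyl_affine unfolding aw by blast
qed (use finite_gens_involution in auto)

end

section \<open>Inversions, the longest element and Bruhat covers\<close>

context based_root_system
begin

definition inversions :: "('v => 'v) => 'v set" where "inversions u = {a\<in>Pos. u a \<notin> Pos}"

text \<open>The surplus of the inversions of \<open>u\<close> over those of
  \<open>u o reflect b\<close>, apart from \<open>b\<close> itself; it is empty exactly when the
  step is a Bruhat cover.\<close>

definition extra :: "('v => 'v) => 'v => 'v set" where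
  "extra u b = {a\<in>Pos. a \<noteq> b \<and> reflect b a \<notin> Pos \<and> u a \<notin> Pos \<and> u (reflect b a) \<in> Pos}"

lemma finite_inversions: "finite (inversions u)" "finite (extra u b)"
  using finite_pos by (auto simp: inversions_def extra_def)

lemma reflect_reflect: "a \<in> \<Phi> ==> reflect a (reflect a x) = x" using affine_refl_invol root_neq_0 by blast

lemma reflect_uminus: "reflect a (- x) = - reflect a x" using linear_refl linear_neg by blast

lemma weyl_neg_iff: "u \<in> weyl ==> a \<in> \<Phi> ==> u (- a) \<in> Pos \<longleftrightarrow> u a \<notin> Pos"
  using weyl_uminus[of u a] uminus_pos_iff[of "u a"] weyl_root[of u a] by simp

text \<open>Stated for any Weyl-invariant \<open>f\<close>: the constant 1 gives lengths, the
  weights \<open>wt a 0\<close> give weighted lengths, with the same surplus set. Positive roots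
  that stay positive under the reflection are permuted; among the others, except \<open>b\<close>,
  an inversion of \<open>u o reflect b\<close> is also one of \<open>u\<close>.\<close>

lemma sum_inversions:
  fixes f :: "'v => nat"
  assumes f: "\<And>w a. w \<in> weyl ==> a \<in> \<Phi> ==> f (w a) = f a"
    and u: "u \<in> weyl" and b: "b \<in> Pos" "u b \<notin> Pos"
  shows "sum f (inversions u) = sum f (inversions (u o reflect b)) + f b + sum f (extra u b)"
proof -
  let ?r = "reflect b"
  have b\<Phi>: "b \<in> \<Phi>" using b pos_subset by blast
  have pos\<Phi>: "a \<in> Pos ==> a \<in> \<Phi>" for a using pos_subset by blast
  have r\<Phi>: "a \<in> \<Phi> ==> ?r a \<in> \<Phi>" for a using refl_root b\<Phi> by blast
  define A where "A = {a\<in>Pos. ?r a \<in> Pos}"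
  define B where "B = {a\<in>Pos. ?r a \<notin> Pos \<and> a \<noteq> b}"
  have rb: "?r b = - b" using refl_self root_neq_0 b\<Phi> by blast
  have bP: "?r b \<notin> Pos" using rb uminus_pos_iff b\<Phi> b by simp
  have split: "sum f (inversions v) = sum f (A \<inter> inversions v) + sum f (B \<inter> inversions v) +
      (if v b \<notin> Pos then f b else 0)" for v
  proof -
    have "inversions v = (A \<inter> inversions v) \<union> (B \<inter> inversions v) \<union> (if v b \<notin> Pos then {b} else {})"
      using b by (auto simp: inversions_def A_def B_def)
    moreover have "finite (A \<inter> inversions v)" "finite (B \<inter> inversions v)" using finite_inversions by auto
    moreover have "(A \<inter> inversions v) \<inter> (B \<inter> inversions v) = {}"
      "((A \<inter> inversions v) \<union> (B \<inter> inversions v)) \<inter> (if v b \<notin> Pos then {b} else {}) = {}"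
      using bP by (auto simp: A_def B_def)
    ultimately have "sum f (inversions v) = sum f (A \<inter> inversions v) + sum f (B \<inter> inversions v) +
      sum f (if v b \<notin> Pos then {b} else {})"
      using sum.union_disjoint[of "A \<inter> inversions v \<union> B \<inter> inversions v" "if v b \<notin> Pos then {b} else {}" f]
        sum.union_disjoint[of "A \<inter> inversions v" "B \<inter> inversions v" f] by (auto split: if_splits)
    then show ?thesis by (simp split: if_splits)
  qed
  have A: "sum f (A \<inter> inversions (u o ?r)) = sum f (A \<inter> inversions u)"
  proof (rule sum.reindex_bij_witness[where i = ?r and j = ?r])
    fix a assume "a \<in> A \<inter> inversions (u o ?r)"
    then show "?r (?r a) = a" "?r a \<in> A \<inter> inversions u" "f (?r a) = f a"
      using f[OF reflect_weyl[OF b\<Phi>]] pos\<Phi> reflect_reflect[OF b\<Phi>] by (auto simp: A_def inversions_def)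
  next
    fix a assume "a \<in> A \<inter> inversions u"
    then show "?r (?r a) = a" "?r a \<in> A \<inter> inversions (u o ?r)"
      using reflect_reflect[OF b\<Phi>] by (auto simp: A_def inversions_def)
  qed
  \<comment> \<open>\<open>u a\<close> is \<open>u (?r a)\<close> plus a positive multiple of
    \<open>u b\<close>, and both summands have nonpositive height.\<close>
  have uneg: "u a \<notin> Pos" if a: "a \<in> B" "u (?r a) \<notin> Pos" for a
  proof -
    have \<Phi>: "a \<in> \<Phi>" "?r a \<in> \<Phi>" using a pos\<Phi> r\<Phi> by (auto simp: B_def)
    have "- ?r a \<in> Pos" using a(1) uminus_pos_iff \<Phi> by (auto simp: B_def)
    then have h1: "(- ?r a) \<bullet> htvec > 0" using pos_iff uminus_root \<Phi> by blast
    have h2: "a \<bullet> htvec > 0" "b \<bullet> htvec > 0" using a(1) b(1) pos_iff \<Phi> b\<Phi> by (auto simp: B_def)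
    have "(a \<cdot> b) * (b \<bullet> htvec) = a \<bullet> htvec - ?r a \<bullet> htvec" by (simp add: refl_eq inner_diff_left)
    then have k: "a \<cdot> b > 0" using h1 h2 by (simp add: inner_minus_left) (smt (verit) mult_nonpos_nonneg)
    have "u (?r a) = u a - (a \<cdot> b) *\<^sub>R u b"
      using weyl_linear[OF u] by (simp add: refl_eq linear_diff linear_scale)
    then have "u a \<bullet> htvec = u (?r a) \<bullet> htvec + (a \<cdot> b) * (u b \<bullet> htvec)" by (simp add: inner_diff_left)
    moreover have "u (?r a) \<bullet> htvec \<le> 0" "u b \<bullet> htvec \<le> 0"
      using a(2) b(2) pos_iff weyl_root[OF u] \<Phi> b\<Phi> by force+
    ultimately have "u a \<bullet> htvec \<le> 0" using k by (smt (verit) mult_nonneg_nonpos)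
    then show ?thesis using pos_iff[of "u a"] weyl_root[OF u \<Phi>(1)] by simp
  qed
  have "B \<inter> inversions u = (B \<inter> inversions (u o ?r)) \<union> extra u b"
    using uneg by (auto simp: B_def inversions_def extra_def)
  moreover have "(B \<inter> inversions (u o ?r)) \<inter> extra u b = {}" by (auto simp: inversions_def extra_def)
  ultimately have B: "sum f (B \<inter> inversions u) = sum f (B \<inter> inversions (u o ?r)) + sum f (extra u b)"
    using finite_inversions by (metis finite_Int sum.union_disjoint)
  have "(u o ?r) b \<in> Pos" using weyl_neg_iff[OF u b\<Phi>] b rb by simp
  then show ?thesis using split[of u] split[of "u o ?r"] A B b(2) by simp
qed

lemma len_inversions: assumes "u \<in> weyl" shows "len u = card (inversions u)"
proof -
  have i: "inv u \<in> weyl" using weyl_inverse assms by blast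
  have "len u = len (inv u)" using len_inverse weyl_aff assms by simp
  also have "\<dots> = (\<Sum>a\<in>Pos. if u a \<notin> Pos then 1 else 0)" unfolding len_def
  proof (rule sum.cong)
    fix a assume a: "a \<in> Pos"
    then have \<Phi>: "a \<in> \<Phi>" using pos_subset by blast
    have "lev (inv u) a = lev id (u a)" using lev_weyl_id[OF i weyl_root[OF assms \<Phi>]] assms by simp
    then show "nat \<bar>lev (inv u) a\<bar> = (if u a \<notin> Pos then 1 else 0)"
      using basept_lev_id(1)[OF weyl_root[OF assms \<Phi>]] by simp
  qed simp
  also have "\<dots> = card (inversions u)" using finite_pos by (simp add: inversions_def sum.If_cases Int_def)
  finally show ?thesis .
qed

lemma len_comp_reflect:
  assumes "u \<in> weyl" "b \<in> Pos"
  shows "u b \<notin> Pos ==> len u = len (u o reflect b) + 1 + card (extra u b)"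
    "u b \<in> Pos ==> len u < len (u o reflect b)"
proof -
  have b\<Phi>: "b \<in> \<Phi>" using assms pos_subset by blast
  have *: "len v = len (v o reflect b) + 1 + card (extra v b)" if "v \<in> weyl" "v b \<notin> Pos" for v
    using sum_inversions[of "\<lambda>_. 1" v b] that assms(2) reflect_weyl[OF b\<Phi>] weyl_comp
    by (simp add: len_inversions)
  show "u b \<notin> Pos ==> len u = len (u o reflect b) + 1 + card (extra u b)" using * assms by blast
  assume u: "u b \<in> Pos"
  have v: "u o reflect b \<in> weyl" using reflect_weyl[OF b\<Phi>] weyl_comp assms by blast
  have "(u o reflect b) b \<notin> Pos" using u weyl_neg_iff[OF assms(1) b\<Phi>] by (simp add: refl_self root_neq_0[OF b\<Phi>])
  moreover have "u o reflect b o reflect b = u" by (simp add: comp_assoc reflect_comp[OF b\<Phi>])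
  ultimately show "len u < len (u o reflect b)" using *[OF v] by simp
qed

section \<open>The longest element\<close>

abbreviation "w0 \<equiv> longest_elt \<Phi> \<Delta>"

lemma weyl_eq_idI: "w \<in> weyl ==> (\<And>a. a \<in> Pos ==> w a \<in> Pos) ==> w = id"
proof -
  assume w: "w \<in> weyl" "\<And>a. a \<in> Pos ==> w a \<in> Pos"
  then have "inversions w = {}" by (auto simp: inversions_def)
  then show "w = id" using len_inversions[OF w(1)] affine_weyl_len_0[OF weyl_affine[OF w(1)]] by simp
qed

lemma longest: "w0 \<in> weyl" "a \<in> \<Phi> ==> w0 a \<in> Pos \<longleftrightarrow> a \<notin> Pos" "w0 o w0 = id"
proof -
  have fin: "finite (len ` weyl)" "len ` weyl \<noteq> {}" using finite_weyl' weyl_id by blast+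
  obtain w where w: "w \<in> weyl" "len w = Max (len ` weyl)" using Max_in[OF fin] by auto
  then have max: "len v \<le> len w" if "v \<in> weyl" for v using that fin by simp
  have "w d \<notin> Pos" if "d \<in> \<Delta>" for d
    using len_reflect(1)[OF w(1) that] max[OF weyl_comp[OF w(1) reflect_weyl]] that simple_subset by force
  then have hd: "w d \<bullet> htvec < 0" if "d \<in> \<Delta>" for d
    using that coord_root[of "w d"] weyl_root w(1) simple_subset by (auto split: if_splits)
  have neg: "w a \<notin> Pos" if "a \<in> Pos" for a
  proof -
    have a\<Phi>: "a \<in> \<Phi>" using that pos_subset by blast
    have "w a = (\<Sum>d\<in>\<Delta>. (a \<bullet> cowt d) *\<^sub>R w d)" using arg_cong[OF expand_simple[of a], of w] weyl_linear[OF w(1)]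
      by (simp add: linear_sum linear_scale)
    then have "w a \<bullet> htvec = (\<Sum>d\<in>\<Delta>. (a \<bullet> cowt d) * (w d \<bullet> htvec))" by (simp add: inner_sum_left)
    also have "\<dots> \<le> 0" using coord_root[OF a\<Phi>] that hd
      by (intro sum_nonpos mult_nonneg_nonpos) (auto simp: less_imp_le)
    finally show ?thesis using pos_iff[of "w a"] weyl_root[OF w(1) a\<Phi>] by simp
  qed
  have all: "w a \<in> Pos \<longleftrightarrow> a \<notin> Pos" if "a \<in> \<Phi>" for a
    using neg[of a] neg[of "- a"] weyl_neg_iff[OF w(1) that] uminus_pos_iff[OF that] by auto
  have uniq: "v = inv w" if "v \<in> weyl" "\<And>a. a \<in> Pos ==> v a \<notin> Pos" for v
  proof -
    have "w o v = id" using that all weyl_root pos_subset by (intro weyl_eq_idI) (auto intro: weyl_comp w(1))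
    then have "inv w o w o v = inv w" by (simp add: comp_assoc)
    moreover have "inv w o w = id" using weyl_inverse(1)[OF w(1)] by (simp add: bij_def)
    ultimately show ?thesis by simp
  qed
  have w_inv: "w = inv w" using uniq[OF w(1) neg] .
  have "w0 = w" unfolding longest_elt_def finite_weyl_eq
  proof (rule the_equality)
    show "w \<in> weyl \<and> (\<forall>v\<in>weyl. cox_length gens v \<le> cox_length gens w)"
      using w max by (simp add: cox_length_affine weyl_affine)
    fix v assume v: "v \<in> weyl \<and> (\<forall>u\<in>weyl. cox_length gens u \<le> cox_length gens v)"
    then have "len w \<le> len v" using w(1) cox_length_affine weyl_affine by metis
    moreover have "inversions w = Pos" using neg by (auto simp: inversions_def)
    ultimately have "card Pos \<le> card (inversions v)" using len_inversions v w(1) by metis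
    then have "inversions v = Pos" using finite_pos by (intro card_seteq) (auto simp: inversions_def)
    then have "v = inv w" using v by (intro uniq) (auto simp: inversions_def)
    then show "v = w" using w_inv by simp
  qed
  then show "w0 \<in> weyl" "a \<in> \<Phi> ==> w0 a \<in> Pos \<longleftrightarrow> a \<notin> Pos" using w all by auto
  have "w o w = id" using weyl_inverse(1)[OF w(1)] w_inv by (metis bij_def inv_o_cancel)
  then show "w0 o w0 = id" using \<open>w0 = w\<close> by simp
qed

section \<open>Bruhat order and covers in the finite Weyl group\<close>

abbreviation "F \<equiv> finite_gens \<Delta>"

definition ascend :: "('v => 'v) => ('v => 'v) => bool" where
  "ascend x y \<longleftrightarrow> x \<in> weyl \<and> (\<exists>b\<in>Pos. x b \<in> Pos \<and> y = x o reflect b)"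

lemma ascendD:
  assumes "ascend x y" shows "x \<in> weyl" "y \<in> weyl" "len x < len y"
  using assms len_comp_reflect(2) weyl_comp reflect_weyl pos_subset by (auto simp: ascend_def)

lemma ascendI:
  assumes "x \<in> weyl" "b \<in> \<Phi>" "len x < len (x o reflect b)" shows "ascend x (x o reflect b)"
proof -
  have *: "ascend x (x o reflect b)" if "b \<in> Pos" "len x < len (x o reflect b)" for b
    using len_comp_reflect(1)[OF assms(1) that(1)] that assms(1) by (auto simp: ascend_def)
  show ?thesis
  proof (cases "b \<in> Pos")
    case False
    then have "- b \<in> Pos" using uminus_pos_iff assms by blast
    then show ?thesis using * assms(3) affine_refl_uminus[of b 0] by fastforce
  qed (use * assms in blast)
qed

lemma bruhat_less_eq: "bruhat_less F = ascend\<^sup>+\<^sup>+"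
proof -
  have "(x \<in> generated F \<and> (\<exists>u\<in>generated F. \<exists>s\<in>F. y = x o (u o s o inv u)) \<and> cox_length F x < cox_length F y)
     \<longleftrightarrow> ascend x y" for x y
  proof
    assume *: "x \<in> generated F \<and> (\<exists>u\<in>generated F. \<exists>s\<in>F. y = x o (u o s o inv u)) \<and> cox_length F x < cox_length F y"
    then obtain u d where u: "x \<in> weyl" "u \<in> weyl" "d \<in> \<Delta>" "y = x o (u o reflect d o inv u)"
      unfolding weyl_eq[symmetric] by (auto simp: finite_gens_def)
    have "y = x o reflect (u d)" using u reflect_conj by simp
    moreover have "u d \<in> \<Phi>" using u weyl_root simple_subset by blast
    moreover have "y \<in> weyl" using calculation u weyl_comp reflect_weyl by blast
    ultimately show "ascend x y" using * u(1) ascendI cox_length_finite by metis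
  next
    assume *: "ascend x y"
    then obtain b where b: "b \<in> Pos" "y = x o reflect b" by (auto simp: ascend_def)
    then obtain w d where "w \<in> generated F" "d \<in> \<Delta>" "b = w d" using root_conj_simple pos_subset by blast
    moreover have "reflect b = w o reflect d o inv w" using reflect_conj calculation finite_gens_subset by blast
    moreover have "reflect d \<in> F" using calculation by (auto simp: finite_gens_def)
    ultimately have "\<exists>u\<in>generated F. \<exists>s\<in>F. y = x o (u o s o inv u)" using b(2) by metis
    then show "x \<in> generated F \<and> (\<exists>u\<in>generated F. \<exists>s\<in>F. y = x o (u o s o inv u)) \<and> cox_length F x < cox_length F y"
      using ascendD[OF *] cox_length_finite weyl_eq by auto
  qed
  then show ?thesis unfolding bruhat_less_def by presburger
qed

lemma ascend_trancl_len: "ascend\<^sup>+\<^sup>+ x y ==> len x < len y"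
  by (induction rule: tranclp_induct) (auto dest: ascendD(3))

text \<open>A simple reflection makes only one positive root negative, so left multiplication by it
  keeps an ascent, unless it carries out that very ascent.\<close>

lemma ascend_left:
  assumes "ascend x y" "d \<in> \<Delta>"
  shows "ascend (reflect d o x) (reflect d o y) \<or> reflect d o x = y"
proof -
  obtain b where b: "x \<in> weyl" "b \<in> Pos" "x b \<in> Pos" "y = x o reflect b"
    using assms(1) by (auto simp: ascend_def)
  have d: "d \<in> \<Phi>" using assms simple_subset by blast
  show ?thesis
  proof (cases "x b = d")
    case True
    have "reflect d o x = x o reflect b o (inv x o x)"
      using reflect_conj[OF b(1), of b] True by (simp add: comp_assoc)
    also have "inv x o x = id" using weyl_inverse(1)[OF b(1)] by (simp add: bij_def)
    finally have "reflect d o x = y" using b(4) by (simp only: comp_id)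
    then show ?thesis by blast
  next
    case False
    then have "(reflect d o x) b \<in> Pos" using refl_pos b assms by simp
    then show ?thesis using b weyl_comp[OF reflect_weyl[OF d] b(1)] unfolding ascend_def by (metis comp_assoc)
  qed
qed

lemma ascend_left_chain:
  assumes "ascend\<^sup>*\<^sup>* x y" "d \<in> \<Delta>"
  shows "ascend\<^sup>*\<^sup>* (reflect d o x) (reflect d o y) \<or> ascend\<^sup>*\<^sup>* (reflect d o x) y" using assms(1)
proof (induction rule: rtranclp_induct)
  case base
  show ?case by blast
next
  case (step y z)
  then have "ascend (reflect d o y) (reflect d o z) \<or> reflect d o y = z" using ascend_left assms(2) by blast
  then show ?case using step(2,3) rtranclp.rtrancl_into_rtrancl by metis
qed

text \<open>Forces length difference one for Bruhat covers. Induction through a left descent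
  \<open>d\<close> of \<open>u\<close>. If \<open>d\<close> is not a left descent of
  \<open>x\<close>, then \<open>reflect d o x\<close> lies in between. Otherwise the pair shortened
  by \<open>reflect d\<close> has an intermediate \<open>z\<close>, and \<open>reflect d o u\<close>
  or \<open>reflect d o z\<close> serves for the original pair.\<close>

lemma ascend_between:
  assumes "ascend x u" "len u \<ge> len x + 2"
  shows "\<exists>z. ascend\<^sup>+\<^sup>+ x z \<and> ascend\<^sup>+\<^sup>+ z u" using assms
proof (induction "len u" arbitrary: x u rule: less_induct)
  case less
  note D = ascendD[OF less.prems(1)]
  have iu: "inv u \<in> weyl" "inv x \<in> weyl" using weyl_inverse D by auto
  have "len (inv u) > 0" using len_inverse weyl_aff D less.prems(2) by simp
  then obtain d where d: "d \<in> \<Delta>" "inv u d \<notin> Pos" using exists_descent_weyl iu by blast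
  let ?s = "reflect d"
  have d\<Phi>: "d \<in> \<Phi>" using d simple_subset by blast
  have s: "?s \<in> weyl" "?s o ?s = id" "inv ?s = ?s"
    using reflect_weyl[OF d\<Phi>] reflect_comp[OF d\<Phi>] inv_unique_comp[OF reflect_comp reflect_comp, OF d\<Phi> d\<Phi>] by auto
  have ss: "?s o (?s o z) = z" for z :: "'v => 'v" using s(2) by (simp flip: comp_assoc)
  have len_s: "len (?s o z) = len (inv z o ?s)" if "z \<in> weyl" for z
  proof -
    have "inv (?s o z) = inv z o ?s"
      using o_inv_distrib[OF weyl_inverse(1)[OF s(1)] weyl_inverse(1)[OF that]] s(3) by simp
    then show ?thesis using len_inverse[OF weyl_aff[OF weyl_comp[OF s(1) that]]] by simp
  qed
  have su: "?s o u \<in> weyl" "?s o x \<in> weyl" using weyl_comp s D by auto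
  have lu: "len u = len (?s o u) + 1"
    using len_s[OF D(2)] len_reflect(2)[OF iu(1) d] len_inverse[OF weyl_aff[OF D(2)]] by simp
  have neq: "?s o u \<noteq> x" "?s o x \<noteq> u"
  proof -
    show 1: "?s o u \<noteq> x" using lu less.prems(2) by auto
    show "?s o x \<noteq> u" using 1 ss by metis
  qed
  have lift: "ascend (?s o x) (?s o u)" using ascend_left[OF less.prems(1) d(1)] neq by blast
  have up: "ascend (?s o u) u"
  proof -
    have "ascend (?s o u) (?s o u o reflect (inv u d))"
    proof (rule ascendI[OF su(1)])
      show "inv u d \<in> \<Phi>" using weyl_root iu d\<Phi> by blast
      have "?s o u o reflect (inv u d) = u" using reflect_conj[OF iu(1), of d] weyl_inverse(1)[OF D(2)] s(2)
        by (simp add: inv_inv_eq fun_eq_iff bij_def surj_f_inv_f)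
      then show "len (?s o u) < len (?s o u o reflect (inv u d))" using lu by simp
    qed
    moreover have "?s o u o reflect (inv u d) = u"
      using reflect_conj[OF iu(1), of d] weyl_inverse(1)[OF D(2)] s(2)
      by (simp add: inv_inv_eq fun_eq_iff bij_def surj_f_inv_f)
    ultimately show ?thesis by simp
  qed
  show ?case
  proof (cases "inv x d \<in> Pos")
    case True
    have "?s o x = x o reflect (inv x d)" using reflect_conj[OF iu(2), of d] weyl_inverse(1)[OF D(1)]
      by (simp add: inv_inv_eq fun_eq_iff bij_def surj_f_inv_f)
    moreover have "x (inv x d) \<in> Pos" using D(1) d(1) simple_pos by auto
    ultimately have "ascend x (?s o x)" using D(1) True unfolding ascend_def by blast
    then show ?thesis using lift up by (meson tranclp.r_into_trancl tranclp.trancl_into_trancl)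
  next
    case False
    have lx: "len x = len (?s o x) + 1"
      using len_s[OF D(1)] len_reflect(2)[OF iu(2) d(1) False] len_inverse[OF weyl_aff[OF D(1)]] by simp
    obtain z where z: "ascend\<^sup>+\<^sup>+ (?s o x) z" "ascend\<^sup>+\<^sup>+ z (?s o u)"
      using less.hyps[OF _ lift] lu lx less.prems(2) by auto
    have ne: "z \<noteq> ?s o x" "z \<noteq> ?s o u" using z ascend_trancl_len by blast+
    have "ascend\<^sup>*\<^sup>* x (?s o z) \<or> ascend\<^sup>*\<^sup>* x z"
      using ascend_left_chain[OF tranclp_into_rtranclp[OF z(1)] d(1)] ss by metis
    then show ?thesis
    proof
      assume "ascend\<^sup>*\<^sup>* x z"
      then have "ascend\<^sup>+\<^sup>+ x (?s o u)" using z(2) by (rule rtranclp_tranclp_tranclp)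
      then show ?thesis using up by blast
    next
      assume a: "ascend\<^sup>*\<^sup>* x (?s o z)"
      have "ascend\<^sup>*\<^sup>* (?s o z) u" using ascend_left_chain[OF tranclp_into_rtranclp[OF z(2)] d(1)] ss[of u] up
        by (metis rtranclp.rtrancl_into_rtrancl)
      moreover have "?s o z \<noteq> x" "?s o z \<noteq> u" using ne ss by metis+
      ultimately show ?thesis using a by (metis rtranclpD)
    qed
  qed
qed

lemma bruhat_covers_reflect:
  assumes "x \<in> weyl" "b \<in> \<Phi>"
  shows "bruhat_covers F x (x o reflect b) \<longleftrightarrow> len (x o reflect b) = len x + 1"
proof
  assume *: "bruhat_covers F x (x o reflect b)"
  then have "len x < len (x o reflect b)" by (simp add: bruhat_covers_def bruhat_less_eq ascend_trancl_len)
  moreover have "\<not> len (x o reflect b) \<ge> len x + 2"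
    using ascend_between[OF ascendI[OF assms]] calculation * by (auto simp: bruhat_covers_def bruhat_less_eq)
  ultimately show "len (x o reflect b) = len x + 1" by linarith
next
  assume *: "len (x o reflect b) = len x + 1"
  then have "ascend x (x o reflect b)" using ascendI[OF assms] by simp
  then show "bruhat_covers F x (x o reflect b)"
    using * ascend_trancl_len unfolding bruhat_covers_def bruhat_less_eq
    by (metis Suc_eq_plus1 Suc_leI leD less_trans_Suc not_less_eq tranclp.r_into_trancl)
qed

end

section \<open>Weights of hyperplanes\<close>

lemma hyperplane_inner: "hyperplane a k = {x. coroot a \<bullet> x = of_int k}"
  by (simp add: hyperplane_def inner_commute)

lemma affine_refl_fixed: "a \<noteq> 0 ==> {x. affine_refl a k x = x} = hyperplane a k"
  by (auto simp: affine_refl_def hyperplane_def)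

lemma hyperplane_uminus: "hyperplane (- a) (- k) = hyperplane a k" by (auto simp: hyperplane_def coroot_uminus)

lemma affine_refl_conj_general:
  assumes "orthogonal_transformation (lin g)" "of_int k' = of_int k + g 0 \<cdot> (lin g b)"
  shows "g o affine_refl b k = affine_refl (lin g b) k' o g"
proof
  fix y
  have lin: "linear (lin g)" using assms(1) by (simp add: orthogonal_transformation_def)
  have g: "g z = lin g z + g 0" for z by (rule lin_apply)
  have "lin g (y - (y \<cdot> b - of_int k) *\<^sub>R b) = lin g y - (y \<cdot> b - of_int k) *\<^sub>R lin g b"
    using lin by (simp only: linear_diff linear_scale)
  moreover have "(lin g y + g 0) \<cdot> (lin g b) - of_int k' = y \<cdot> b - of_int k"
    using orthogonal_inner_coroot[OF assms(1), of y b] assms(2) by (simp add: inner_left_distrib)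
  ultimately have "lin g (affine_refl b k y) + g 0 = affine_refl (lin g b) k' (lin g y + g 0)"
    by (simp only: affine_refl_def) simp
  then show "(g o affine_refl b k) y = (affine_refl (lin g b) k' o g) y"
    unfolding o_apply g[of "affine_refl b k y"] g[of y] .
qed

context based_root_system
begin

abbreviation "A0 \<equiv> fund_alcove \<Phi> \<Delta>"

lemma hyperplane_subsetD:
  assumes "a \<in> \<Phi>" "b \<in> \<Phi>" "hyperplane b j \<subseteq> hyperplane a k"
  shows "(a = b \<and> k = j) \<or> (a = - b \<and> k = - j)"
proof -
  have nz: "a \<noteq> 0" "b \<noteq> 0" using assms root_neq_0 by auto
  have orth: "v \<bullet> a = 0" if "v \<bullet> b = 0" for v
  proof -
    let ?x = "(of_int j / 2) *\<^sub>R b"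
    have "v \<cdot> b = 0" using that by (simp add: inner_coroot)
    then have "?x \<in> hyperplane b j" "?x + v \<in> hyperplane b j"
      using nz by (auto simp: hyperplane_def inner_coroot_self inner_left_distrib)
    then have "?x \<in> hyperplane a k" "?x + v \<in> hyperplane a k" using assms by auto
    then have "v \<cdot> a = 0" by (simp add: hyperplane_def inner_left_distrib)
    then show ?thesis using nz by (simp add: inner_coroot)
  qed
  define c where "c = (a \<bullet> b) / (b \<bullet> b)"
  let ?v = "a - c *\<^sub>R b"
  have "?v \<bullet> b = 0" using nz by (simp add: c_def inner_diff_left)
  then have "?v \<bullet> ?v = 0" using orth[of ?v] by (simp add: inner_diff_right)
  then have a: "a = c *\<^sub>R b" by simp
  then have c: "c = 1 \<or> c = -1" using root_scaled[OF assms(2)] assms(1) by blast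
  have "(of_int j / 2) *\<^sub>R b \<in> hyperplane b j" using nz by (simp add: hyperplane_def inner_coroot_self)
  then have "(of_int j / 2) *\<^sub>R b \<in> hyperplane a k" using assms by blast
  then show ?thesis using c a nz by (auto simp: hyperplane_def coroot_uminus inner_coroot_self)
qed

lemma fund_alcove_eq: "A0 = {x. \<forall>a\<in>Pos. 0 < x \<cdot> a \<and> x \<cdot> a < 1}" by (simp add: fund_alcove_def)

lemma basept_alcove: "basept \<in> A0" using basept_pos by (auto simp: fund_alcove_eq)

lemma open_alcove: "open A0"
proof -
  have "A0 = (\<Inter>a\<in>Pos. {x. 0 < x \<cdot> a} \<inter> {x. x \<cdot> a < 1})" by (auto simp: fund_alcove_eq)
  also have "open \<dots>" using finite_pos
    by (intro open_INT open_Int) (auto intro!: open_Collect_less continuous_intros)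
  finally show ?thesis .
qed

lemma convex_alcove: "convex A0"
proof -
  have "A0 = (\<Inter>a\<in>Pos. {x. coroot a \<bullet> x > 0} \<inter> {x. coroot a \<bullet> x < 1})"
    by (auto simp: fund_alcove_eq inner_commute)
  then show ?thesis by (auto intro!: convex_INT convex_Int convex_halfspace_gt convex_halfspace_lt)
qed

lemma alcove_wall:
  assumes "t \<in> walls" "x \<in> A0" shows "of_int (lev id t) < x \<cdot> t" "x \<cdot> t < of_int (lev id t + 1)"
proof -
  have "of_int (lev id t) < x \<cdot> t \<and> x \<cdot> t < of_int (lev id t + 1)"
  proof (cases "t = \<alpha>t")
    case True
    then show ?thesis using assms(2) alpha_tilde_pos lev_id_walls(2) by (auto simp: fund_alcove_eq)
  next
    case False
    then obtain d where "d \<in> \<Delta>" "t = - d" using assms(1) by (auto simp: walls_def)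
    moreover have "0 < x \<cdot> d" "x \<cdot> d < 1"
      using assms(2) subsetD[OF simple_pos] calculation by (auto simp: fund_alcove_eq)
    ultimately show ?thesis using lev_id_walls(1) by (simp add: coroot_uminus)
  qed
  then show "of_int (lev id t) < x \<cdot> t" "x \<cdot> t < of_int (lev id t + 1)" by auto
qed

lemma aff_dim_hyperplane_root: "a \<in> \<Phi> ==> aff_dim (hyperplane a k) = DIM('v) - 1"
  using root_neq_0 by (simp add: hyperplane_inner)

lemma aff_dim_closure_alcove: "aff_dim (closure A0) = DIM('v)"
  using aff_dim_open[OF open_alcove] basept_alcove by auto

text \<open>Weights are defined through facets, so each wall must be shown to carry one. A
  relatively open piece of the wall lies in the closure of the alcove, since each of its points is
  joined to the base point by a segment inside the alcove.\<close>

lemma wall_facet: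
  assumes "\<theta> \<in> walls"
  shows "(closure A0 \<inter> hyperplane \<theta> (lev id \<theta> + 1)) facet_of closure A0"
proof -
  let ?k = "lev id \<theta> + 1"
  let ?H = "hyperplane \<theta> ?k"
  let ?s = "affine_refl \<theta> ?k"
  have \<theta>: "\<theta> \<in> \<Phi>" "\<theta> \<noteq> 0" using assms walls_subset root_neq_0 by auto
  have le: "coroot \<theta> \<bullet> x \<le> of_int ?k" if "x \<in> closure A0" for x
  proof -
    have "A0 \<subseteq> {x. coroot \<theta> \<bullet> x \<le> of_int ?k}"
      using alcove_wall(2)[OF assms] by (auto simp: inner_commute less_imp_le)
    then have "closure A0 \<subseteq> {x. coroot \<theta> \<bullet> x \<le> of_int ?k}" by (rule closure_minimal) (rule closed_halfspace_le)
    then show ?thesis using that by blast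
  qed
  have face: "(closure A0 \<inter> ?H) face_of closure A0" unfolding hyperplane_inner
    by (rule face_of_Int_supporting_hyperplane_le[OF convex_closure[OF convex_alcove] le])
  define U where "U = {x. \<forall>r\<in>Pos - {\<theta>, - \<theta>}. 0 < x \<cdot> r \<and> x \<cdot> r < 1}"
  have "U = (\<Inter>r\<in>Pos - {\<theta>, - \<theta>}. {x. 0 < x \<cdot> r} \<inter> {x. x \<cdot> r < 1})" by (auto simp: U_def)
  also have "open \<dots>" using finite_pos
    by (intro open_INT open_Int) (auto intro!: open_Collect_less continuous_intros)
  finally have "open U" .
  \<comment> \<open>The midpoint of the base point and its mirror image lies on the wall. Both
    points have the same level in every other direction, so \<open>q\<close> satisfies all remaining
    inequalities strictly.\<close>
  define q where "q = (1/2) *\<^sub>R (basept + ?s basept)"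
  have "q \<in> ?H" using \<theta>
    by (simp add: q_def hyperplane_def affine_refl_def inner_left_distrib inner_diff_left inner_coroot_self algebra_simps)
  moreover have "q \<in> U" unfolding U_def
  proof (intro CollectI ballI)
    fix r assume r: "r \<in> Pos - {\<theta>, - \<theta>}"
    then have r\<Phi>: "r \<in> \<Phi>" using pos_subset by blast
    have "lev ?s r = 0" using lev_wall(2)[OF assms r\<Phi>] r basept_lev_id(1)[OF r\<Phi>] by simp
    then have "0 < ?s basept \<cdot> r" "?s basept \<cdot> r < 1"
      using lev_strict[OF affine_refl_aff[OF \<theta>(1)] r\<Phi>, of ?k] by auto
    then show "0 < q \<cdot> r \<and> q \<cdot> r < 1" using basept_pos[of r] r by (simp add: q_def inner_left_distrib)
  qed
  ultimately have ne: "?H \<inter> U \<noteq> {}" by blast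
  have affH: "affine ?H" unfolding hyperplane_inner by (rule affine_hyperplane)
  have sub: "?H \<inter> U \<subseteq> closure A0"
  proof
    fix x assume x: "x \<in> ?H \<inter> U"
    have "open_segment x basept \<subseteq> A0"
    proof
      fix y assume "y \<in> open_segment x basept"
      then obtain t where t: "0 < t" "t < 1" "y = (1 - t) *\<^sub>R x + t *\<^sub>R basept" by (auto simp: in_segment)
      have ineq: "a < (1 - t) * u + t * v" "(1 - t) * u + t * v < b"
        if "a \<le> u" "u \<le> b" "a < v" "v < b" for a b u v :: real
      proof -
        have "(1 - t) * a \<le> (1 - t) * u" "t * a < t * v" "(1 - t) * u \<le> (1 - t) * b" "t * v < t * b"
          using t that by auto
        then show "a < (1 - t) * u + t * v" "(1 - t) * u + t * v < b" by (auto simp: algebra_simps)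
      qed
      have yi: "y \<cdot> r = (1 - t) * (x \<cdot> r) + t * (basept \<cdot> r)" for r by (simp add: t inner_left_distrib)
      have y\<theta>: "of_int (lev id \<theta>) < y \<cdot> \<theta>" "y \<cdot> \<theta> < of_int (lev id \<theta>) + 1"
      proof -
        have "x \<cdot> \<theta> = of_int (lev id \<theta>) + 1" using x by (simp add: hyperplane_def)
        then show "of_int (lev id \<theta>) < y \<cdot> \<theta>" "y \<cdot> \<theta> < of_int (lev id \<theta>) + 1"
          unfolding yi using basept_lev_id(2,3)[OF \<theta>(1)]
            ineq[of "of_int (lev id \<theta>)" "x \<cdot> \<theta>" "of_int (lev id \<theta>) + 1" "basept \<cdot> \<theta>"] by auto
      qed
      show "y \<in> A0" unfolding fund_alcove_eq
      proof (intro CollectI ballI)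
        fix r assume r: "r \<in> Pos"
        consider "r = \<theta>" | "r = - \<theta>" | "r \<in> Pos - {\<theta>, - \<theta>}" using r by blast
        then show "0 < y \<cdot> r \<and> y \<cdot> r < 1"
        proof cases
          case 1
          then show ?thesis using y\<theta> basept_lev_id(1)[OF \<theta>(1)] r by simp
        next
          case 2
          then have "lev id \<theta> = -1" using basept_lev_id(1)[OF \<theta>(1)] r uminus_pos_iff[OF \<theta>(1)] by auto
          then show ?thesis using y\<theta> 2 by (simp add: coroot_uminus)
        next
          case 3
          then have "0 < x \<cdot> r" "x \<cdot> r < 1" using x by (auto simp: U_def)
          then show ?thesis unfolding yi using basept_pos[OF r] by (intro conjI ineq) auto
        qed
      qed
    qed
    then have "closure (open_segment x basept) \<subseteq> closure A0" by (rule closure_mono)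
    moreover have "x \<noteq> basept" using x alcove_wall(2)[OF assms basept_alcove] by (auto simp: hyperplane_def)
    ultimately show "x \<in> closure A0" by (auto simp: closure_open_segment)
  qed
  have "aff_dim (?H \<inter> U) = aff_dim ?H"
    using affine_hull_affine_Int_open[OF affH \<open>open U\<close> ne] aff_dim_affine_hull by metis
  moreover have "aff_dim (?H \<inter> U) \<le> aff_dim (closure A0 \<inter> ?H)" "aff_dim (closure A0 \<inter> ?H) \<le> aff_dim ?H"
    using sub by (auto intro!: aff_dim_subset)
  ultimately have "aff_dim (closure A0 \<inter> ?H) = DIM('v) - 1" using aff_dim_hyperplane_root[OF \<theta>(1)] by simp
  then show ?thesis using face ne sub aff_dim_closure_alcove by (auto simp: facet_of_def)
qed

end

locale weighted_root_system = based_root_system \<Phi> \<Delta> for \<Phi> \<Delta> :: "'v::euclidean_space set" +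
  fixes L :: "('v => 'v) => nat"
  assumes weight_function: "pos_weight_function \<Phi> \<Delta> L" and zero_weight: "0 \<in> L_weights \<Phi> \<Delta> L"
begin

lemma L_pos: "s \<in> gens ==> L s > 0" using weight_function by (simp add: pos_weight_function_def)

lemma L_add:
  assumes "v \<in> affine_weyl \<Phi>" "w \<in> affine_weyl \<Phi>" "len (v o w) = len v + len w"
  shows "L (v o w) = L v + L w"
proof -
  have "v o w \<in> affine_weyl \<Phi>" using assms comp_generated unfolding affine_weyl_eq by blast
  then show ?thesis using assms weight_function cox_length_affine by (simp add: pos_weight_function_def)
qed

lemma gens_affine_weyl: "s \<in> gens ==> s \<in> affine_weyl \<Phi>" unfolding affine_weyl_eq by (rule gen_generated)

lemma affine_weyl_comp: "v \<in> affine_weyl \<Phi> ==> w \<in> affine_weyl \<Phi> ==> v o w \<in> affine_weyl \<Phi>"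
  unfolding affine_weyl_eq by (rule comp_generated)

lemma affine_weyl_inv: "v \<in> affine_weyl \<Phi> ==> inv v \<in> affine_weyl \<Phi>"
  unfolding affine_weyl_eq using generated_inverse[OF gens_involution] by blast

lemma len_gen: "s \<in> gens ==> len s = 1" using len_step[OF id_aff, of s] by force

text \<open>If \<open>g o s\<close> is longer than \<open>g\<close>, additivity of \<open>L\<close>
  on both sides of \<open>g o s = s' o g\<close> gives the equality; otherwise \<open>g o s\<close>
  takes the role of \<open>g\<close>.\<close>

lemma L_conj:
  assumes "s \<in> gens" "s' \<in> gens" "g \<in> affine_weyl \<Phi>" "g o s = s' o g"
  shows "L s = L s'"
proof -
  have *: "L s = L s'" if "g \<in> affine_weyl \<Phi>" "g o s = s' o g" "len (g o s) = len g + 1" for g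
  proof -
    have "L (g o s) = L g + L s" using that assms gens_affine_weyl len_gen by (intro L_add) auto
    moreover have "L (s' o g) = L s' + L g" using that assms gens_affine_weyl len_gen by (intro L_add) auto
    ultimately show ?thesis using that by simp
  qed
  have ga: "g \<in> aff" using affine_weyl_aff assms by blast
  show ?thesis
  proof (cases "len (g o s) = len g + 1")
    case False
    then have l: "len g = len (g o s) + 1" using len_step[OF ga assms(1)] by linarith
    have gss: "g o s o s = g" using gens_involution[OF assms(1)] by (simp add: comp_assoc)
    then have "s' o (g o s) = g" using assms(4) by (metis comp_assoc)
    then show ?thesis using *[of "g o s"] l gss assms affine_weyl_comp gens_affine_weyl by simp
  qed (use * assms in blast)
qed

definition wt :: "'v => int => nat" where "wt a k = hyperplane_weight \<Phi> \<Delta> L (hyperplane a k)"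

lemma affine_image_hyperplane:
  assumes "g \<in> aff" "b \<in> \<Phi>" "of_int k' = of_int k + g 0 \<cdot> (lin g b)"
  shows "g ` hyperplane b k = hyperplane (lin g b) k'"
proof -
  have in1: "g y \<in> hyperplane (lin g b) k' \<longleftrightarrow> y \<in> hyperplane b k" for y
    using inner_comp[OF assms(1,2), of y] assms(3) by (simp add: hyperplane_def)
  show ?thesis
  proof (intro equalityI subsetI)
    fix y assume "y \<in> hyperplane (lin g b) k'"
    moreover have "y = g (inv g y)" using aff_inverse(1)[OF assms(1)] by (simp add: bij_def surj_f_inv_f)
    ultimately show "y \<in> g ` hyperplane b k" using in1 by (metis imageI)
  qed (use in1 in auto)
qed

text \<open>Evaluates the definite description. The image of a wall facet under \<open>x\<close>
  lies in the hyperplane; any other typed face inside it spans it affinely, so its generator is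
  conjugate to \<open>s\<close> and has the same \<open>L\<close>.\<close>

lemma wt_eq_L:
  assumes "a \<in> \<Phi>" "x \<in> affine_weyl \<Phi>" "s \<in> gens" "affine_refl a k o x = x o s"
  shows "wt a k = L s"
proof -
  obtain t where t: "t \<in> walls" "s = affine_refl t (lev id t + 1)" using assms(3) gens_eq by auto
  have t\<Phi>: "t \<in> \<Phi>" "t \<noteq> 0" using t walls_subset root_neq_0 by auto
  have xa: "x \<in> aff" using affine_weyl_aff assms by blast
  have fix_s: "{y. s y = y} = hyperplane t (lev id t + 1)" using affine_refl_fixed t\<Phi> t by blast
  show ?thesis unfolding wt_def hyperplane_weight_def
  proof (rule the_equality)
    let ?F = "closure A0 \<inter> hyperplane t (lev id t + 1)"
    have "face_of_type \<Phi> \<Delta> s (x ` ?F)" unfolding face_of_type_def using assms wall_facet[OF t(1)] fix_s by blast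
    moreover have "x ` ?F \<subseteq> hyperplane a k"
    proof
      fix z assume "z \<in> x ` ?F"
      then obtain y where y: "z = x y" "s y = y" using fix_s by blast
      then have "affine_refl a k z = z" using assms(4) by (metis o_apply)
      then show "z \<in> hyperplane a k" using affine_refl_fixed[of a k] root_neq_0[OF assms(1)] by blast
    qed
    ultimately show "\<exists>s' F. face_of_type \<Phi> \<Delta> s' F \<and> F \<subseteq> hyperplane a k \<and> L s = L s'" by blast
  next
    fix j assume "\<exists>s F. face_of_type \<Phi> \<Delta> s F \<and> F \<subseteq> hyperplane a k \<and> j = L s"
    then obtain s' w F0 where s': "s' \<in> gens" "w \<in> affine_weyl \<Phi>" "F0 facet_of closure A0"
      "F0 \<subseteq> {y. s' y = y}" "w ` F0 \<subseteq> hyperplane a k" "j = L s'" unfolding face_of_type_def by auto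
    obtain \<eta> where \<eta>: "\<eta> \<in> walls" "s' = affine_refl \<eta> (lev id \<eta> + 1)" using s'(1) gens_eq by auto
    let ?k = "lev id \<eta> + 1"
    have \<eta>\<Phi>: "\<eta> \<in> \<Phi>" "\<eta> \<noteq> 0" using \<eta> walls_subset root_neq_0 by auto
    have wa: "w \<in> aff" using affine_weyl_aff s' by blast
    have "F0 \<subseteq> hyperplane \<eta> ?k" using s'(4) affine_refl_fixed \<eta>\<Phi> \<eta> by blast
    moreover have "aff_dim F0 = aff_dim (hyperplane \<eta> ?k)"
      using s'(3) aff_dim_hyperplane_root[OF \<eta>\<Phi>(1)] aff_dim_closure_alcove by (auto simp: facet_of_def)
    ultimately have hull: "affine hull F0 = hyperplane \<eta> ?k"
      using aff_dim_eq_full_gen affine_hull_eq affine_hyperplane by (metis hyperplane_inner)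
    let ?b = "lin w \<eta>"
    have b\<Phi>: "?b \<in> \<Phi>" using weyl_root affD(1)[OF wa] \<eta>\<Phi> by blast
    have "w 0 \<cdot> ?b \<in> \<int>" using affD(2)[OF wa] b\<Phi> by (auto simp: intwt_def)
    then obtain i :: int where "w 0 \<cdot> ?b = of_int i" by (auto elim: Ints_cases)
    then have k': "of_int (?k + i) = of_int ?k + w 0 \<cdot> ?b" by simp
    have "affine (w -` hyperplane a k)" unfolding affine_def
    proof (intro ballI allI impI)
      fix y z and u v :: real
      assume yz: "y \<in> w -` hyperplane a k" "z \<in> w -` hyperplane a k" "u + v = 1"
      have "w (u *\<^sub>R y + v *\<^sub>R z) = u *\<^sub>R lin w y + v *\<^sub>R lin w z + (u + v) *\<^sub>R w 0"
        using affD(3)[OF wa] lin_apply[of w "u *\<^sub>R y + v *\<^sub>R z"] yz(3) by (simp add: linear_add linear_scale)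
      also have "\<dots> = u *\<^sub>R w y + v *\<^sub>R w z"
        unfolding lin_apply[of w y] lin_apply[of w z] by (simp add: algebra_simps)
      finally show "u *\<^sub>R y + v *\<^sub>R z \<in> w -` hyperplane a k"
        using yz by (simp add: hyperplane_def inner_left_distrib flip: distrib_right)
    qed
    then have "affine hull F0 \<subseteq> w -` hyperplane a k" using s'(5) by (intro hull_minimal) auto
    then have "w ` hyperplane \<eta> ?k \<subseteq> hyperplane a k"
      unfolding hull by (simp only: image_subset_iff_subset_vimage)
    then have "hyperplane ?b (?k + i) \<subseteq> hyperplane a k" unfolding affine_image_hyperplane[OF wa \<eta>\<Phi>(1) k'] .
    from hyperplane_subsetD[OF assms(1) b\<Phi> this]
    have "affine_refl a k = affine_refl ?b (?k + i)" using affine_refl_uminus by metis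
    then have conj: "affine_refl a k o w = w o s'"
      using affine_refl_conj_general[OF weyl_orthogonal[OF affD(1)[OF wa]] k'] \<eta>(2) by simp
    let ?g = "inv x o w"
    have "x o (s o ?g) = x o (?g o s')"
    proof -
      have "x o (s o ?g) = affine_refl a k o (x o inv x) o w" using assms(4) by (simp flip: comp_assoc)
      also have "\<dots> = (x o inv x) o (w o s')" using xa conj by (simp add: comp_assoc)
      finally show ?thesis by (simp add: comp_assoc)
    qed
    then have "inv x o x o (s o ?g) = inv x o x o (?g o s')" by (simp add: comp_assoc)
    then have "?g o s' = s o ?g" using xa by simp
    then show "j = L s"
      using L_conj[OF s'(1) assms(3)] affine_weyl_comp affine_weyl_inv assms(2) s'(2,6) by blast
  qed
qed

lemma wt_cr: "x \<in> affine_weyl \<Phi> ==> s \<in> gens ==> wt (cr x s) (lev x (cr x s) + 1) = L s"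
  using wt_eq_L[of "cr x s" x s] cr(1,4)[of x s] affine_weyl_aff by metis

lemma affine_refl_conj_gen:
  assumes "a \<in> \<Phi>"
  obtains x s where "x \<in> affine_weyl \<Phi>" "s \<in> gens" "affine_refl a k o x = x o s"
proof -
  obtain us s where us: "set us \<subseteq> gens" "s \<in> gens" "affine_refl a k = word_prod us o s o inv (word_prod us)"
    using affine_refl_generated assms by blast
  have "affine_refl a k o word_prod us = word_prod us o s" using us word_aff by (simp add: comp_assoc)
  moreover have "word_prod us \<in> affine_weyl \<Phi>" unfolding affine_weyl_eq by (rule generatedI[OF us(1)])
  ultimately show ?thesis using that us(2) by blast
qed

lemma wt_pos: "a \<in> \<Phi> ==> wt a k > 0" using affine_refl_conj_gen[of a k] wt_eq_L L_pos by metis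

lemma wt_affine_weyl:
  assumes "g \<in> affine_weyl \<Phi>" "b \<in> \<Phi>" "of_int k' = of_int k + g 0 \<cdot> (lin g b)"
  shows "wt (lin g b) k' = wt b k"
proof -
  have ga: "g \<in> aff" using affine_weyl_aff assms by blast
  obtain x s where x: "x \<in> affine_weyl \<Phi>" "s \<in> gens" "affine_refl b k o x = x o s"
    using affine_refl_conj_gen[OF assms(2)] by blast
  have "affine_refl (lin g b) k' o (g o x) = g o affine_refl b k o x"
    using affine_refl_conj_general[OF weyl_orthogonal[OF affD(1)[OF ga]] assms(3)] by (simp flip: comp_assoc)
  also have "\<dots> = (g o x) o s" using x(3) by (simp add: comp_assoc)
  finally have "wt (lin g b) k' = L s"
    using wt_eq_L[OF weyl_root[OF affD(1)[OF ga] assms(2)] affine_weyl_comp[OF assms(1) x(1)] x(2)] by blast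
  then show ?thesis using wt_eq_L[OF assms(2) x] by simp
qed

lemma wt_weyl: "w \<in> weyl ==> b \<in> \<Phi> ==> wt (w b) k = wt b k"
  using wt_affine_weyl[OF weyl_affine, of w b k k] by (simp add: lin_eq)

lemma wt_uminus: "wt (- a) (- k) = wt a k" by (simp add: wt_def hyperplane_uminus)

lemma transl_root_affine_weyl: assumes "a \<in> \<Phi>" shows "transl a \<in> affine_weyl \<Phi>"
proof -
  have "transl a = affine_refl a 1 o affine_refl a 0"
    by (simp add: fun_eq_iff transl_def affine_refl_def inner_diff_left inner_coroot_self root_neq_0[OF assms] algebra_simps)
  moreover have "affine_refl a k \<in> affine_weyl \<Phi>" for k
    unfolding affine_weyl_def using assms by (intro gen_generated) auto
  ultimately show ?thesis using affine_weyl_comp by metis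
qed

lemma wt_transl:
  assumes "transl v \<in> affine_weyl \<Phi>" "b \<in> \<Phi>" "v \<cdot> b = of_int j"
  shows "wt b (k + j) = wt b k"
  using wt_affine_weyl[OF assms(1,2), of "k + j" k] assms(3) by (simp add: lin_transl_id) (simp add: transl_def)

text \<open>Translation by \<open>b\<close> lies in the affine Weyl group and moves the levels of
  direction \<open>b\<close> by 2. So a direction carries at most two weights, one for even and one
  for odd levels.\<close>

lemma wt_even: "b \<in> \<Phi> ==> wt b (k + 2 * j) = wt b k"
proof -
  assume b: "b \<in> \<Phi>"
  have *: "wt b (k + 2 * int n) = wt b k" for k n
  proof (induction n)
    case (Suc n)
    have "wt b ((k + 2 * int n) + 2) = wt b (k + 2 * int n)"
      using wt_transl[OF transl_root_affine_weyl[OF b] b, of 2] inner_coroot_self[OF root_neq_0[OF b]] by simp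
    then show ?case using Suc by (simp add: algebra_simps)
  qed simp
  show ?thesis
  proof (cases "j \<ge> 0")
    case True
    then show ?thesis using *[of k "nat j"] by simp
  next
    case False
    then show ?thesis using *[of "k + 2 * j" "nat (- j)"] by simp
  qed
qed

lemma wt_parity: "b \<in> \<Phi> ==> wt b k = (if even k then wt b 0 else wt b 1)"
  using wt_even[of b 0 "k div 2"] wt_even[of b 1 "k div 2"] by (auto elim!: evenE oddE simp: add.commute)

lemma even_if_unequal:
  assumes "a \<in> \<Phi>" "b \<in> \<Phi>" "wt b 0 \<noteq> wt b 1" shows "\<exists>j. a \<cdot> b = of_int (2 * j)"
proof -
  obtain i :: int where i: "a \<cdot> b = of_int i" using inner_coroot_Ints assms by (metis Ints_cases)
  have "wt b (0 + i) = wt b 0" using wt_transl[OF transl_root_affine_weyl[OF assms(1)] assms(2) i] .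
  then have "even i" using wt_parity[OF assms(2), of i] assms(3) by (metis add_0)
  then show ?thesis using i by (auto elim!: evenE)
qed

text \<open>Taken with coefficients constant on Weyl orbits, it serves to exclude that odd levels
  are heavier than even ones, to build strictly dominant weights, and as \<open>rho\<close>.\<close>

definition half_sum :: "('v => int) => 'v" where "half_sum c = (1/2) *\<^sub>R (\<Sum>a\<in>Pos. of_int (c a) *\<^sub>R a)"

lemma reflect_half_sum:
  assumes c: "\<forall>w\<in>weyl. \<forall>r\<in>\<Phi>. c (w r) = c r" and "d \<in> \<Delta>"
  shows "reflect d (half_sum c) = half_sum c - of_int (c d) *\<^sub>R d"
proof -
  let ?f = "\<lambda>r. of_int (c r) *\<^sub>R r" and ?s = "reflect d"
  have d: "d \<in> \<Phi>" "d \<in> Pos" using assms simple_subset simple_pos by auto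
  have "(\<Sum>r\<in>Pos - {d}. ?s (?f r)) = (\<Sum>r\<in>Pos - {d}. ?f r)"
  proof (rule sum.reindex_bij_witness[of _ ?s ?s])
    show m: "?s r \<in> Pos - {d}" if a: "r \<in> Pos - {d}" for r
    proof -
      have "?s r \<noteq> d"
      proof
        assume "?s r = d"
        then have "r = - d" using reflect_reflect[OF d(1), of r] refl_self[OF root_neq_0[OF d(1)]] by simp
        then show False using a uminus_pos_iff[OF d(1)] d by simp
      qed
      then show ?thesis using refl_pos a assms by simp
    qed
    then show "?s r \<in> Pos - {d}" if "r \<in> Pos - {d}" for r using that .
    fix r assume a: "r \<in> Pos - {d}"
    show "of_int (c (?s r)) *\<^sub>R ?s r = ?s (?f r)"
      using c reflect_weyl[OF d(1)] a pos_subset by (auto simp: linear_scale[OF linear_refl])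
  qed (use reflect_reflect[OF d(1)] in auto)
  moreover have "?s (?f d) = - ?f d"
    using refl_self[OF root_neq_0[OF d(1)]] by (simp add: linear_scale[OF linear_refl])
  ultimately have "(\<Sum>r\<in>Pos. ?s (?f r)) = sum ?f Pos - (?f d + ?f d)"
    using sum.remove[OF finite_pos d(2), of ?f] sum.remove[OF finite_pos d(2), of "\<lambda>r. ?s (?f r)"] by simp
  moreover have "?s (sum ?f Pos) = (\<Sum>r\<in>Pos. ?s (?f r))" by (rule linear_sum[OF linear_refl])
  ultimately have "?s (half_sum c) = (1/2) *\<^sub>R (sum ?f Pos - (?f d + ?f d))"
    by (simp only: half_sum_def linear_scale[OF linear_refl])
  then show ?thesis by (simp only: half_sum_def scaleR_right_diff_distrib scaleR_half_double)
qed

lemma half_sum_simple: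
  assumes "\<forall>w\<in>weyl. \<forall>a\<in>\<Phi>. c (w a) = c a" "d \<in> \<Delta>" shows "half_sum c \<cdot> d = of_int (c d)"
  using reflect_half_sum[OF assms] root_neq_0[of d] simple_subset assms(2) by (auto simp: refl_eq)

text \<open>Against a simple coroot the level is \<open>c d\<close>. Along \<open>pos_induct\<close>
  it changes by multiples of pairings with the coroot of \<open>b\<close>, which are even whenever
  the direction has two weights, so the parity persists.\<close>

lemma half_sum_level:
  assumes c: "\<forall>w\<in>weyl. \<forall>a\<in>\<Phi>. c (w a) = c a" and "b \<in> Pos"
  shows "\<exists>j. half_sum c \<cdot> b = of_int j \<and> (wt b 0 \<noteq> wt b 1 \<longrightarrow> (even j \<longleftrightarrow> even (c b)))" using assms(2)
proof (induction rule: pos_induct)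
  case (simple d)
  then show ?case using half_sum_simple[OF c] by (intro exI[of _ "c d"]) simp
next
  case (step b d)
  have r: "b \<in> \<Phi>" "d \<in> \<Phi>" using step pos_subset simple_subset by auto
  obtain j where j: "half_sum c \<cdot> b = of_int j" "wt b 0 \<noteq> wt b 1 ==> even j \<longleftrightarrow> even (c b)" using step by blast
  obtain i where i: "d \<cdot> b = of_int i" using inner_coroot_Ints[OF r] Ints_cases by blast
  have ev: "even i" if "wt b 0 \<noteq> wt b 1" using even_if_unequal[OF r(2,1) that] unfolding i by (auto simp flip: of_int_mult)
  have "half_sum c \<cdot> (reflect d b) = reflect d (half_sum c) \<cdot> b"
    using inner_refl_left[OF root_neq_0[OF r(2)]] by (simp add: coroot_refl)
  also have "\<dots> = of_int (j - c d * i)" using j i by (simp add: reflect_half_sum[OF c step(2)] inner_diff_left)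
  finally show ?case
    using j(2) ev wt_weyl[OF reflect_weyl[OF r(2)] r(1)] bspec[OF bspec[OF c reflect_weyl[OF r(2)]] r(1)]
    by (intro exI[of _ "j - c d * i"]) auto
qed

lemma point_weight_eq:
  "point_weight \<Phi> \<Delta> L x = (\<Sum>a\<in>{a\<in>Pos. x \<cdot> a \<in> \<int>}. wt a \<lfloor>x \<cdot> a\<rfloor>)"
proof -
  let ?h = "\<lambda>a. hyperplane a \<lfloor>x \<cdot> a\<rfloor>"
  have inj: "inj_on ?h {a\<in>Pos. x \<cdot> a \<in> \<int>}"
  proof (rule inj_onI)
    fix a b assume *: "a \<in> {a\<in>Pos. x \<cdot> a \<in> \<int>}" "b \<in> {a\<in>Pos. x \<cdot> a \<in> \<int>}" "?h a = ?h b"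
    then have \<Phi>: "a \<in> \<Phi>" "b \<in> \<Phi>" using pos_subset by auto
    have "a = b \<or> a = - b" using hyperplane_subsetD[OF \<Phi>] *(3) by blast
    then show "a = b" using * uminus_pos_iff[OF \<Phi>(2)] by auto
  qed
  have img: "{H. H \<in> hyperplanes \<Phi> \<and> x \<in> H} = ?h ` {a\<in>Pos. x \<cdot> a \<in> \<int>}"
  proof (intro equalityI subsetI)
    fix H assume "H \<in> {H. H \<in> hyperplanes \<Phi> \<and> x \<in> H}"
    then obtain a n where a: "a \<in> \<Phi>" "H = hyperplane a n" "x \<cdot> a = of_int n"
      by (auto simp: hyperplanes_def hyperplane_def)
    show "H \<in> ?h ` {a\<in>Pos. x \<cdot> a \<in> \<int>}"
    proof (cases "a \<in> Pos")
      case False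
      have "- a \<in> Pos" using False a(1) uminus_pos_iff by blast
      moreover have "x \<cdot> (- a) = of_int (- n)" using a(3) by (simp add: coroot_uminus)
      moreover have "H = hyperplane (- a) (- n)" unfolding a(2) hyperplane_uminus ..
      ultimately show ?thesis by (intro image_eqI[of _ _ "- a"]) (simp_all del: of_int_minus)
    qed (use a in \<open>auto intro!: image_eqI[of _ _ a]\<close>)
  next
    fix H assume "H \<in> ?h ` {a\<in>Pos. x \<cdot> a \<in> \<int>}"
    then obtain a where "a \<in> Pos" "x \<cdot> a \<in> \<int>" "H = ?h a" by blast
    moreover have "a \<in> \<Phi>" using calculation(1) pos_subset by blast
    moreover have "x \<in> H" using calculation by (auto simp: hyperplane_def elim!: Ints_cases)
    ultimately show "H \<in> {H. H \<in> hyperplanes \<Phi> \<and> x \<in> H}" unfolding hyperplanes_def by blast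
  qed
  show ?thesis unfolding point_weight_def img sum.reindex[OF inj] by (simp add: wt_def)
qed

text \<open>Were \<open>wt \<alpha> 0 < wt \<alpha> 1\<close> for some roots, half the sum of these positive roots would have odd
  levels exactly there, and a larger weight than the origin.\<close>

lemma wt_1_le_0: assumes "a \<in> \<Phi>" shows "wt a 1 \<le> wt a 0"
proof (rule ccontr)
  assume "\<not> ?thesis"
  then have lt: "wt a 0 < wt a 1" by simp
  define c :: "'v => int" where "c r = (if wt r 0 < wt r 1 then 1 else 0)" for r
  have c: "\<forall>w\<in>weyl. \<forall>r\<in>\<Phi>. c (w r) = c r" using wt_weyl by (simp add: c_def)
  let ?x = "half_sum c"
  have x: "?x \<cdot> r \<in> \<int> \<and> wt r 0 \<le> wt r \<lfloor>?x \<cdot> r\<rfloor> \<and> (wt r 0 < wt r 1 \<longrightarrow> wt r 0 < wt r \<lfloor>?x \<cdot> r\<rfloor>)"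
    if b: "r \<in> Pos" for r
  proof -
    obtain j where j: "?x \<cdot> r = of_int j" "wt r 0 \<noteq> wt r 1 \<longrightarrow> (even j \<longleftrightarrow> even (c r))"
      using half_sum_level[OF c b] by blast
    have "r \<in> \<Phi>" using b pos_subset by blast
    from wt_parity[OF this, of j] show ?thesis using j by (auto simp: c_def split: if_splits)
  qed
  have all: "{r\<in>Pos. ?x \<cdot> r \<in> \<int>} = Pos" using x by blast
  obtain r where b: "r \<in> Pos" "wt r 0 < wt r 1"
  proof (cases "a \<in> Pos")
    case False
    then have "- a \<in> Pos" using uminus_pos_iff assms by blast
    moreover have "wt (- a) k = wt a k" for k
      using wt_weyl[OF reflect_weyl[OF assms] assms] refl_self[OF root_neq_0[OF assms]] by simp
    ultimately show ?thesis using that[of "- a"] lt by simp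
  qed (use that lt in blast)
  have "(\<Sum>r\<in>Pos. wt r 0) < (\<Sum>r\<in>Pos. wt r \<lfloor>?x \<cdot> r\<rfloor>)" using x b by (intro sum_strict_mono_ex1[OF finite_pos]) auto
  then have "point_weight \<Phi> \<Delta> L 0 < point_weight \<Phi> \<Delta> L ?x" by (simp add: point_weight_eq all)
  then show False using zero_weight by (simp add: L_weights_def not_less[symmetric])
qed

end

section \<open>Weights of maximal weight and the extended group\<close>

context weighted_root_system
begin

abbreviation "P \<equiv> L_weights \<Phi> \<Delta> L"
abbreviation "Pp \<equiv> dom_weights \<Phi> \<Delta> L"
abbreviation "We \<equiv> ext_weyl \<Phi> \<Delta> L"

lemma wt_le_0: "a \<in> \<Phi> ==> wt a k \<le> wt a 0" using wt_parity[of a k] wt_1_le_0[of a] by (simp split: if_splits)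

lemma point_weight_0: "point_weight \<Phi> \<Delta> L 0 = (\<Sum>a\<in>Pos. wt a 0)" by (simp add: point_weight_eq)

lemma P_I: assumes "\<And>a. a \<in> Pos ==> \<exists>j. n \<cdot> a = of_int j \<and> wt a j = wt a 0" shows "n \<in> P"
proof -
  have "n \<cdot> a \<in> \<int>" if "a \<in> Pos" for a using assms[OF that] by auto
  then have "{a\<in>Pos. n \<cdot> a \<in> \<int>} = Pos" by blast
  moreover have "wt a \<lfloor>n \<cdot> a\<rfloor> = wt a 0" if "a \<in> Pos" for a using assms[OF that] by auto
  ultimately have "point_weight \<Phi> \<Delta> L n = point_weight \<Phi> \<Delta> L 0" unfolding point_weight_0 by (simp add: point_weight_eq)
  then show ?thesis using zero_weight by (simp add: L_weights_def)
qed

text \<open>With 0 maximal and \<open>wt a k \<le> wt a 0\<close>, a maximal point must lie, in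
  every direction, on a hyperplane as heavy as the one through 0. By parity this means that
  translation by the point preserves all weights; hence \<open>P\<close> is a lattice stable under
  the finite group.\<close>

lemma L_weights_iff:
  "n \<in> P \<longleftrightarrow> intwt n \<and> (\<forall>a\<in>\<Phi>. \<forall>j k. n \<cdot> a = of_int j \<longrightarrow> wt a (k + j) = wt a k)"
proof
  assume "n \<in> P"
  then have ge: "point_weight \<Phi> \<Delta> L 0 \<le> point_weight \<Phi> \<Delta> L n" by (simp add: L_weights_def)
  let ?I = "{a\<in>Pos. n \<cdot> a \<in> \<int>}"
  have pos\<Phi>: "a \<in> Pos ==> a \<in> \<Phi>" for a using pos_subset by blast
  have split: "(\<Sum>a\<in>Pos. wt a 0) = (\<Sum>a\<in>?I. wt a 0) + (\<Sum>a\<in>Pos - ?I. wt a 0)"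
    using finite_pos sum.subset_diff[of ?I Pos "\<lambda>a. wt a 0"] by (simp add: add.commute)
  have le: "(\<Sum>a\<in>?I. wt a \<lfloor>n \<cdot> a\<rfloor>) \<le> (\<Sum>a\<in>?I. wt a 0)" using wt_le_0 pos\<Phi> by (intro sum_mono) auto
  have ge': "(\<Sum>a\<in>Pos. wt a 0) \<le> (\<Sum>a\<in>?I. wt a \<lfloor>n \<cdot> a\<rfloor>)"
    using ge unfolding point_weight_0 by (simp add: point_weight_eq)
  have "(\<Sum>a\<in>Pos - ?I. wt a 0) = 0" using split le ge' by linarith
  moreover have "wt a 0 \<noteq> 0" if "a \<in> Pos - ?I" for a using wt_pos[of a 0] pos\<Phi>[of a] that by simp
  moreover have "finite (Pos - ?I)" using finite_pos by simp
  ultimately have "Pos - ?I = {}" by (metis (no_types, lifting) equals0I sum_eq_0_iff)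
  then have I: "?I = Pos" by blast
  have "(\<Sum>a\<in>?I. wt a \<lfloor>n \<cdot> a\<rfloor>) = (\<Sum>a\<in>?I. wt a 0)" using split le ge' by linarith
  then have eq: "wt a \<lfloor>n \<cdot> a\<rfloor> = wt a 0" if "a \<in> Pos" for a
    using sum_mono_inv[of "\<lambda>a. wt a \<lfloor>n \<cdot> a\<rfloor>" ?I "\<lambda>a. wt a 0" a] wt_le_0 pos\<Phi> that I finite_pos by auto
  have pos: "n \<cdot> a \<in> \<int> \<and> (\<forall>j k. n \<cdot> a = of_int j \<longrightarrow> wt a (k + j) = wt a k)" if "a \<in> Pos" for a
  proof (intro conjI allI impI)
    show "n \<cdot> a \<in> \<int>" using I that by blast
    fix j k assume j: "n \<cdot> a = of_int j"
    then have "wt a j = wt a 0" using eq[OF that] by simp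
    then show "wt a (k + j) = wt a k" using wt_parity[OF pos\<Phi>[OF that], of j] wt_parity[OF pos\<Phi>[OF that], of k]
        wt_parity[OF pos\<Phi>[OF that], of "k + j"] by (auto split: if_splits)
  qed
  have all: "n \<cdot> a \<in> \<int> \<and> (\<forall>j k. n \<cdot> a = of_int j \<longrightarrow> wt a (k + j) = wt a k)" if "a \<in> \<Phi>" for a
  proof (cases "a \<in> Pos")
    case False
    then have p: "- a \<in> Pos" using uminus_pos_iff that by blast
    have "n \<cdot> a \<in> \<int>" using pos[OF p] by (simp add: coroot_uminus)
    moreover have "wt a (k + j) = wt a k" if "n \<cdot> a = of_int j" for j k
    proof -
      have "wt (- a) (- k + - j) = wt (- a) (- k)"
        using pos[OF p] that by (simp only: coroot_uminus inner_minus_right of_int_minus)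
      then show ?thesis using wt_uminus[of a "k + j"] wt_uminus[of a k] by (simp only: minus_add_distrib)
    qed
    ultimately show ?thesis by blast
  qed (use pos in blast)
  then show "intwt n \<and> (\<forall>a\<in>\<Phi>. \<forall>j k. n \<cdot> a = of_int j \<longrightarrow> wt a (k + j) = wt a k)" by (auto simp: intwt_def)
next
  assume *: "intwt n \<and> (\<forall>a\<in>\<Phi>. \<forall>j k. n \<cdot> a = of_int j \<longrightarrow> wt a (k + j) = wt a k)"
  show "n \<in> P"
  proof (rule P_I)
    fix a assume "a \<in> Pos"
    then have a: "a \<in> \<Phi>" using pos_subset by blast
    then obtain j :: int where j: "n \<cdot> a = of_int j" using * unfolding intwt_def by (metis Ints_cases)
    then have "wt a (0 + j) = wt a 0" using * a by blast
    then show "\<exists>j. n \<cdot> a = of_int j \<and> wt a j = wt a 0" using j by auto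
  qed
qed

lemma P_intwt: "n \<in> P ==> intwt n" using L_weights_iff by blast

lemma P_wt: "n \<in> P ==> a \<in> \<Phi> ==> n \<cdot> a = of_int j ==> wt a (k + j) = wt a k" using L_weights_iff by blast

lemma P_int: "n \<in> P ==> a \<in> \<Phi> ==> \<exists>j::int. n \<cdot> a = of_int j"
  using P_intwt unfolding intwt_def by (metis Ints_cases)

lemma P_add: assumes "\<mu> \<in> P" "n \<in> P" shows "\<mu> + n \<in> P" unfolding L_weights_iff
proof (intro conjI ballI allI impI)
  show "intwt (\<mu> + n)" using intwt_simps(2) P_intwt assms by blast
  fix r j k assume r: "r \<in> \<Phi>" "(\<mu> + n) \<cdot> r = of_int j"
  obtain a b :: int where ab: "\<mu> \<cdot> r = of_int a" "n \<cdot> r = of_int b" using P_int assms r by meson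
  have "of_int j = (of_int (a + b) :: real)" using r(2) ab by (simp add: inner_left_distrib)
  then have "j = a + b" by (simp only: of_int_eq_iff)
  then show "wt r (k + j) = wt r k"
    using P_wt[OF assms(1) r(1) ab(1), of k] P_wt[OF assms(2) r(1) ab(2), of "k + a"] by (simp add: add.assoc)
qed

lemma P_uminus: assumes "n \<in> P" shows "- n \<in> P" unfolding L_weights_iff
proof (intro conjI ballI allI impI)
  show "intwt (- n)" using intwt_simps(3) P_intwt assms by blast
  fix a j k assume a: "a \<in> \<Phi>" "(- n) \<cdot> a = of_int j"
  then have "n \<cdot> a = of_int (- j)" by simp
  then show "wt a (k + j) = wt a k" using P_wt[OF assms a(1), of "- j" "k + j"] by simp
qed

lemma P_diff: "\<mu> \<in> P ==> n \<in> P ==> \<mu> - n \<in> P" using P_add[of \<mu> "- n"] P_uminus by simp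

lemma P_weyl: assumes "n \<in> P" "w \<in> weyl" shows "w n \<in> P" unfolding L_weights_iff
proof (intro conjI ballI allI impI)
  show "intwt (w n)" using intwt_weyl P_intwt assms by blast
  fix a j k assume a: "a \<in> \<Phi>" "w n \<cdot> a = of_int j"
  let ?b = "inv w a"
  have b: "?b \<in> \<Phi>" "w ?b = a" using weyl_root weyl_inverse assms a by auto
  then have "n \<cdot> ?b = of_int j" using weyl_inner[OF assms(2), of n ?b] a by simp
  then show "wt a (k + j) = wt a k" using P_wt[OF assms(1) b(1), of j k] wt_weyl[OF assms(2) b(1)] b(2) by metis
qed

lemma P_affine_weyl: assumes "transl n \<in> affine_weyl \<Phi>" shows "n \<in> P" unfolding L_weights_iff
proof (intro conjI ballI allI impI)
  show "intwt n" using affD(2)[OF affine_weyl_aff[OF assms]] by (simp add: transl_def)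
qed (use wt_transl[OF assms] in blast)

lemma P_root: "a \<in> \<Phi> ==> a \<in> P" using P_affine_weyl transl_root_affine_weyl by blast

lemma P_0: "0 \<in> P" by (rule zero_weight)

lemma P_of_nat: "\<nu> \<in> P ==> of_nat n *\<^sub>R \<nu> \<in> P" by (induction n) (simp_all add: P_0 P_add scaleR_left_distrib)

lemma P_sum: "(\<And>i. i \<in> I ==> f i \<in> P) ==> sum f I \<in> P"
  by (induction I rule: infinite_finite_induct) (auto simp: P_0 P_add)

lemma We_iff: "x \<in> We \<longleftrightarrow> x \<in> aff \<and> x 0 \<in> P"
proof
  assume "x \<in> We"
  then obtain n w where "x = transl n o w" "n \<in> P" "w \<in> weyl" by (auto simp: ext_weyl_def finite_weyl_eq)
  then show "x \<in> aff \<and> x 0 \<in> P" using aff_comp[OF transl_aff[OF P_intwt] weyl_aff] by (simp add: transl_def)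
next
  assume *: "x \<in> aff \<and> x 0 \<in> P"
  then show "x \<in> We"
    using transl_lin[of x] affD(1)[of x] unfolding ext_weyl_def finite_weyl_eq by (metis (mono_tags, lifting) mem_Collect_eq)
qed

lemma We_aff: "x \<in> We ==> x \<in> aff" and We_P: "x \<in> We ==> x 0 \<in> P" using We_iff by auto

lemma We_lin: "x \<in> We ==> lin x \<in> weyl" using We_aff affD(1) by blast

lemma We_comp: assumes "x \<in> We" "y \<in> We" shows "x o y \<in> We"
proof -
  have "(x o y) 0 = lin x (y 0) + x 0" by (simp add: lin_def)
  then have "(x o y) 0 \<in> P" using P_add[OF P_weyl[OF We_P[OF assms(2)] We_lin[OF assms(1)]] We_P[OF assms(1)]] by simp
  then show ?thesis using aff_comp[OF We_aff We_aff, OF assms] We_iff by blast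
qed

lemma weyl_We: "w \<in> weyl ==> w \<in> We" using weyl_aff P_0 by (simp add: We_iff)

lemma id_We [simp]: "id \<in> We" using weyl_We weyl_id by blast

lemma transl_We: "n \<in> P ==> transl n \<in> We" using transl_aff P_intwt by (simp add: We_iff) (simp add: transl_def)

lemma We_inv: assumes "x \<in> We" shows "inv x \<in> We"
proof -
  have xa: "x \<in> aff" using We_aff assms .
  have "lin (inv x) (x 0) + inv x 0 = inv x (x 0)" by (simp add: lin_def)
  also have "\<dots> = 0" using aff_inverse(1)[OF xa] by (simp add: bij_def)
  finally have "inv x 0 = - lin (inv x) (x 0)" by (simp add: add_eq_0_iff2)
  then have "inv x 0 \<in> P" using P_uminus[OF P_weyl[OF We_P[OF assms] affD(1)[OF aff_inverse(2)[OF xa]]]] by simp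
  then show ?thesis using aff_inverse(2)[OF xa] We_iff by blast
qed

lemma affine_weyl_We: assumes "g \<in> affine_weyl \<Phi>" shows "g \<in> We"
proof -
  have ga: "g \<in> aff" using affine_weyl_aff assms .
  have "transl (g 0) = g o inv (lin g)"
    using transl_lin[of g] weyl_inv_apply(2)[OF affD(1)[OF ga]] by (metis comp_assoc comp_id fun_eq_iff id_apply o_apply)
  then have "transl (g 0) \<in> affine_weyl \<Phi>"
    using affine_weyl_comp assms weyl_affine weyl_inverse(2) affD(1)[OF ga] by metis
  then show ?thesis using P_affine_weyl ga We_iff by blast
qed

lemma gens_We: "s \<in> gens ==> s \<in> We" using gens_affine_weyl affine_weyl_We by blast

lemma word_We: "set ss \<subseteq> gens ==> word_prod ss \<in> We"
  using affine_weyl_We generatedI unfolding affine_weyl_eq by blast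

text \<open>Translations in \<open>P\<close> preserve weights, so also in the extended group the
  weight of a crossed hyperplane is read off from the letter.\<close>

lemma wt_cr_We: assumes "x \<in> We" "s \<in> gens" shows "wt (cr x s) (lev x (cr x s) + 1) = L s"
proof -
  let ?w = "lin x"
  have w: "?w \<in> weyl" using We_lin assms by blast
  have wa: "?w \<in> aff" using weyl_aff w by blast
  have ta: "transl (x 0) \<in> aff" using transl_aff P_intwt We_P assms by blast
  have x: "x = transl (x 0) o ?w" using transl_lin by metis
  let ?b = "cr ?w s"
  have b: "?b \<in> \<Phi>" using cr(1)[OF wa assms(2)] .
  have c: "cr x s = ?b" using cr(5)[OF wa assms(2) ta] x by (simp add: lin_transl_id)
  obtain j :: int where j: "x 0 \<cdot> ?b = of_int j" using P_int We_P assms(1) b by blast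
  have "of_int (lev x ?b) = (of_int (lev ?w ?b + j) :: real)"
    using lev_transl[OF P_intwt[OF We_P[OF assms(1)]] b, of ?w] x j by simp
  then have l: "lev x ?b = lev ?w ?b + j" by (simp only: of_int_eq_iff)
  have "wt ?b (lev ?w ?b + 1 + j) = wt ?b (lev ?w ?b + 1)" using P_wt[OF We_P[OF assms(1)] b j] .
  also have "\<dots> = L s" using wt_cr[OF weyl_affine[OF w] assms(2)] .
  finally show ?thesis unfolding c l by (simp add: algebra_simps)
qed

lemma alcove_lev:
  assumes "x \<in> aff" "a \<in> \<Phi>" "y \<in> alcove \<Phi> \<Delta> x"
  shows "of_int (lev x a) < y \<cdot> a" "y \<cdot> a < of_int (lev x a) + 1"
proof -
  obtain y' where y': "y' \<in> A0" "y = x y'" using assms(3) unfolding alcove_def by blast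
  obtain b where b: "b \<in> \<Phi>" "a = lin x b" using root_lin_cases assms by blast
  have "of_int (lev id b) < y' \<cdot> b \<and> y' \<cdot> b < of_int (lev id b) + 1"
  proof (cases "b \<in> Pos")
    case True
    then show ?thesis using y'(1) basept_lev_id(1)[OF b(1)] by (auto simp: fund_alcove_eq)
  next
    case False
    then have "- b \<in> Pos" using uminus_pos_iff b by blast
    then have "0 < y' \<cdot> (- b)" "y' \<cdot> (- b) < 1" using y'(1) unfolding fund_alcove_eq by blast+
    then show ?thesis using False basept_lev_id(1)[OF b(1)] by (simp add: coroot_uminus)
  qed
  then show "of_int (lev x a) < y \<cdot> a" "y \<cdot> a < of_int (lev x a) + 1"
    using lev_lin[OF assms(1) b(1)] inner_comp[OF assms(1) b(1), of y'] b(2) y'(2) by simp_all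
qed

lemma alcove_stab_eq: "alcove_stab \<Phi> \<Delta> L = {a \<in> We. len a = 0}"
proof (intro equalityI subsetI)
  fix a assume a: "a \<in> alcove_stab \<Phi> \<Delta> L"
  then have "a basept \<in> A0" using basept_alcove by (auto simp: alcove_stab_def)
  then have "len a = 0" by (intro len_0I) (auto simp: lev_def fund_alcove_eq floor_eq_iff)
  then show "a \<in> {a \<in> We. len a = 0}" using a by (auto simp: alcove_stab_def)
next
  have *: "b ` A0 \<subseteq> A0" if b: "b \<in> aff" "len b = 0" for b
  proof
    fix z assume z: "z \<in> b ` A0"
    have "0 < z \<cdot> r \<and> z \<cdot> r < 1" if "r \<in> Pos" for r
    proof -
      have r: "r \<in> \<Phi>" using that pos_subset by blast
      then have "lev b r = 0" using len_0D[OF b r] basept_lev_id(1) that by simp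
      then show ?thesis using alcove_lev[OF b(1) r] z unfolding alcove_def by force
    qed
    then show "z \<in> A0" unfolding fund_alcove_eq by blast
  qed
  fix a assume "a \<in> {a \<in> We. len a = 0}"
  then have a: "a \<in> We" "a \<in> aff" "len a = 0" using We_aff by auto
  have "inv a ` A0 \<subseteq> A0" using *[of "inv a"] aff_inverse(2) len_inverse a by simp
  then have "a ` inv a ` A0 \<subseteq> a ` A0" by blast
  then have "A0 \<subseteq> a ` A0"
    using aff_inverse(1)[OF a(2)] by (simp add: image_comp[symmetric] image_inv_f_f bij_def image_f_inv_f)
  then show "a \<in> alcove_stab \<Phi> \<Delta> L" using * a by (auto simp: alcove_stab_def)
qed

lemma decompose_We:
  assumes "x \<in> We"
  obtains a ss where "a \<in> We" "len a = 0" "set ss \<subseteq> gens" "length ss = len x" "x = a o word_prod ss"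
proof -
  obtain a ss where a: "a \<in> aff" "len a = 0" "set ss \<subseteq> gens" "length ss = len x" "x = a o word_prod ss"
    using decompose[OF We_aff[OF assms]] by blast
  have "x o inv (word_prod ss) = a" using a(5) word_aff[OF a(3)] by (simp add: comp_assoc)
  moreover have "x o inv (word_prod ss) \<in> We" using We_comp We_inv word_We assms a(3) by blast
  ultimately show ?thesis using that a by simp
qed

lemma ext_length_eq: assumes "x \<in> We" shows "ext_length \<Phi> \<Delta> L x = len x" unfolding ext_length_def
proof (rule the_equality)
  obtain a ss where a: "a \<in> We" "len a = 0" "set ss \<subseteq> gens" "length ss = len x" "x = a o word_prod ss"
    using decompose_We assms by blast
  have w: "word_prod ss \<in> affine_weyl \<Phi>" unfolding affine_weyl_eq by (rule generatedI[OF a(3)])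
  have "len x = len (word_prod ss)" using a len_comp_left We_aff affine_weyl_aff[OF w] by metis
  then show "\<exists>a\<in>alcove_stab \<Phi> \<Delta> L. \<exists>w\<in>affine_weyl \<Phi>. x = a o w \<and> len x = cox_length gens w"
    unfolding alcove_stab_eq using a w cox_length_affine[OF w]
    by (intro bexI[of _ a] bexI[of _ "word_prod ss"]) auto
  fix n assume "\<exists>a\<in>alcove_stab \<Phi> \<Delta> L. \<exists>w\<in>affine_weyl \<Phi>. x = a o w \<and> n = cox_length gens w"
  then obtain b v where "b \<in> We" "len b = 0" "v \<in> affine_weyl \<Phi>" "x = b o v" "n = len v"
    using alcove_stab_eq cox_length_affine by auto
  then show "n = len x" using len_comp_left We_aff affine_weyl_aff by metis
qed

section \<open>Dominant alcoves\<close>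

definition Dom :: "('v => 'v) set" where "Dom = {x \<in> We. \<forall>a\<in>Pos. lev x a \<ge> 0}"

lemma Dom_We: "x \<in> Dom ==> x \<in> We" and Dom_aff: "x \<in> Dom ==> x \<in> aff" using We_aff by (auto simp: Dom_def)

lemma Dom_lev: "x \<in> Dom ==> a \<in> Pos ==> lev x a \<ge> 0" by (simp add: Dom_def)

lemma lev_id_pos: "a \<in> Pos ==> lev id a = 0" using basept_lev_id(1)[of a] pos_subset by auto

lemma sum_abs_weyl:
  fixes f :: "'v => nat"
  assumes "v \<in> weyl" "\<And>a. a \<in> \<Phi> ==> f (- a) = f a"
  shows "(\<Sum>a\<in>Pos. f (v a)) = sum f Pos"
proof -
  have "2 * (\<Sum>a\<in>Pos. f (v a)) = (\<Sum>a\<in>\<Phi>. f (v a))" unfolding sum_roots sum_distrib_left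
  proof (rule sum.cong)
    fix a assume "a \<in> Pos"
    then have "v a \<in> \<Phi>" using weyl_root assms(1) pos_subset by blast
    then show "2 * f (v a) = f (v a) + f (v (- a))"
      using assms(2)[of "v a"] weyl_uminus[OF assms(1), of a] by simp
  qed simp
  also have "\<dots> = sum f \<Phi>" by (rule sum_weyl[OF assms(1)])
  also have "\<dots> = 2 * sum f Pos"
    unfolding sum_roots sum_distrib_left using assms(2) pos_subset by (intro sum.cong) auto
  finally show ?thesis by simp
qed

text \<open>The level of \<open>v o z\<close> in direction \<open>v b\<close> is that of
  \<open>z\<close> in direction \<open>b\<close>. If \<open>v b\<close> is negative, passing to the
  positive root turns a level \<open>n\<close> into \<open>- n - 1\<close>.\<close>

lemma len_weyl_comp:
  assumes "v \<in> weyl" "z \<in> aff"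
  shows "len (v o z) = (\<Sum>b\<in>Pos. nat \<bar>if v b \<in> Pos then lev z b else lev z b + 1\<bar>)"
proof -
  have "len (v o z) = (\<Sum>b\<in>Pos. (\<lambda>a. nat \<bar>if a \<in> Pos then lev (v o z) a else lev (v o z) (- a)\<bar>) (v b))"
    unfolding len_def
    using sum_abs_weyl[OF assms(1), of "\<lambda>a. nat \<bar>if a \<in> Pos then lev (v o z) a else lev (v o z) (- a)\<bar>"]
      uminus_pos_iff by auto
  also have "\<dots> = (\<Sum>b\<in>Pos. nat \<bar>if v b \<in> Pos then lev z b else lev z b + 1\<bar>)"
  proof (rule sum.cong)
    fix b assume "b \<in> Pos"
    then have b: "b \<in> \<Phi>" using pos_subset by blast
    have vz: "v o z \<in> aff" using aff_comp weyl_aff assms by blast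
    have "lev (v o z) (v b) = lev z b" using lev_weyl assms b by blast
    then show "(\<lambda>a. nat \<bar>if a \<in> Pos then lev (v o z) a else lev (v o z) (- a)\<bar>) (v b) =
      nat \<bar>if v b \<in> Pos then lev z b else lev z b + 1\<bar>" using lev_uminus[OF vz weyl_root[OF assms(1) b]] by auto
  qed simp
  finally show ?thesis .
qed

lemma len_weyl_Dom: assumes "v \<in> weyl" "z \<in> Dom" shows "len (v o z) = len v + len z"
proof -
  have "len v = (\<Sum>b\<in>Pos. nat \<bar>if v b \<in> Pos then lev id b else lev id b + 1\<bar>)"
    using len_weyl_comp[OF assms(1) id_aff] by simp
  then have "len v + len z = (\<Sum>b\<in>Pos. nat \<bar>if v b \<in> Pos then lev id b else lev id b + 1\<bar> + nat \<bar>lev z b\<bar>)"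
    by (simp add: len_def sum.distrib)
  also have "\<dots> = len (v o z)" unfolding len_weyl_comp[OF assms(1) Dom_aff[OF assms(2)]]
  proof (rule sum.cong)
    fix b assume "b \<in> Pos"
    then show "nat \<bar>if v b \<in> Pos then lev id b else lev id b + 1\<bar> + nat \<bar>lev z b\<bar> =
      nat \<bar>if v b \<in> Pos then lev z b else lev z b + 1\<bar>"
      using Dom_lev[OF assms(2), of b] lev_id_pos[of b] by auto
  qed simp
  finally show ?thesis by simp
qed

text \<open>Termwise \<open>|n + 1| \<le> 1 + |n|\<close>, with equality only for
  \<open>n \<ge> 0\<close>. Since \<open>w0\<close> inverts every positive root, additivity of
  lengths forces all levels to be nonnegative.\<close>

lemma min_coset_reps_eq: "min_coset_reps \<Phi> \<Delta> L = Dom"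
proof -
  have "ext_length \<Phi> \<Delta> L (w0 o x) = ext_length \<Phi> \<Delta> L w0 + ext_length \<Phi> \<Delta> L x \<longleftrightarrow> (\<forall>a\<in>Pos. lev x a \<ge> 0)"
    if x: "x \<in> We" for x
  proof -
    have w: "w0 b \<notin> Pos" if "b \<in> Pos" for b using longest(2) that pos_subset by blast
    have 1: "len (w0 o x) = (\<Sum>b\<in>Pos. nat \<bar>lev x b + 1\<bar>)"
      using len_weyl_comp[OF longest(1) We_aff[OF x]] w by (simp cong: sum.cong)
    have 2: "len w0 = (\<Sum>b\<in>Pos. 1)"
      using len_weyl_comp[OF longest(1) id_aff] w lev_id_pos by (simp cong: sum.cong)
    have "len (w0 o x) = len w0 + len x \<longleftrightarrow> (\<Sum>b\<in>Pos. nat \<bar>lev x b + 1\<bar>) = (\<Sum>b\<in>Pos. 1 + nat \<bar>lev x b\<bar>)"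
      unfolding 1 2 unfolding len_def sum.distrib ..
    also have "\<dots> \<longleftrightarrow> (\<forall>a\<in>Pos. lev x a \<ge> 0)"
    proof
      assume eq: "(\<Sum>b\<in>Pos. nat \<bar>lev x b + 1\<bar>) = (\<Sum>b\<in>Pos. 1 + nat \<bar>lev x b\<bar>)"
      show "\<forall>a\<in>Pos. lev x a \<ge> 0"
      proof
        fix a assume "a \<in> Pos"
        then have "nat \<bar>lev x a + 1\<bar> = 1 + nat \<bar>lev x a\<bar>" using sum_mono_inv[OF eq _ _ finite_pos] by simp
        then show "lev x a \<ge> 0" by linarith
      qed
    qed (intro sum.cong, auto)
    finally show ?thesis using ext_length_eq x weyl_We[OF longest(1)] We_comp by simp
  qed
  then show ?thesis unfolding min_coset_reps_def Dom_def by blast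
qed

lemma len_transl_Dom:
  assumes "d \<in> Pp" "z \<in> Dom"
  shows "transl d o z \<in> Dom" "len (transl d o z) = len (transl d) + len z" "transl d \<in> Dom"
proof -
  have d: "d \<in> P" using assms by (simp add: dom_weights_def)
  have *: "lev (transl d o x) a = lev x a + lev (transl d) a \<and> lev (transl d) a \<ge> 0" if "a \<in> Pos" for a x
  proof -
    have a\<Phi>: "a \<in> \<Phi>" using that pos_subset by blast
    have "of_int (lev (transl d) a) = d \<cdot> a"
      using lev_transl[OF P_intwt[OF d] a\<Phi>, of id] basept_lev_id(1)[OF a\<Phi>] that by simp
    moreover have "d \<cdot> a \<ge> 0" using assms that by (simp add: dom_weights_def)
    ultimately show ?thesis using lev_transl[OF P_intwt[OF d] a\<Phi>, of x] by (simp flip: of_int_eq_iff)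
  qed
  show "transl d o z \<in> Dom" "transl d \<in> Dom"
    using * Dom_lev[OF assms(2)] We_comp[OF transl_We[OF d] Dom_We[OF assms(2)]] transl_We[OF d]
    by (auto simp: Dom_def)
  have "len (transl d) + len z = (\<Sum>a\<in>Pos. nat \<bar>lev (transl d) a\<bar> + nat \<bar>lev z a\<bar>)"
    by (simp add: len_def sum.distrib)
  also have "\<dots> = len (transl d o z)" unfolding len_def
  proof (rule sum.cong)
    fix a assume a: "a \<in> Pos"
    show "nat \<bar>lev (transl d) a\<bar> + nat \<bar>lev z a\<bar> = nat \<bar>lev (transl d o z) a\<bar>"
      using *[OF a, of z] Dom_lev[OF assms(2) a] by linarith
  qed simp
  finally show "len (transl d o z) = len (transl d) + len z" by simp
qed

lemma id_Dom [simp]: "id \<in> Dom" using basept_lev_id(1) pos_subset by (auto simp: Dom_def)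

lemma Dom_0: assumes "z \<in> Dom" shows "z 0 \<in> Pp"
proof -
  have "0 \<le> z 0 \<cdot> a" if "a \<in> Pos" for a
  proof -
    have a\<Phi>: "a \<in> \<Phi>" using that pos_subset by blast
    obtain b where b: "b \<in> \<Phi>" "a = lin z b" using root_lin_cases[OF Dom_aff[OF assms] a\<Phi>] by blast
    have "of_int (lev z a) = of_int (lev id b) + z 0 \<cdot> a" using lev_lin[OF Dom_aff[OF assms] b(1)] b(2) by simp
    moreover have "(of_int (lev id b) :: real) \<le> 0" using basept_lev_id(1)[OF b(1)] by simp
    moreover have "(of_int (lev z a) :: real) \<ge> 0" using Dom_lev[OF assms that] by simp
    ultimately show ?thesis by linarith
  qed
  then show ?thesis using We_P[OF Dom_We[OF assms]] by (simp add: dom_weights_def)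
qed

lemma weyl_Dom_unique:
  assumes "v \<in> weyl" "v' \<in> weyl" "z \<in> Dom" "z' \<in> Dom" "v o z = v' o z'"
  shows "v = v'" "z = z'"
proof -
  let ?u = "inv v' o v"
  have u: "?u \<in> weyl" using weyl_comp weyl_inverse assms by blast
  have v': "inv v' o v' = id" "v' o inv v' = id" using weyl_inverse(1)[OF assms(2)] by (auto simp: bij_def surj_iff)
  have v: "inv v o v = id" "v o inv v = id" using weyl_inverse(1)[OF assms(1)] by (auto simp: bij_def surj_iff)
  have z': "z' = ?u o z" using arg_cong[OF assms(5), of "\<lambda>x. inv v' o x"] v' by (simp add: comp_assoc[symmetric])
  have z: "z = (inv v o v') o z'" using arg_cong[OF assms(5), of "\<lambda>x. inv v o x"] v by (simp add: comp_assoc[symmetric])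
  have "len z' = len ?u + len z" using len_weyl_Dom[OF u assms(3)] z' by simp
  moreover have "len z = len (inv v o v') + len z'"
    using len_weyl_Dom[OF weyl_comp assms(4)] weyl_inverse(2)[OF assms(1)] assms(2) z by metis
  ultimately have "len ?u = 0" by linarith
  then have "?u = id" using affine_weyl_len_0 weyl_affine u by blast
  then show "z = z'" "v = v'" using z' v' by (simp, metis comp_assoc comp_id id_comp)
qed

text \<open>A step leaves the dominant chamber only through a wall of the chamber; right
  multiplication by \<open>s\<close> is then left multiplication by a simple reflection, which
  \<open>C0\<close> will absorb.\<close>

lemma Dom_step:
  assumes "y \<in> Dom" "s \<in> gens"
  shows "cr y s \<in> Pos ==> y o s \<in> Dom \<and> len (y o s) = len y + 1"
    "cr y s \<notin> Pos ==> y o s \<in> Dom ==> len y = len (y o s) + 1"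
    "y o s \<notin> Dom ==> - cr y s \<in> \<Delta> \<and> lev y (cr y s) = -1 \<and> y o s = reflect (- cr y s) o y"
proof -
  let ?b = "cr y s"
  note y = Dom_aff[OF assms(1)]
  have b: "?b \<in> \<Phi>" "- ?b \<in> \<Phi>" using cr(1)[OF y assms(2)] uminus_root by auto
  have ys: "y o s \<in> We" "y o s \<in> aff" using We_comp Dom_We gens_We We_aff assms by blast+
  have levb: "lev (y o s) ?b = lev y ?b + 1" "lev y (- ?b) = - lev y ?b - 1"
      "lev (y o s) (- ?b) = lev y (- ?b) - 1"
    using cr(2)[OF y assms(2)] lev_uminus[OF y b(1)] lev_uminus[OF ys(2) b(1)] by auto
  have other: "lev (y o s) a = lev y a" if "a \<in> Pos" "a \<noteq> ?b" "a \<noteq> - ?b" for a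
    using cr(3)[OF y assms(2)] that pos_subset by blast
  note id = basept_lev_id(1)[OF b(1)]
  show "y o s \<in> Dom \<and> len (y o s) = len y + 1" if p: "?b \<in> Pos"
  proof
    have "lev (y o s) a \<ge> 0" if "a \<in> Pos" for a
    proof -
      have "a \<noteq> - ?b" using that p uminus_pos_iff[OF b(1)] by auto
      then show ?thesis using other[OF that] Dom_lev[OF assms(1) that] levb(1) by (cases "a = ?b") auto
    qed
    then show "y o s \<in> Dom" using ys by (simp add: Dom_def)
    show "len (y o s) = len y + 1" using len_step(1)[OF y assms(2)] id p Dom_lev[OF assms(1) p] by simp
  qed
  show "len y = len (y o s) + 1" if n: "?b \<notin> Pos" "y o s \<in> Dom"
  proof -
    have "- ?b \<in> Pos" using n(1) uminus_pos_iff b by blast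
    then have "lev (y o s) (- ?b) \<ge> 0" using Dom_lev n(2) by blast
    then have "lev y ?b < lev id ?b" using levb id n(1) by simp
    then show ?thesis using len_step(2)[OF y assms(2)] by blast
  qed
  show "- ?b \<in> \<Delta> \<and> lev y ?b = -1 \<and> y o s = reflect (- ?b) o y" if n: "y o s \<notin> Dom"
  proof -
    have "\<exists>a\<in>Pos. lev (y o s) a < 0" using n ys(1) by (force simp: Dom_def)
    then obtain a where a: "a \<in> Pos" "lev (y o s) a < 0" by blast
    then have "a = - ?b" using other[OF a(1)] Dom_lev[OF assms(1) a(1)] levb(1) by (cases "a = ?b") auto
    then have p: "- ?b \<in> Pos" and neg: "lev (y o s) (- ?b) < 0" using a by auto
    have l: "lev y ?b = -1" using neg levb Dom_lev[OF assms(1) p] by linarith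
    \<comment> \<open>Were the root not simple, all simple levels would remain nonnegative, and with
      them the level in every positive direction.\<close>
    have "- ?b \<in> \<Delta>"
    proof (rule ccontr)
      assume nd: "- ?b \<notin> \<Delta>"
      have "coroot d \<bullet> (y o s) basept \<ge> 0" if "d \<in> \<Delta>" for d
      proof -
        have d: "d \<in> Pos" "d \<in> \<Phi>" using that simple_pos simple_subset by auto
        have "?b \<notin> Pos" using p uminus_pos_iff[OF b(1)] by blast
        then have "lev (y o s) d \<ge> 0" using other[OF d(1)] nd that Dom_lev[OF assms(1) d(1)] d(1) by metis
        then have "(of_int (lev (y o s) d) :: real) \<ge> 0" by simp
        then show ?thesis using lev_strict(1)[OF ys(2) d(2)] by (simp add: inner_commute)
      qed
      then have "coroot (- ?b) \<bullet> (y o s) basept \<ge> 0" unfolding inner_crd[of "coroot (- ?b)"]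
        using crd_pos_coroot[OF p] Nats_nonneg by (intro sum_nonneg mult_nonneg_nonneg) auto
      then have "lev (y o s) (- ?b) \<ge> 0" unfolding lev_def by (simp add: inner_commute)
      then show False using neg by linarith
    qed
    moreover have "y o s = reflect (- ?b) o y" using cr(4)[OF y assms(2)] l affine_refl_uminus[of ?b 0] by simp
    ultimately show ?thesis using l by blast
  qed
qed

text \<open>A multiple of the sum of all positive roots, which pairs to 2 with each simple coroot
  and lies in \<open>P\<close> because roots do.\<close>

lemma strictly_dominant: "\<exists>d\<in>Pp. \<forall>a\<in>Pos. d \<cdot> a \<ge> real n"
proof -
  define r where "r = half_sum (\<lambda>_. 2)"
  have r: "r \<cdot> d = 2" if "d \<in> \<Delta>" for d using half_sum_simple[of "\<lambda>_. 2"] that by (simp add: r_def)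
  have "r = \<Sum>Pos" by (simp add: r_def half_sum_def flip: scaleR_right.sum)
  then have rP: "r \<in> P" using P_sum[of Pos "\<lambda>x. x"] P_root pos_subset by auto
  have ge: "(real n *\<^sub>R r) \<cdot> a \<ge> real n" if a: "a \<in> Pos" for a
  proof -
    obtain c :: "'v => nat" where c: "coroot a = (\<Sum>d\<in>\<Delta>. real (c d) *\<^sub>R coroot d)" using coroot_nonneg_comb[OF a] by blast
    then have "r \<cdot> a = (\<Sum>d\<in>\<Delta>. real (c d) * 2)" using r by (simp add: inner_sum_right)
    also have "\<dots> = real (\<Sum>d\<in>\<Delta>. c d * 2)" by simp
    finally have rc: "r \<cdot> a = real (\<Sum>d\<in>\<Delta>. c d * 2)" .
    have "coroot a \<noteq> 0" using a pos_subset root_neq_0 by auto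
    then have "\<exists>d\<in>\<Delta>. c d \<noteq> 0" using c by (metis (no_types, lifting) of_nat_0 scaleR_zero_left sum.neutral)
    then have "(\<Sum>d\<in>\<Delta>. c d * 2) \<noteq> 0" using finite_simple by simp
    then have "1 \<le> r \<cdot> a" unfolding rc by (metis One_nat_def Suc_leI not_gr_zero of_nat_1 of_nat_mono)
    then have "real n * 1 \<le> real n * (r \<cdot> a)" by (intro mult_left_mono) auto
    then show ?thesis by simp
  qed
  moreover have "real n *\<^sub>R r \<in> P" using P_of_nat[OF rP] by simp
  ultimately have "real n *\<^sub>R r \<in> Pp" unfolding dom_weights_def using order_trans[OF of_nat_0_le_iff] by blast
  then show ?thesis using ge by blast
qed

lemma exists_transl_Dom: assumes "x \<in> We" shows "\<exists>d\<in>Pp. transl d o x \<in> Dom"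
proof -
  let ?n = "\<Sum>a\<in>Pos. nat \<bar>lev x a\<bar>"
  obtain d where d: "d \<in> Pp" "\<And>a. a \<in> Pos ==> d \<cdot> a \<ge> real ?n" using strictly_dominant by blast
  have dP: "d \<in> P" using d(1) by (simp add: dom_weights_def)
  have "lev (transl d o x) a \<ge> 0" if "a \<in> Pos" for a
  proof -
    have "nat \<bar>lev x a\<bar> \<le> ?n" using member_le_sum[OF that _ finite_pos, of "\<lambda>a. nat \<bar>lev x a\<bar>"] by simp
    then have "real_of_int (lev x a) \<ge> - real ?n" by linarith
    then have "real_of_int (lev (transl d o x) a) \<ge> 0"
      using lev_transl[OF P_intwt[OF dP], of a x] d(2)[OF that] that pos_subset by auto
    then show ?thesis by simp
  qed
  then show ?thesis using d(1) We_comp[OF transl_We[OF dP] assms] by (auto simp: Dom_def)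
qed

lemma Pp_P: "n \<in> Pp ==> n \<in> P" by (simp add: dom_weights_def)

lemma Pp_add: "\<mu> \<in> Pp ==> n \<in> Pp ==> \<mu> + n \<in> Pp" by (simp add: dom_weights_def P_add inner_left_distrib)

lemma Pp_0: "0 \<in> Pp" by (simp add: dom_weights_def P_0)

lemma Pp_iff_Dom: "n \<in> P ==> n \<in> Pp \<longleftrightarrow> transl n \<in> Dom"
  using Dom_0[of "transl n"] len_transl_Dom(3)[OF _ id_Dom, of n] by (auto simp: transl_def)

lemma P_diff_dominant: assumes "n \<in> P" obtains \<mu> \<mu>' where "\<mu> \<in> Pp" "\<mu>' \<in> Pp" "n = \<mu> - \<mu>'"
proof -
  obtain d where d: "d \<in> Pp" "transl d o transl n \<in> Dom" using exists_transl_Dom transl_We assms by blast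
  then have "d + n \<in> Pp" using Pp_iff_Dom[OF P_add[OF Pp_P[OF d(1)] assms]] by (simp add: transl_comp)
  then show ?thesis using that[of "d + n" d] d(1) by simp
qed

lemma direction_eq: "a \<in> Pos ==> direction \<Phi> \<Delta> (hyperplane a k) = a"
proof -
  assume a: "a \<in> Pos"
  then have a\<Phi>: "a \<in> \<Phi>" using pos_subset by blast
  show ?thesis unfolding direction_def
  proof (rule the_equality)
    fix b assume b: "b \<in> Pos \<and> (\<exists>n. hyperplane a k = hyperplane b n)"
    then have "b \<in> \<Phi>" using pos_subset by blast
    then have "b = a \<or> b = - a" using b hyperplane_subsetD[OF _ a\<Phi>] by (metis order_refl)
    then show "b = a" using b uminus_pos_iff[OF a\<Phi>] a by auto
  qed (use a in blast)
qed

lemma root_weight_eq: assumes "a \<in> Pos" shows "root_weight \<Phi> \<Delta> L a = wt a 0"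
proof -
  have a\<Phi>: "a \<in> \<Phi>" using assms pos_subset by blast
  have "{hyperplane_weight \<Phi> \<Delta> L H | H. H \<in> hyperplanes \<Phi> \<and> direction \<Phi> \<Delta> H = a} = range (wt a)"
  proof (intro equalityI subsetI)
    fix k assume "k \<in> {hyperplane_weight \<Phi> \<Delta> L H | H. H \<in> hyperplanes \<Phi> \<and> direction \<Phi> \<Delta> H = a}"
    then obtain b n where b: "k = hyperplane_weight \<Phi> \<Delta> L (hyperplane b n)" "b \<in> \<Phi>" "direction \<Phi> \<Delta> (hyperplane b n) = a"
      by (auto simp: hyperplanes_def)
    show "k \<in> range (wt a)"
    proof (cases "b \<in> Pos")
      case True
      then have "k = wt a n" using b direction_eq by (simp add: wt_def)
      then show ?thesis by blast
    next
      case False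
      then have p: "- b \<in> Pos" using uminus_pos_iff b by blast
      have "direction \<Phi> \<Delta> (hyperplane (- b) (- n)) = - b" using direction_eq[OF p] .
      then have "- b = a" using b(3) hyperplane_uminus by metis
      then have "k = wt a (- n)" unfolding wt_def b(1) using hyperplane_uminus by metis
      then show ?thesis by blast
    qed
  next
    fix k assume "k \<in> range (wt a)"
    then obtain n where "k = hyperplane_weight \<Phi> \<Delta> L (hyperplane a n)" by (auto simp: wt_def)
    then show "k \<in> {hyperplane_weight \<Phi> \<Delta> L H | H. H \<in> hyperplanes \<Phi> \<and> direction \<Phi> \<Delta> H = a}"
      using direction_eq[OF assms] a\<Phi> unfolding hyperplanes_def by blast
  qed
  moreover have "Max (range (wt a)) = wt a 0"
  proof (rule Max_eqI)
    have "range (wt a) \<subseteq> {..wt a 0}" using wt_le_0[OF a\<Phi>] by auto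
    then show "finite (range (wt a))" using finite_subset by blast
  qed (use wt_le_0[OF a\<Phi>] in auto)
  ultimately show ?thesis unfolding root_weight_def by simp
qed

end

section \<open>Laurent polynomials of bounded degree\<close>

abbreviation coef :: "('a \<Rightarrow>\<^sub>0 'b::zero) => 'a => 'b" where "coef \<equiv> Poly_Mapping.lookup"

abbreviation scale (infixr "\<odot>" 75) where "c \<odot> h \<equiv> hscale c h"

lemma coef_hscale [simp]: "coef (c \<odot> h) w = c * coef h w"
  unfolding hscale_def by (simp add: Poly_Mapping.map.rep_eq when_def)

lemma hscale_simps:
  "c \<odot> (x + y) = c \<odot> x + c \<odot> y" "(c + d) \<odot> x = c \<odot> x + d \<odot> x" "c \<odot> d \<odot> x = (c * d) \<odot> x"
  "1 \<odot> x = x" "0 \<odot> x = 0" "c \<odot> 0 = 0" "c \<odot> (- x) = - (c \<odot> x)" "(- c) \<odot> x = - (c \<odot> x)"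
  "c \<odot> (x - y) = c \<odot> x - c \<odot> y" "(c - d) \<odot> x = c \<odot> x - d \<odot> x"
  by (rule poly_mapping_eqI; simp add: lookup_add lookup_minus algebra_simps)+

lemma hscale_sum: "c \<odot> sum f A = (\<Sum>x\<in>A. c \<odot> f x)"
  by (rule poly_mapping_eqI) (simp add: lookup_sum sum_distrib_left)

lemma keys_hscale: "Poly_Mapping.keys (c \<odot> h) \<subseteq> Poly_Mapping.keys h" by (auto simp: in_keys_iff)

lemma coef_hT: "coef (hT w) v = (if v = w then 1 else 0)" by (simp add: hT_def lookup_single when_def)

lemma keys_hT [simp]: "Poly_Mapping.keys (hT w) = {w}" by (simp add: hT_def)

lemma hecke_expand: "h = (\<Sum>w\<in>Poly_Mapping.keys h. coef h w \<odot> hT w)" by (rule poly_mapping_eqI)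
    (simp add: lookup_sum coef_hT if_distrib in_keys_iff cong: if_cong)

text \<open>Degree at most \<open>d\<close>. Integrality is carried along because
  \<open>hecke_neg\<close> asks for integers among the complex coefficients.\<close>

definition Ld :: "int => laurent set" where
  "Ld d = {p. (\<forall>n. coef p n \<in> \<int>) \<and> (\<forall>n>d. coef p n = 0)}"

lemma Ld_0 [simp]: "0 \<in> Ld d" by (simp add: Ld_def)

lemma Ld_add: "p \<in> Ld d ==> q \<in> Ld d ==> p + q \<in> Ld d"
  and Ld_uminus: "p \<in> Ld d ==> - p \<in> Ld d"
  and Ld_diff: "p \<in> Ld d ==> q \<in> Ld d ==> p - q \<in> Ld d" by (auto simp: Ld_def lookup_add lookup_minus)

lemma Ld_sum: "(\<And>i. i \<in> I ==> f i \<in> Ld d) ==> sum f I \<in> Ld d"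
  by (induction I rule: infinite_finite_induct) (auto intro: Ld_add)

lemma Ld_mono: "p \<in> Ld a ==> a \<le> b ==> p \<in> Ld b" by (auto simp: Ld_def)

lemma Ld_single: "c \<in> \<int> ==> n \<le> d ==> Poly_Mapping.single n c \<in> Ld d"
  by (auto simp: Ld_def lookup_single when_def)

lemma q_pow_Ld: "q_pow n \<in> Ld n" by (simp add: q_pow_def Ld_single)

lemma one_Ld [simp]: "1 \<in> Ld 0" using Ld_single[of 1 0 0] by simp

lemma expand_single: "p = (\<Sum>n\<in>Poly_Mapping.keys p. Poly_Mapping.single n (coef p n))"
  by (rule poly_mapping_eqI) (simp add: lookup_sum lookup_single when_def in_keys_iff)

lemma Ld_mult: assumes "p \<in> Ld a" "q \<in> Ld b" shows "p * q \<in> Ld (a + b)"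
proof -
  have "p * q = (\<Sum>i\<in>Poly_Mapping.keys p. \<Sum>j\<in>Poly_Mapping.keys q.
      Poly_Mapping.single (i + j) (coef p i * coef q j))"
    by (subst expand_single[of p], subst expand_single[of q]) (simp add: sum_product mult_single)
  also have "\<dots> \<in> Ld (a + b)"
  proof (intro Ld_sum Ld_single)
    fix i j assume "i \<in> Poly_Mapping.keys p" "j \<in> Poly_Mapping.keys q"
    then have "i \<le> a" "j \<le> b" using assms by (force simp: Ld_def in_keys_iff)+
    then show "i + j \<le> a + b" by simp
  qed (use assms in \<open>auto simp: Ld_def\<close>)
  finally show ?thesis .
qed

lemma q_pow_add: "q_pow a * q_pow b = q_pow (a + b)" by (simp add: q_pow_def mult_single)

lemma q_pow_0 [simp]: "q_pow 0 = 1" by (simp add: q_pow_def)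

lemma coef_laurent_bar: "coef (laurent_bar p) n = coef p (- n)" by (simp add: laurent_bar_def map_key.rep_eq)

lemma laurent_bar_simps [simp]:
  "laurent_bar 0 = 0" "laurent_bar 1 = 1" "laurent_bar (p + q) = laurent_bar p + laurent_bar q"
  "laurent_bar (- p) = - laurent_bar p" "laurent_bar (p - q) = laurent_bar p - laurent_bar q"
  "laurent_bar (q_pow n) = q_pow (- n)" "laurent_bar (laurent_bar p) = p"
  by (rule poly_mapping_eqI; auto simp: coef_laurent_bar lookup_add lookup_minus lookup_one
      q_pow_def lookup_single when_def)+

lemma laurent_bar_single: "laurent_bar (Poly_Mapping.single n c) = Poly_Mapping.single (- n) c"
  by (rule poly_mapping_eqI) (auto simp: coef_laurent_bar lookup_single when_def)

lemma laurent_bar_sum: "laurent_bar (sum f A) = (\<Sum>i\<in>A. laurent_bar (f i))"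
  by (induction A rule: infinite_finite_induct) auto

lemma laurent_bar_mult [simp]: "laurent_bar (p * q) = laurent_bar p * laurent_bar q"
proof -
  have pq: "p * q = (\<Sum>i\<in>Poly_Mapping.keys p. \<Sum>j\<in>Poly_Mapping.keys q.
      Poly_Mapping.single (i + j) (coef p i * coef q j))"
    by (subst expand_single[of p], subst expand_single[of q]) (simp add: sum_product mult_single)
  have "laurent_bar p = (\<Sum>i\<in>Poly_Mapping.keys p. Poly_Mapping.single (- i) (coef p i))"
    by (subst expand_single[of p]) (simp add: laurent_bar_sum laurent_bar_single)
  moreover have "laurent_bar q = (\<Sum>i\<in>Poly_Mapping.keys q. Poly_Mapping.single (- i) (coef q i))"
    by (subst expand_single[of q]) (simp add: laurent_bar_sum laurent_bar_single)
  ultimately show ?thesis unfolding pq laurent_bar_sum laurent_bar_single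
    by (simp add: sum_product mult_single add.commute)
qed

lemma bar_invariant_neg: assumes "laurent_bar p = p" "p \<in> Ld (-1)" shows "p = 0"
proof (rule poly_mapping_eqI)
  fix n
  have neg: "coef p k = 0" if "k \<ge> 0" for k using assms(2) that by (auto simp: Ld_def)
  show "coef p n = coef 0 n"
    using neg[of n] neg[of "- n"] coef_laurent_bar[of p n] assms(1) by (cases "n \<ge> 0") auto
qed

lemma Ld_neg_iff: "p \<in> Ld (-1) \<longleftrightarrow> p \<in> Ld 0 \<and> coef p 0 = 0"
proof -
  have "n > -1 \<longleftrightarrow> n > 0 \<or> n = 0" for n :: int by auto
  then show ?thesis by (auto simp: Ld_def)
qed

lemma Ld_const: "c \<in> \<int> ==> Poly_Mapping.single 0 c \<in> Ld 0" by (rule Ld_single) auto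

lemma Ld_diff_const: "p \<in> Ld 0 ==> p - Poly_Mapping.single 0 (coef p 0) \<in> Ld (-1)"
  unfolding Ld_neg_iff by (auto simp: lookup_minus intro!: Ld_diff Ld_const) (simp add: Ld_def)

text \<open>The scalar by which \<open>T s\<close> differs from its inverse; the bar involution
  changes its sign.\<close>

definition kap :: "nat => laurent" where "kap n = q_pow (int n) - q_pow (- int n)"

lemma laurent_bar_kap [simp]: "laurent_bar (kap n) = - kap n" by (simp add: kap_def)

lemma kap_Ld: "kap n \<in> Ld (int n)" unfolding kap_def by (intro Ld_diff q_pow_Ld Ld_mono[OF q_pow_Ld]) auto

section \<open>The Hecke algebra\<close>

locale affine_hecke = weighted_root_system \<Phi> \<Delta> L
  for \<Phi> \<Delta> :: "'v::euclidean_space set" and L +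
  fixes m :: "'v hecke => 'v hecke => 'v hecke"
  assumes mult: "hecke_mult \<Phi> \<Delta> L m"
begin

abbreviation "HH \<equiv> hecke_carrier \<Phi> \<Delta> L"
abbreviation T :: "('v => 'v) => 'v hecke" where "T \<equiv> hT"
abbreviation "keys \<equiv> Poly_Mapping.keys"

lemma H_iff: "h \<in> HH \<longleftrightarrow> keys h \<subseteq> We" by (simp add: hecke_carrier_def)

lemma H_simps:
  "0 \<in> HH" "x \<in> HH ==> y \<in> HH ==> x + y \<in> HH" "x \<in> HH ==> y \<in> HH ==> x - y \<in> HH" "x \<in> HH ==> - x \<in> HH"
  "x \<in> HH ==> c \<odot> x \<in> HH" "w \<in> We ==> T w \<in> HH"
  using keys_add[of x y] keys_diff[of x y] keys_hscale[of c x] by (auto simp: H_iff in_keys_iff)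

lemma H_sum: "(\<And>i. i \<in> I ==> f i \<in> HH) ==> sum f I \<in> HH"
  by (induction I rule: infinite_finite_induct) (auto intro: H_simps)

lemma m_rules:
  "x \<in> HH ==> y \<in> HH ==> m x y \<in> HH"
  "x \<in> HH ==> y \<in> HH ==> z \<in> HH ==> m (x + y) z = m x z + m y z"
  "x \<in> HH ==> y \<in> HH ==> z \<in> HH ==> m z (x + y) = m z x + m z y"
  "x \<in> HH ==> y \<in> HH ==> m (c \<odot> x) y = c \<odot> m x y"
  "x \<in> HH ==> y \<in> HH ==> m x (c \<odot> y) = c \<odot> m x y"
  "x \<in> HH ==> y \<in> HH ==> z \<in> HH ==> m (m x y) z = m x (m y z)"
  "u \<in> We ==> v \<in> We ==> len (u o v) = len u + len v ==> m (T u) (T v) = T (u o v)"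
  "s \<in> gens ==> m (T s - q_pow (int (L s)) \<odot> T id) (T s + q_pow (- int (L s)) \<odot> T id) = 0"
  using mult We_comp ext_length_eq unfolding hecke_mult_def Let_def by simp_all

definition hproj :: "'v hecke => 'v hecke" where
  "hproj h = (\<Sum>w\<in>keys h \<inter> We. coef h w \<odot> T w)"

lemma coef_hproj: "coef (hproj h) w = (if w \<in> We then coef h w else 0)"
  by (auto simp: hproj_def lookup_sum coef_hT if_distrib in_keys_iff cong: if_cong)

lemma hproj_H [simp]: "hproj h \<in> HH" unfolding hproj_def by (intro H_sum H_simps) auto

lemma hproj_id: "h \<in> HH ==> hproj h = h"
  by (rule poly_mapping_eqI) (auto simp: coef_hproj H_iff in_keys_iff subset_iff)

lemma hproj_linear: "hproj (x + y) = hproj x + hproj y" "hproj (c \<odot> x) = c \<odot> hproj x"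
  by (rule poly_mapping_eqI; simp add: coef_hproj lookup_add)+

text \<open>\<open>m\<close> is only constrained on the carrier; the projection makes the algebra laws unconditional.\<close>

definition mm :: "'v hecke => 'v hecke => 'v hecke" (infixl "\<star>" 70) where
  "x \<star> y = m (hproj x) (hproj y)"

lemma mm_m: "x \<in> HH ==> y \<in> HH ==> m x y = x \<star> y" by (simp add: mm_def hproj_id)

lemma mm_H [simp]: "x \<star> y \<in> HH" by (simp add: mm_def m_rules)

lemma mm_add: "(x + y) \<star> z = x \<star> z + y \<star> z" "z \<star> (x + y) = z \<star> x + z \<star> y"
  by (simp_all add: mm_def hproj_linear m_rules)

lemma mm_scale: "(c \<odot> x) \<star> y = c \<odot> (x \<star> y)" "x \<star> (c \<odot> y) = c \<odot> (x \<star> y)"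
  by (simp_all add: mm_def hproj_linear m_rules)

lemma mm_assoc: "x \<star> y \<star> z = x \<star> (y \<star> z)" by (simp add: mm_def hproj_id m_rules)

lemma mm_uminus: "(- x) \<star> y = - (x \<star> y)" "x \<star> (- y) = - (x \<star> y)"
  using mm_scale(1)[of "-1" x y] mm_scale(2)[of x "-1" y] by (simp_all add: hscale_simps)

lemma mm_diff: "(x - y) \<star> z = x \<star> z - y \<star> z" "z \<star> (x - y) = z \<star> x - z \<star> y"
  using mm_add(1)[of x "- y" z] mm_add(2)[of z x "- y"] by (simp_all add: mm_uminus)

lemma mm_0 [simp]: "0 \<star> x = 0" "x \<star> 0 = 0"
  using mm_scale(1)[of 0 0 x] mm_scale(2)[of x 0 0] by (simp_all add: hscale_simps)

lemma mm_sum: "sum f A \<star> y = (\<Sum>i\<in>A. f i \<star> y)" "y \<star> sum f A = (\<Sum>i\<in>A. y \<star> f i)"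
  by (induction A rule: infinite_finite_induct; simp add: mm_add)+

lemma T_mult: "u \<in> We ==> v \<in> We ==> len (u o v) = len u + len v ==> T u \<star> T v = T (u o v)"
  by (simp add: mm_m[symmetric] H_simps m_rules)

abbreviation one :: "'v hecke" where "one \<equiv> T id"

lemma mm_one [simp]: assumes "h \<in> HH" shows "one \<star> h = h" "h \<star> one = h"
proof -
  have "one \<star> h = (\<Sum>w\<in>keys h. coef h w \<odot> (one \<star> T w))" by (subst hecke_expand[of h]) (simp add: mm_sum mm_scale)
  also have "\<dots> = (\<Sum>w\<in>keys h. coef h w \<odot> T w)"
    using assms T_mult[of id] by (intro sum.cong) (auto simp: H_iff subset_iff)
  finally show "one \<star> h = h" using hecke_expand[of h] by simp
  have "h \<star> one = (\<Sum>w\<in>keys h. coef h w \<odot> (T w \<star> one))" by (subst hecke_expand[of h]) (simp add: mm_sum mm_scale)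
  also have "\<dots> = (\<Sum>w\<in>keys h. coef h w \<odot> T w)"
    using assms T_mult[of _ id] by (intro sum.cong) (auto simp: H_iff subset_iff)
  finally show "h \<star> one = h" using hecke_expand[of h] by simp
qed

lemma one_H [simp]: "one \<in> HH" by (simp add: H_simps)

lemma T_H: "w \<in> We ==> T w \<in> HH" by (simp add: H_simps)

lemma T_quadratic: assumes "s \<in> gens" shows "T s \<star> T s = one + kap (L s) \<odot> T s"
proof -
  let ?q = "q_pow (int (L s))" and ?r = "q_pow (- int (L s))"
  have s: "T s \<in> HH" using gens_We[OF assms] T_H by blast
  have "(T s - ?q \<odot> one) \<star> (T s + ?r \<odot> one) = 0" using m_rules(8)[OF assms] mm_m s by (simp add: H_simps)
  then have "T s \<star> T s + ?r \<odot> T s - ?q \<odot> T s - ?q \<odot> ?r \<odot> one = 0"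
    using s by (simp add: mm_diff mm_add mm_scale hscale_simps algebra_simps)
  moreover have "?q \<odot> ?r \<odot> one = one" by (simp add: hscale_simps q_pow_add)
  ultimately show ?thesis by (simp add: kap_def hscale_simps algebra_simps)
qed

lemma T_gen:
  assumes "x \<in> We" "s \<in> gens"
  shows "len (x o s) = len x + 1 ==> T x \<star> T s = T (x o s)"
    "len x = len (x o s) + 1 ==> T x \<star> T s = T (x o s) + kap (L s) \<odot> T x"
proof -
  have s: "s \<in> We" "T s \<in> HH" using gens_We[OF assms(2)] T_H by auto
  show "len (x o s) = len x + 1 ==> T x \<star> T s = T (x o s)"
    using T_mult[OF assms(1) s(1)] len_gen[OF assms(2)] by simp
  assume l: "len x = len (x o s) + 1"
  have xs: "x o s \<in> We" using We_comp assms(1) s(1) by blast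
  have "x o s o s = x" using gens_involution[OF assms(2)] by (simp add: comp_assoc)
  then have x: "T x = T (x o s) \<star> T s" using T_mult[OF xs s(1)] l len_gen[OF assms(2)] by simp
  have "T x \<star> T s = T (x o s) \<star> (one + kap (L s) \<odot> T s)" by (simp add: x mm_assoc T_quadratic[OF assms(2)])
  also have "\<dots> = T (x o s) + kap (L s) \<odot> T x" using T_H[OF xs] by (simp add: mm_add mm_scale x)
  finally show "T x \<star> T s = T (x o s) + kap (L s) \<odot> T x" .
qed

lemma T_stab:
  assumes "x \<in> We" "a \<in> We" "len a = 0"
  shows "T x \<star> T a = T (x o a)" "T a \<star> T x = T (a o x)"
  using T_mult[OF assms(1,2)] T_mult[OF assms(2,1)] assms We_aff by (simp_all add: len_comp_right len_comp_left)

lemma We_induct [consumes 1, case_names stab gen]: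
  assumes "x \<in> We"
    and stab: "\<And>a. a \<in> We ==> len a = 0 ==> Q a"
    and gen: "\<And>x s. x \<in> We ==> s \<in> gens ==> len (x o s) = len x + 1 ==> Q x ==> Q (x o s)"
  shows "Q x"
proof -
  have "\<And>x. x \<in> We ==> len x = n ==> Q x" for n
  proof (induction n)
    case (Suc n)
    then obtain s where s: "s \<in> gens" "len x = len (x o s) + 1"
      using exists_descent We_aff by (metis zero_less_Suc)
    have xs: "x o s \<in> We" using We_comp Suc gens_We s by blast
    have eq: "x o s o s = x" using gens_involution[OF s(1)] by (simp add: comp_assoc)
    have "len (x o s) = n" using s Suc by simp
    then have "Q (x o s)" using Suc(1)[OF xs] by blast
    then have "Q (x o s o s)" using gen[OF xs s(1)] s(2) unfolding eq by simp
    then show ?case unfolding eq .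
  qed (use stab in blast)
  then show ?thesis using assms(1) by blast
qed

definition is_inverse :: "'v hecke => 'v hecke => bool" where
  "is_inverse y x \<longleftrightarrow> y \<in> HH \<and> x \<star> y = one \<and> y \<star> x = one"

lemma hinv_eqI: assumes "x \<in> HH" "is_inverse y x" shows "hinv \<Phi> \<Delta> L m x = y" unfolding hinv_def
proof (rule the_equality)
  show "y \<in> HH \<and> m x y = one \<and> m y x = one" using assms by (simp add: is_inverse_def mm_m)
  fix z assume z: "z \<in> HH \<and> m x z = one \<and> m z x = one"
  then have "z \<star> x = one" using mm_m[of z x] assms(1) by metis
  have "z = z \<star> (x \<star> y)" using assms(2) z by (simp add: is_inverse_def)
  also have "\<dots> = z \<star> x \<star> y" by (simp only: mm_assoc)
  also have "\<dots> = y" using \<open>z \<star> x = one\<close> assms by (simp add: is_inverse_def)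
  finally show "z = y" .
qed

abbreviation Ti :: "('v => 'v) => 'v hecke" where "Ti x \<equiv> hinv \<Phi> \<Delta> L m (T x)"

lemma is_inverse_mult: "is_inverse y x ==> is_inverse y' x' ==> x \<in> HH ==> x' \<in> HH ==> is_inverse (y' \<star> y) (x \<star> x')"
  unfolding is_inverse_def by (metis mm_assoc mm_H mm_one)

lemma is_inverse_gen: assumes "s \<in> gens" shows "is_inverse (T s - kap (L s) \<odot> one) (T s)"
  using T_quadratic[OF assms] T_H[OF gens_We[OF assms]] by (simp add: is_inverse_def H_simps mm_diff mm_scale)

lemma is_inverse_stab: assumes "a \<in> We" "len a = 0" shows "is_inverse (T (inv a)) (T a)"
  using T_stab[OF We_inv[OF assms(1)] assms] We_inv[OF assms(1)] We_aff[OF assms(1)]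
  by (simp add: is_inverse_def T_H)

lemma is_inverse_Ti: assumes "x \<in> We" shows "is_inverse (Ti x) (T x)"
proof -
  have "\<exists>y. is_inverse y (T x)" using assms
  proof (induction rule: We_induct)
    case (stab a)
    show ?case using is_inverse_stab[OF stab] by blast
  next
    case (gen x s)
    then have "T (x o s) = T x \<star> T s" using T_gen(1) by simp
    moreover have "\<exists>y. is_inverse y (T x \<star> T s)"
      using gen(4) is_inverse_mult is_inverse_gen[OF gen(2)] T_H gen(1) gens_We[OF gen(2)] by blast
    ultimately show ?case by metis
  qed
  then show ?thesis using hinv_eqI[OF T_H[OF assms]] by metis
qed

lemma Ti [simp]: assumes "x \<in> We" shows "Ti x \<in> HH" "T x \<star> Ti x = one" "Ti x \<star> T x = one"
  using is_inverse_Ti[OF assms] by (auto simp: is_inverse_def)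

lemma Ti_gen: "s \<in> gens ==> Ti s = T s - kap (L s) \<odot> one"
  using hinv_eqI[OF T_H[OF gens_We] is_inverse_gen] by blast

lemma Ti_stab: "a \<in> We ==> len a = 0 ==> Ti a = T (inv a)" using hinv_eqI[OF T_H is_inverse_stab] by blast

lemma Ti_mult:
  assumes "u \<in> We" "v \<in> We" "len (u o v) = len u + len v" shows "Ti (u o v) = Ti v \<star> Ti u"
  using hinv_eqI[OF T_H[OF We_comp[OF assms(1,2)]]] T_mult[OF assms]
    is_inverse_mult[OF is_inverse_Ti is_inverse_Ti T_H T_H, OF assms(1,2,1,2)] by simp

section \<open>The bar involution\<close>

abbreviation "bar \<equiv> hecke_bar \<Phi> \<Delta> L m"

lemma bar_extend:
  assumes "finite A" "keys h \<subseteq> A" shows "bar h = (\<Sum>w\<in>A. laurent_bar (coef h w) \<odot> Ti (inv w))"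
  unfolding hecke_bar_def by (rule sum.mono_neutral_left) (use assms in \<open>auto simp: in_keys_iff hscale_simps\<close>)

lemma bar_add: "bar (x + y) = bar x + bar y"
proof -
  let ?A = "keys x \<union> keys y"
  have "keys (x + y) \<subseteq> ?A" by (rule keys_add)
  then show ?thesis by (simp add: bar_extend[of ?A] lookup_add hscale_simps sum.distrib)
qed

lemma bar_scale: "bar (c \<odot> x) = laurent_bar c \<odot> bar x" using bar_extend[of "keys x" "c \<odot> x"] keys_hscale[of c x]
  by (simp add: bar_extend[of "keys x" x] hscale_sum hscale_simps)

lemma bar_T: "bar (T w) = Ti (inv w)" by (simp add: hecke_bar_def coef_hT hscale_simps)

lemma bar_expand: "bar h = (\<Sum>w\<in>keys h. laurent_bar (coef h w) \<odot> bar (T w))"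
  unfolding bar_T by (rule hecke_bar_def)

lemma bar_0 [simp]: "bar 0 = 0" by (simp add: hecke_bar_def)

lemma bar_sum: "bar (sum f A) = (\<Sum>i\<in>A. bar (f i))"
  by (induction A rule: infinite_finite_induct) (simp_all add: bar_add)

lemma bar_uminus: "bar (- x) = - bar x" using bar_scale[of "-1" x] by (simp add: hscale_simps)

lemma bar_diff: "bar (x - y) = bar x - bar y" using bar_add[of x "- y"] by (simp add: bar_uminus)

lemma bar_H: "h \<in> HH ==> bar h \<in> HH"
  unfolding hecke_bar_def by (intro H_sum H_simps(5) Ti(1) We_inv) (auto simp: H_iff)

lemma bar_one [simp]: "bar one = one" using bar_T[of id] Ti_stab[of id] by (simp add: inv_id)

lemma bar_gen: "s \<in> gens ==> bar (T s) = Ti s"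
proof -
  assume "s \<in> gens"
  then have "inv s = s" using gens_involution[of s] inv_unique_comp by blast
  then show "bar (T s) = Ti s" by (simp add: bar_T)
qed

lemma bar_stab: "a \<in> We ==> len a = 0 ==> bar (T a) = T a"
  using Ti_stab[OF We_inv] len_inverse[OF We_aff] aff_inverse(1)[OF We_aff] by (simp add: bar_T inv_inv_eq)

lemma bar_step:
  assumes "x \<in> We" "s \<in> gens" "len (x o s) = len x + 1"
  shows "bar (T (x o s)) = bar (T x) \<star> Ti s"
proof -
  have s: "inv s = s" using gens_involution[OF assms(2)] inv_unique_comp by blast
  have sa: "s \<in> aff" using gens_aff assms by blast
  have xs: "x o s \<in> aff" using aff_comp We_aff assms sa by blast
  have i: "inv (x o s) = s o inv x"
    using o_inv_distrib[OF aff_inverse(1)[OF We_aff[OF assms(1)]] aff_inverse(1)[OF sa]] s by simp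
  then have "len (s o inv x) = len s + len (inv x)"
    using len_inverse[OF xs] len_inverse[OF We_aff[OF assms(1)]] assms(3) len_gen[OF assms(2)] by simp
  then show ?thesis using Ti_mult[OF gens_We We_inv] assms i by (simp add: bar_T)
qed

text \<open>\<open>hecke_bar\<close> is given additively on the basis, so multiplicativity has to be
  built up: right multiplication of a basis element by a generator, as here, then of any element by
  a basis element, then in general.\<close>

lemma bar_mult_gen_T:
  assumes "x \<in> We" "s \<in> gens" shows "bar (T x \<star> T s) = bar (T x) \<star> Ti s"
proof (cases "len (x o s) = len x + 1")
  case True
  then show ?thesis using T_gen(1)[OF assms True] bar_step[OF assms True] by simp
next
  case False
  then have l: "len x = len (x o s) + 1" using len_step[OF We_aff[OF assms(1)] assms(2)] by linarith
  have s: "s \<in> We" and xs: "x o s \<in> We" using gens_We We_comp assms by auto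
  have eq: "x o s o s = x" using gens_involution[OF assms(2)] by (simp add: comp_assoc)
  have bx: "bar (T x) = bar (T (x o s)) \<star> Ti s" using bar_step[OF xs assms(2)] l eq by simp
  have "Ti s \<star> Ti s = one - kap (L s) \<odot> Ti s" using Ti(2)[OF s] Ti(1)[OF s] Ti_gen[OF assms(2)] T_H[OF s]
    by (metis (no_types, lifting) mm_diff(1) mm_one(1) mm_scale(1))
  then have "bar (T x) \<star> Ti s = bar (T (x o s)) \<star> (one - kap (L s) \<odot> Ti s)" by (simp add: bx mm_assoc)
  also have "\<dots> = bar (T (x o s)) - kap (L s) \<odot> bar (T x)"
    using bar_H[OF T_H[OF xs]] by (simp add: mm_diff mm_scale bx)
  also have "\<dots> = bar (T x \<star> T s)" using T_gen(2)[OF assms l] by (simp add: bar_add bar_scale hscale_simps)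
  finally show ?thesis by simp
qed

lemma bar_mult_right:
  assumes "\<And>x. x \<in> We ==> bar (T x \<star> k) = bar (T x) \<star> k'" "h \<in> HH"
  shows "bar (h \<star> k) = bar h \<star> k'"
proof -
  have "bar (h \<star> k) = (\<Sum>w\<in>keys h. laurent_bar (coef h w) \<odot> bar (T w \<star> k))"
    by (subst hecke_expand[of h]) (simp add: mm_sum mm_scale bar_sum bar_scale)
  also have "\<dots> = (\<Sum>w\<in>keys h. laurent_bar (coef h w) \<odot> (bar (T w) \<star> k'))"
    using assms by (intro sum.cong) (auto simp: H_iff subset_iff)
  also have "\<dots> = bar h \<star> k'" unfolding bar_expand[of h] by (simp add: mm_sum mm_scale)
  finally show ?thesis .
qed

lemma bar_mult_T: assumes "h \<in> HH" "x \<in> We" shows "bar (h \<star> T x) = bar h \<star> bar (T x)" using assms(2)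
proof (induction rule: We_induct)
  case (stab a)
  show ?case
  proof (rule bar_mult_right[OF _ assms(1)])
    fix x assume x: "x \<in> We"
    have i: "inv (x o a) = inv a o inv x" using o_inv_distrib aff_inverse(1) We_aff x stab by blast
    have a: "inv a \<in> We" "len (inv a) = 0" using We_inv len_inverse We_aff stab by auto
    have "len (inv a o inv x) = len (inv a) + len (inv x)" using len_comp_left We_aff We_inv x a by simp
    then have "Ti (inv (x o a)) = Ti (inv x) \<star> Ti (inv a)" unfolding i using Ti_mult a(1) We_inv x by blast
    then show "bar (T x \<star> T a) = bar (T x) \<star> bar (T a)" using T_stab(1)[OF x stab] by (simp add: bar_T)
  qed
next
  case (gen x s)
  have s: "T s \<in> HH" using T_H gens_We gen by blast
  have "bar (h \<star> (T x \<star> T s)) = bar (h \<star> T x \<star> T s)" by (simp add: mm_assoc)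
  also have "\<dots> = bar (h \<star> T x) \<star> Ti s" by (rule bar_mult_right[OF bar_mult_gen_T mm_H]) (use gen in auto)
  also have "\<dots> = bar h \<star> (bar (T x) \<star> Ti s)" using gen(4) by (simp add: mm_assoc)
  also have "bar (T x) \<star> Ti s = bar (T x \<star> T s)" using bar_mult_gen_T gen by simp
  finally show ?case unfolding T_gen(1)[OF gen(1-3)] .
qed

lemma bar_mult: assumes "h \<in> HH" "k \<in> HH" shows "bar (h \<star> k) = bar h \<star> bar k"
proof -
  have "bar (h \<star> k) = (\<Sum>w\<in>keys k. laurent_bar (coef k w) \<odot> bar (h \<star> T w))"
    by (subst hecke_expand[of k]) (simp add: mm_sum mm_scale bar_sum bar_scale)
  also have "\<dots> = (\<Sum>w\<in>keys k. laurent_bar (coef k w) \<odot> (bar h \<star> bar (T w)))"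
    using assms bar_mult_T by (intro sum.cong) (auto simp: H_iff subset_iff)
  also have "\<dots> = bar h \<star> bar k" unfolding bar_expand[of k] by (simp add: mm_sum mm_scale)
  finally show ?thesis .
qed

section \<open>Triangularity of the bar involution and uniqueness of Kazhdan-Lusztig
  elements\<close>

definition lower :: "nat => 'v hecke set" where
  "lower n = {h \<in> HH. \<forall>y\<in>keys h. len y < n}"

lemma lower_simps:
  "0 \<in> lower n" "x \<in> lower n ==> y \<in> lower n ==> x + y \<in> lower n"
  "x \<in> lower n ==> c \<odot> x \<in> lower n" "w \<in> We ==> len w < n ==> T w \<in> lower n"
  "x \<in> lower n ==> n \<le> n' ==> x \<in> lower n'" "x \<in> lower n ==> y \<in> lower n ==> x - y \<in> lower n"
  using keys_add[of x y] keys_diff[of x y] keys_hscale[of c x] by (auto simp: lower_def H_simps)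

lemma lower_sum: "(\<And>i. i \<in> I ==> f i \<in> lower n) ==> sum f I \<in> lower n"
  by (induction I rule: infinite_finite_induct) (auto intro: lower_simps)

lemma lower_mult_gen: assumes "h \<in> lower n" "s \<in> gens" shows "h \<star> T s \<in> lower (Suc n)"
proof -
  have "T y \<star> T s \<in> lower (Suc n)" if y: "y \<in> We" "len y < n" for y
  proof (cases "len (y o s) = len y + 1")
    case True
    have "T (y o s) \<in> lower (Suc n)"
      using y True We_comp[OF y(1) gens_We[OF assms(2)]] by (intro lower_simps(4)) auto
    then show ?thesis using T_gen(1)[OF y(1) assms(2) True] by simp
  next
    case False
    then have l: "len y = len (y o s) + 1" using len_step[OF We_aff[OF y(1)] assms(2)] by linarith
    have "T (y o s) \<in> lower (Suc n)" "T y \<in> lower (Suc n)"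
      using y l We_comp[OF y(1) gens_We[OF assms(2)]] by (auto intro!: lower_simps(4))
    then show ?thesis using T_gen(2)[OF y(1) assms(2) l] lower_simps(2,3) by simp
  qed
  moreover have "h \<star> T s = (\<Sum>w\<in>keys h. coef h w \<odot> (T w \<star> T s))"
    by (subst hecke_expand[of h]) (simp add: mm_sum mm_scale)
  ultimately show ?thesis using assms(1) by (auto simp: lower_def[of n] H_iff intro!: lower_sum lower_simps(3))
qed

lemma bar_T_lower: "x \<in> We ==> bar (T x) - T x \<in> lower (len x)"
proof (induction rule: We_induct)
  case (stab a)
  show ?case using bar_stab[OF stab] by (simp add: lower_simps)
next
  case (gen x s)
  have s: "T s \<in> HH" using T_H gens_We gen by blast
  have "bar (T (x o s)) - T (x o s) = bar (T x) \<star> (T s - kap (L s) \<odot> one) - T x \<star> T s"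
    using bar_step gen T_gen(1) Ti_gen by simp
  also have "\<dots> = (bar (T x) - T x) \<star> T s - kap (L s) \<odot> bar (T x)"
    using bar_H[OF T_H] gen(1) by (simp add: mm_diff mm_scale)
  also have "\<dots> = (bar (T x) - T x) \<star> T s - kap (L s) \<odot> ((bar (T x) - T x) + T x)" by simp
  also have "\<dots> \<in> lower (len (x o s))" unfolding gen(3) Suc_eq_plus1[symmetric]
    by (intro lower_simps(6)[OF lower_mult_gen[OF gen(4,2)] lower_simps(3)[OF lower_simps(2)]]
        lower_simps(5)[OF gen(4)] lower_simps(4)[OF gen(1)]) auto
  finally show ?case .
qed

text \<open>By triangularity the coefficient at a longest element of the support is itself bar
  invariant; having only negative degrees, it vanishes. Both the uniqueness of the Kazhdan-Lusztig
  basis and the final identity rest on this.\<close>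

lemma bar_neg_zero:
  assumes "h \<in> HH" "bar h = h" "\<And>w. coef h w \<in> Ld (-1)" shows "h = 0"
proof (rule ccontr)
  assume "h \<noteq> 0"
  then have ne: "keys h \<noteq> {}" by simp

  have fin: "finite (len ` keys h)" "len ` keys h \<noteq> {}" using ne by auto
  obtain w where w: "w \<in> keys h" "len w = Max (len ` keys h)" using Max_in[OF fin] by auto
  have max: "len y \<le> len w" if "y \<in> keys h" for y using w(2) fin that by simp
  have We: "y \<in> We" if "y \<in> keys h" for y using that assms(1) by (auto simp: H_iff)
  have "coef (bar h) w = (\<Sum>y\<in>keys h. laurent_bar (coef h y) * coef (bar (T y)) w)"
    by (subst bar_expand) (simp add: lookup_sum)
  also have "\<dots> = (\<Sum>y\<in>keys h. if y = w then laurent_bar (coef h w) else 0)"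
  proof (rule sum.cong)
    fix y assume y: "y \<in> keys h"
    have "w \<notin> keys (bar (T y) - T y)" using bar_T_lower[OF We[OF y]] max[OF y] by (auto simp: lower_def)
    then have "coef (bar (T y)) w = coef (T y) w" by (simp add: in_keys_iff lookup_minus)
    then show "laurent_bar (coef h y) * coef (bar (T y)) w = (if y = w then laurent_bar (coef h w) else 0)"
      by (simp add: coef_hT)
  qed simp
  also have "\<dots> = laurent_bar (coef h w)" using w(1) by simp
  finally have "laurent_bar (coef h w) = coef h w" using assms(2) by simp
  then have "coef h w = 0" using bar_invariant_neg assms(3) by blast
  then show False using w(1) by (simp add: in_keys_iff)
qed

abbreviation "neg \<equiv> hecke_neg \<Phi> \<Delta> L"

lemma neg_iff: "h \<in> neg \<longleftrightarrow> h \<in> HH \<and> (\<forall>w. coef h w \<in> Ld (-1))"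
proof -
  have "n > -1 \<longleftrightarrow> n \<ge> 0" for n :: int by auto
  then show ?thesis by (auto simp: hecke_neg_def Ld_def)
qed

lemma neg_simps: "0 \<in> neg" "x \<in> neg ==> y \<in> neg ==> x + y \<in> neg" "x \<in> neg ==> y \<in> neg ==> x - y \<in> neg"
    "x \<in> neg ==> - x \<in> neg" by (auto simp: neg_iff H_simps lookup_add lookup_minus Ld_add Ld_diff Ld_uminus)

lemma neg_sum: "(\<And>i. i \<in> I ==> f i \<in> neg) ==> sum f I \<in> neg"
  by (induction I rule: infinite_finite_induct) (auto intro: neg_simps)

lemma KL_eqI: assumes "C \<in> HH" "bar C = C" "C - T w \<in> neg" shows "KL_basis \<Phi> \<Delta> L m w = C" unfolding KL_basis_def
proof (rule the_equality)
  fix D assume D: "D \<in> HH \<and> bar D = D \<and> D - T w \<in> neg"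
  have "D - C = (D - T w) - (C - T w)" by simp
  then have "D - C \<in> neg" using neg_simps(3) D assms(3) by metis
  then have "D - C = 0" using D assms by (intro bar_neg_zero) (auto simp: neg_iff bar_diff)
  then show "D = C" by simp
qed (use assms in blast)

end

section \<open>The spherical module\<close>

context affine_hecke
begin

text \<open>Weighted length on the finite group: an inversion counts with the weight of its
  hyperplane through 0, the largest of that direction.\<close>

definition Lw :: "('v => 'v) => int" where "Lw u = int (\<Sum>a\<in>inversions u. wt a 0)"

text \<open>The drop exceeds \<open>wt b 0\<close> by the total weight of \<open>extra u b\<close>.
  Weights are positive, so the excess vanishes exactly when the lengths differ by one: this is how
  degrees detect Bruhat covers.\<close>

lemma Lw_reflect:
  assumes "u \<in> weyl" "b \<in> Pos" "u b \<notin> Pos"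
  shows "Lw u \<ge> Lw (u o reflect b) + int (wt b 0)"
    "len u = len (u o reflect b) + 1 \<longleftrightarrow> Lw u = Lw (u o reflect b) + int (wt b 0)"
proof -
  define e where "e = (\<Sum>a\<in>extra u b. wt a 0)"
  have eq: "Lw u = Lw (u o reflect b) + int (wt b 0) + int e"
    using sum_inversions[of "\<lambda>a. wt a 0", OF _ assms] wt_weyl by (simp add: Lw_def e_def del: of_nat_sum)
  then show "Lw u \<ge> Lw (u o reflect b) + int (wt b 0)" by simp
  have "e = 0 \<longleftrightarrow> extra u b = {}"
  proof -
    have "wt a 0 \<noteq> 0" if "a \<in> extra u b" for a using that wt_pos[of a 0] pos_subset by (auto simp: extra_def)
    then show ?thesis using finite_inversions(2)[of u b] by (auto simp: e_def sum_eq_0_iff)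
  qed
  moreover have "card (extra u b) = 0 \<longleftrightarrow> extra u b = {}" using finite_inversions(2) by simp
  ultimately show "len u = len (u o reflect b) + 1 \<longleftrightarrow> Lw u = Lw (u o reflect b) + int (wt b 0)"
    using eq len_comp_reflect(1)[OF assms] by auto
qed

lemma reflect_twice: "b \<in> \<Phi> ==> u o reflect b o reflect b = u" by (simp add: comp_assoc reflect_comp)

lemma Lw_up:
  assumes "u \<in> weyl" "b \<in> Pos" "u b \<in> Pos" "len (u o reflect b) = len u + 1"
  shows "Lw (u o reflect b) = Lw u + int (wt b 0)"
proof -
  have b: "b \<in> \<Phi>" using assms pos_subset by blast
  have "(u o reflect b) b \<notin> Pos"
    using assms weyl_neg_iff[OF assms(1) b] by (simp add: refl_self root_neq_0[OF b])
  then show ?thesis using Lw_reflect(2)[OF weyl_comp[OF assms(1) reflect_weyl[OF b]] assms(2)] assms(4)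
    by (simp add: reflect_twice[OF b])
qed

lemma Lw_id [simp]: "Lw id = 0" by (simp add: Lw_def inversions_def)

lemma Lw_nonneg: "Lw u \<ge> 0" unfolding Lw_def by (rule of_nat_0_le_iff)

lemma L_reflect: assumes "d \<in> \<Delta>" shows "L (reflect d) = wt d 0"
proof -
  have "cr id (reflect d) = - d" using cr_simple[OF id_aff assms] by (simp add: lin_def)
  then have "wt (- d) 0 = L (reflect d)"
    using wt_cr_We[OF id_We reflect_gens[OF assms]] lev_id_walls(1)[OF assms] by simp
  then show ?thesis using wt_uminus[of d 0] by simp
qed

text \<open>The closed formula for the Kazhdan-Lusztig element of \<open>w0\<close>: coefficient 1
  at \<open>w0\<close> and negative degrees elsewhere.\<close>

definition C0 :: "'v hecke" where "C0 = (\<Sum>v\<in>weyl. q_pow (Lw v - Lw w0) \<odot> T v)"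

lemma C0_H [simp]: "C0 \<in> HH" unfolding C0_def by (intro H_sum H_simps(5) T_H weyl_We)

lemma simple_root: "d \<in> \<Delta> ==> d \<in> \<Phi>" "d \<in> \<Delta> ==> d \<in> Pos" using simple_subset simple_pos by auto

text \<open>The coefficients at \<open>v\<close> and \<open>v o reflect d\<close> differ by a factor
  of degree \<open>wt d 0\<close>, which is what the quadratic relation requires of an
  eigenvector.\<close>

lemma C0_right: assumes d: "d \<in> \<Delta>" shows "C0 \<star> T (reflect d) = q_pow (int (wt d 0)) \<odot> C0"
proof -
  let ?s = "reflect d" and ?b = "int (wt d 0)" and ?N = "Lw w0"
  have s: "?s \<in> gens" "?s \<in> weyl" using reflect_gens reflect_weyl d simple_root by auto
  have l: "kap (L ?s) = q_pow ?b - q_pow (- ?b)" using L_reflect[OF d] by (simp add: kap_def)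
  have Tv: "T v \<star> T ?s = T (v o ?s) + (if v d \<in> Pos then 0 else kap (L ?s) \<odot> T v)" if "v \<in> weyl" for v
    using T_gen[OF weyl_We[OF that] s(1)] len_reflect[OF that d] by simp
  have "C0 \<star> T ?s = (\<Sum>v\<in>weyl. q_pow (Lw v - ?N) \<odot> (T v \<star> T ?s))" by (simp add: C0_def mm_sum mm_scale)
  also have "\<dots> = (\<Sum>v\<in>weyl. q_pow (Lw v - ?N) \<odot> T (v o ?s)) +
      (\<Sum>v\<in>weyl. q_pow (Lw v - ?N) \<odot> (if v d \<in> Pos then 0 else kap (L ?s) \<odot> T v))"
    by (simp add: Tv hscale_simps sum.distrib)
  also have "(\<Sum>v\<in>weyl. q_pow (Lw v - ?N) \<odot> T (v o ?s)) = (\<Sum>v\<in>weyl. q_pow (Lw (v o ?s) - ?N) \<odot> T v)"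
  proof -
    note ss = reflect_twice[OF simple_root(1)[OF d]]
    have "bij_betw (\<lambda>v. v o ?s) weyl weyl"
      by (rule bij_betwI[where g = "\<lambda>v. v o ?s"]) (use s ss in \<open>auto simp only: Pi_iff intro: weyl_comp\<close>)
    from sum.reindex_bij_betw[OF this, of "\<lambda>v. q_pow (Lw (v o ?s) - ?N) \<odot> T v"]
    show ?thesis by (simp only: ss)
  qed
  also have "\<dots> + (\<Sum>v\<in>weyl. q_pow (Lw v - ?N) \<odot> (if v d \<in> Pos then 0 else kap (L ?s) \<odot> T v)) =
      (\<Sum>v\<in>weyl. q_pow ?b \<odot> q_pow (Lw v - ?N) \<odot> T v)" unfolding sum.distrib[symmetric]
  proof (rule sum.cong)
    fix v assume v: "v \<in> weyl"
    show "q_pow (Lw (v o ?s) - ?N) \<odot> T v + q_pow (Lw v - ?N) \<odot> (if v d \<in> Pos then 0 else kap (L ?s) \<odot> T v) =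
      q_pow ?b \<odot> q_pow (Lw v - ?N) \<odot> T v"
    proof (cases "v d \<in> Pos")
      case True
      then have "Lw (v o ?s) = Lw v + ?b" using Lw_up[OF v simple_root(2)[OF d]] len_reflect(1)[OF v d] by simp
      then show ?thesis using True by (simp add: hscale_simps q_pow_add algebra_simps)
    next
      case False
      then have "Lw v = Lw (v o ?s) + ?b"
        using Lw_reflect(2)[OF v simple_root(2)[OF d] False] len_reflect(2)[OF v d False] by blast
      then show ?thesis using False by (simp add: l hscale_simps q_pow_add algebra_simps flip: hscale_simps(2))
    qed
  qed simp
  finally show ?thesis by (simp add: C0_def hscale_sum)
qed

text \<open>Comparison of the coefficients of \<open>T x\<close>: if \<open>x o s\<close> is longer,
  \<open>T x\<close> arises in \<open>h \<star> T s\<close> only from the term at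
  \<open>x o s\<close>. So the coefficients of an eigenvector propagate along ascents.\<close>

lemma coef_right:
  assumes "h \<in> HH" "s \<in> gens" "h \<star> T s = c \<odot> h" "x \<in> We" "len (x o s) = len x + 1"
  shows "coef h (x o s) = c * coef h x"
proof -
  have ss: "y o s o s = y" for y using gens_involution[OF assms(2)] by (simp add: comp_assoc)
  have "c * coef h x = coef (\<Sum>y\<in>keys h. coef h y \<odot> (T y \<star> T s)) x"
    using arg_cong[OF assms(3), of "\<lambda>k. coef k x"]
    by (subst (asm) hecke_expand[of h]) (simp add: mm_sum mm_scale)
  also have "\<dots> = (\<Sum>y\<in>keys h. if y = x o s then coef h (x o s) else 0)" unfolding lookup_sum
  proof (rule sum.cong)
    fix y assume "y \<in> keys h"
    then have y: "y \<in> We" using assms(1) by (auto simp: H_iff)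
    have "coef (T y \<star> T s) x = (if y = x o s then 1 else 0)"
    proof (cases "len (y o s) = len y + 1")
      case True
      have "x = y o s \<longleftrightarrow> y = x o s" using ss by metis
      then show ?thesis unfolding T_gen(1)[OF y assms(2) True] coef_hT by simp
    next
      case False
      then have l: "len y = len (y o s) + 1" using len_step[OF We_aff[OF y] assms(2)] by linarith
      then have "x \<noteq> y" using assms(5) by auto
      moreover have "x = y o s \<longleftrightarrow> y = x o s" using ss by metis
      ultimately show ?thesis unfolding T_gen(2)[OF y assms(2) l] by (simp add: lookup_add coef_hT)
    qed
    then show "coef (coef h y \<odot> (T y \<star> T s)) x = (if y = x o s then coef h (x o s) else 0)" by simp
  qed simp
  also have "\<dots> = coef h (x o s)" by (simp add: in_keys_iff)
  finally show ?thesis by simp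
qed

lemma weyl_eq_longestI: assumes "w \<in> weyl" "\<And>d. d \<in> \<Delta> ==> w d \<notin> Pos" shows "w = w0"
proof -
  have "(w0 o w) d \<in> Pos" if "d \<in> \<Delta>" for d
    using longest(2)[OF weyl_root[OF assms(1) simple_root(1)[OF that]]] assms(2)[OF that] by simp
  then have "len (w0 o w) = 0" using exists_descent_weyl[OF weyl_comp[OF longest(1) assms(1)]] by blast
  then have "w0 o w = id" using affine_weyl_len_0 weyl_affine weyl_comp longest(1) assms(1) by blast
  then have "w0 o w0 o w = w0" by (simp add: comp_assoc)
  then show ?thesis using longest(3) by simp
qed

lemma keys_sum_scale: "keys (\<Sum>v\<in>A. c v \<odot> f v) \<subseteq> (\<Union>v\<in>A. keys (f v))"
proof -
  have "keys (\<Sum>v\<in>A. c v \<odot> f v) \<subseteq> (\<Union>v\<in>A. keys (c v \<odot> f v))" by (rule keys_sum)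
  moreover have "keys (c v \<odot> f v) \<subseteq> keys (f v)" for v by (rule keys_hscale)
  ultimately show ?thesis by blast
qed

lemma keys_mult_gen_weyl:
  assumes "keys h \<subseteq> weyl" "d \<in> \<Delta>" shows "keys (h \<star> T (reflect d)) \<subseteq> weyl"
proof -
  have "keys (T v \<star> T (reflect d)) \<subseteq> weyl" if v: "v \<in> weyl" for v
  proof -
    have vs: "v o reflect d \<in> weyl" using weyl_comp v reflect_weyl simple_root assms by blast
    have "T v \<star> T (reflect d) = T (v o reflect d) \<or>
        T v \<star> T (reflect d) = T (v o reflect d) + kap (L (reflect d)) \<odot> T v"
      using T_gen[OF weyl_We[OF v] reflect_gens[OF assms(2)]] len_reflect[OF v assms(2)] by metis
    then show ?thesis using keys_add[of "T (v o reflect d)" "kap (L (reflect d)) \<odot> T v"]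
        keys_hscale[of "kap (L (reflect d))" "T v"] vs v by auto
  qed
  then have "(\<Union>v\<in>keys h. keys (T v \<star> T (reflect d))) \<subseteq> weyl" using assms(1) by blast
  moreover have "h \<star> T (reflect d) = (\<Sum>v\<in>keys h. coef h v \<odot> (T v \<star> T (reflect d)))"
    by (subst hecke_expand[of h]) (simp add: mm_sum mm_scale)
  ultimately show ?thesis using keys_sum_scale[of "coef h" "\<lambda>v. T v \<star> T (reflect d)" "keys h"] by simp
qed

lemma keys_bar_T_weyl: "v \<in> weyl ==> keys (bar (T v)) \<subseteq> weyl"
proof -
  have "v \<in> generated F ==> keys (bar (T v)) \<subseteq> weyl" for v
  proof (induction rule: generated_induct_right)
    case id
    have "keys (bar one) \<subseteq> weyl" by (simp del: id_apply)
    then show ?case by (simp add: id_def)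
  next
    case (step s w)
    then obtain d where d: "d \<in> \<Delta>" "s = reflect d" by (auto simp: finite_gens_def)
    have w: "w \<in> weyl" "w \<in> We" using step(2) weyl_eq weyl_We by auto
    have s: "s \<in> gens" using d reflect_gens by simp
    have sW: "s \<in> We" using gens_We s by blast
    have ws: "w o s \<in> We" using We_comp w sW by blast
    have kT: "keys (bar (T w) \<star> T s) \<subseteq> weyl" using keys_mult_gen_weyl step(3) d by simp
    have "keys (bar (T (w o s))) \<subseteq> weyl"
    proof (cases "len (w o s) = len w + 1")
      case True
      have "bar (T (w o s)) = bar (T w) \<star> T s - kap (L s) \<odot> bar (T w)"
        using bar_step[OF w(2) s True] Ti_gen[OF s] bar_H[OF T_H[OF w(2)]] by (simp add: mm_diff mm_scale)
      then show ?thesis using kT step(3) keys_hscale[of "kap (L s)" "bar (T w)"]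
          keys_diff[of "bar (T w) \<star> T s" "kap (L s) \<odot> bar (T w)"] by auto
    next
      case False
      then have l: "len w = len (w o s) + 1" using len_step[OF We_aff[OF w(2)] s] by linarith
      have "bar (T w) = bar (T (w o s)) \<star> Ti s"
        using bar_step[OF ws s] l gens_involution[OF s] by (simp add: comp_assoc)
      then have "bar (T w) \<star> T s = bar (T (w o s))"
        using Ti(3)[OF sW] bar_H[OF T_H[OF ws]] by (simp add: mm_assoc)
      then show ?thesis using kT by simp
    qed
    then show ?case .
  qed
  then show "v \<in> weyl ==> ?thesis" unfolding weyl_eq by blast
qed

text \<open>The difference \<open>?D\<close> is an eigenvector supported on the finite group. By
  propagation along ascents a longest key of it can only be \<open>w0\<close>, but there both terms
  have coefficient 1.\<close>

lemma bar_C0: "bar C0 = C0"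
proof (rule ccontr)
  let ?D = "bar C0 - C0"
  assume "bar C0 \<noteq> C0"
  then have ne: "keys ?D \<noteq> {}" by simp
  have DH: "?D \<in> HH" by (intro H_simps bar_H C0_H)
  have eig: "?D \<star> T (reflect d) = q_pow (int (wt d 0)) \<odot> ?D" if d: "d \<in> \<Delta>" for d
  proof -
    let ?s = "reflect d" and ?b = "int (wt d 0)"
    have s: "?s \<in> gens" "?s \<in> We" using reflect_gens gens_We d by auto
    have "bar C0 \<star> Ti ?s = q_pow (- ?b) \<odot> bar C0"
      using bar_mult[OF C0_H T_H[OF s(2)]] bar_gen[OF s(1)] C0_right[OF d] by (simp add: bar_scale)
    moreover have "bar C0 \<star> Ti ?s = bar C0 \<star> T ?s - kap (wt d 0) \<odot> bar C0"
      using Ti_gen[OF s(1)] L_reflect[OF d] bar_H[OF C0_H] by (simp add: mm_diff mm_scale)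
    ultimately have "bar C0 \<star> T ?s = q_pow (- ?b) \<odot> bar C0 + kap (wt d 0) \<odot> bar C0" by (simp add: diff_eq_eq)
    then have "bar C0 \<star> T ?s = q_pow ?b \<odot> bar C0" unfolding kap_def hscale_simps(2)[symmetric] by simp
    then show ?thesis using C0_right[OF d] by (simp add: mm_diff hscale_simps)
  qed
  have kC: "keys C0 \<subseteq> weyl" unfolding C0_def using keys_sum_scale[of "\<lambda>v. q_pow (Lw v - Lw w0)" T weyl] by simp
  have "bar C0 = (\<Sum>v\<in>weyl. laurent_bar (q_pow (Lw v - Lw w0)) \<odot> bar (T v))"
    unfolding C0_def by (simp add: bar_sum bar_scale)
  then have "keys (bar C0) \<subseteq> weyl"
    using keys_sum_scale[of "\<lambda>v. laurent_bar (q_pow (Lw v - Lw w0))" "\<lambda>v. bar (T v)" weyl]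
      keys_bar_T_weyl by (simp del: laurent_bar_simps) blast
  then have kD: "keys ?D \<subseteq> weyl" using kC keys_diff[of "bar C0" C0] by blast
  have fin: "finite (len ` keys ?D)" "len ` keys ?D \<noteq> {}" using ne by auto
  obtain w where w: "w \<in> keys ?D" "len w = Max (len ` keys ?D)" using Max_in[OF fin] by auto
  have max: "len y \<le> len w" if "y \<in> keys ?D" for y using w(2) fin that by simp
  have wW: "w \<in> weyl" using w kD by blast
  have "w d \<notin> Pos" if d: "d \<in> \<Delta>" for d
  proof
    assume "w d \<in> Pos"
    then have l: "len (w o reflect d) = len w + 1" using len_reflect wW d by blast
    have "coef ?D (w o reflect d) = q_pow (int (wt d 0)) * coef ?D w"
      using coef_right[OF DH reflect_gens[OF d] eig[OF d] weyl_We[OF wW] l] .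
    moreover have "coef ?D (w o reflect d) = 0" using max[of "w o reflect d"] l by (auto simp: in_keys_iff)
    ultimately have "q_pow (- int (wt d 0)) * (q_pow (int (wt d 0)) * coef ?D w) = 0" by simp
    then have "coef ?D w = 0" unfolding mult.assoc[symmetric] q_pow_add by simp
    then show False using w(1) by (simp add: in_keys_iff)
  qed
  then have ww: "w = w0" using weyl_eq_longestI wW by blast
  have "coef (bar (T v)) w0 = (if v = w0 then 1 else 0)" if v: "v \<in> weyl" for v
  proof -
    have "len v \<le> len w0"
    proof -
      have "inversions v \<subseteq> Pos" by (auto simp: inversions_def)
      then have "card (inversions v) \<le> card Pos" using finite_pos card_mono by blast
      moreover have "inversions w0 = Pos" using longest(2) pos_subset by (auto simp: inversions_def)
      ultimately show ?thesis using len_inversions v longest(1) by metis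
    qed
    then have "w0 \<notin> keys (bar (T v) - T v)" using bar_T_lower[OF weyl_We[OF v]] by (auto simp: lower_def)
    then show ?thesis by (auto simp: in_keys_iff lookup_minus coef_hT)
  qed
  then have "coef (bar C0) w0 = (\<Sum>v\<in>weyl. if v = w0 then 1 else 0)"
    unfolding C0_def bar_sum bar_scale lookup_sum by (intro sum.cong) auto
  moreover have "coef C0 w0 = (\<Sum>v\<in>weyl. if v = w0 then 1 else 0)"
    unfolding C0_def lookup_sum by (intro sum.cong) (auto simp: coef_hT)
  ultimately have "coef ?D w0 = 0" by (simp add: lookup_minus)
  then show False using w(1) ww by (simp add: in_keys_iff)
qed

text \<open>Each element is uniquely \<open>v o z\<close> with additive lengths, so
  \<open>C0 \<star> T z\<close> spreads over the coset of \<open>z\<close> with the coefficients of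
  \<open>C0\<close>. Hence these elements are independent, and their coordinates are visible at
  \<open>w0 o z\<close>.\<close>

lemma coef_C0_mult:
  assumes "keys k \<subseteq> Dom" "v \<in> weyl" "z \<in> Dom"
  shows "coef (C0 \<star> k) (v o z) = q_pow (Lw v - Lw w0) * coef k z"
proof -
  have "C0 \<star> T y = (\<Sum>v\<in>weyl. q_pow (Lw v - Lw w0) \<odot> T (v o y))" if "y \<in> Dom" for y
    unfolding C0_def mm_sum mm_scale
    using T_mult weyl_We Dom_We[OF that] len_weyl_Dom[OF _ that] by (intro sum.cong) auto
  then have eq: "C0 \<star> k = (\<Sum>y\<in>keys k. coef k y \<odot> (\<Sum>u\<in>weyl. q_pow (Lw u - Lw w0) \<odot> T (u o y)))"
    using assms(1) by (subst hecke_expand[of k]) (auto simp: mm_sum mm_scale intro!: sum.cong)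
  have "coef (C0 \<star> k) (v o z) = (\<Sum>y\<in>keys k. if y = z then q_pow (Lw v - Lw w0) * coef k z else 0)"
    unfolding eq lookup_sum
  proof (rule sum.cong)
    fix y assume "y \<in> keys k"
    then have y: "y \<in> Dom" using assms(1) by blast
    have "coef (\<Sum>u\<in>weyl. q_pow (Lw u - Lw w0) \<odot> T (u o y)) (v o z) =
        (\<Sum>u\<in>weyl. if u = v then (if y = z then q_pow (Lw v - Lw w0) else 0) else 0)" unfolding lookup_sum
    proof (rule sum.cong)
      fix u assume u: "u \<in> weyl"
      have "v o z = u o y \<longleftrightarrow> u = v \<and> y = z" using weyl_Dom_unique[OF assms(2) u assms(3) y] by auto
      then show "coef (q_pow (Lw u - Lw w0) \<odot> T (u o y)) (v o z) =
          (if u = v then (if y = z then q_pow (Lw v - Lw w0) else 0) else 0)" by (auto simp: coef_hT)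
    qed simp
    then show "coef (coef k y \<odot> (\<Sum>u\<in>weyl. q_pow (Lw u - Lw w0) \<odot> T (u o y))) (v o z) =
        (if y = z then q_pow (Lw v - Lw w0) * coef k z else 0)"
      using assms(2) finite_weyl' by (simp add: algebra_simps)
  qed simp
  also have "\<dots> = q_pow (Lw v - Lw w0) * coef k z" by (simp add: in_keys_iff)
  finally show ?thesis .
qed

lemma coef_C0_longest: "keys k \<subseteq> Dom ==> z \<in> Dom ==> coef (C0 \<star> k) (w0 o z) = coef k z"
  using coef_C0_mult[OF _ longest(1)] by simp

lemma Lw_longest_max: assumes "v \<in> weyl" shows "Lw v \<le> Lw w0" "v \<noteq> w0 ==> Lw v < Lw w0"
proof -
  have inv0: "inversions w0 = Pos" using longest(2) pos_subset by (auto simp: inversions_def)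
  have sub: "inversions v \<subseteq> Pos" by (auto simp: inversions_def)
  then show "Lw v \<le> Lw w0" unfolding Lw_def inv0 using finite_pos by (simp add: sum_mono2)
  assume "v \<noteq> w0"
  then have "\<exists>d\<in>\<Delta>. v d \<in> Pos" using weyl_eq_longestI assms by blast
  then obtain a where a: "a \<in> Pos" "a \<notin> inversions v" using simple_pos by (auto simp: inversions_def)
  have "(\<Sum>a\<in>inversions v. wt a 0) < (\<Sum>a\<in>Pos. wt a 0)"
    by (rule sum_strict_mono2[OF finite_pos sub, of a]) (use a wt_pos pos_subset in auto)
  then show "Lw v < Lw w0" unfolding Lw_def inv0 by (simp del: of_nat_sum)
qed

lemma weyl_Dom_decompose: assumes "x \<in> We" obtains v z where "v \<in> weyl" "z \<in> Dom" "x = v o z"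
proof -
  have "\<exists>v\<in>weyl. \<exists>z\<in>Dom. x = v o z" using assms
  proof (induction rule: We_induct)
    case (stab a)
    then have "a \<in> Dom" using len_0D[OF We_aff[OF stab(1)] stab(2)] lev_id_pos pos_subset
      by (auto simp: Dom_def)
    then show ?case using weyl_id by (metis id_comp)
  next
    case (gen x s)
    then obtain v z where vz: "v \<in> weyl" "z \<in> Dom" "x = v o z" by blast
    have "\<exists>v'\<in>weyl. \<exists>z'\<in>Dom. x o s = v' o z'"
    proof (cases "z o s \<in> Dom")
      case True
      then show ?thesis using vz by (metis comp_assoc)
    next
      case False
      note st = Dom_step(3)[OF vz(2) gen(2) False]
      have "x o s = v o reflect (- cr z s) o z" using vz(3) st by (simp add: comp_assoc)
      moreover have "v o reflect (- cr z s) \<in> weyl" using weyl_comp vz reflect_weyl st simple_root by blast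
      ultimately show ?thesis using vz(2) by blast
    qed
    then show ?case .
  qed
  then show ?thesis using that by blast
qed

lemma C0_mult_neg:
  assumes "k \<in> HH" "keys k \<subseteq> Dom" "\<And>z. coef k z \<in> Ld (-1)" shows "C0 \<star> k \<in> neg" unfolding neg_iff
proof (intro conjI allI)
  fix w
  show "coef (C0 \<star> k) w \<in> Ld (-1)"
  proof (cases "w \<in> We")
    case True
    then obtain v z where vz: "v \<in> weyl" "z \<in> Dom" "w = v o z" by (rule weyl_Dom_decompose)
    have "q_pow (Lw v - Lw w0) \<in> Ld 0" using Lw_longest_max(1)[OF vz(1)] by (intro Ld_mono[OF q_pow_Ld]) auto
    then have "q_pow (Lw v - Lw w0) * coef k z \<in> Ld (0 + -1)" using Ld_mult assms(3) by blast
    then show ?thesis using coef_C0_mult[OF assms(2) vz(1,2)] vz(3) by simp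
  next
    case False
    then have "coef (C0 \<star> k) w = 0" using mm_H[of C0 k] by (auto simp: H_iff in_keys_iff)
    then show ?thesis by simp
  qed
qed simp

lemma C0_T_neg: assumes "z \<in> Dom" shows "C0 \<star> T z - T (w0 o z) \<in> neg" unfolding neg_iff
proof (intro conjI allI)
  have z: "w0 o z \<in> We" using We_comp weyl_We longest(1) Dom_We assms by blast
  then show "C0 \<star> T z - T (w0 o z) \<in> HH" by (intro H_simps mm_H)
  fix w
  show "coef (C0 \<star> T z - T (w0 o z)) w \<in> Ld (-1)"
  proof (cases "w \<in> We")
    case True
    then obtain v y where vy: "v \<in> weyl" "y \<in> Dom" "w = v o y" by (rule weyl_Dom_decompose)
    have eq: "coef (C0 \<star> T z) w = (if y = z then q_pow (Lw v - Lw w0) else 0)"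
      using coef_C0_mult[of "T z", OF _ vy(1,2)] assms vy(3) by (simp add: coef_hT)
    have w: "w = w0 o z \<longleftrightarrow> v = w0 \<and> y = z" using weyl_Dom_unique[OF vy(1) longest(1) vy(2) assms] vy(3) by metis
    show ?thesis
    proof (cases "v = w0")
      case True
      then show ?thesis using eq w by (simp add: lookup_minus coef_hT)
    next
      case False
      then have "q_pow (Lw v - Lw w0) \<in> Ld (-1)"
        using Lw_longest_max(2)[OF vy(1)] by (intro Ld_mono[OF q_pow_Ld]) auto
      then show ?thesis using eq w False by (simp add: lookup_minus coef_hT)
    qed
  next
    case False
    then have "coef (C0 \<star> T z) w = 0" "w \<noteq> w0 o z" using mm_H[of C0 "T z"] z by (auto simp: H_iff in_keys_iff)
    then show ?thesis by (simp add: lookup_minus coef_hT)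
  qed
qed

text \<open>If the step leaves the chamber, \<open>z o s = reflect d o z\<close> for a simple
  \<open>d\<close>; then \<open>T z \<star> T s = T (reflect d) \<star> T z\<close>, and
  \<open>C0\<close> absorbs the left factor as a power of \<open>q\<close>: a forced fold at the
  chamber wall.\<close>

lemma C0_T_step:
  assumes "z \<in> Dom" "s \<in> gens"
  shows "cr z s \<in> Pos ==> C0 \<star> T z \<star> T s = C0 \<star> T (z o s)"
    "cr z s \<notin> Pos ==> z o s \<in> Dom ==> C0 \<star> T z \<star> T s = C0 \<star> T (z o s) + kap (L s) \<odot> (C0 \<star> T z)"
    "z o s \<notin> Dom ==> C0 \<star> T z \<star> T s = q_pow (int (L s)) \<odot> (C0 \<star> T z)"
    "z o s \<notin> Dom ==> L s = wt (- cr z s) 0"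
proof -
  have z: "z \<in> We" using Dom_We assms by blast
  show "cr z s \<in> Pos ==> C0 \<star> T z \<star> T s = C0 \<star> T (z o s)"
    using Dom_step(1)[OF assms] T_gen(1)[OF z assms(2)] by (simp add: mm_assoc)
  show "cr z s \<notin> Pos ==> z o s \<in> Dom ==> C0 \<star> T z \<star> T s = C0 \<star> T (z o s) + kap (L s) \<odot> (C0 \<star> T z)"
    using Dom_step(2)[OF assms] T_gen(2)[OF z assms(2)] by (simp add: mm_assoc mm_add mm_scale)
  assume n: "z o s \<notin> Dom"
  note st = Dom_step(3)[OF assms n]
  let ?d = "- cr z s"
  have d: "?d \<in> \<Delta>" using st by blast
  have "wt (cr z s) (lev z (cr z s) + 1) = L s" using wt_cr_We[OF z assms(2)] .
  then show Ls: "L s = wt ?d 0" using st wt_uminus[of "cr z s" 0] by simp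
  have lz: "len (reflect ?d o z) = len z + 1"
    using len_weyl_Dom[OF reflect_weyl[OF simple_root(1)[OF d]] assms(1)] len_gen[OF reflect_gens[OF d]] by simp
  have "T z \<star> T s = T (z o s)" using T_gen(1)[OF z assms(2)] lz st by simp
  also have "\<dots> = T (reflect ?d) \<star> T z"
    using T_mult[OF gens_We[OF reflect_gens[OF d]] z] lz len_gen[OF reflect_gens[OF d]] st by simp
  finally have "C0 \<star> T z \<star> T s = C0 \<star> T (reflect ?d) \<star> T z" by (simp add: mm_assoc)
  also have "\<dots> = q_pow (int (L s)) \<odot> (C0 \<star> T z)" by (simp add: C0_right[OF d] mm_scale Ls)
  finally show "C0 \<star> T z \<star> T s = q_pow (int (L s)) \<odot> (C0 \<star> T z)" .
qed

end

section \<open>Galleries and degrees\<close>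

context affine_hecke
begin

text \<open>Compares the end \<open>z\<close> of a folded gallery with the end \<open>x\<close> of
  the unfolded one. It is unchanged when both cross, and picks up the reflection in
  \<open>cr x s\<close> on the right when only \<open>x\<close> moves.\<close>

definition dir :: "('v => 'v) => ('v => 'v) => 'v => 'v" where
  "dir z x = lin z o inv (lin x)"

lemma lin_comp_We: "x \<in> We ==> lin (x o y) = lin x o lin y" using lin_comp affD(3) We_aff by blast

lemma inv_comp_weyl: "v \<in> weyl ==> w \<in> weyl ==> inv (v o w) = inv w o inv v"
  using o_inv_distrib weyl_inverse(1) by blast

lemma lin_inv_comp [simp]: "x \<in> We ==> inv (lin x) o lin x = id" "x \<in> We ==> lin x o inv (lin x) = id"
  using weyl_inverse(1)[OF We_lin] by (auto simp: bij_def surj_iff)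

lemma dir_weyl: "z \<in> We ==> x \<in> We ==> dir z x \<in> weyl"
  unfolding dir_def using weyl_comp We_lin weyl_inverse by blast

lemma lin_crossing: assumes "x \<in> We" "s \<in> gens" shows "lin x o lin s = reflect (cr x s) o lin x"
proof -
  have c: "cr x s \<in> \<Phi>" using cr(1) We_aff assms by blast
  have "lin (x o s) = lin (affine_refl (cr x s) (lev x (cr x s) + 1) o x)"
    using cr(4)[OF We_aff[OF assms(1)] assms(2)] by simp
  also have "\<dots> = lin (affine_refl (cr x s) (lev x (cr x s) + 1)) o lin x"
    by (rule lin_comp) (simp only: lin_affine_refl linear_refl)
  finally show ?thesis using lin_comp_We[OF assms(1), of s] by (simp add: lin_affine_refl)
qed

lemma dir_cr: assumes "z \<in> We" "x \<in> We" "s \<in> gens" shows "cr z s = dir z x (cr x s)"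
proof -
  let ?g = "z o inv x"
  have g: "?g \<in> We" using We_comp We_inv assms by blast
  have gx: "?g o x = z" using We_aff[OF assms(2)] by (simp add: comp_assoc)
  have "lin (inv x) = inv (lin x)" using aff_inverse(3)[OF We_aff[OF assms(2)]] .
  then have "lin ?g = dir z x" using lin_comp_We[OF assms(1)] by (simp add: dir_def)
  then show ?thesis using cr(5)[OF We_aff[OF assms(2)] assms(3) We_aff[OF g]] gx by simp
qed

lemma dir_step:
  assumes "z \<in> We" "x \<in> We" "s \<in> gens"
  shows "dir (z o s) (x o s) = dir z x" "dir z (x o s) = dir z x o reflect (cr x s)"
proof -
  have c: "cr x s \<in> \<Phi>" using cr(1) We_aff assms by blast
  have s: "lin s \<in> weyl" using We_lin gens_We assms by blast
  have rr: "inv (reflect (cr x s)) = reflect (cr x s)"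
    using inv_unique_comp[OF reflect_comp reflect_comp, OF c c] .
  have "lin (x o s) = reflect (cr x s) o lin x" using lin_crossing[OF assms(2,3)] lin_comp_We[OF assms(2)] by simp
  then have "inv (lin (x o s)) = inv (lin x) o reflect (cr x s)"
    using inv_comp_weyl[OF reflect_weyl[OF c] We_lin[OF assms(2)]] rr by simp
  then show "dir z (x o s) = dir z x o reflect (cr x s)" by (simp add: dir_def comp_assoc)
  have "inv (lin (x o s)) = inv (lin s) o inv (lin x)"
    using inv_comp_weyl[OF We_lin[OF assms(2)] s] lin_comp_We[OF assms(2)] by simp
  then have "dir (z o s) (x o s) = lin z o (lin s o inv (lin s)) o inv (lin x)"
    unfolding dir_def lin_comp_We[OF assms(1)] by (simp add: comp_assoc)
  then show "dir (z o s) (x o s) = dir z x"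
    using lin_inv_comp(2)[OF gens_We[OF assms(3)]] by (simp add: dir_def)
qed

lemma dir_stab:
  assumes "z \<in> We" "x \<in> We" "a \<in> We" shows "dir (z o a) (x o a) = dir z x"
proof -
  have "inv (lin (x o a)) = inv (lin a) o inv (lin x)"
    using inv_comp_weyl We_lin assms lin_comp_We[OF assms(2)] by simp
  then have "dir (z o a) (x o a) = lin z o (lin a o inv (lin a)) o inv (lin x)"
    unfolding dir_def lin_comp_We[OF assms(1)] by (simp add: comp_assoc)
  then show ?thesis using lin_inv_comp(2)[OF assms(3)] by (simp add: dir_def)
qed

text \<open>A folded gallery of the type of a gallery from the identity to \<open>x\<close> that has reached \<open>z\<close>
  carries the direction \<open>dir z x\<close>; each fold shortens it by at least the degree it contributes.\<close>

definition good :: "int => ('v => 'v) => 'v hecke set" where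
  "good d x = {C0 \<star> k | k. k \<in> HH \<and> keys k \<subseteq> Dom \<and> (\<forall>z\<in>Dom. coef k z \<in> Ld (d - Lw (dir z x)))}"

lemma good_0: "0 \<in> good d x" unfolding good_def by (intro CollectI exI[of _ 0]) (auto simp: H_simps)

lemma good_add: assumes "h \<in> good d x" "h' \<in> good d x" shows "h + h' \<in> good d x"
proof -
  obtain k where k: "h = C0 \<star> k" "k \<in> HH" "keys k \<subseteq> Dom" "\<forall>z\<in>Dom. coef k z \<in> Ld (d - Lw (dir z x))"
    using assms(1) unfolding good_def by blast
  obtain k' where k': "h' = C0 \<star> k'" "k' \<in> HH" "keys k' \<subseteq> Dom" "\<forall>z\<in>Dom. coef k' z \<in> Ld (d - Lw (dir z x))"
    using assms(2) unfolding good_def by blast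
  show ?thesis unfolding good_def by (intro CollectI exI[of _ "k + k'"])
      (use k k' keys_add[of k k'] in \<open>auto simp: mm_add H_simps lookup_add Ld_add\<close>)
qed

lemma good_sum: "(\<And>i. i \<in> I ==> f i \<in> good d x) ==> sum f I \<in> good d x"
  by (induction I rule: infinite_finite_induct) (auto intro: good_0 good_add)

lemma good_scale: assumes "h \<in> good d x" "c \<in> Ld e" shows "c \<odot> h \<in> good (d + e) x"
proof -
  obtain k where k: "h = C0 \<star> k" "k \<in> HH" "keys k \<subseteq> Dom" "\<forall>z\<in>Dom. coef k z \<in> Ld (d - Lw (dir z x))"
    using assms(1) unfolding good_def by blast
  have "c * coef k z \<in> Ld (d + e - Lw (dir z x))" if "z \<in> Dom" for z
    using Ld_mult[OF assms(2), of "coef k z" "d - Lw (dir z x)"] k that by (simp add: algebra_simps)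
  then show ?thesis unfolding good_def by (intro CollectI exI[of _ "c \<odot> k"])
      (use k keys_hscale[of c k] in \<open>auto simp: mm_scale H_simps\<close>)
qed

lemma good_uminus: "h \<in> good d x ==> - h \<in> good d x"
  using good_scale[of h d x "-1" 0] Ld_uminus[OF one_Ld] by (simp add: hscale_simps)

lemma good_T: "z \<in> Dom ==> c \<in> Ld (d - Lw (dir z x)) ==> c \<odot> (C0 \<star> T z) \<in> good d x" unfolding good_def
  by (intro CollectI exI[of _ "c \<odot> T z"])
    (use keys_hscale[of c "T z"] Dom_We in \<open>auto simp: mm_scale H_simps coef_hT\<close>)

lemma good_neg: assumes "h \<in> good (-1) x" "x \<in> We" shows "h \<in> neg"
proof -
  obtain k where k: "h = C0 \<star> k" "k \<in> HH" "keys k \<subseteq> Dom" "\<forall>z\<in>Dom. coef k z \<in> Ld (-1 - Lw (dir z x))"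
    using assms(1) unfolding good_def by blast
  have "coef k z \<in> Ld (-1)" for z
  proof (cases "z \<in> Dom")
    case True
    have "Lw (dir z x) \<ge> 0" by (rule Lw_nonneg)
    then show ?thesis using k(4) True by (auto intro: Ld_mono)
  next
    case False
    then have "coef k z = 0" using k(3) by (auto simp: in_keys_iff)
    then show ?thesis by simp
  qed
  then show ?thesis unfolding k(1) using C0_mult_neg k(2,3) by blast
qed

lemma L_le_wt: assumes "x \<in> We" "s \<in> gens" shows "L s \<le> wt (cr x s) 0"
  using wt_cr_We[OF assms] wt_le_0[OF cr(1)[OF We_aff[OF assms(1)] assms(2)]] by metis

lemma wt_neg_0: "wt (- a) 0 = wt a 0" using wt_uminus[of a 0] by simp

text \<open>At a chamber wall the reflection on the right of the direction becomes a simple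
  reflection on its left. So the length rises by exactly one, and \<open>Lw\<close> by the weight of
  the wall.\<close>

lemma wall_direction:
  assumes "z \<in> Dom" "x \<in> We" "s \<in> gens" "z o s \<notin> Dom" "cr x s \<notin> Pos"
  shows "Lw (dir z x o reflect (cr x s)) = Lw (dir z x) + int (L s)"
proof -
  let ?b = "cr x s" and ?u = "dir z x"
  have z: "z \<in> We" using Dom_We assms by blast
  have u: "?u \<in> weyl" using dir_weyl z assms by blast
  have b: "?b \<in> \<Phi>" "- ?b \<in> Pos" "- ?b \<in> \<Phi>"
    using cr(1)[OF We_aff[OF assms(2)] assms(3)] uminus_pos_iff uminus_root assms(5) by auto
  have rb: "reflect (- ?b) = reflect ?b" using affine_refl_uminus[of ?b 0] by simp
  have c: "cr z s = ?u ?b" using dir_cr z assms by blast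
  note st = Dom_step(3)[OF assms(1,3,4)]
  let ?g = "- cr z s"
  have g: "?u (- ?b) = ?g" using c weyl_uminus[OF u] by simp
  have "reflect ?g = ?u o reflect (- ?b) o inv ?u" using reflect_conj[OF u, of "- ?b"] g by simp
  then have ur: "?u o reflect (- ?b) = reflect ?g o ?u"
    using weyl_inverse(1)[OF u] by (simp add: comp_assoc bij_def)
  have gs: "reflect ?g \<in> gens" using st reflect_gens by blast
  have iu: "inv ?u \<in> weyl" using weyl_inverse u by blast
  have "inv (reflect ?g o ?u) = inv ?u o reflect ?g"
    using inv_comp_weyl[OF reflect_weyl u] inv_unique_comp[OF reflect_comp reflect_comp] st simple_root by metis
  then have "len (reflect ?g o ?u) = len (inv ?u o reflect ?g)"
    using len_inverse[OF weyl_aff[OF weyl_comp[OF reflect_weyl u]]] st simple_root by metis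
  also have "\<dots> \<le> Suc (len (inv ?u))" using len_le_Suc[OF weyl_aff[OF iu] gs] .
  finally have le: "len (?u o reflect (- ?b)) \<le> Suc (len ?u)" using ur len_inverse[OF weyl_aff[OF u]] by simp
  have up: "?u (- ?b) \<in> Pos" using g st simple_root by simp
  then have "len (?u o reflect (- ?b)) = len ?u + 1" using len_comp_reflect(2)[OF u b(2)] le by simp
  then have "Lw (?u o reflect (- ?b)) = Lw ?u + int (wt (- ?b) 0)" using Lw_up[OF u b(2) up] by blast
  moreover have "wt (- ?b) 0 = L s" using C0_T_step(4)[OF assms(1,3,4)] wt_weyl[OF u b(3)] g by metis
  ultimately show ?thesis using rb by simp
qed

text \<open>Oriented by the positive side of each hyperplane: products of these factors along a
  gallery from \<open>id\<close> depend only on its end, where they give \<open>X\<close>.\<close>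

definition Tsgn :: "('v => 'v) => ('v => 'v) => 'v hecke" where
  "Tsgn x s = (if cr x s \<in> Pos then T s else Ti s)"

text \<open>Crossing keeps the direction. A fold contributes degree at most \<open>L s\<close>,
  hence at most \<open>wt (cr x s) 0\<close>, and this is paid for by the drop of \<open>Lw\<close>.
  The only fold with rising \<open>Lw\<close> is the wall case with \<open>Ti s\<close>, where the
  factor of degree \<open>- L s\<close> compensates exactly.\<close>

lemma good_step_T:
  assumes "z \<in> Dom" "x \<in> We" "s \<in> gens" "c \<in> Ld (d - Lw (dir z x))"
  shows "c \<odot> (C0 \<star> T z) \<star> Tsgn x s \<in> good d (x o s)"
proof -
  let ?b = "cr x s" and ?u = "dir z x" and ?B = "C0 \<star> T z" and ?B' = "C0 \<star> T (z o s)"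
  have z: "z \<in> We" using Dom_We assms by blast
  have u: "?u \<in> weyl" using dir_weyl z assms by blast
  have b: "?b \<in> \<Phi>" "- ?b \<in> \<Phi>" using cr(1)[OF We_aff[OF assms(2)] assms(3)] uminus_root by auto
  have c: "cr z s = ?u ?b" using dir_cr z assms by blast
  have Ls: "int (L s) \<le> int (wt ?b 0)" using L_le_wt[OF assms(2,3)] by simp
  note ds = dir_step[OF z assms(2,3)]
  have cross: "c \<odot> ?B' \<in> good d (x o s)" if "z o s \<in> Dom" using that ds(1) assms(4) by (intro good_T) auto
  have fold: "e \<odot> ?B \<in> good d (x o s)" if "e \<in> Ld (d - Lw (?u o reflect ?b))" for e
    using that ds(2) assms(1) by (intro good_T) auto
  have TiB: "c \<odot> ?B \<star> Ti s = c \<odot> (?B \<star> T s) - (c * kap (L s)) \<odot> ?B"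
    using Ti_gen[OF assms(3)] by (simp add: mm_diff mm_scale hscale_simps mult.commute)
  have ub: "?u ?b \<in> \<Phi>" using weyl_root u b by blast
  show ?thesis
  proof (cases "?b \<in> Pos")
    case True
    note bP = True
    have eT: "Tsgn x s = T s" using True by (simp add: Tsgn_def)
    show ?thesis
    proof (cases "?u ?b \<in> Pos")
      case True
      then show ?thesis using C0_T_step(1)[OF assms(1,3)] Dom_step(1)[OF assms(1,3)] c cross eT
        by (simp add: mm_scale)
    next
      case False
      have le: "Lw (?u o reflect ?b) + int (L s) \<le> Lw ?u" using Lw_reflect(1)[OF u bP False] Ls by linarith
      have f1: "(c * kap (L s)) \<odot> ?B \<in> good d (x o s)" "(c * q_pow (int (L s))) \<odot> ?B \<in> good d (x o s)"
        using Ld_mult[OF assms(4) kap_Ld[of "L s"]] Ld_mult[OF assms(4) q_pow_Ld[of "int (L s)"]] le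
        by (auto intro!: fold elim: Ld_mono)
      show ?thesis
      proof (cases "z o s \<in> Dom")
        case True
        then show ?thesis using C0_T_step(2)[OF assms(1,3)] False c eT good_add[OF cross[OF True] f1(1)]
          by (simp add: mm_scale hscale_simps)
      next
        case n: False
        then show ?thesis using C0_T_step(3)[OF assms(1,3) n] eT f1(2) by (simp add: mm_scale hscale_simps)
      qed
    qed
  next
    case bN: False
    have eT: "Tsgn x s = Ti s" using bN by (simp add: Tsgn_def)
    have mb: "- ?b \<in> Pos" using bN uminus_pos_iff b by blast
    have rb: "reflect (- ?b) = reflect ?b" using affine_refl_uminus[of ?b 0] by simp
    show ?thesis
    proof (cases "?u ?b \<in> Pos")
      case True
      have "?u (- ?b) \<notin> Pos" using True weyl_neg_iff[OF u b(1)] by simp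
      then have "Lw (?u o reflect ?b) + int (L s) \<le> Lw ?u"
        using Lw_reflect(1)[OF u mb] Ls rb wt_neg_0[of ?b] by simp
      then have f1: "(c * kap (L s)) \<odot> ?B \<in> good d (x o s)"
        using Ld_mult[OF assms(4) kap_Ld[of "L s"]] by (auto intro!: fold elim: Ld_mono)
      have "z o s \<in> Dom" using Dom_step(1)[OF assms(1,3)] c True by simp
      then have "c \<odot> ?B \<star> Ti s = c \<odot> ?B' + - ((c * kap (L s)) \<odot> ?B)"
        using TiB C0_T_step(1)[OF assms(1,3)] c True by simp
      then show ?thesis using good_add[OF cross good_uminus[OF f1]] \<open>z o s \<in> Dom\<close> eT by simp
    next
      case False
      show ?thesis
      proof (cases "z o s \<in> Dom")
        case True
        then have "c \<odot> ?B \<star> Ti s = c \<odot> ?B'"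
          using TiB C0_T_step(2)[OF assms(1,3)] c False by (simp add: hscale_simps)
        then show ?thesis using cross[OF True] eT by simp
      next
        case n: False
        have "c \<odot> ?B \<star> Ti s = (c * q_pow (- int (L s))) \<odot> ?B" using TiB C0_T_step(3)[OF assms(1,3) n]
          by (simp add: hscale_simps kap_def algebra_simps)
        moreover have "c * q_pow (- int (L s)) \<in> Ld (d - Lw (?u o reflect ?b))"
          using Ld_mult[OF assms(4) q_pow_Ld[of "- int (L s)"]] wall_direction[OF assms(1-3) n bN]
          by (simp add: algebra_simps)
        ultimately show ?thesis using fold eT by simp
      qed
    qed
  qed
qed

lemma good_step:
  assumes "h \<in> good d x" "x \<in> We" "s \<in> gens" shows "h \<star> Tsgn x s \<in> good d (x o s)"
proof -
  obtain k where k: "h = C0 \<star> k" "k \<in> HH" "keys k \<subseteq> Dom" "\<forall>z\<in>Dom. coef k z \<in> Ld (d - Lw (dir z x))"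
    using assms(1) unfolding good_def by blast
  have "h \<star> Tsgn x s = (\<Sum>z\<in>keys k. coef k z \<odot> (C0 \<star> T z) \<star> Tsgn x s)"
    unfolding k(1) by (subst hecke_expand[of k]) (simp add: mm_sum mm_scale)
  then show ?thesis using k(3,4) assms(2,3) by (auto intro!: good_sum good_step_T)
qed

lemma Dom_stab: "z \<in> Dom ==> a \<in> We ==> len a = 0 ==> z o a \<in> Dom"
  using lev_comp_right[OF Dom_aff We_aff, of z a] Dom_lev[of z] We_comp[OF Dom_We] pos_subset
  unfolding Dom_def by auto

lemma good_stab:
  assumes "h \<in> good d x" "x \<in> We" "a \<in> We" "len a = 0" shows "h \<star> T a \<in> good d (x o a)"
proof -
  obtain k where k: "h = C0 \<star> k" "k \<in> HH" "keys k \<subseteq> Dom" "\<forall>z\<in>Dom. coef k z \<in> Ld (d - Lw (dir z x))"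
    using assms(1) unfolding good_def by blast
  have "h \<star> T a = (\<Sum>z\<in>keys k. coef k z \<odot> (C0 \<star> (T z \<star> T a)))"
    unfolding k(1) by (subst hecke_expand[of k]) (simp add: mm_sum mm_scale mm_assoc)
  moreover have "coef k z \<odot> (C0 \<star> (T z \<star> T a)) \<in> good d (x o a)" if "z \<in> keys k" for z
  proof -
    have z: "z \<in> Dom" "z \<in> We" using that k(3) Dom_We by auto
    have "coef k z \<odot> (C0 \<star> T (z o a)) \<in> good d (x o a)"
      using k(4) z dir_stab[OF z(2) assms(2,3)] Dom_stab[OF z(1) assms(3,4)] by (intro good_T) auto
    then show ?thesis using T_stab(1)[OF z(2) assms(3,4)] by simp
  qed
  ultimately show ?thesis by (auto intro: good_sum)
qed

section \<open>The alcove basis and Bernstein's relation\<close>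

text \<open>The alcove-walk form of the Bernstein basis: a far dominant translation makes
  \<open>T\<close> usable and is divided out again. \<open>X_eq\<close> shows that its choice does
  not matter.\<close>

definition X :: "('v => 'v) => 'v hecke" where
  "X x = (let d = SOME d. d \<in> Pp \<and> transl d o x \<in> Dom in Ti (transl d) \<star> T (transl d o x))"

lemma T_transl:
  assumes "d \<in> Pp" "z \<in> Dom"
  shows "T (transl d) \<star> T z = T (transl d o z)"
  using T_mult[OF transl_We[OF Pp_P] Dom_We, OF assms] len_transl_Dom(2)[OF assms] by blast

lemma transl_Dom: "d \<in> Pp ==> transl d \<in> Dom" using len_transl_Dom(3) id_Dom by blast

lemma Ti_transl:
  assumes "d \<in> Pp" "d' \<in> Pp" shows "Ti (transl (d + d')) = Ti (transl d') \<star> Ti (transl d)"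
  using Ti_mult[OF transl_We transl_We, OF Pp_P Pp_P, OF assms] len_transl_Dom(2)[OF assms(1) transl_Dom[OF assms(2)]]
  by (simp add: transl_comp)

lemma X_eq:
  assumes "x \<in> We" "d \<in> Pp" "transl d o x \<in> Dom"
  shows "X x = Ti (transl d) \<star> T (transl d o x)"
proof -
  have *: "Ti (transl d) \<star> T (transl d o x) = Ti (transl (d' + d)) \<star> T (transl (d' + d) o x)"
    if "d \<in> Pp" "d' \<in> Pp" "transl d o x \<in> Dom" for d d'
  proof -
    have "Ti (transl (d' + d)) \<star> T (transl (d' + d) o x) =
        Ti (transl d) \<star> (Ti (transl d') \<star> T (transl d')) \<star> T (transl d o x)"
      using Ti_transl[OF that(2,1)] T_transl[OF that(2,3)] by (simp add: mm_assoc comp_assoc flip: transl_comp)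
    also have "\<dots> = Ti (transl d) \<star> T (transl d o x)" using transl_We[OF Pp_P] that by simp
    finally show ?thesis by simp
  qed
  let ?d = "SOME d. d \<in> Pp \<and> transl d o x \<in> Dom"
  have s: "?d \<in> Pp \<and> transl ?d o x \<in> Dom" by (rule someI_ex) (use assms in blast)
  have "X x = Ti (transl ?d) \<star> T (transl ?d o x)" by (simp add: X_def Let_def)
  also have "\<dots> = Ti (transl (d + ?d)) \<star> T (transl (d + ?d) o x)" using *[of ?d d] s assms by blast
  also have "\<dots> = Ti (transl d) \<star> T (transl d o x)" using *[of d ?d] s assms by (simp add: add.commute)
  finally show ?thesis .
qed

lemma X_Dom: "x \<in> Dom ==> X x = T x"
proof -
  assume x: "x \<in> Dom"
  have "Ti id = one" using Ti_stab[of id] by (simp add: inv_id)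
  then show ?thesis using X_eq[of x 0] x Dom_We[OF x] Pp_0 T_H by simp
qed

lemma X_id [simp]: "X id = one" by (rule X_Dom) simp

lemma X_H [simp]: "X x \<in> HH" by (simp add: X_def Let_def)

lemma exists_transl_Dom2:
  assumes "x \<in> We" "y \<in> We" shows "\<exists>z\<in>Pp. transl z o x \<in> Dom \<and> transl z o y \<in> Dom"
proof -
  obtain z z' where d: "z \<in> Pp" "transl z o x \<in> Dom" "z' \<in> Pp" "transl z' o y \<in> Dom"
    using exists_transl_Dom assms by meson
  have "transl (z' + z) o x \<in> Dom" "transl (z + z') o y \<in> Dom"
    using len_transl_Dom(1)[OF d(3,2)] len_transl_Dom(1)[OF d(1,4)] by (simp_all add: comp_assoc flip: transl_comp)
  then show ?thesis using Pp_add[OF d(1,3)] by (metis add.commute)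
qed

lemma X_step: assumes "x \<in> We" "s \<in> gens" shows "X x \<star> Tsgn x s = X (x o s)"
proof -
  have sW: "s \<in> We" and xs: "x o s \<in> We" using gens_We We_comp assms by auto
  obtain d where d: "d \<in> Pp" "transl d o x \<in> Dom" "transl d o (x o s) \<in> Dom"
    using exists_transl_Dom2[OF assms(1) xs] by blast
  let ?y = "transl d o x"
  have tW: "transl d \<in> We" using transl_We Pp_P d by blast
  have y: "?y \<in> We" using We_comp tW assms by blast
  have ys: "?y o s \<in> Dom" "?y o s \<in> We" using d(3) Dom_We by (auto simp: comp_assoc)
  have c: "cr ?y s = cr x s" using cr(5)[OF We_aff[OF assms(1)] assms(2) We_aff[OF tW]] by (simp add: lin_transl_id)
  have "T ?y \<star> Tsgn x s = T (?y o s)"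
  proof (cases "cr x s \<in> Pos")
    case True
    then show ?thesis using T_gen(1)[OF y assms(2)] Dom_step(1)[OF d(2) assms(2)] c by (simp add: Tsgn_def)
  next
    case False
    then have l: "len ?y = len (?y o s) + 1" using Dom_step(2)[OF d(2) assms(2)] c ys by simp
    have "?y o s o s = ?y" using gens_involution[OF assms(2)] by (simp add: comp_assoc)
    then have "T ?y = T (?y o s) \<star> T s" using T_gen(1)[OF ys(2) assms(2)] l by simp
    then show ?thesis using False Ti(2)[OF sW] T_H[OF ys(2)] by (simp add: Tsgn_def mm_assoc)
  qed
  then show ?thesis using X_eq[OF assms(1) d(1,2)] X_eq[OF xs d(1,3)] by (simp add: mm_assoc comp_assoc)
qed

lemma X_stab: assumes "x \<in> We" "a \<in> We" "len a = 0" shows "X x \<star> T a = X (x o a)"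
proof -
  have xa: "x o a \<in> We" using We_comp assms by blast
  obtain d where d: "d \<in> Pp" "transl d o x \<in> Dom" "transl d o (x o a) \<in> Dom"
    using exists_transl_Dom2[OF assms(1) xa] by blast
  have "T (transl d o x) \<star> T a = T (transl d o (x o a))"
    using T_stab(1)[OF Dom_We[OF d(2)] assms(2,3)] by (simp add: comp_assoc)
  then show ?thesis using X_eq[OF assms(1) d(1,2)] X_eq[OF xa d(1,3)] by (simp add: mm_assoc)
qed

lemma stab_Dom: "a \<in> We ==> len a = 0 ==> a \<in> Dom" using Dom_stab[of id a] by simp

lemma good_X: assumes "x \<in> We" "h \<in> good d id" shows "h \<star> X x \<in> good d x" using assms(1)
proof (induction rule: We_induct)
  case (stab a)
  have "h \<star> X a \<in> good d (id o a)" using good_stab[OF assms(2) id_We stab] X_Dom[OF stab_Dom[OF stab]] by simp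
  then show ?case by (simp only: id_comp)
next
  case (gen x s)
  have "h \<star> X (x o s) \<in> good d (x o s)"
    using good_step[OF gen(4,1,2)] X_step[OF gen(1,2)] by (simp add: mm_assoc)
  then show ?case .
qed

lemma C0_good: "C0 \<in> good 0 id"
proof -
  have "lin id = id" by (simp add: lin_def fun_eq_iff)
  then have "dir id id = id" by (simp add: dir_def)
  then have "1 \<odot> (C0 \<star> T id) \<in> good 0 id" by (intro good_T) auto
  then show ?thesis by (simp add: hscale_simps)
qed

section \<open>Translation elements and Bernstein's relation\<close>

lemma T_transl_commute:
  assumes "\<mu> \<in> Pp" "n \<in> Pp" shows "T (transl \<mu>) \<star> T (transl n) = T (transl n) \<star> T (transl \<mu>)"
  using T_transl[OF assms(1) transl_Dom[OF assms(2)]] T_transl[OF assms(2) transl_Dom[OF assms(1)]]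
  by (simp add: transl_comp add.commute)

lemma T_Ti_transl_commute:
  assumes "\<mu> \<in> Pp" "n \<in> Pp" shows "T (transl \<mu>) \<star> Ti (transl n) = Ti (transl n) \<star> T (transl \<mu>)"
proof -
  have n: "transl n \<in> We" and \<mu>: "transl \<mu> \<in> We" using transl_We Pp_P assms by auto
  have "Ti (transl n) \<star> (T (transl n) \<star> T (transl \<mu>)) \<star> Ti (transl n) = T (transl \<mu>) \<star> Ti (transl n)"
    using n \<mu> T_H by (simp add: mm_assoc[symmetric])
  moreover have "Ti (transl n) \<star> (T (transl \<mu>) \<star> T (transl n)) \<star> Ti (transl n) = Ti (transl n) \<star> T (transl \<mu>)"
    using n \<mu> T_H by (simp add: mm_assoc)
  ultimately show ?thesis using T_transl_commute[OF assms] by simp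
qed

abbreviation E :: "'v => 'v hecke" where "E n \<equiv> X (transl n)"

lemma E_diff: assumes "\<mu> \<in> Pp" "n \<in> Pp" shows "E (\<mu> - n) = T (transl \<mu>) \<star> Ti (transl n)"
proof -
  have "transl n o transl (\<mu> - n) = transl \<mu>" by (simp add: transl_comp)
  then show ?thesis using X_eq[of "transl (\<mu> - n)" n] transl_We[OF P_diff[OF Pp_P Pp_P], OF assms] assms
      transl_Dom[OF assms(1)] T_Ti_transl_commute[OF assms] by simp
qed

lemma e_elt_eq: assumes "l \<in> P" shows "e_elt \<Phi> \<Delta> L m l = E l" unfolding e_elt_def
proof (rule the_equality)
  have *: "m (T (transl \<mu>)) (Ti (transl n)) = T (transl \<mu>) \<star> Ti (transl n)" if "\<mu> \<in> Pp" "n \<in> Pp" for \<mu> n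
    using that transl_We Pp_P T_H by (intro mm_m) auto
  obtain \<mu> n where "\<mu> \<in> Pp" "n \<in> Pp" "l = \<mu> - n" using P_diff_dominant[OF assms] by blast
  then show "\<exists>\<mu>\<in>Pp. \<exists>n\<in>Pp. \<mu> - n = l \<and> E l = m (T (transl \<mu>)) (Ti (transl n))" using E_diff * by metis
  fix h assume "\<exists>\<mu>\<in>Pp. \<exists>n\<in>Pp. \<mu> - n = l \<and> h = m (T (transl \<mu>)) (Ti (transl n))"
  then show "h = E l" using E_diff * by metis
qed

lemma E_mult_X: assumes "n \<in> P" "x \<in> We" shows "E n \<star> X x = X (transl n o x)"
proof -
  obtain \<mu> \<mu>' where \<mu>: "\<mu> \<in> Pp" "\<mu>' \<in> Pp" "n = \<mu> - \<mu>'" using P_diff_dominant[OF assms(1)] by blast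
  obtain d where d: "d \<in> Pp" "transl d o x \<in> Dom" using exists_transl_Dom assms(2) by blast
  have eq: "transl (d + \<mu>') o (transl n o x) = transl \<mu> o (transl d o x)"
    using \<mu> by (simp add: transl_def fun_eq_iff)
  have D: "transl (d + \<mu>') o (transl n o x) \<in> Dom" unfolding eq using len_transl_Dom(1)[OF \<mu>(1) d(2)] .
  have "E n \<star> X x = Ti (transl \<mu>') \<star> (T (transl \<mu>) \<star> Ti (transl d)) \<star> T (transl d o x)"
    unfolding \<mu>(3) E_diff[OF \<mu>(1,2)] X_eq[OF assms(2) d] T_Ti_transl_commute[OF \<mu>(1,2)] by (simp add: mm_assoc)
  also have "\<dots> = Ti (transl \<mu>') \<star> Ti (transl d) \<star> (T (transl \<mu>) \<star> T (transl d o x))"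
    unfolding T_Ti_transl_commute[OF \<mu>(1) d(1)] by (simp add: mm_assoc)
  also have "\<dots> = Ti (transl (d + \<mu>')) \<star> T (transl (d + \<mu>') o (transl n o x))"
    using Ti_transl[OF d(1) \<mu>(2)] T_transl[OF \<mu>(1) d(2)] eq by simp
  also have "\<dots> = X (transl n o x)"
    using X_eq[OF We_comp[OF transl_We[OF assms(1)] assms(2)] Pp_add[OF d(1) \<mu>(2)] D] by simp
  finally show ?thesis .
qed

lemma E_add: "\<mu> \<in> P ==> n \<in> P ==> E \<mu> \<star> E n = E (\<mu> + n)"
  using E_mult_X[of \<mu> "transl n"] transl_We by (simp add: transl_comp)

text \<open>The folded galleries that appear when \<open>T (reflect d)\<close> passes a gallery, one
  for each parallel hyperplane of level 0 up to \<open>j\<close>; for \<open>j < -1\<close> the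
  levels \<open>j + 1\<close> up to \<open>-1\<close> count negatively, so that
  \<open>bsum_Suc\<close> holds for all integers.\<close>

definition bsum :: "'v => ('v => 'v) => int => 'v hecke" where
  "bsum d x j = (\<Sum>i\<in>{0..j}. kap (wt d i) \<odot> X (transl (- of_int i *\<^sub>R d) o x))
     - (\<Sum>i\<in>{j+1..-1}. kap (wt d i) \<odot> X (transl (- of_int i *\<^sub>R d) o x))"

lemma bsum_Suc: "bsum d x (j + 1) = bsum d x j + kap (wt d (j + 1)) \<odot> X (transl (- of_int (j + 1) *\<^sub>R d) o x)"
proof -
  define f where "f i = kap (wt d i) \<odot> X (transl (- of_int i *\<^sub>R d) o x)" for i :: int
  have "sum f {0..j + 1} - sum f {j + 1 + 1..-1} = sum f {0..j} - sum f {j + 1..-1} + f (j + 1)"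
  proof (cases "j \<ge> -1")
    case True
    then have "{0..j + 1} = insert (j + 1) {0..j}" by auto
    then show ?thesis using True by (simp add: add.commute)
  next
    case False
    then have "{j + 1..-1} = insert (j + 1) {j + 1 + 1..-1}" by auto
    then show ?thesis using False by simp
  qed
  then show ?thesis unfolding bsum_def f_def[abs_def] by simp
qed

lemma P_scale_root: "a \<in> \<Phi> ==> of_int k *\<^sub>R a \<in> P"
proof (cases "k \<ge> 0")
  case True
  then show "a \<in> \<Phi> ==> ?thesis" using P_of_nat[OF P_root, of a "nat k"] by simp
next
  case False
  assume "a \<in> \<Phi>"
  then have "of_nat (nat (- k)) *\<^sub>R (- a) \<in> P" using P_of_nat P_root uminus_root by blast
  then show ?thesis using False by simp
qed

lemma bsum_step:
  assumes "d \<in> \<Phi>" "x \<in> We" "t \<in> gens" shows "bsum d x j \<star> Tsgn x t = bsum d (x o t) j"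
proof -
  have "X (transl (- of_int i *\<^sub>R d) o x) \<star> Tsgn x t = X (transl (- of_int i *\<^sub>R d) o (x o t))" for i
  proof -
    have P: "- of_int i *\<^sub>R d \<in> P" using P_scale_root[OF assms(1), of "- i"] by simp
    let ?t = "transl (- of_int i *\<^sub>R d)"
    have t: "?t \<in> We" using transl_We P by blast
    have "cr (?t o x) t = cr x t"
      using cr(5)[OF We_aff[OF assms(2)] assms(3) We_aff[OF t]] by (simp add: lin_transl_id)
    then have "Tsgn (?t o x) t = Tsgn x t" by (simp add: Tsgn_def)
    then show ?thesis using X_step[OF We_comp[OF t assms(2)] assms(3)] by (simp add: comp_assoc)
  qed
  then show ?thesis by (simp add: bsum_def mm_diff mm_sum mm_scale)
qed

lemma reflect_affine_refl: "d \<noteq> 0 ==> reflect d o affine_refl d k = transl (- of_int k *\<^sub>R d)"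
  by (simp add: fun_eq_iff affine_refl_def transl_def inner_diff_left inner_coroot_self algebra_simps)
    (metis mult_2_right scaleR_left_distrib)

text \<open>Moving \<open>T s\<close> past a gallery reflects it in the wall of \<open>s\<close>; the orientation changes exactly at
  the crossings parallel to that wall, and each of them contributes a folded gallery.\<close>

lemma bernstein_X:
  assumes "d \<in> \<Delta>" "x \<in> We"
  shows "T (reflect d) \<star> X x = X (reflect d o x) + bsum d x (lev x d)" using assms(2)
proof (induction rule: We_induct)
  case (stab a)
  let ?s = "reflect d"
  have d: "d \<in> \<Phi>" "d \<in> Pos" using simple_root assms by auto
  have s: "?s \<in> gens" "?s \<in> We" using reflect_gens gens_We assms by auto
  have "lev a d = 0" using len_0D[OF We_aff[OF stab(1)] stab(2) d(1)] lev_id_pos[OF d(2)] by simp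
  then have b: "bsum d a (lev a d) = kap (wt d 0) \<odot> T a"
    using X_Dom[OF stab_Dom[OF stab]] by (simp add: bsum_def)
  have "cr id ?s = - d" using cr_simple[OF id_aff assms(1)] by (simp add: lin_def)
  then have "Tsgn id ?s = Ti ?s" using uminus_pos_iff[OF d(1)] d(2) by (simp add: Tsgn_def)
  then have "X ?s = Ti ?s" using X_step[OF id_We s(1)] Ti(1)[OF s(2)] by simp
  then have "X (?s o a) = (T ?s - kap (wt d 0) \<odot> one) \<star> T a"
    using X_stab[OF s(2) stab] Ti_gen[OF s(1)] L_reflect[OF assms(1)] by simp
  also have "\<dots> = T ?s \<star> T a - kap (wt d 0) \<odot> T a" using T_H[OF stab(1)] by (simp add: mm_diff mm_scale)
  finally have "T ?s \<star> X a = X (?s o a) + bsum d a (lev a d)" using b X_Dom[OF stab_Dom[OF stab]] by simp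
  then show ?case .
next
  case (gen x t)
  let ?s = "reflect d" and ?b = "cr x t" and ?y = "x o t"
  have d: "d \<in> \<Phi>" "d \<in> Pos" "d \<noteq> 0" using simple_root assms root_neq_0 by auto
  have s: "?s \<in> gens" "?s \<in> We" using reflect_gens gens_We assms by auto
  note xa = We_aff[OF gen(1)]
  have y: "?y \<in> We" and sx: "?s o x \<in> We" using We_comp gens_We gen s by auto
  have tW: "t \<in> We" using gens_We gen by blast
  have b: "?b \<in> \<Phi>" using cr(1)[OF xa gen(2)] .
  have "lin ?s = ?s" using lin_affine_refl by blast
  then have csx: "cr (?s o x) t = ?s ?b" using cr(5)[OF xa gen(2) We_aff[OF s(2)]] by simp
  have Xy: "X x \<star> Tsgn x t = X ?y" using X_step gen by blast
  have Xsy: "X (?s o x) \<star> Tsgn (?s o x) t = X (?s o ?y)" using X_step[OF sx gen(2)] by (simp add: comp_assoc)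
  have IH: "T ?s \<star> X ?y = X (?s o x) \<star> Tsgn x t + bsum d ?y (lev x d)"
  proof -
    have "T ?s \<star> X x = X (?s o x) + bsum d x (lev x d)" using gen(4) by (simp add: comp_def)
    then show ?thesis using bsum_step[OF d(1) gen(1,2)]
      by (simp add: Xy[symmetric] mm_assoc[symmetric] mm_add del: comp_apply)
  qed
  have wt: "wt ?b (lev x ?b + 1) = L t" using wt_cr_We gen by blast
  have yx: "?y = affine_refl ?b (lev x ?b + 1) o x" using cr(4)[OF xa gen(2)] .
  have xy: "affine_refl ?b (lev x ?b + 1) o ?y = x"
    unfolding yx using reflect_comp[OF b] by (simp flip: comp_assoc)
  have TiT: "h \<star> Ti t = h \<star> T t - kap (L t) \<odot> h" if "h \<in> HH" for h
    using Ti_gen[OF gen(2)] that by (simp add: mm_diff mm_scale)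
  have "T ?s \<star> X ?y = X (?s o ?y) + bsum d ?y (lev ?y d)"
  proof (cases "?b = d \<or> ?b = - d")
    case False
    have rP: "?s ?b \<in> Pos \<longleftrightarrow> ?b \<in> Pos"
    proof (cases "?b \<in> Pos")
      case True
      then show ?thesis using refl_pos[OF True assms(1)] False by simp
    next
      case n: False
      then have "- ?b \<in> Pos" using uminus_pos_iff b by blast
      then have "?s (- ?b) \<in> Pos" using refl_pos[of "- ?b" d] assms(1) False by fastforce
      then show ?thesis using n reflect_uminus[of d ?b] uminus_pos_iff[OF refl_root[OF d(1) b]] by simp
    qed
    then have "Tsgn (?s o x) t = Tsgn x t" using csx by (simp add: Tsgn_def)
    moreover have "lev ?y d = lev x d" using cr(3)[OF xa gen(2) d(1)] False by (metis minus_minus)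
    ultimately show ?thesis using IH Xsy by simp
  next
    case True
    then show ?thesis
    proof
      assume bd: "?b = d"
      let ?j = "lev x d"
      have ly: "lev ?y d = ?j + 1" using cr(2)[OF xa gen(2)] bd by simp
      have "?s d = - d" using refl_self d(3) by blast
      then have "Tsgn (?s o x) t = Ti t" using csx bd uminus_pos_iff[OF d(1)] d(2) by (simp add: Tsgn_def)
      then have Xs: "X (?s o x) \<star> T t = X (?s o ?y) + kap (L t) \<odot> X (?s o x)"
        using Xsy TiT[OF X_H, of "?s o x"] by (simp add: diff_eq_eq)
      have "?s o x = ?s o (affine_refl d (?j + 1) o ?y)" using xy unfolding bd by (simp only:)
      also have "\<dots> = transl (- of_int (?j + 1) *\<^sub>R d) o ?y"
        unfolding comp_assoc[symmetric] reflect_affine_refl[OF d(3)] ..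
      finally have sx': "?s o x = transl (- of_int (?j + 1) *\<^sub>R d) o ?y" .
      have Tt: "Tsgn x t = T t" using bd d(2) by (simp add: Tsgn_def)
      have Lt: "L t = wt d (?j + 1)" using wt bd by simp
      have "T ?s \<star> X ?y = X (?s o ?y) + (bsum d ?y ?j + kap (L t) \<odot> X (?s o x))" using IH Xs Tt by simp
      also have "bsum d ?y ?j + kap (L t) \<odot> X (?s o x) = bsum d ?y (?j + 1)" unfolding bsum_Suc Lt sx' ..
      finally show ?thesis unfolding ly .
    next
      assume bd: "?b = - d"
      let ?j = "lev x d"
      have xm: "lev x (- d) = - ?j - 1" using lev_uminus[OF xa d(1)] .
      have "lev ?y (- d) = - ?j" using cr(2)[OF xa gen(2)] bd xm by simp
      then have ly: "lev ?y d = ?j - 1" using lev_uminus[OF We_aff[OF y] d(1)] by simp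
      have "?s (- d) = d" using refl_self[OF d(3)] reflect_uminus[of d d] by simp
      then have "Tsgn (?s o x) t = T t" using csx bd d(2) by (simp add: Tsgn_def)
      then have Xs: "X (?s o x) \<star> Ti t = X (?s o ?y) - kap (L t) \<odot> X (?s o x)"
        using Xsy TiT[OF X_H, of "?s o x"] by simp
      have "affine_refl (- d) (- ?j) = affine_refl d ?j" by (rule affine_refl_uminus)
      then have "?s o x = ?s o (affine_refl d ?j o ?y)" using xy unfolding bd xm by simp
      also have "\<dots> = transl (- of_int ?j *\<^sub>R d) o ?y"
        unfolding comp_assoc[symmetric] reflect_affine_refl[OF d(3)] ..
      finally have sx': "?s o x = transl (- of_int ?j *\<^sub>R d) o ?y" .
      have Tt: "Tsgn x t = Ti t" using bd uminus_pos_iff[OF d(1)] d(2) by (simp add: Tsgn_def)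
      have "wt (- d) (- ?j) = L t" using wt bd xm by simp
      then have Lt: "L t = wt d ?j" using wt_uminus by simp
      have "bsum d ?y ?j = bsum d ?y (?j - 1) + kap (L t) \<odot> X (?s o x)"
        using bsum_Suc[of d ?y "?j - 1"] unfolding Lt sx' by simp
      then show ?thesis using IH Xs Tt ly by simp
    qed
  qed
  then show ?case .
qed

lemma reflect_transl: "d \<in> \<Phi> ==> reflect d o transl n = transl (reflect d n) o reflect d"
  using linear_refl linear_add by (fastforce simp: fun_eq_iff transl_def)

text \<open>Replacing \<open>X (reflect d o transl \<nu>)\<close> by
  \<open>E (reflect d \<nu>) \<star> T (reflect d)\<close> costs \<open>kap (wt d 0)\<close> times
  \<open>E (reflect d \<nu>)\<close>. This is the last summand, of index \<open>n\<close>, in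
  \<open>bernstein_X\<close>; hence \<open>n - 1\<close>.\<close>

lemma bernstein:
  assumes "d \<in> \<Delta>" "\<nu> \<in> P" "\<nu> \<cdot> d = of_int n"
  shows "T (reflect d) \<star> E \<nu> = E (reflect d \<nu>) \<star> T (reflect d) + bsum d (transl \<nu>) (n - 1)"
proof -
  let ?s = "reflect d"
  have d: "d \<in> \<Phi>" "d \<in> Pos" using simple_root assms by auto
  have s: "?s \<in> gens" "?s \<in> We" using reflect_gens gens_We assms by auto
  have s\<nu>: "?s \<nu> \<in> P" using P_weyl assms(2) reflect_weyl d by blast
  have tW: "transl (?s \<nu>) \<in> We" using transl_We s\<nu> by blast
  have "of_int (lev (transl \<nu>) d) = (of_int n :: real)"
    using lev_transl[OF P_intwt[OF assms(2)] d(1), of id] lev_id_pos[OF d(2)] assms(3) by simp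
  then have lev: "lev (transl \<nu>) d = n" by simp
  have "cr (transl (?s \<nu>)) ?s = - d" using cr_simple[OF We_aff[OF tW] assms(1)] by (simp add: lin_transl_id)
  then have "Tsgn (transl (?s \<nu>)) ?s = Ti ?s" using uminus_pos_iff[OF d(1)] d(2) by (simp add: Tsgn_def)
  then have "X (?s o transl \<nu>) = E (?s \<nu>) \<star> Ti ?s" using X_step[OF tW s(1)] reflect_transl[OF d(1)] by simp
  also have "\<dots> = E (?s \<nu>) \<star> T ?s - kap (wt d 0) \<odot> E (?s \<nu>)"
    using Ti_gen[OF s(1)] L_reflect[OF assms(1)] by (simp add: mm_diff mm_scale)
  finally have 1: "T ?s \<star> E \<nu> = E (?s \<nu>) \<star> T ?s - kap (wt d 0) \<odot> E (?s \<nu>) + bsum d (transl \<nu>) n"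
    using bernstein_X[OF assms(1) transl_We[OF assms(2)]] lev by simp
  have "transl (- of_int n *\<^sub>R d) o transl \<nu> = transl (?s \<nu>)" using assms(3) by (simp add: transl_comp refl_eq)
  moreover have "wt d (0 + n) = wt d 0" using P_wt[OF assms(2) d(1) assms(3)] by blast
  ultimately have "bsum d (transl \<nu>) n = bsum d (transl \<nu>) (n - 1) + kap (wt d 0) \<odot> E (?s \<nu>)"
    using bsum_Suc[of d "transl \<nu>" "n - 1"] by simp
  then show ?thesis using 1 by simp
qed

end

section \<open>Sums over integer intervals with orientation\<close>

text \<open>The sum over the indices from \<open>-n\<close> to \<open>-1\<close>, continued to
  negative \<open>n\<close> like an oriented integral, so that the formulas for root strings hold on
  both sides of a wall.\<close>

definition isum :: "(int => 'a::ab_group_add) => int => 'a" where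
  "isum F n = sum F {-n..-1} - sum F {0..-n-1}"

lemma isum_cong: "(\<And>i. F i = G i) ==> isum F n = isum G n" by (simp add: isum_def)

lemma isum_shift: "F 0 + isum F n = F (- n) + isum (\<lambda>i. F (i + 1)) n"
proof (cases "n \<ge> 0")
  case True
  have "(\<Sum>i\<in>{-n..-1}. F (i + 1)) = sum F {1-n..0}"
    by (rule sum.reindex_bij_witness[of _ "\<lambda>i. i - 1" "\<lambda>i. i + 1"]) auto
  moreover have "insert 0 {-n..-1} = insert (-n) {1-n..0}" using True by auto
  then have "sum F (insert 0 {-n..-1}) = sum F (insert (-n) {1-n..0})" by (rule arg_cong)
  ultimately show ?thesis using True by (simp add: isum_def)
next
  case False
  have "(\<Sum>i\<in>{0..-n-1}. F (i + 1)) = sum F {1..-n}"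
    by (rule sum.reindex_bij_witness[of _ "\<lambda>i. i - 1" "\<lambda>i. i + 1"]) auto
  moreover have "insert 0 {1..-n} = insert (-n) {0..-n-1}" using False by auto
  then have "sum F (insert 0 {1..-n}) = sum F (insert (-n) {0..-n-1})" by (rule arg_cong)
  ultimately show ?thesis using False by (simp add: isum_def algebra_simps)
qed

lemma isum_reflect: "isum (\<lambda>i. F (- n - 1 - i)) n = isum F n"
proof -
  have "(\<Sum>i\<in>{-n..-1}. F (- n - 1 - i)) = sum F {-n..-1}"
    by (rule sum.reindex_bij_witness[of _ "\<lambda>i. - n - 1 - i" "\<lambda>i. - n - 1 - i"]) auto
  moreover have "(\<Sum>i\<in>{0..-n-1}. F (- n - 1 - i)) = sum F {0..-n-1}"
    by (rule sum.reindex_bij_witness[of _ "\<lambda>i. - n - 1 - i" "\<lambda>i. - n - 1 - i"]) auto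
  ultimately show ?thesis by (simp add: isum_def)
qed

lemma isum_neg: "isum (\<lambda>i. F (n + i)) n = - isum F (- n)"
proof -
  have "(\<Sum>i\<in>{-n..-1}. F (n + i)) = sum F {0..n-1}"
    by (rule sum.reindex_bij_witness[of _ "\<lambda>i. i - n" "\<lambda>i. n + i"]) auto
  moreover have "(\<Sum>i\<in>{0..-n-1}. F (n + i)) = sum F {n..-1}"
    by (rule sum.reindex_bij_witness[of _ "\<lambda>i. i - n" "\<lambda>i. n + i"]) auto
  ultimately show ?thesis by (simp add: isum_def)
qed

lemma sum_dvd:
  fixes d :: int
  assumes "finite A" "d > 0" "\<And>i. \<not> d dvd i ==> F i = 0"
  shows "sum F A = (\<Sum>i\<in>(\<lambda>i. d * i) -` A. F (d * i))"
proof -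
  have "sum F A = sum F ((\<lambda>i. d * i) ` ((\<lambda>i. d * i) -` A))"
    using assms(1,3) by (intro sum.mono_neutral_right) (auto simp: dvd_def)
  then show ?thesis using assms(2) by (subst (asm) sum.reindex) (auto simp: inj_on_def)
qed

lemma isum_dvd:
  assumes "d > 0" "\<And>i. \<not> d dvd i ==> F i = 0" shows "isum F (d * k) = isum (\<lambda>i. F (d * i)) k"
proof -
  have "- (d * k) \<le> d * i \<longleftrightarrow> - k \<le> i" "d * i \<le> -1 \<longleftrightarrow> i \<le> -1"
       "0 \<le> d * i \<longleftrightarrow> 0 \<le> i" "d * i \<le> - (d * k) - 1 \<longleftrightarrow> i \<le> - k - 1" for i
  proof -
    show "- (d * k) \<le> d * i \<longleftrightarrow> - k \<le> i" using mult_le_cancel_left_pos[OF assms(1), of "- k" i] by simp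
    show "d * i \<le> -1 \<longleftrightarrow> i \<le> -1" using mult_less_cancel_left_pos[OF assms(1), of i 0] by auto
    show "0 \<le> d * i \<longleftrightarrow> 0 \<le> i" using assms(1) by (simp add: zero_le_mult_iff)
    show "d * i \<le> - (d * k) - 1 \<longleftrightarrow> i \<le> - k - 1" using mult_less_cancel_left_pos[OF assms(1), of i "- k"] by auto
  qed
  then have "(\<lambda>i. d * i) -` {-(d * k)..-1} = {-k..-1}" "(\<lambda>i. d * i) -` {0..-(d * k)-1} = {0..-k-1}" by auto
  then show ?thesis using sum_dvd[where A = "{-(d * k)..-1}", OF finite_atLeastAtMost_int assms]
      sum_dvd[where A = "{0..-(d * k)-1}", OF finite_atLeastAtMost_int assms] by (simp add: isum_def)
qed

lemma eq_uminus_0: fixes h :: "'a \<Rightarrow>\<^sub>0 laurent" assumes "h = - h" shows "h = 0"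
proof (intro poly_mapping_eqI)
  fix w n
  have "coef (coef h w) n = - coef (coef h w) n" using arg_cong[OF assms, of "\<lambda>h. coef (coef h w) n"] by simp
  then show "coef (coef h w) n = coef (coef 0 w) n" by simp
qed

text \<open>On Laurent polynomials of degree at most 0 this is the ring homomorphism killing the
  negative degrees; the value is kept as a Laurent polynomial so that it can again act as a
  scalar.\<close>

definition c0 :: "laurent => laurent" where "c0 p = Poly_Mapping.single 0 (coef p 0)"

lemma c0_simps [simp]: "c0 0 = 0" "c0 1 = 1" "c0 (p + q) = c0 p + c0 q" "c0 (p - q) = c0 p - c0 q"
  by (simp_all add: c0_def lookup_add lookup_minus single_add single_diff lookup_one)

lemma c0_sum: "c0 (sum f A) = (\<Sum>i\<in>A. c0 (f i))" by (induction A rule: infinite_finite_induct) auto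

lemma c0_Ld: "p \<in> Ld 0 ==> p - c0 p \<in> Ld (-1)" "p \<in> Ld 0 ==> c0 p \<in> Ld 0" "p \<in> Ld (-1) ==> c0 p = 0"
proof -
  show "p \<in> Ld 0 ==> p - c0 p \<in> Ld (-1)" unfolding c0_def by (rule Ld_diff_const)
  show "p \<in> Ld 0 ==> c0 p \<in> Ld 0" unfolding c0_def by (rule Ld_const) (simp add: Ld_def)
  show "p \<in> Ld (-1) ==> c0 p = 0" by (simp add: c0_def Ld_neg_iff)
qed

lemma c0_mult: assumes "p \<in> Ld 0" "q \<in> Ld 0" shows "c0 (p * q) = c0 p * c0 q"
proof -
  have "(p - c0 p) * q \<in> Ld (-1)" "c0 p * (q - c0 q) \<in> Ld (-1)"
    using Ld_mult[OF c0_Ld(1)[OF assms(1)] assms(2)] Ld_mult[OF c0_Ld(2)[OF assms(1)] c0_Ld(1)[OF assms(2)]] by simp_all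
  then have "c0 ((p - c0 p) * q) = 0" "c0 (c0 p * (q - c0 q)) = 0" using c0_Ld(3) by blast+
  moreover have "p * q = (p - c0 p) * q + (c0 p * (q - c0 q) + c0 p * c0 q)" by (simp add: algebra_simps)
  ultimately have "c0 (p * q) = c0 (c0 p * c0 q)" by (metis add_0 c0_simps(3))
  then show ?thesis by (simp add: c0_def mult_single lookup_single)
qed

text \<open>After division by the heaviest power of \<open>q\<close>, only hyperplanes of maximal
  weight leave a constant term: here the lighter parallel hyperplanes disappear.\<close>

lemma c0_scaled_kap: assumes "b > 0" "w > 0" "w \<le> b" shows "q_pow (- int b) * kap w \<in> Ld 0"
  "c0 (q_pow (- int b) * kap w) = (if w = b then 1 else 0)"
proof -
  have *: "q_pow (- int b) * kap w = q_pow (int w - int b) - q_pow (- int b - int w)"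
    by (simp add: kap_def right_diff_distrib q_pow_add add.commute)
  show "q_pow (- int b) * kap w \<in> Ld 0" unfolding * using assms by (intro Ld_diff Ld_mono[OF q_pow_Ld]) auto
  show "c0 (q_pow (- int b) * kap w) = (if w = b then 1 else 0)"
    unfolding * using assms by (simp add: c0_def q_pow_def lookup_minus lookup_single when_def)
qed

context weighted_root_system
begin

lemma weyl_induct [consumes 1, case_names id step]:
  assumes "w \<in> weyl" "Q id"
    and step: "\<And>w z. w \<in> weyl ==> z \<in> \<Delta> ==> w z \<in> Pos ==> Q w ==> Q (w o reflect z)"
  shows "Q w"
proof -
  have "w \<in> weyl ==> len w = n ==> Q w" for n w
  proof (induction n arbitrary: w)
    case 0
    then have "w = id" using affine_weyl_len_0 weyl_affine by blast
    then show ?case using assms(2) by (simp only:)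
  next
    case (Suc n)
    then obtain z where z: "z \<in> \<Delta>" "w z \<notin> Pos" using exists_descent_weyl by (metis zero_less_Suc)
    have d: "z \<in> \<Phi>" using z simple_subset by blast
    let ?w = "w o reflect z"
    have w: "?w \<in> weyl" using weyl_comp[OF Suc(2) reflect_weyl[OF d]] .
    have "?w z = - w z" using refl_self[OF root_neq_0[OF d]] weyl_uminus[OF Suc(2)] by simp
    then have "?w z \<in> Pos" using uminus_pos_iff[OF weyl_root[OF Suc(2) d]] z by simp
    moreover have "len ?w = n" using len_reflect(2)[OF Suc(2) z] Suc(3) by simp
    then have "Q ?w" by (rule Suc(1)[OF w])
    ultimately have "Q (?w o reflect z)" using step w z by blast
    then show ?case using reflect_comp[OF d, of 0] by (simp only: comp_assoc comp_id)
  qed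
  then show ?thesis using assms(1) by blast
qed

section \<open>Spacing of the heaviest hyperplanes and the shift by rho\<close>

abbreviation \<rho> :: 'v where "\<rho> \<equiv> rho \<Phi> \<Delta> L"

text \<open>The spacing of the hyperplanes of maximal weight in direction \<open>a\<close>; the
  multiples \<open>dd a\<close> of the roots \<open>a\<close> form the root system that governs
  \<open>P\<close>.\<close>

definition dd :: "'v => int" where "dd a = (if wt a 1 = wt a 0 then 1 else 2)"

lemma dd_weyl: "w \<in> weyl ==> a \<in> \<Phi> ==> dd (w a) = dd a" by (simp add: dd_def wt_weyl)

lemma dd_pos: "dd a > 0" by (simp add: dd_def)

lemma dd_dvd: assumes "a \<in> \<Phi>" shows "dd a dvd i \<longleftrightarrow> wt a i = wt a 0"
  using wt_parity[OF assms, of i] by (auto simp: dd_def)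

lemma dd_dvd_P: assumes "a \<in> \<Phi>" "\<nu> \<in> P" "\<nu> \<cdot> a = of_int n" shows "dd a dvd n"
  using dd_dvd[OF assms(1)] P_wt[OF assms(2,1,3), of 0] by simp

lemma rho_eq: "\<rho> = (1/2) *\<^sub>R (\<Sum>a\<in>Pos. of_int (dd a) *\<^sub>R a)"
proof -
  have "(if \<forall>n. hyperplane_weight \<Phi> \<Delta> L (hyperplane a n) = root_weight \<Phi> \<Delta> L a then a else 2 *\<^sub>R a)
      = of_int (dd a) *\<^sub>R a" if "a \<in> Pos" for a
  proof -
    have "(\<forall>n. wt a n = wt a 0) \<longleftrightarrow> wt a 1 = wt a 0" using wt_parity[of a] that pos_subset by (metis subsetD)
    then show ?thesis unfolding root_weight_eq[OF that] by (simp add: dd_def wt_def)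
  qed
  then show ?thesis unfolding rho_def by (simp cong: sum.cong)
qed

lemma rho_half_sum: "\<rho> = half_sum dd" by (simp add: rho_eq half_sum_def)

lemma reflect_rho: "d \<in> \<Delta> ==> reflect d \<rho> = \<rho> - of_int (dd d) *\<^sub>R d"
  unfolding rho_half_sum by (rule reflect_half_sum) (simp_all add: dd_weyl)

lemma rho_P: "\<rho> \<in> P"
proof (rule P_I)
  fix r assume b: "r \<in> Pos"
  then have r: "r \<in> \<Phi>" using pos_subset by blast
  from half_sum_level[OF _ b, of dd] obtain j where "\<rho> \<cdot> r = of_int j" "dd r dvd j"
    unfolding rho_half_sum using dd_weyl by (auto simp: dd_def split: if_splits)
  then show "\<exists>j. \<rho> \<cdot> r = of_int j \<and> wt r j = wt r 0" using dd_dvd[OF r] by blast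
qed

text \<open>Along a reduced word every step subtracts a positive multiple of a positive root. So the
  leading term of the Weyl denominator is unique.\<close>

lemma rho_htvec: assumes "w \<in> weyl" "w \<noteq> id" shows "w \<rho> \<bullet> htvec < \<rho> \<bullet> htvec"
proof -
  have lt: "(w o reflect d) \<rho> \<bullet> htvec < w \<rho> \<bullet> htvec" if "w \<in> weyl" "d \<in> \<Delta>" "w d \<in> Pos" for w d
  proof -
    have "(w o reflect d) \<rho> = w \<rho> - of_int (dd d) *\<^sub>R w d"
      using reflect_rho[OF that(2)] weyl_linear[OF that(1)] by (simp add: linear_diff linear_scale)
    moreover have "w d \<bullet> htvec > 0" using pos_iff that pos_subset by blast
    ultimately show ?thesis using dd_pos by (simp add: inner_diff_left)
  qed
  have "w = id \<or> w \<rho> \<bullet> htvec < \<rho> \<bullet> htvec" using assms(1)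
  proof (induction rule: weyl_induct)
    case (step w d)
    have "w \<rho> \<bullet> htvec \<le> \<rho> \<bullet> htvec" using step(4) by auto
    then show ?case using lt[OF step(1-3)] by linarith
  qed simp
  then show ?thesis using assms(2) by blast
qed

end

section \<open>Formal combinations of translations\<close>

context affine_hecke
begin

abbreviation e :: "'v => 'v hecke" where "e n \<equiv> T (transl n)"

text \<open>Combinations of the \<open>e \<nu>\<close> stand for elements of the group algebra of \<open>P\<close>.\<close>

definition lext :: "('v => 'v hecke) => 'v hecke => 'v hecke" where
  "lext D f = (\<Sum>x\<in>keys f. coef f x \<odot> D (x 0))"

lemma lext_extend: "finite A ==> keys f \<subseteq> A ==> lext D f = (\<Sum>x\<in>A. coef f x \<odot> D (x 0))"
  unfolding lext_def by (rule sum.mono_neutral_left) (auto simp: in_keys_iff hscale_simps)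

lemma lext_e [simp]: "lext D (e n) = D n" by (simp add: lext_def coef_hT hscale_simps transl_def)

lemma lext_add: "lext D (f + g) = lext D f + lext D g"
proof -
  have "finite (keys f \<union> keys g)" "keys (f + g) \<subseteq> keys f \<union> keys g" using keys_add[of f g] by simp_all
  then show ?thesis by (simp add: lext_extend[of "keys f \<union> keys g"] lookup_add hscale_simps sum.distrib)
qed

lemma lext_scale: "lext D (c \<odot> f) = c \<odot> lext D f"
  using lext_extend[of "keys f" "c \<odot> f" D] keys_hscale[of c f] by (simp add: lext_def hscale_sum hscale_simps)

lemma lext_diff: "lext D (f - g) = lext D f - lext D g" using lext_add[of D "f - g" g] by simp

lemma lext_0 [simp]: "lext D 0 = 0" by (simp add: lext_def)

lemma lext_sum: "lext D (sum f A) = (\<Sum>i\<in>A. lext D (f i))"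
  by (induction A rule: infinite_finite_induct) (simp_all add: lext_add)

lemma lext_isum: "lext D (isum f n) = isum (\<lambda>i. lext D (f i)) n" by (simp add: isum_def lext_diff lext_sum)

lemma lext_hom:
  assumes "\<And>x y. h (x + y) = h x + h y" "\<And>c x. h (c \<odot> x) = c \<odot> h x"
  shows "h (lext D f) = lext (\<lambda>n. h (D n)) f"
proof -
  have "h 0 = 0" using assms(2)[of 0 0] by (simp add: hscale_simps)
  then have "h (sum g A) = (\<Sum>i\<in>A. h (g i))" for g :: "('v => 'v) => 'v hecke" and A
    by (induction A rule: infinite_finite_induct) (simp_all add: assms)
  then show ?thesis by (simp add: lext_def assms)
qed

lemma lext_lext: "lext G (lext D f) = lext (\<lambda>n. lext G (D n)) f"
  by (rule lext_hom) (simp_all add: lext_add lext_scale)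

lemma lext_mult: "k \<star> lext D f \<star> h = lext (\<lambda>n. k \<star> D n \<star> h) f"
  by (rule lext_hom[of "\<lambda>x. k \<star> x \<star> h"]) (simp_all add: mm_add mm_scale)

lemma lext_scaled: "lext (\<lambda>n. c \<odot> D n) f = c \<odot> lext D f"
  by (simp add: lext_def hscale_simps hscale_sum mult.commute)

lemma lext_sum_fun: "lext (\<lambda>n. \<Sum>i\<in>A. D i n) f = (\<Sum>i\<in>A. lext (D i) f)"
  by (simp add: lext_def hscale_sum) (rule sum.swap)

definition LP :: "'v hecke set" where "LP = {f. keys f \<subseteq> transl ` P}"

lemma LP_simps: "0 \<in> LP" "f \<in> LP ==> g \<in> LP ==> f + g \<in> LP" "f \<in> LP ==> g \<in> LP ==> f - g \<in> LP" "f \<in> LP ==> c \<odot> f \<in> LP"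
  "n \<in> P ==> e n \<in> LP" using keys_add[of f g] keys_diff[of f g] keys_hscale[of c f] by (auto simp: LP_def)

lemma LP_sum: "(\<And>i. i \<in> A ==> f i \<in> LP) ==> sum f A \<in> LP"
  by (induction A rule: infinite_finite_induct) (auto simp: LP_simps)

lemma lext_cong: assumes "f \<in> LP" "\<And>n. n \<in> P ==> D n = G n" shows "lext D f = lext G f"
  using assms unfolding lext_def LP_def by (intro sum.cong) (auto simp: transl_def)

lemma lext_in:
  assumes "f \<in> LP" "\<And>n. n \<in> P ==> D n \<in> A" "0 \<in> A" "\<And>x y. x \<in> A ==> y \<in> A ==> x + y \<in> A" "\<And>c x. x \<in> A ==> c \<odot> x \<in> A"
  shows "lext D f \<in> A"
proof -
  have sum: "sum g B \<in> A" if "\<And>x. x \<in> B ==> g x \<in> A" for g :: "('v => 'v) => 'v hecke" and B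
    using that by (induction B rule: infinite_finite_induct) (auto intro: assms)
  have "x 0 \<in> P" if "x \<in> keys f" for x using that assms(1) by (auto simp: LP_def transl_def)
  then show ?thesis unfolding lext_def by (intro sum assms(5) assms(2))
qed

lemma lext_LP: "f \<in> LP ==> (\<And>n. n \<in> P ==> D n \<in> LP) ==> lext D f \<in> LP" by (rule lext_in) (auto simp: LP_simps)

lemma lext_id: "f \<in> LP ==> lext e f = f"
proof -
  assume f: "f \<in> LP"
  have "lext e f = (\<Sum>x\<in>keys f. coef f x \<odot> T x)"
    unfolding lext_def using f by (intro sum.cong) (auto simp: LP_def transl_def)
  then show ?thesis using hecke_expand[of f] by simp
qed

lemma exists_common_dominant:
  assumes "finite M" "M \<subseteq> P" shows "\<exists>z\<in>Pp. \<forall>n\<in>M. n + z \<in> Pp" using assms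
proof (induction M rule: finite_induct)
  case (insert \<mu> M)
  then obtain z where d: "z \<in> Pp" "\<forall>n\<in>M. n + z \<in> Pp" by auto
  obtain \<mu>1 \<mu>2 where m: "\<mu>1 \<in> Pp" "\<mu>2 \<in> Pp" "\<mu> = \<mu>1 - \<mu>2" using P_diff_dominant[of \<mu>] insert by auto
  have "n + (z + \<mu>2) \<in> Pp" if "n \<in> insert \<mu> M" for n
  proof (cases "n = \<mu>")
    case True
    then show ?thesis using Pp_add[OF m(1) d(1)] m(3) by simp
  next
    case False
    then show ?thesis using Pp_add[of "n + z" \<mu>2] d m that by (simp add: add.assoc)
  qed
  then show ?case using Pp_add[OF d(1) m(2)] by blast
qed (use Pp_0 in auto)

lemma E_dominant: "n \<in> Pp ==> E n = e n" by (rule X_Dom[OF transl_Dom])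

text \<open>Multiplication by \<open>E d\<close> with \<open>d\<close> sufficiently dominant moves
  the finite support into dominant translations, where \<open>E\<close> is \<open>T\<close> and the
  coefficients can be read off at \<open>w0 o z\<close>.\<close>

lemma C0_lext_E_inj: assumes "f \<in> LP" "C0 \<star> lext E f = 0" shows "f = 0"
proof -
  have "finite ((\<lambda>x. x 0) ` keys f)" "(\<lambda>x. x 0) ` keys f \<subseteq> P" using assms(1) by (auto simp: LP_def transl_def)
  from exists_common_dominant[OF this]
  obtain d where d: "d \<in> Pp" "\<forall>x\<in>keys f. x 0 + d \<in> Pp" by auto
  define k where "k = (\<Sum>x\<in>keys f. coef f x \<odot> e (x 0 + d))"
  have x: "x = transl (x 0)" "x 0 \<in> P" if "x \<in> keys f" for x using assms(1) that by (auto simp: LP_def transl_def)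
  have "lext E f \<star> E d = k" unfolding lext_def k_def mm_sum mm_scale
    using x(2) d(2) by (intro sum.cong refl) (simp add: E_add[OF _ Pp_P[OF d(1)]] E_dominant)
  then have 0: "C0 \<star> k = 0" using assms(2) by (metis mm_0(1) mm_assoc)
  have kD: "keys k \<subseteq> Dom"
    unfolding k_def using keys_sum_scale[of "coef f" "\<lambda>x. e (x 0 + d)" "keys f"] d(2) transl_Dom by fastforce
  have "coef f x = 0" if a: "x \<in> keys f" for x
  proof -
    have "coef k (transl (x 0 + d)) = (\<Sum>y\<in>keys f. coef f y * (if x = y then 1 else 0))"
      unfolding k_def lookup_sum
    proof (intro sum.cong refl)
      fix y assume y: "y \<in> keys f"
      have "transl (x 0 + d) = transl (y 0 + d) \<longleftrightarrow> x = y"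
        using x(1)[OF a] x(1)[OF y] by (metis add_right_cancel transl_def)
      then show "coef (coef f y \<odot> e (y 0 + d)) (transl (x 0 + d)) = coef f y * (if x = y then 1 else 0)"
        by (simp add: coef_hT)
    qed
    also have "\<dots> = coef f x" using a by (simp add: if_distrib cong: if_cong)
    finally show ?thesis using coef_C0_longest[OF kD transl_Dom, of "x 0 + d"] 0 d(2) a by simp
  qed
  then show ?thesis by (intro poly_mapping_eqI) (metis in_keys_iff lookup_zero)
qed

section \<open>Demazure operators\<close>

definition IL :: "'v hecke set" where "IL = {f. \<forall>x. coef f x \<in> Ld 0}"

lemma IL_simps: "0 \<in> IL" "f \<in> IL ==> g \<in> IL ==> f + g \<in> IL" "f \<in> IL ==> g \<in> IL ==> f - g \<in> IL"
  "f \<in> IL ==> c \<in> Ld 0 ==> c \<odot> f \<in> IL" "T x \<in> IL"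
  using Ld_mult[of _ 0 _ 0] by (auto simp: IL_def lookup_add lookup_minus coef_hT intro: Ld_add Ld_diff)

lemma IL_sum: "(\<And>i. i \<in> A ==> f i \<in> IL) ==> sum f A \<in> IL"
  by (induction A rule: infinite_finite_induct) (auto simp: IL_simps)

lemma lext_IL: "f \<in> IL ==> (\<And>n. D n \<in> IL) ==> lext D f \<in> IL"
  unfolding lext_def by (intro IL_sum IL_simps) (auto simp: IL_def)

definition ct :: "'v hecke => 'v hecke" where "ct f = Poly_Mapping.map c0 f"

lemma coef_ct [simp]: "coef (ct f) x = c0 (coef f x)" by (simp add: ct_def Poly_Mapping.map.rep_eq when_def)

lemma ct_simps: "ct (f + g) = ct f + ct g" "ct (f - g) = ct f - ct g" "ct (T x) = T x"
  by (rule poly_mapping_eqI; simp add: lookup_add lookup_minus coef_hT)+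

lemma ct_scale: "f \<in> IL ==> c \<in> Ld 0 ==> ct (c \<odot> f) = c0 c \<odot> ct f"
  by (rule poly_mapping_eqI) (simp add: c0_mult IL_def)

lemma ct_sum: "ct (sum f A) = (\<Sum>i\<in>A. ct (f i))" by (rule poly_mapping_eqI) (simp add: lookup_sum c0_sum)

lemma ct_scale_neg: "f \<in> IL ==> c \<in> Ld (-1) ==> ct (c \<odot> f) = 0"
  using ct_scale[of f c] c0_Ld(3)[of c] Ld_mono[of c "-1" 0] by (simp add: hscale_simps)

lemma ct_IL: "f \<in> IL ==> ct f \<in> IL" by (simp add: IL_def c0_Ld)

lemma ct_LP: "f \<in> LP ==> ct f \<in> LP" unfolding LP_def by (auto simp: in_keys_iff subset_iff) (metis c0_simps(1))

lemma ct_lext: assumes "f \<in> IL" "\<And>n. D n \<in> IL" shows "ct (lext D f) = lext (\<lambda>n. ct (D n)) (ct f)"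
proof -
  have "keys (ct f) \<subseteq> keys f" by (auto simp: in_keys_iff)
  then have "lext (\<lambda>n. ct (D n)) (ct f) = (\<Sum>x\<in>keys f. c0 (coef f x) \<odot> ct (D (x 0)))"
    using lext_extend[of "keys f" "ct f"] by simp
  also have "\<dots> = ct (lext D f)" using assms by (simp add: lext_def ct_sum ct_scale IL_def)
  finally show ?thesis by simp
qed

text \<open>The sum over the string between \<open>reflect d n\<close> and \<open>n\<close>. With
  \<open>qk d\<close> it describes the normalised action of \<open>T (reflect d)\<close> exactly;
  with \<open>dv d\<close>, the degree-0 part of \<open>qk d\<close>, it is the Demazure operator of
  the root \<open>dd d\<close> times \<open>d\<close>.\<close>

definition dem :: "(int => laurent) => 'v => 'v => 'v hecke" where
  "dem c d n = e (reflect d n) + isum (\<lambda>i. c i \<odot> e (reflect d n - of_int i *\<^sub>R d)) \<lfloor>n \<cdot> d\<rfloor>"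

abbreviation qk :: "'v => int => laurent" where "qk d i \<equiv> q_pow (- int (wt d 0)) * kap (wt d i)"
abbreviation dv :: "'v => int => laurent" where "dv d i \<equiv> (if dd d dvd i then 1 else 0)"

lemma qk: assumes "d \<in> \<Phi>" shows "qk d i \<in> Ld 0" "c0 (qk d i) = dv d i"
  using c0_scaled_kap[of "wt d 0" "wt d i"] wt_pos[OF assms] wt_le_0[OF assms, of i] dd_dvd[OF assms] by auto

lemma dem_LP: assumes "d \<in> \<Phi>" "n \<in> P" shows "dem c d n \<in> LP"
proof -
  have "reflect d n - of_int i *\<^sub>R d \<in> P" for i
    using P_diff[OF P_weyl[OF assms(2) reflect_weyl] P_scale_root] assms by blast
  then show ?thesis unfolding dem_def isum_def
    using P_weyl[OF assms(2) reflect_weyl[OF assms(1)]] by (intro LP_simps(2-5) LP_sum) auto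
qed

lemma dem_IL: "(\<And>i. c i \<in> Ld 0) ==> dem c d n \<in> IL"
  unfolding dem_def isum_def by (intro IL_simps(2-5) IL_sum) auto

lemma ct_dem: assumes "d \<in> \<Phi>" shows "ct (dem (qk d) d n) = dem (dv d) d n"
  unfolding dem_def isum_def using qk[OF assms] by (simp add: ct_simps ct_sum ct_scale IL_simps)

text \<open>Bernstein's relation is applied to \<open>reflect d \<nu>\<close>, which puts
  \<open>E \<nu>\<close> to the left of \<open>T (reflect d)\<close>; in the other main term
  \<open>C0\<close> absorbs \<open>T (reflect d)\<close> as a power of \<open>q\<close>.\<close>

lemma C0_E_T:
  assumes "d \<in> \<Delta>" "\<nu> \<in> P"
  shows "C0 \<star> E \<nu> \<star> T (reflect d) = q_pow (int (wt d 0)) \<odot> (C0 \<star> lext E (dem (qk d) d \<nu>))"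
proof -
  let ?s = "reflect d" and ?b = "q_pow (int (wt d 0))" and ?n = "\<lfloor>\<nu> \<cdot> d\<rfloor>"
  have d: "d \<in> \<Phi>" using simple_root assms by blast
  have n: "\<nu> \<cdot> d = of_int ?n" using P_int[OF assms(2) d] by auto
  have sP: "?s \<nu> \<in> P" using P_weyl assms(2) reflect_weyl d by blast
  have "?s \<nu> \<cdot> d = of_int (- ?n)" using inner_refl_left[OF root_neq_0[OF d], of \<nu> "coroot d"] n
    by (simp add: coroot_refl[symmetric] refl_self root_neq_0[OF d] coroot_uminus)
  from bernstein[OF assms(1) sP this]
  have "C0 \<star> (T ?s \<star> E (?s \<nu>)) = C0 \<star> (E \<nu> \<star> T ?s) + C0 \<star> bsum d (transl (?s \<nu>)) (- ?n - 1)"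
    by (simp add: mm_add reflect_reflect[OF d])
  then have 1: "C0 \<star> E \<nu> \<star> T ?s = ?b \<odot> (C0 \<star> E (?s \<nu>)) - C0 \<star> bsum d (transl (?s \<nu>)) (- ?n - 1)"
    by (simp add: C0_right[OF assms(1)] mm_scale flip: mm_assoc)
  have "transl (- of_int i *\<^sub>R d) o transl (?s \<nu>) = transl (?s \<nu> - of_int i *\<^sub>R d)" for i
    by (simp add: transl_comp)
  then have 2: "- bsum d (transl (?s \<nu>)) (- ?n - 1) = isum (\<lambda>i. kap (wt d i) \<odot> E (?s \<nu> - of_int i *\<^sub>R d)) ?n"
    by (simp add: bsum_def isum_def)
  have bb: "?b * qk d i = kap (wt d i)" for i by (simp add: mult.assoc[symmetric] q_pow_add)
  have "?b \<odot> isum (\<lambda>i. qk d i \<odot> E (?s \<nu> - of_int i *\<^sub>R d)) ?n = isum (\<lambda>i. kap (wt d i) \<odot> E (?s \<nu> - of_int i *\<^sub>R d)) ?n"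
    by (simp add: isum_def hscale_simps(3,9) hscale_sum bb)
  then have "?b \<odot> lext E (dem (qk d) d \<nu>) = ?b \<odot> E (?s \<nu>) - bsum d (transl (?s \<nu>)) (- ?n - 1)"
    using 2 by (simp add: dem_def lext_add lext_isum lext_scale hscale_simps(1))
  then show ?thesis using 1 by (metis mm_diff(2) mm_scale(2))
qed

lemma C0_lext_T:
  assumes "d \<in> \<Delta>" "f \<in> LP"
  shows "C0 \<star> lext E f \<star> T (reflect d) = q_pow (int (wt d 0)) \<odot> (C0 \<star> lext E (lext (dem (qk d) d) f))"
proof -
  have "C0 \<star> lext E f \<star> T (reflect d) = lext (\<lambda>n. q_pow (int (wt d 0)) \<odot> (C0 \<star> lext E (dem (qk d) d n))) f"
    unfolding lext_mult using C0_E_T[OF assms(1)] by (intro lext_cong[OF assms(2)]) auto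
  also have "\<dots> = q_pow (int (wt d 0)) \<odot> (C0 \<star> lext E (lext (dem (qk d) d) f))" unfolding lext_scaled lext_lext
    by (subst lext_hom[of "\<lambda>x. C0 \<star> x", symmetric]) (simp_all add: mm_add mm_scale)
  finally show ?thesis .
qed

lemma dem_cases:
  assumes "d \<in> \<Phi>" "\<nu> \<in> P"
  obtains k where "\<nu> \<cdot> d = of_int (dd d * k)" "\<nu> = reflect d \<nu> + of_int (dd d * k) *\<^sub>R d"
    "\<And>G. lext G (dem (dv d) d \<nu>) = G (reflect d \<nu>) + isum (\<lambda>i. G (reflect d \<nu> - of_int (dd d * i) *\<^sub>R d)) k"
proof -
  obtain n where n: "\<nu> \<cdot> d = of_int n" using P_int assms by blast
  then obtain k where k: "n = dd d * k" using dd_dvd_P[OF assms] by (auto simp: dvd_def)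
  have "isum (\<lambda>i. dv d i \<odot> G (reflect d \<nu> - of_int i *\<^sub>R d)) (dd d * k)
      = isum (\<lambda>i. G (reflect d \<nu> - of_int (dd d * i) *\<^sub>R d)) k" for G :: "'v => 'v hecke"
    by (subst isum_dvd[OF dd_pos]) (simp_all add: hscale_simps)
  then show ?thesis using that[of k] n k
    by (simp add: dem_def lext_add lext_isum lext_scale refl_eq del: of_int_mult)
qed

text \<open>The reflection reverses the string, taking term \<open>i\<close> to term
  \<open>- k - i\<close>; \<open>isum_shift\<close> accounts for the end point that stands outside
  the oriented sum.\<close>

lemma dem_invariant:
  assumes "d \<in> \<Phi>" "n \<in> P" shows "lext (\<lambda>\<mu>. e (reflect d \<mu>)) (dem (dv d) d n) = dem (dv d) d n"
proof -
  let ?s = "reflect d"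
  obtain k where k: "n \<cdot> d = of_int (dd d * k)" "n = ?s n + of_int (dd d * k) *\<^sub>R d"
    "\<And>G. lext G (dem (dv d) d n) = G (?s n) + isum (\<lambda>i. G (?s n - of_int (dd d * i) *\<^sub>R d)) k"
    using dem_cases[OF assms] by metis
  define H where "H i = e (?s n - of_int (dd d * i) *\<^sub>R d)" for i :: int
  have H: "e (?s (?s n - of_int (dd d * i) *\<^sub>R d)) = H (- k - i)" for i
  proof -
    have "?s (?s n - of_int (dd d * i) *\<^sub>R d) = n + of_int (dd d * i) *\<^sub>R d"
      using reflect_reflect[OF assms(1)] refl_self[OF root_neq_0[OF assms(1)]]
      by (simp add: linear_diff[OF linear_refl] linear_scale[OF linear_refl])
    also have "\<dots> = ?s n - of_int (dd d * (- k - i)) *\<^sub>R d" by (subst k(2)) (simp add: algebra_simps)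
    finally show ?thesis by (simp add: H_def)
  qed
  have "lext (\<lambda>\<mu>. e (?s \<mu>)) (dem (dv d) d n) = H (- k) + isum (\<lambda>i. H (- k - i)) k"
    unfolding k(3) H using H[of 0] by simp
  also have "isum (\<lambda>i. H (- k - i)) k = isum (\<lambda>i. H (i + 1)) k" using isum_reflect[of "\<lambda>i. H (i + 1)" k] by simp
  also have "H (- k) + \<dots> = H 0 + isum H k" by (rule isum_shift[symmetric])
  also have "\<dots> = lext e (dem (dv d) d n)" unfolding k(3) H_def[abs_def] by simp
  finally show ?thesis using lext_id[OF dem_LP[OF assms]] by simp
qed

definition AA :: "'v => 'v hecke" where "AA \<mu> = (\<Sum>w\<in>weyl. (-1) ^ len w \<odot> E (w \<mu>))"

lemma AA_reflect: assumes "d \<in> \<Delta>" shows "AA (reflect d \<mu>) = - AA \<mu>"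
proof -
  let ?s = "reflect d"
  have d: "d \<in> \<Phi>" using simple_root assms by blast
  have "AA \<mu> = (\<Sum>w\<in>weyl. (-1) ^ len (w o ?s) \<odot> E ((w o ?s) \<mu>))" unfolding AA_def
    by (rule sum.reindex_bij_witness[of _ "\<lambda>w. w o ?s" "\<lambda>w. w o ?s"])
      (auto simp: weyl_comp reflect_weyl[OF d] reflect_twice[OF d] simp del: comp_apply)
  also have "\<dots> = (\<Sum>w\<in>weyl. - ((-1) ^ len w \<odot> E (w (?s \<mu>))))"
  proof (intro sum.cong refl)
    fix w assume w: "w \<in> weyl"
    have "(-1) ^ len (w o ?s) = (- ((-1) ^ len w) :: laurent)"
      using len_reflect[OF w assms] by (cases "w d \<in> Pos") auto
    then show "(-1) ^ len (w o ?s) \<odot> E ((w o ?s) \<mu>) = - ((-1) ^ len w \<odot> E (w (?s \<mu>)))"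
      by (simp add: hscale_simps)
  qed
  finally show ?thesis by (simp add: AA_def sum_negf)
qed

text \<open>After the shift by \<open>\<rho>\<close> the reflection takes term \<open>i\<close> of
  the string to term \<open>1 - k - i\<close>, and the alternation changes sign, so everything
  cancels except the term of \<open>n\<close>. That Demazure operators leave this alternation alone
  is the source of Weyl's character formula here.\<close>

lemma dem_alternating:
  assumes "d \<in> \<Delta>" "n \<in> P" shows "lext (\<lambda>\<mu>. AA (\<rho> + \<mu>)) (dem (dv d) d n) = AA (\<rho> + n)"
proof -
  let ?s = "reflect d"
  have d: "d \<in> \<Phi>" using simple_root assms by blast
  obtain k where k: "n \<cdot> d = of_int (dd d * k)" "n = ?s n + of_int (dd d * k) *\<^sub>R d"
    "\<And>G. lext G (dem (dv d) d n) = G (?s n) + isum (\<lambda>i. G (?s n - of_int (dd d * i) *\<^sub>R d)) k"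
    using dem_cases[OF d assms(2)] by metis
  define H where "H i = AA (\<rho> + (?s n - of_int (dd d * i) *\<^sub>R d))" for i :: int
  have H: "H (1 - k - i) = - H i" for i
  proof -
    have "?s (\<rho> + (?s n - of_int (dd d * i) *\<^sub>R d)) = \<rho> - of_int (dd d) *\<^sub>R d + (n + of_int (dd d * i) *\<^sub>R d)"
      using reflect_reflect[OF d] refl_self[OF root_neq_0[OF d]] reflect_rho[OF assms(1)]
      by (simp add: linear_add[OF linear_refl] linear_diff[OF linear_refl] linear_scale[OF linear_refl])
    also have "\<dots> = \<rho> + (?s n - of_int (dd d * (1 - k - i)) *\<^sub>R d)" by (subst k(2)) (simp add: algebra_simps)
    finally show ?thesis using AA_reflect[OF assms(1)] unfolding H_def by metis
  qed
  have "isum (\<lambda>i. H (i + 1)) k = isum (\<lambda>i. H (- k - i)) k" using isum_reflect[of "\<lambda>i. H (i + 1)" k] by simp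
  also have "\<dots> = isum (\<lambda>i. - H (i + 1)) k"
  proof (rule isum_cong)
    show "H (- k - i) = - H (i + 1)" for i using H[of "i + 1"] by simp
  qed
  also have "\<dots> = - isum (\<lambda>i. H (i + 1)) k" by (simp add: isum_def sum_negf)
  finally have "isum (\<lambda>i. H (i + 1)) k = 0" by (rule eq_uminus_0)
  then have "lext (\<lambda>\<mu>. AA (\<rho> + \<mu>)) (dem (dv d) d n) = H (- k)"
    using isum_shift[of H k] unfolding k(3) H_def[abs_def] by simp
  also have "\<dots> = AA (\<rho> + n)" using arg_cong[OF k(2), of "\<lambda>x. AA (\<rho> + x)"] by (simp add: H_def)
  finally show ?thesis .
qed

section \<open>The Weyl character\<close>

text \<open>With \<open>b\<close> the weight of the wall, both \<open>q_pow (- b)\<close> and its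
  product with \<open>kap b\<close> have degree at most 0, so no coefficient leaves the negative
  range.\<close>

lemma neg_gen:
  assumes "h \<in> neg" "z \<in> \<Delta>" shows "q_pow (- int (wt z 0)) \<odot> (h \<star> T (reflect z)) \<in> neg"
proof -
  let ?s = "reflect z" and ?b = "q_pow (- int (wt z 0))"
  have s: "?s \<in> gens" "?s \<in> We" using reflect_gens gens_We assms by auto
  have 1: "c * d \<in> Ld (-1)" if "c \<in> Ld (-1)" "d \<in> Ld 0" for c d using Ld_mult[OF that] by simp
  have b: "?b \<in> Ld 0" "?b * kap (wt z 0) \<in> Ld 0"
    using Ld_mono[OF q_pow_Ld, of "- int (wt z 0)" 0] c0_scaled_kap(1)[of "wt z 0" "wt z 0"] wt_pos[of z 0]
      simple_root assms by auto
  have T: "coef h x \<odot> T y \<in> neg" "d \<in> Ld 0 ==> (coef h x * d) \<odot> T y \<in> neg" if "y \<in> We" for x y d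
    using assms(1) that 1[of "coef h x"] unfolding neg_iff by (auto simp: H_simps coef_hT)
  have "?b \<odot> (h \<star> T ?s) = (\<Sum>x\<in>keys h. (coef h x * ?b) \<odot> (T x \<star> T ?s))"
    by (subst hecke_expand[of h]) (simp add: mm_sum mm_scale hscale_sum hscale_simps mult.commute)
  also have "\<dots> \<in> neg"
  proof (rule neg_sum)
    fix x assume "x \<in> keys h"
    then have x: "x \<in> We" "x o ?s \<in> We" using assms(1) We_comp s unfolding neg_iff H_iff by auto
    show "(coef h x * ?b) \<odot> (T x \<star> T ?s) \<in> neg"
    proof (cases "lev x (cr x ?s) \<ge> lev id (cr x ?s)")
      case True
      then show ?thesis
        using T_gen(1)[OF x(1) s(1)] len_step(1)[OF We_aff[OF x(1)] s(1)] T(2)[OF x(2) b(1)] by simp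
    next
      case False
      then have "T x \<star> T ?s = T (x o ?s) + kap (wt z 0) \<odot> T x"
        using T_gen(2)[OF x(1) s(1)] len_step(2)[OF We_aff[OF x(1)] s(1)] L_reflect[OF assms(2)] by simp
      then show ?thesis using neg_simps(2)[OF T(2)[OF x(2) b(1)] T(2)[OF x(1) b(2)]]
        by (simp add: hscale_simps mult.assoc)
    qed
  qed
  finally show ?thesis .
qed

lemma C0_T_scaled_neg: "z \<in> Dom ==> c \<in> Ld (-1) ==> c \<odot> (C0 \<star> T z) \<in> neg"
proof -
  assume a: "z \<in> Dom" "c \<in> Ld (-1)"
  have "keys (c \<odot> T z) \<subseteq> Dom" using keys_hscale[of c "T z"] a by auto
  moreover have "coef (c \<odot> T z) y \<in> Ld (-1)" for y using a by (simp add: coef_hT)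
  ultimately show ?thesis using C0_mult_neg[of "c \<odot> T z"] Dom_We[OF a(1)] by (simp add: mm_scale H_simps)
qed

text \<open>Either the step stays dominant and the term with \<open>kap\<close> restores the element
  modulo negative degrees, or it is a wall step and the element is an eigenvector. So the leading
  term survives every Demazure step.\<close>

lemma C0_dominant_gen:
  assumes "t \<in> Pp" "d \<in> \<Delta>"
  shows "q_pow (- int (wt d 0)) \<odot> (C0 \<star> e t \<star> T (reflect d)) - C0 \<star> e t \<in> neg"
proof -
  let ?s = "reflect d" and ?b = "q_pow (- int (wt d 0))" and ?z = "transl t"
  have s: "?s \<in> gens" using reflect_gens assms by blast
  have d: "d \<in> \<Phi>" "d \<in> Pos" using simple_root assms by auto
  have z: "?z \<in> Dom" using transl_Dom assms by blast
  have "cr ?z ?s = - d" using cr_simple[OF Dom_aff[OF z] assms(2)] by (simp add: lin_transl_id)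
  then have c: "cr ?z ?s \<notin> Pos" using uminus_pos_iff d by simp
  show ?thesis
  proof (cases "?z o ?s \<in> Dom")
    case True
    have b: "?b \<in> Ld (-1)" "?b * kap (wt d 0) - 1 \<in> Ld (-1)"
    proof -
      show "?b \<in> Ld (-1)" using wt_pos[OF d(1), of 0] by (intro Ld_mono[OF q_pow_Ld]) simp
      have "?b * kap (wt d 0) \<in> Ld 0" "c0 (?b * kap (wt d 0)) = 1"
        using c0_scaled_kap[of "wt d 0" "wt d 0"] wt_pos[OF d(1), of 0] by auto
      then show "?b * kap (wt d 0) - 1 \<in> Ld (-1)" using c0_Ld(1) by metis
    qed
    have "?b \<odot> (C0 \<star> e t \<star> T ?s) - C0 \<star> e t = ?b \<odot> (C0 \<star> T (?z o ?s)) + (?b * kap (wt d 0) - 1) \<odot> (C0 \<star> T ?z)"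
      using C0_T_step(2)[OF z s c True] L_reflect[OF assms(2)] by (simp add: hscale_simps)
    then show ?thesis using neg_simps(2) C0_T_scaled_neg b True z by simp
  next
    case False
    have "?b \<odot> (C0 \<star> e t \<star> T ?s) = C0 \<star> e t"
      using C0_T_step(3)[OF z s False] L_reflect[OF assms(2)] by (simp add: hscale_simps q_pow_add)
    then show ?thesis by (simp add: neg_simps)
  qed
qed

text \<open>\<open>f\<close> holds the coordinates, in terms of the \<open>E \<nu>\<close>, of the
  normalised product \<open>C0 \<star> e t \<star> T w\<close>. The last two conditions are
  invariants carried along a reduced word of \<open>w\<close>: the alternation of the degree-0 part
  and the leading term.\<close>

definition demazure_rep :: "'v => ('v => 'v) => 'v hecke => bool" where
  "demazure_rep t w f \<longleftrightarrow> f \<in> LP \<and> f \<in> IL \<and> q_pow (- Lw w) \<odot> (C0 \<star> e t \<star> T w) = C0 \<star> lext E f \<and>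
     lext (\<lambda>\<mu>. AA (\<rho> + \<mu>)) (ct f) = AA (\<rho> + t) \<and> C0 \<star> lext E f - C0 \<star> e t \<in> neg"

lemma demazure_rep_step:
  assumes "t \<in> Pp" "w \<in> weyl" "d \<in> \<Delta>" "w d \<in> Pos" "demazure_rep t w f"
  shows "demazure_rep t (w o reflect d) (lext (dem (qk d) d) f)"
proof -
  let ?s = "reflect d" and ?f = "lext (dem (qk d) d) f" and ?b = "int (wt d 0)"
  have f: "f \<in> LP" "f \<in> IL" "q_pow (- Lw w) \<odot> (C0 \<star> e t \<star> T w) = C0 \<star> lext E f"
    "lext (\<lambda>\<mu>. AA (\<rho> + \<mu>)) (ct f) = AA (\<rho> + t)" "C0 \<star> lext E f - C0 \<star> e t \<in> neg"
    using assms(5) unfolding demazure_rep_def by auto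
  have d: "d \<in> \<Phi>" "d \<in> Pos" using simple_root assms by auto
  have s: "?s \<in> gens" using reflect_gens assms by blast
  have l: "len (w o ?s) = len w + 1" using len_reflect(1)[OF assms(2-4)] .
  have Lw: "- Lw (w o ?s) = - ?b - Lw w" using Lw_up[OF assms(2) d(2) assms(4) l] by simp
  have C: "C0 \<star> lext E ?f = q_pow (- ?b) \<odot> (C0 \<star> lext E f \<star> T ?s)"
    using C0_lext_T[OF assms(3) f(1)] by (simp add: hscale_simps q_pow_add)
  have "T (w o ?s) = T w \<star> T ?s" using T_gen(1)[OF weyl_We[OF assms(2)] s l] by simp
  then have 1: "q_pow (- Lw (w o ?s)) \<odot> (C0 \<star> e t \<star> T (w o ?s)) = C0 \<star> lext E ?f"
    unfolding C f(3)[symmetric] Lw by (simp add: mm_scale mm_assoc hscale_simps q_pow_add)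
  have 2: "?f \<in> LP" "?f \<in> IL" using lext_LP[OF f(1) dem_LP[OF d(1)]] lext_IL[OF f(2) dem_IL] qk(1)[OF d(1)] by auto
  have "ct ?f = lext (dem (dv d) d) (ct f)" using ct_lext[OF f(2) dem_IL] qk(1)[OF d(1)] ct_dem[OF d(1)] by simp
  then have "lext (\<lambda>\<mu>. AA (\<rho> + \<mu>)) (ct ?f) = lext (\<lambda>n. lext (\<lambda>\<mu>. AA (\<rho> + \<mu>)) (dem (dv d) d n)) (ct f)"
    by (simp add: lext_lext)
  also have "\<dots> = lext (\<lambda>\<mu>. AA (\<rho> + \<mu>)) (ct f)"
    by (rule lext_cong[OF ct_LP[OF f(1)]]) (rule dem_alternating[OF assms(3)])
  finally have 3: "lext (\<lambda>\<mu>. AA (\<rho> + \<mu>)) (ct ?f) = AA (\<rho> + t)" using f(4) by simp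
  have "C0 \<star> lext E ?f - C0 \<star> e t = q_pow (- ?b) \<odot> ((C0 \<star> lext E f - C0 \<star> e t) \<star> T ?s)
      + (q_pow (- ?b) \<odot> (C0 \<star> e t \<star> T ?s) - C0 \<star> e t)" unfolding C by (simp add: mm_diff hscale_simps)
  then have "C0 \<star> lext E ?f - C0 \<star> e t \<in> neg"
    using neg_simps(2)[OF neg_gen[OF f(5) assms(3)] C0_dominant_gen[OF assms(1,3)]] by (simp only:)
  then show ?thesis unfolding demazure_rep_def using 1 2 3 by blast
qed

lemma exists_demazure_rep: assumes "t \<in> Pp" "w \<in> weyl" shows "\<exists>f. demazure_rep t w f" using assms(2)
proof (induction rule: weyl_induct)
  case id
  have "C0 \<star> e t \<in> HH" by simp
  then have "demazure_rep t id (e t)" unfolding demazure_rep_def using Pp_P[OF assms(1)] E_dominant[OF assms(1)]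
    by (simp add: LP_simps IL_simps ct_simps neg_simps hscale_simps)
  then show ?case by blast
next
  case (step w d)
  then show ?case using demazure_rep_step[OF assms(1)] by blast
qed

text \<open>The degree-0 part of the representative at \<open>w0\<close>. Since
  \<open>T w0 \<star> T s\<close> is \<open>kap\<close> times \<open>T w0\<close> plus a shorter
  term, the operator for \<open>s\<close> fixes \<open>f\<close> up to negative degrees. So the
  degree-0 part is fixed by each Demazure operator and, lying in its image, is invariant under each
  simple reflection.\<close>

lemma exists_invariant:
  assumes "t \<in> Pp"
  shows "\<exists>g. g \<in> LP \<and> g \<in> IL \<and> ct g = g \<and> (\<forall>z\<in>\<Delta>. lext (\<lambda>\<mu>. e (reflect z \<mu>)) g = g) \<and>
    lext (\<lambda>\<mu>. AA (\<rho> + \<mu>)) g = AA (\<rho> + t) \<and> C0 \<star> lext E g - C0 \<star> e t \<in> neg"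
proof -
  obtain f where "demazure_rep t w0 f" using exists_demazure_rep assms longest by blast
  then have f: "f \<in> LP" "f \<in> IL" "q_pow (- Lw w0) \<odot> (C0 \<star> e t \<star> T w0) = C0 \<star> lext E f"
    "lext (\<lambda>\<mu>. AA (\<rho> + \<mu>)) (ct f) = AA (\<rho> + t)" "C0 \<star> lext E f - C0 \<star> e t \<in> neg" unfolding demazure_rep_def by auto
  have g: "ct f \<in> LP" "ct f \<in> IL" using ct_LP ct_IL f by auto
  have "lext (\<lambda>\<mu>. e (reflect z \<mu>)) (ct f) = ct f" if d: "z \<in> \<Delta>" for z
  proof -
    let ?s = "reflect z" and ?b = "int (wt z 0)" and ?D = "dem (qk z) z"
    have z: "z \<in> \<Phi>" "z \<in> Pos" using simple_root d by auto
    have s: "?s \<in> gens" using reflect_gens d by blast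
    let ?w = "w0 o ?s"
    have w: "?w \<in> weyl" using weyl_comp longest(1) reflect_weyl[OF z(1)] by blast
    have ws: "?w o ?s = w0" by (rule reflect_twice[OF z(1)])
    have "w0 z \<notin> Pos" using longest(2) z by blast
    then have l: "len w0 = len ?w + 1" using len_reflect(2)[OF longest(1) d] by blast
    have "?w z \<in> Pos" using longest(2)[OF uminus_root[OF z(1)]] refl_self[OF root_neq_0[OF z(1)]] uminus_pos_iff[OF z(1)] z by simp
    then have Lw: "Lw w0 = Lw ?w + ?b" using Lw_up[OF w z(2)] l ws by simp
    obtain f' where "demazure_rep t ?w f'" using exists_demazure_rep assms w by blast
    then have f': "f' \<in> LP" "f' \<in> IL" "q_pow (- Lw ?w) \<odot> (C0 \<star> e t \<star> T ?w) = C0 \<star> lext E f'"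
      unfolding demazure_rep_def by auto
    have TT: "T w0 \<star> T ?s = T ?w + kap (wt z 0) \<odot> T w0"
      using T_gen(2)[OF weyl_We[OF longest(1)] s l] L_reflect[OF d] by simp
    \<comment> \<open>The defect from an exactly fixed vector will carry the factor
      \<open>q_pow (-2 * ?b)\<close>, of negative degree because weights are positive.\<close>
    have q2: "q_pow (- ?b) * kap (wt z 0) = 1 - q_pow (-2 * ?b)" by (simp add: kap_def right_diff_distrib q_pow_add)
    have "C0 \<star> lext E (lext ?D f) = q_pow (- ?b) \<odot> (C0 \<star> lext E f \<star> T ?s)"
      using C0_lext_T[OF d f(1)] by (simp add: hscale_simps q_pow_add)
    also have "\<dots> = (q_pow (- ?b) * q_pow (- Lw w0)) \<odot> (C0 \<star> e t \<star> T ?w)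
        + (q_pow (- ?b) * kap (wt z 0)) \<odot> (q_pow (- Lw w0) \<odot> (C0 \<star> e t \<star> T w0))"
      unfolding f(3)[symmetric] by (simp add: mm_scale mm_assoc TT mm_add hscale_simps mult_ac)
    also have "(q_pow (- ?b) * q_pow (- Lw w0)) \<odot> (C0 \<star> e t \<star> T ?w) = q_pow (-2 * ?b) \<odot> (C0 \<star> lext E f')"
      unfolding f'(3)[symmetric] Lw by (simp add: hscale_simps q_pow_add)
    also have "(q_pow (- ?b) * kap (wt z 0)) \<odot> (q_pow (- Lw w0) \<odot> (C0 \<star> e t \<star> T w0))
        = C0 \<star> lext E f - q_pow (-2 * ?b) \<odot> (C0 \<star> lext E f)" unfolding f(3) q2 by (simp add: hscale_simps)
    finally have "C0 \<star> lext E (lext ?D f - (f + q_pow (-2 * ?b) \<odot> (f' - f))) = 0"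
      by (simp add: lext_diff lext_add lext_scale mm_diff mm_add mm_scale hscale_simps)
    moreover have "lext ?D f \<in> LP" by (rule lext_LP[OF f(1) dem_LP[OF z(1)]])
    ultimately have "lext ?D f = f + q_pow (-2 * ?b) \<odot> (f' - f)"
      using C0_lext_E_inj f(1) f'(1) by (metis LP_simps(2,3,4) eq_iff_diff_eq_0)
    moreover have "q_pow (-2 * ?b) \<in> Ld (-1)" using wt_pos[OF z(1), of 0] by (intro Ld_mono[OF q_pow_Ld]) simp
    ultimately have "ct (lext ?D f) = ct f"
      using ct_scale_neg[OF IL_simps(3)[OF f'(2) f(2)]] by (simp add: ct_simps)
    then have D: "lext (dem (dv z) z) (ct f) = ct f"
      using ct_lext[OF f(2) dem_IL] qk(1)[OF z(1)] ct_dem[OF z(1)] by simp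
    have "lext (\<lambda>\<mu>. e (?s \<mu>)) (ct f) = lext (\<lambda>\<mu>. e (?s \<mu>)) (lext (dem (dv z) z) (ct f))" by (simp only: D)
    also have "\<dots> = lext (dem (dv z) z) (ct f)"
      unfolding lext_lext by (rule lext_cong[OF g(1) dem_invariant[OF z(1)]])
    finally show ?thesis using D by simp
  qed
  moreover have "C0 \<star> lext E (ct f) - C0 \<star> e t \<in> neg"
  proof -
    \<comment> \<open>Passing from \<open>f\<close> to its degree-0 part changes the product only
      within \<open>neg\<close>: by \<open>good_X\<close> each \<open>C0 \<star> E \<nu>\<close> has
      coefficients of degree at most 0, and those of \<open>f - ct f\<close> are of negative
      degree.\<close>
    have "C0 \<star> lext E (f - ct f) = (\<Sum>x\<in>keys (f - ct f). coef (f - ct f) x \<odot> (C0 \<star> E (x 0)))"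
      by (simp only: lext_def mm_sum mm_scale)
    also have "\<dots> \<in> neg"
    proof (rule neg_sum)
      fix x assume "x \<in> keys (f - ct f)"
      moreover have "f - ct f \<in> LP" using LP_simps f g by blast
      ultimately have x: "transl (x 0) \<in> We" using transl_We by (auto simp: LP_def transl_def)
      have "coef (f - ct f) x \<in> Ld (-1)" using f(2) c0_Ld(1) by (simp add: lookup_minus IL_def)
      from good_scale[OF good_X[OF x C0_good] this]
      show "coef (f - ct f) x \<odot> (C0 \<star> E (x 0)) \<in> neg" using good_neg[OF _ x] by simp
    qed
    finally have "(C0 \<star> lext E f - C0 \<star> e t) - C0 \<star> lext E (f - ct f) \<in> neg" using neg_simps(3) f(5) by blast
    then show ?thesis by (simp add: lext_diff mm_diff)
  qed
  moreover have "ct (ct f) = ct f" by (rule poly_mapping_eqI) (simp add: c0_def lookup_single)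
  ultimately show ?thesis using g f(4) by blast
qed

section \<open>Invariant combinations: commutation with the finite Hecke algebra and bar
  invariance\<close>

lemma lext_weyl_invariant:
  assumes "g \<in> LP" "\<forall>d\<in>\<Delta>. lext (\<lambda>\<mu>. e (reflect d \<mu>)) g = g" "w \<in> weyl" shows "lext (\<lambda>\<mu>. D (w \<mu>)) g = lext D g"
proof -
  have "lext (\<lambda>\<mu>. e (w \<mu>)) g = g" using assms(3)
  proof (induction rule: weyl_induct)
    case id
    show ?case using lext_id[OF assms(1)] by simp
  next
    case (step w d)
    have "lext (\<lambda>\<mu>. e ((w o reflect d) \<mu>)) g = lext (\<lambda>\<mu>. e (w \<mu>)) (lext (\<lambda>\<mu>. e (reflect d \<mu>)) g)"
      by (simp add: lext_lext)
    also have "\<dots> = g" using assms(2) step by simp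
    finally show ?case by simp
  qed
  then have "lext D g = lext D (lext (\<lambda>\<mu>. e (w \<mu>)) g)" by simp
  then show ?thesis by (simp add: lext_lext)
qed

text \<open>The sums in Bernstein's relation for \<open>\<nu>\<close> and
  \<open>reflect d \<nu>\<close> run over one string in opposite orientation, the weights agreeing
  because \<open>\<nu>\<close> lies in \<open>P\<close>. So the commutation defect is odd under the
  reflection and cancels in an invariant combination.\<close>

lemma bernstein_alternating:
  assumes "d \<in> \<Delta>" "\<nu> \<in> P"
  shows "T (reflect d) \<star> E (reflect d \<nu>) - E \<nu> \<star> T (reflect d) = - (T (reflect d) \<star> E \<nu> - E (reflect d \<nu>) \<star> T (reflect d))"
proof -
  let ?s = "reflect d"
  have d: "d \<in> \<Phi>" using simple_root assms by blast
  obtain n where n: "\<nu> \<cdot> d = of_int n" using P_int[OF assms(2) d] by blast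
  have sP: "?s \<nu> \<in> P" using P_weyl assms(2) reflect_weyl d by blast
  have sn: "?s \<nu> \<cdot> d = of_int (- n)"
    using n inner_coroot_self[OF root_neq_0[OF d]] by (simp add: refl_eq inner_diff_left)
  define K where "K i = kap (wt d i) \<odot> E (\<nu> - of_int i *\<^sub>R d)" for i
  have K: "transl (- of_int i *\<^sub>R d) o transl \<nu> = transl (\<nu> - of_int i *\<^sub>R d)" for i by (simp add: transl_comp)
  have K': "kap (wt d i) \<odot> X (transl (- of_int i *\<^sub>R d) o transl (?s \<nu>)) = K (n + i)" for i
  proof -
    have "- of_int i *\<^sub>R d + ?s \<nu> = \<nu> - of_int (n + i) *\<^sub>R d" using n by (simp add: refl_eq algebra_simps)
    moreover have "wt d (n + i) = wt d i" using P_wt[OF assms(2) d n, of i] by (simp add: add.commute)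
    ultimately show ?thesis by (simp add: K_def transl_comp)
  qed
  have "bsum d (transl \<nu>) (n - 1) = - isum K (- n)" unfolding bsum_def K by (simp add: isum_def K_def)
  moreover have "bsum d (transl (?s \<nu>)) (- n - 1) = - isum (\<lambda>i. K (n + i)) n"
    unfolding bsum_def K' by (simp add: isum_def)
  ultimately have "bsum d (transl (?s \<nu>)) (- n - 1) = - bsum d (transl \<nu>) (n - 1)" by (simp add: isum_neg)
  then show ?thesis using bernstein[OF assms n] bernstein[OF assms(1) sP sn] reflect_reflect[OF d] by simp
qed

lemma lext_E_commute:
  assumes "g \<in> LP" "d \<in> \<Delta>" "lext (\<lambda>\<mu>. e (reflect d \<mu>)) g = g"
  shows "T (reflect d) \<star> lext E g = lext E g \<star> T (reflect d)"
proof -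
  let ?s = "reflect d" and ?B = "\<lambda>n. T (reflect d) \<star> E n - E (reflect d n) \<star> T (reflect d)"
  have inv: "lext (\<lambda>\<mu>. D (?s \<mu>)) g = lext D g" for D
    using arg_cong[OF assms(3), of "lext D"] by (simp add: lext_lext)
  have s: "?s (?s n) = n" for n using reflect_reflect simple_root assms by blast
  have "lext ?B g = lext (\<lambda>n. - ?B n) g"
    using inv[of ?B] bernstein_alternating[OF assms(2)] lext_cong[OF assms(1), of "\<lambda>n. ?B (?s n)" "\<lambda>n. - ?B n"]
    by (simp add: s)
  also have "\<dots> = - lext ?B g" using lext_scaled[of "-1" ?B g] by (simp add: hscale_simps)
  finally have "lext ?B g = 0" by (rule eq_uminus_0)
  moreover have "lext ?B g = T ?s \<star> lext E g - lext (\<lambda>n. E (?s n)) g \<star> T ?s"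
    by (simp add: lext_def mm_sum mm_scale hscale_simps sum_subtractf)
  ultimately show ?thesis using inv[of E] by simp
qed

lemma commute_weyl:
  assumes "z \<in> HH" "\<And>d. d \<in> \<Delta> ==> T (reflect d) \<star> z = z \<star> T (reflect d)" "w \<in> weyl"
  shows "T w \<star> z = z \<star> T w" using assms(3)
proof (induction rule: weyl_induct)
  case (step w d)
  have "T (w o reflect d) = T w \<star> T (reflect d)"
    using T_gen(1)[OF weyl_We[OF step(1)] reflect_gens[OF step(2)] len_reflect(1)[OF step(1-3)]] by simp
  then show ?case using step(4) assms(2)[OF step(2)] by (metis mm_assoc)
qed (use assms(1) in \<open>simp del: id_apply\<close>)

lemma len_transl: "\<mu> \<in> P ==> len (transl \<mu>) = (\<Sum>r\<in>Pos. nat \<lfloor>\<bar>\<mu> \<cdot> r\<bar>\<rfloor>)"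
proof -
  assume \<mu>: "\<mu> \<in> P"
  have "\<bar>lev (transl \<mu>) r\<bar> = \<lfloor>\<bar>\<mu> \<cdot> r\<bar>\<rfloor>" if a: "r \<in> Pos" for r
  proof -
    have "of_int (lev (transl \<mu>) r) = \<mu> \<cdot> r"
      using lev_transl[OF P_intwt[OF \<mu>], of r id] lev_id_pos[OF a] a pos_subset by auto
    then show ?thesis by (metis floor_of_int of_int_abs)
  qed
  then show ?thesis by (simp add: len_def)
qed

text \<open>The products \<open>w0 o transl (- w0 n)\<close> and \<open>transl (- n) o w0\<close>
  agree and are both length-additive. So conjugation by \<open>T w0\<close> takes
  \<open>e (- w0 n)\<close>, the inverse of \<open>E (w0 n)\<close>, to \<open>e (- n)\<close>,
  whose inverse is the bar of \<open>e n\<close>.\<close>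

lemma bar_e: assumes "n \<in> Pp" shows "bar (e n) = T w0 \<star> E (w0 n) \<star> Ti w0"
proof -
  let ?n = "- w0 n"
  have w0: "w0 \<in> weyl" "w0 \<in> We" "w0 o w0 = id" using longest weyl_We by auto
  have n: "n \<in> P" "w0 n \<in> P" "- n \<in> P" using Pp_P[OF assms] P_weyl P_uminus w0 by auto
  have d: "?n \<in> Pp"
  proof -
    have "?n \<cdot> r \<ge> 0" if "r \<in> Pos" for r
    proof -
      have a: "r \<in> \<Phi>" using that pos_subset by blast
      have "- w0 r \<in> Pos" using longest(2)[OF a] that uminus_pos_iff weyl_root[OF w0(1) a] by blast
      moreover have "w0 n \<cdot> r = n \<cdot> (w0 r)"
        using weyl_inner[OF w0(1), of n "w0 r"] w0(3) by (metis comp_apply id_apply)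
      ultimately show ?thesis using assms unfolding dom_weights_def by (auto simp: coroot_uminus)
    qed
    then show ?thesis using P_uminus[OF n(2)] by (simp add: dom_weights_def)
  qed
  have t: "transl n \<in> We" "transl (- n) \<in> We" "transl ?n \<in> We" using transl_We n P_uminus by auto
  have "w0 o transl ?n = transl (- n) o w0"
  proof
    fix x
    have "w0 (- w0 n) = - n" using weyl_uminus[OF w0(1)] w0(3) by (metis comp_apply id_apply)
    then show "(w0 o transl ?n) x = (transl (- n) o w0) x"
      using linear_add[OF weyl_linear[OF w0(1)], of "- w0 n" x] by (simp add: transl_def)
  qed
  moreover have "len (w0 o transl ?n) = len w0 + len (transl ?n)"
    using len_weyl_Dom[OF w0(1) transl_Dom[OF d]] .
  moreover have "len (transl ?n) = len (transl (- n))"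
  proof -
    have "w0 n \<cdot> r = n \<cdot> (w0 r)" for r
      using weyl_inner[OF w0(1), of n "w0 r"] w0(3) by (metis comp_apply id_apply)
    then show ?thesis using sum_abs_weyl[OF w0(1), of "\<lambda>r. nat \<lfloor>\<bar>n \<cdot> r\<bar>\<rfloor>"]
      by (simp add: len_transl n(3) P_uminus[OF n(2)] coroot_uminus)
  qed
  ultimately have "T w0 \<star> e ?n = e (- n) \<star> T w0" using T_mult[OF w0(2) t(3)] T_mult[OF t(2) w0(2)] by simp
  moreover have "e ?n \<star> E (w0 n) = one" using E_add[OF P_uminus[OF n(2)] n(2)] E_dominant[OF d] by simp
  ultimately have "e (- n) \<star> (T w0 \<star> E (w0 n) \<star> Ti w0) = one" using w0(2) by (metis Ti(1,2) mm_assoc mm_one(1))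
  moreover have "Ti (transl (- n)) \<star> (e (- n) \<star> (T w0 \<star> E (w0 n) \<star> Ti w0)) = T w0 \<star> E (w0 n) \<star> Ti w0"
    using t(2) T_H[OF w0(2)] by (simp add: mm_assoc[symmetric])
  moreover have "inv (transl n) = transl (- n)"
    using inv_unique_comp[of "transl n" "transl (- n)"] by (simp add: transl_comp)
  ultimately show ?thesis using t(2) bar_T[of "transl n"] by simp
qed

lemma bar_E: assumes "\<mu> \<in> P" shows "bar (E \<mu>) = T w0 \<star> E (w0 \<mu>) \<star> Ti w0"
proof -
  have w0: "w0 \<in> weyl" "w0 \<in> We" using longest weyl_We by auto
  obtain n n' where n: "n \<in> Pp" "n' \<in> Pp" "\<mu> = n - n'" using P_diff_dominant[OF assms] by blast
  have P: "\<mu> \<in> P" "n \<in> P" "n' \<in> P" "w0 \<mu> \<in> P" "w0 n \<in> P" "w0 n' \<in> P" using assms Pp_P n P_weyl[OF _ w0(1)] by auto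
  have "E \<mu> \<star> e n' = e n" using E_add[OF P(1,3)] n E_dominant by simp
  then have "bar (E \<mu>) \<star> (T w0 \<star> E (w0 n') \<star> Ti w0) = T w0 \<star> E (w0 n) \<star> Ti w0"
    using bar_mult[OF X_H T_H[OF transl_We[OF P(3)]]] bar_e n by metis
  moreover have "E (w0 n') \<star> E (- w0 n') = one" "E (w0 n) \<star> E (- w0 n') = E (w0 \<mu>)"
    using E_add[OF P(6) P_uminus[OF P(6)]] E_add[OF P(5) P_uminus[OF P(6)]] n(3)
    by (simp_all add: linear_diff[OF weyl_linear[OF w0(1)]])
  moreover have "bar (E \<mu>) \<star> (T w0 \<star> E (w0 n') \<star> Ti w0) \<star> (T w0 \<star> E (- w0 n') \<star> Ti w0)
      = bar (E \<mu>) \<star> (T w0 \<star> (E (w0 n') \<star> ((Ti w0 \<star> T w0) \<star> (E (- w0 n') \<star> Ti w0))))"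
    "T w0 \<star> E (w0 n) \<star> Ti w0 \<star> (T w0 \<star> E (- w0 n') \<star> Ti w0)
      = T w0 \<star> (E (w0 n) \<star> ((Ti w0 \<star> T w0) \<star> (E (- w0 n') \<star> Ti w0)))" by (simp_all only: mm_assoc)
  moreover have "E (w0 n') \<star> (E (- w0 n') \<star> Ti w0) = Ti w0" "E (w0 n) \<star> (E (- w0 n') \<star> Ti w0) = E (w0 \<mu>) \<star> Ti w0"
    using calculation(2,3) w0(2) by (metis Ti(1) mm_assoc mm_one(1))+
  ultimately show ?thesis using w0(2) bar_H[OF X_H, of "transl \<mu>"] by (simp add: mm_assoc)
qed

definition chf :: "'v => 'v hecke" where
  "chf t = (SOME g. g \<in> LP \<and> g \<in> IL \<and> ct g = g \<and> (\<forall>d\<in>\<Delta>. lext (\<lambda>\<mu>. e (reflect d \<mu>)) g = g) \<and>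
    lext (\<lambda>\<mu>. AA (\<rho> + \<mu>)) g = AA (\<rho> + t) \<and> C0 \<star> lext E g - C0 \<star> e t \<in> neg)"

lemma chf:
  assumes "t \<in> Pp"
  shows "chf t \<in> LP" "ct (chf t) = chf t" "\<forall>d\<in>\<Delta>. lext (\<lambda>\<mu>. e (reflect d \<mu>)) (chf t) = chf t"
    "lext (\<lambda>\<mu>. AA (\<rho> + \<mu>)) (chf t) = AA (\<rho> + t)" "C0 \<star> lext E (chf t) - C0 \<star> e t \<in> neg"
  using someI_ex[OF exists_invariant[OF assms]] unfolding chf_def by blast+

abbreviation ch :: "'v => 'v hecke" where "ch t \<equiv> lext E (chf t)"

lemma lext_H: "(\<And>n. D n \<in> HH) ==> lext D f \<in> HH" unfolding lext_def by (intro H_sum H_simps)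

lemma ch_H [simp]: "ch t \<in> HH" by (rule lext_H) simp

lemma ch_commute: assumes "t \<in> Pp" shows
  "d \<in> \<Delta> ==> T (reflect d) \<star> ch t = ch t \<star> T (reflect d)" "w \<in> weyl ==> T w \<star> ch t = ch t \<star> T w" "C0 \<star> ch t = ch t \<star> C0"
proof -
  show 1: "T (reflect d) \<star> ch t = ch t \<star> T (reflect d)" if "d \<in> \<Delta>" for d
    using lext_E_commute chf(1,3)[OF assms] that by blast
  show 2: "T w \<star> ch t = ch t \<star> T w" if "w \<in> weyl" for w using commute_weyl[OF ch_H 1 that] .
  show "C0 \<star> ch t = ch t \<star> C0" unfolding C0_def using 2 by (simp add: mm_sum mm_scale)
qed

text \<open>By \<open>bar_E\<close> the bar involution acts on each \<open>E \<mu>\<close> as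
  \<open>w0\<close> followed by conjugation with \<open>T w0\<close>. Invariance under
  \<open>w0\<close> and commutation with \<open>T w0\<close> undo both, and the coefficients are
  constants.\<close>

lemma bar_ch: assumes "t \<in> Pp" shows "bar (ch t) = ch t"
proof -
  have w0: "w0 \<in> weyl" "w0 \<in> We" using longest weyl_We by auto
  have c: "laurent_bar (coef (chf t) x) = coef (chf t) x" for x
  proof -
    have "coef (chf t) x = c0 (coef (chf t) x)" using chf(2)[OF assms] by (metis coef_ct)
    then show ?thesis by (metis c0_def laurent_bar_single minus_zero)
  qed
  have "bar (ch t) = lext (\<lambda>\<mu>. bar (E \<mu>)) (chf t)" by (simp add: lext_def bar_sum bar_scale c)
  also have "\<dots> = lext (\<lambda>\<mu>. T w0 \<star> E (w0 \<mu>) \<star> Ti w0) (chf t)" by (rule lext_cong[OF chf(1)[OF assms] bar_E])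
  also have "\<dots> = T w0 \<star> lext (\<lambda>\<mu>. E (w0 \<mu>)) (chf t) \<star> Ti w0" by (rule lext_mult[symmetric])
  also have "\<dots> = T w0 \<star> ch t \<star> Ti w0" using lext_weyl_invariant[OF chf(1,3)[OF assms] w0(1), of E] by simp
  also have "\<dots> = ch t" using ch_commute(2)[OF assms w0(1)] w0(2) by (simp add: mm_assoc)
  finally show ?thesis .
qed

lemma KL_translation: assumes "t \<in> Pp" shows "KL_basis \<Phi> \<Delta> L m (w0 o transl t) = C0 \<star> ch t"
proof (rule KL_eqI)
  show "bar (C0 \<star> ch t) = C0 \<star> ch t" using bar_mult[OF C0_H ch_H] bar_C0 bar_ch[OF assms] by simp
  have "(C0 \<star> ch t - C0 \<star> e t) + (C0 \<star> e t - T (w0 o transl t)) \<in> neg"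
    using neg_simps(2) chf(5)[OF assms] C0_T_neg[OF transl_Dom[OF assms]] by blast
  then show "C0 \<star> ch t - T (w0 o transl t) \<in> neg" by simp
qed simp

text \<open>Weyl's character formula. Invariance of \<open>chf t\<close> lets \<open>w\<close> act
  on \<open>\<rho> + \<mu>\<close> as a whole, and the alternation stored in \<open>chf\<close>
  evaluates the resulting sum.\<close>

lemma AA_factor: assumes "t \<in> Pp" shows "ch t \<star> AA \<rho> = AA (t + \<rho>)"
proof -
  have "ch t \<star> E (w \<rho>) = lext (\<lambda>\<mu>. E (w (\<rho> + \<mu>))) (chf t)" if w: "w \<in> weyl" for w
  proof -
    have "ch t \<star> E (w \<rho>) = lext (\<lambda>\<mu>. E (w \<mu>)) (chf t) \<star> E (w \<rho>)"
      using lext_weyl_invariant[OF chf(1,3)[OF assms] w, of E] by simp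
    also have "\<dots> = lext (\<lambda>\<mu>. E (w \<mu>) \<star> E (w \<rho>)) (chf t)" by (rule lext_hom) (simp_all add: mm_add mm_scale)
    also have "\<dots> = lext (\<lambda>\<mu>. E (w (\<rho> + \<mu>))) (chf t)"
      using E_add P_weyl rho_P w by (intro lext_cong[OF chf(1)[OF assms]])
        (simp add: linear_add[OF weyl_linear[OF w]] add.commute)
    finally show ?thesis .
  qed
  then have "ch t \<star> AA \<rho> = lext (\<lambda>\<mu>. AA (\<rho> + \<mu>)) (chf t)"
    unfolding AA_def lext_sum_fun lext_scaled by (simp add: mm_sum mm_scale)
  then show ?thesis using chf(4)[OF assms] by (simp add: add.commute)
qed

text \<open>The leading term of the denominator is \<open>e \<rho>\<close>, so the term of \<open>f\<close> of largest height survives.\<close>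

lemma AA_cancel: assumes "f \<in> LP" "lext E f \<star> AA \<rho> = 0" shows "f = 0"
proof (rule ccontr)
  assume "f \<noteq> 0"
  then have "Max ((\<lambda>x. x 0 \<bullet> htvec) ` keys f) \<in> (\<lambda>x. x 0 \<bullet> htvec) ` keys f" by (intro Max_in) auto
  then obtain x where x: "x \<in> keys f" "x 0 \<bullet> htvec = Max ((\<lambda>x. x 0 \<bullet> htvec) ` keys f)" by fastforce
  have x_max: "y 0 \<bullet> htvec \<le> x 0 \<bullet> htvec" if "y \<in> keys f" for y unfolding x(2) using that by (intro Max_ge) auto
  define G where "G \<mu> = (\<Sum>w\<in>weyl. (-1) ^ len w \<odot> e (\<mu> + w \<rho>))" for \<mu>
  have P: "w \<rho> \<in> P" if "w \<in> weyl" for w using rho_P P_weyl that by blast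
  have "lext E f \<star> AA \<rho> = lext (\<lambda>\<mu>. E \<mu> \<star> AA \<rho>) f" by (rule lext_hom) (simp_all add: mm_add mm_scale)
  also have "\<dots> = lext (\<lambda>\<mu>. lext E (G \<mu>)) f"
    using P E_add by (intro lext_cong[OF assms(1)]) (simp add: AA_def G_def lext_sum lext_scale mm_sum mm_scale)
  finally have "C0 \<star> lext E (lext G f) = 0" using assms(2) by (simp add: lext_lext)
  moreover have "lext G f \<in> LP"
  proof (rule lext_LP[OF assms(1)])
    fix n assume "n \<in> P"
    then have "n + w \<rho> \<in> P" if "w \<in> weyl" for w using P[OF that] P_add by blast
    then show "G n \<in> LP" unfolding G_def by (intro LP_sum LP_simps(4,5)) simp
  qed
  ultimately have 0: "lext G f = 0" using C0_lext_E_inj by blast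
  have tr: "transl a = transl b \<longleftrightarrow> a = b" for a b :: 'v by (metis add_right_cancel transl_def)
  have c: "coef (G (y 0)) (transl (x 0 + \<rho>)) = (if y = x then 1 else 0)" if y: "y \<in> keys f" for y
  proof -
    have eq: "x 0 + \<rho> = y 0 + w \<rho> \<longleftrightarrow> w = id \<and> y = x" if w: "w \<in> weyl" for w
    proof
      assume a: "x 0 + \<rho> = y 0 + w \<rho>"
      then have "x 0 \<bullet> htvec + \<rho> \<bullet> htvec = y 0 \<bullet> htvec + w \<rho> \<bullet> htvec" by (metis inner_add_left)
      then have "w = id" using x_max[OF y] rho_htvec[OF w] by fastforce
      moreover have "x = transl (x 0)" "y = transl (y 0)"
        using x(1) y assms(1) by (auto simp: LP_def transl_def)
      ultimately show "w = id \<and> y = x" using a by (metis add_right_cancel id_apply)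
    qed simp
    have "coef (G (y 0)) (transl (x 0 + \<rho>)) = (\<Sum>w\<in>weyl. if w = id \<and> y = x then (-1) ^ len w else 0)"
      unfolding G_def lookup_sum by (intro sum.cong refl) (simp add: coef_hT tr eq)
    also have "\<dots> = (\<Sum>w\<in>weyl. if w = id then (if y = x then 1 else 0) else 0)" by (intro sum.cong) auto
    also have "\<dots> = (if y = x then 1 else 0)" using finite_weyl' by simp
    finally show ?thesis .
  qed
  have "0 = (\<Sum>y\<in>keys f. coef f y * coef (G (y 0)) (transl (x 0 + \<rho>)))"
    using arg_cong[OF 0, of "\<lambda>h. coef h (transl (x 0 + \<rho>))"] by (simp add: lext_def lookup_sum)
  also have "\<dots> = (\<Sum>y\<in>keys f. if y = x then coef f y else 0)" using c by (intro sum.cong) auto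
  also have "\<dots> = coef f x" using x(1) by simp
  finally show False using x(1) by (simp add: in_keys_iff)
qed

section \<open>Identification with the quotient of alternating sums\<close>

lemma lattice_algebra_eq: "lattice_algebra \<Phi> \<Delta> L m = lext E ` LP"
proof (intro set_eqI iffI)
  fix h assume "h \<in> lattice_algebra \<Phi> \<Delta> L m"
  then obtain M c where M: "finite M" "M \<subseteq> P" "h = (\<Sum>\<mu>\<in>M. c \<mu> \<odot> e_elt \<Phi> \<Delta> L m \<mu>)" unfolding lattice_algebra_def by blast
  have "h = lext E (\<Sum>\<mu>\<in>M. c \<mu> \<odot> e \<mu>)"
    unfolding M(3) lext_sum lext_scale lext_e using e_elt_eq M(2) by (intro sum.cong) auto
  moreover have "(\<Sum>\<mu>\<in>M. c \<mu> \<odot> e \<mu>) \<in> LP" using M(2) by (intro LP_sum LP_simps) auto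
  ultimately show "h \<in> lext E ` LP" by blast
next
  fix h assume "h \<in> lext E ` LP"
  then obtain f where f: "f \<in> LP" "h = lext E f" by blast
  have x: "x = transl (x 0)" "x 0 \<in> P" if "x \<in> keys f" for x using f(1) that by (auto simp: LP_def transl_def)
  have "h = (\<Sum>\<mu>\<in>(\<lambda>x. x 0) ` keys f. coef f (transl \<mu>) \<odot> e_elt \<Phi> \<Delta> L m \<mu>)"
  proof -
    have "inj_on (\<lambda>x. x 0) (keys f)"
    proof (rule inj_onI)
      fix y z assume "y \<in> keys f" "z \<in> keys f" "y 0 = z 0"
      then show "y = z" using x(1)[of y] x(1)[of z] by simp
    qed
    from sum.reindex[OF this, of "\<lambda>\<mu>. coef f (transl \<mu>) \<odot> e_elt \<Phi> \<Delta> L m \<mu>"]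
    have "(\<Sum>\<mu>\<in>(\<lambda>x. x 0) ` keys f. coef f (transl \<mu>) \<odot> e_elt \<Phi> \<Delta> L m \<mu>)
        = (\<Sum>x\<in>keys f. coef f (transl (x 0)) \<odot> e_elt \<Phi> \<Delta> L m (x 0))" by simp
    also have "\<dots> = h" unfolding f(2) lext_def
    proof (intro sum.cong refl)
      fix y assume "y \<in> keys f"
      from x(1)[OF this, symmetric] e_elt_eq[OF x(2)[OF this]]
      show "coef f (transl (y 0)) \<odot> e_elt \<Phi> \<Delta> L m (y 0) = coef f y \<odot> E (y 0)" by simp
    qed
    finally show ?thesis by simp
  qed
  moreover have "finite ((\<lambda>x. x 0) ` keys f)" "(\<lambda>x. x 0) ` keys f \<subseteq> P" using x(2) by auto
  ultimately show "h \<in> lattice_algebra \<Phi> \<Delta> L m" unfolding lattice_algebra_def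
    by (intro CollectI exI[of _ "(\<lambda>x. x 0) ` keys f"] exI[of _ "\<lambda>\<mu>. coef f (transl \<mu>)"]) simp
qed

lemma a_elt_eq: "\<mu> \<in> P ==> a_elt \<Phi> \<Delta> L m \<mu> = AA \<mu>" unfolding a_elt_def AA_def finite_weyl_eq
  using cox_length_affine weyl_affine e_elt_eq P_weyl by (intro sum.cong) auto

lemma weyl_character_eq: assumes "t \<in> Pp" shows "weyl_character \<Phi> \<Delta> L m t = ch t" unfolding weyl_character_def
proof (rule the_equality)
  have a: "a_elt \<Phi> \<Delta> L m \<rho> = AA \<rho>" "a_elt \<Phi> \<Delta> L m (t + \<rho>) = AA (t + \<rho>)"
    using a_elt_eq P_add Pp_P[OF assms] rho_P by auto
  have A: "AA \<rho> \<in> HH" unfolding AA_def by (intro H_sum H_simps X_H)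
  show "ch t \<in> lattice_algebra \<Phi> \<Delta> L m \<and> m (ch t) (a_elt \<Phi> \<Delta> L m \<rho>) = a_elt \<Phi> \<Delta> L m (t + \<rho>)"
    using AA_factor[OF assms] chf(1)[OF assms] mm_m[OF ch_H A] unfolding a lattice_algebra_eq by simp
  fix h assume h: "h \<in> lattice_algebra \<Phi> \<Delta> L m \<and> m h (a_elt \<Phi> \<Delta> L m \<rho>) = a_elt \<Phi> \<Delta> L m (t + \<rho>)"
  then obtain f where f: "f \<in> LP" "h = lext E f" unfolding lattice_algebra_eq by blast
  have "h \<in> HH" unfolding f(2) by (rule lext_H) simp
  then have "h \<star> AA \<rho> = ch t \<star> AA \<rho>" using h A AA_factor[OF assms] unfolding a by (simp add: mm_m)
  then have "lext E (f - chf t) \<star> AA \<rho> = 0" by (simp add: f(2) lext_diff mm_diff)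
  then show "h = ch t" using AA_cancel LP_simps(3)[OF f(1) chf(1)[OF assms]] f(2) by (metis eq_iff_diff_eq_0)
qed

end

section \<open>The Kazhdan-Lusztig elements of translations\<close>

context affine_hecke
begin

lemma exists_dominant_rep:
  "\<exists>k\<in>HH. keys k \<subseteq> Dom \<and> C0 \<star> ch t = C0 \<star> k" if "t \<in> Pp"
proof -
  have "\<exists>k\<in>HH. keys k \<subseteq> Dom \<and> C0 \<star> E (x 0) = C0 \<star> k" if "x \<in> keys (chf t)" for x
  proof -
    have "x 0 \<in> P" using chf(1)[OF \<open>t \<in> Pp\<close>] that by (auto simp: LP_def transl_def)
    then show ?thesis using good_X[OF transl_We C0_good] unfolding good_def by blast
  qed
  then obtain K where K: "\<And>x. x \<in> keys (chf t) ==> K x \<in> HH \<and> keys (K x) \<subseteq> Dom \<and> C0 \<star> E (x 0) = C0 \<star> K x"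
    by metis
  let ?k = "\<Sum>x\<in>keys (chf t). coef (chf t) x \<odot> K x"
  have "C0 \<star> ch t = C0 \<star> ?k" using K by (simp add: lext_def mm_sum mm_scale)
  moreover have "?k \<in> HH" using K by (intro H_sum H_simps) blast
  moreover have "keys ?k \<subseteq> Dom" using keys_sum_scale[of "coef (chf t)" K "keys (chf t)"] K by fastforce
  ultimately show ?thesis by blast
qed

text \<open>The dominant coordinates of the Kazhdan-Lusztig element of \<open>w0 o transl t\<close>;
  \<open>h_elt_eq\<close> recognises them as the element \<open>h\<close> of
  \<open>t\<close>.\<close>

definition kk :: "'v => 'v hecke" where
  "kk t = (SOME k. k \<in> HH \<and> keys k \<subseteq> Dom \<and> C0 \<star> ch t = C0 \<star> k)"

lemma kk: assumes "t \<in> Pp" shows "kk t \<in> HH" "keys (kk t) \<subseteq> Dom" "C0 \<star> ch t = C0 \<star> kk t"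
  using someI_ex[of "\<lambda>k. k \<in> HH \<and> keys k \<subseteq> Dom \<and> C0 \<star> ch t = C0 \<star> k"] exists_dominant_rep[OF assms]
  unfolding kk_def by blast+

lemma kk_lead: assumes "t \<in> Pp" shows "coef (kk t) z - (if z = transl t then 1 else 0) \<in> Ld (-1)"
proof (cases "z \<in> Dom")
  case True
  have w0: "w0 \<in> weyl" using longest by blast
  have "(C0 \<star> ch t - C0 \<star> e t) + (C0 \<star> e t - T (w0 o transl t)) \<in> neg"
    using neg_simps(2) chf(5)[OF assms] C0_T_neg[OF transl_Dom[OF assms]] by blast
  then have "C0 \<star> kk t - T (w0 o transl t) \<in> neg" using kk(3)[OF assms] by simp
  then have "coef (C0 \<star> kk t - T (w0 o transl t)) (w0 o z) \<in> Ld (-1)" unfolding neg_iff by blast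
  moreover have "w0 o z = w0 o transl t \<longleftrightarrow> z = transl t"
    using weyl_Dom_unique(2)[OF w0 w0 True transl_Dom[OF assms]] by blast
  ultimately show ?thesis using coef_C0_longest[OF kk(2)[OF assms] True] by (simp add: lookup_minus coef_hT)
next
  case False
  then have "z \<notin> keys (kk t)" using kk(2)[OF assms] by blast
  then have "coef (kk t) z = 0" by (simp add: in_keys_iff)
  then show ?thesis using False transl_Dom[OF assms] by auto
qed

lemma h_elt_eq: assumes "t \<in> Pp" shows "h_elt \<Phi> \<Delta> L m t = kk t"
proof -
  have c: "KL_coeff \<Phi> \<Delta> L m (w0 o x) (w0 o transl t) = coef (kk t) x" if "x \<in> Dom" for x
    unfolding KL_coeff_def KL_translation[OF assms] kk(3)[OF assms]
    by (rule coef_C0_longest[OF kk(2)[OF assms] that])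
  have "{x. x \<in> Dom \<and> KL_coeff \<Phi> \<Delta> L m (w0 o x) (w0 o transl t) \<noteq> 0} = keys (kk t)"
    using c kk(2)[OF assms] by (auto simp: in_keys_iff)
  then have "h_elt \<Phi> \<Delta> L m t = (\<Sum>x\<in>keys (kk t). coef (kk t) x \<odot> T x)"
    unfolding h_elt_def Let_def min_coset_reps_eq using c kk(2)[OF assms] by (intro sum.cong) auto
  then show ?thesis using hecke_expand[of "kk t"] by simp
qed

lemma Dom_stepD:
  assumes "n \<in> P" "v \<in> weyl" "d \<in> \<Delta>" "v d \<in> Pos" "transl n o v o reflect d \<in> Dom"
  shows "transl n o v \<in> Dom" "len (transl n o v) = len (transl n o v o reflect d) + 1"
proof -
  let ?y = "transl n o v" and ?s = "reflect d"
  have y: "?y \<in> We" using We_comp transl_We weyl_We assms by blast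
  have s: "?s \<in> gens" using reflect_gens assms by blast
  have vd: "v d \<in> \<Phi>" "- v d \<in> \<Phi>" using assms(4) pos_subset uminus_root by auto
  have "lin ?y = v" using lin_transl weyl_linear assms by blast
  then have c: "cr ?y ?s = - v d" using cr_simple[OF We_aff[OF y] assms(3)] by simp
  have "lev ?y r \<ge> 0" if a: "r \<in> Pos" for r
  proof (cases "r = v d")
    case True
    have "lev (?y o ?s) (- v d) = lev ?y (- v d) + 1" using cr(2)[OF We_aff[OF y] s] c by simp
    then have "lev (?y o ?s) (v d) = lev ?y (v d) - 1"
      using lev_uminus[OF We_aff[OF y] vd(1)] lev_uminus[OF Dom_aff[OF assms(5)] vd(1)] by simp
    then show ?thesis using Dom_lev[OF assms(5) a] True by simp
  next
    case False
    moreover have "r \<noteq> - v d" using a assms(4) uminus_pos_iff[OF vd(1)] by auto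
    ultimately have "lev (?y o ?s) r = lev ?y r" using cr(3)[OF We_aff[OF y] s] c a pos_subset by auto
    then show ?thesis using Dom_lev[OF assms(5) a] by simp
  qed
  then show D: "?y \<in> Dom" using y by (simp add: Dom_def)
  have "cr ?y ?s \<notin> Pos" using c assms(4) uminus_pos_iff[OF vd(1)] by simp
  then show "len ?y = len (?y o ?s) + 1" using Dom_step(2)[OF D s] assms(5) by simp
qed

lemma C0_ch_right: "t \<in> Pp ==> d \<in> \<Delta> ==> C0 \<star> ch t \<star> T (reflect d) = q_pow (int (wt d 0)) \<odot> (C0 \<star> ch t)"
  using ch_commute(3) C0_right by (metis mm_assoc mm_scale(2))

text \<open>As \<open>ch l\<close> commutes with \<open>C0\<close>, the Kazhdan-Lusztig element is
  also an eigenvector for right multiplication by finite generators, and \<open>coef_right\<close>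
  fixes its coefficients along \<open>v\<close>. These powers of \<open>q\<close> are the deficits
  with which galleries start.\<close>

lemma coef_kk_weyl:
  assumes "l \<in> Pp" "n \<in> P" "v \<in> weyl" "transl n o v \<in> Dom"
  shows "coef (kk l) (transl n o v) = q_pow (- Lw v) * coef (kk l) (transl n)" using assms(3,4)
proof (induction rule: weyl_induct)
  case (step v d)
  let ?s = "reflect d" and ?y = "transl n o v"
  have d: "d \<in> \<Phi>" "d \<in> Pos" using simple_root step by auto
  have s: "?s \<in> gens" "?s \<in> We" using reflect_gens gens_We step by auto
  have w0: "w0 \<in> weyl" "w0 \<in> We" using longest weyl_We by auto
  have D: "?y o ?s \<in> Dom" using step(5) by (simp only: comp_assoc)
  note y = Dom_stepD[OF assms(2) step(1-3) D]
  let ?x = "w0 o ?y o ?s"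
  have x: "?x o ?s = w0 o ?y" by (rule reflect_twice[OF d(1)])
  have xW: "?x \<in> We" using We_comp w0 Dom_We[OF y(1)] s by blast
  have "len (w0 o ?y) = len (w0 o (?y o ?s)) + 1"
    using len_weyl_Dom[OF w0(1) y(1)] len_weyl_Dom[OF w0(1) D] y(2) by simp
  then have "len (?x o ?s) = len ?x + 1" unfolding x by (simp only: comp_assoc)
  from coef_right[OF mm_H s(1) C0_ch_right[OF assms(1) step(2)] xW this]
  have "coef (C0 \<star> kk l) (w0 o ?y) = q_pow (int (wt d 0)) * coef (C0 \<star> kk l) (w0 o (?y o ?s))"
    unfolding x kk(3)[OF assms(1)] by (simp only: comp_assoc)
  then have "coef (kk l) ?y = q_pow (int (wt d 0)) * coef (kk l) (?y o ?s)"
    using coef_C0_longest[OF kk(2)[OF assms(1)]] y(1) D by simp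
  then have "coef (kk l) (?y o ?s) = q_pow (- int (wt d 0)) * coef (kk l) ?y"
    by (simp add: mult.assoc[symmetric] q_pow_add)
  moreover have "Lw (v o ?s) = Lw v + int (wt d 0)"
    using Lw_up[OF step(1) d(2) step(3)] len_reflect(1)[OF step(1-3)] by blast
  moreover have "coef (kk l) ?y = q_pow (- Lw v) * coef (kk l) (transl n)" using step(4) y(1) by blast
  ultimately have "coef (kk l) (transl n o (v o ?s)) = q_pow (- Lw (v o ?s)) * coef (kk l) (transl n)"
    by (simp add: mult.assoc[symmetric] q_pow_add comp_assoc add.commute del: comp_apply)
  then show ?case .
qed simp

section \<open>Folded galleries\<close>

definition gterm :: "('v => 'v) => ('v => 'v) => 'v hecke" where
  "gterm z x = q_pow (- Lw (dir z x)) \<odot> (C0 \<star> T z)"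

definition VV :: "'v => ('v => 'v) set" where "VV l = {v \<in> weyl. transl l o v \<in> Dom}"

lemma finite_VV: "finite (VV l)" unfolding VV_def using finite_weyl' by simp

lemma dir_id: "z \<in> We ==> dir z id = lin z" by (simp add: dir_def lin_def comp_def)

text \<open>By \<open>kk_lead\<close> only the translation by \<open>l\<close> has a coefficient
  with a constant term, so by \<open>coef_kk_weyl\<close> the top-degree part lives on the dominant
  elements \<open>transl l o v\<close>.\<close>

lemma start:
  assumes "l \<in> Pp"
  shows "C0 \<star> ch l \<in> good 0 id" "C0 \<star> ch l - (\<Sum>v\<in>VV l. gterm (transl l o v) id) \<in> good (-1) id"
proof -
  define k' where "k' = (\<Sum>v\<in>VV l. q_pow (- Lw v) \<odot> T (transl l o v))"
  have l: "l \<in> P" using assms Pp_P by blast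
  have lead: "coef (kk l) z = q_pow (- Lw (lin z)) * coef (kk l) (transl (z 0))" if "z \<in> Dom" for z
    using coef_kk_weyl[OF assms We_P[OF Dom_We[OF that]] We_lin[OF Dom_We[OF that]]] that
    by (simp add: transl_lin)
  have k0: "coef (kk l) y \<in> Ld 0" for y
    using Ld_add[OF Ld_mono[OF kk_lead[OF assms, of y]] Ld_mono[OF one_Ld], of 0]
      Ld_mono[OF kk_lead[OF assms, of y], of 0] by (auto split: if_splits)
  have "coef (kk l) z \<in> Ld (0 - Lw (dir z id))" if "z \<in> Dom" for z
    using Ld_mult[OF q_pow_Ld k0] lead[OF that] dir_id[OF Dom_We[OF that]] by simp
  then show "C0 \<star> ch l \<in> good 0 id" unfolding good_def using kk[OF assms] by blast
  have "keys k' \<subseteq> Dom"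
    unfolding k'_def using keys_sum_scale[of "\<lambda>v. q_pow (- Lw v)" "\<lambda>v. T (transl l o v)" "VV l"]
    by (auto simp: VV_def)
  then have "keys (kk l - k') \<subseteq> Dom" using keys_diff[of "kk l" k'] kk(2)[OF assms] by blast
  then have K: "kk l - k' \<in> HH" "keys (kk l - k') \<subseteq> Dom" using Dom_We by (auto simp: H_iff)
  have "coef (kk l - k') z \<in> Ld (-1 - Lw (dir z id))" if z: "z \<in> Dom" for z
  proof -
    let ?v = "lin z"
    have v: "?v \<in> weyl" using We_lin Dom_We z by blast
    have "coef k' z = (\<Sum>v\<in>VV l. q_pow (- Lw v) * (if transl l o v = z then 1 else 0))"
      unfolding k'_def lookup_sum by (intro sum.cong) (auto simp: coef_hT)
    also have "\<dots> = (\<Sum>v\<in>VV l. if v = ?v then (if z 0 = l then q_pow (- Lw ?v) else 0) else 0)"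
    proof (intro sum.cong refl)
      fix v assume v: "v \<in> VV l"
      have "transl l o v = z \<longleftrightarrow> v = ?v \<and> z 0 = l"
      proof
        assume "transl l o v = z"
        then show "v = ?v \<and> z 0 = l" using lin_transl[of v l] weyl_linear v by (auto simp: VV_def transl_def)
      next
        assume "v = ?v \<and> z 0 = l"
        then show "transl l o v = z" using transl_lin[of z] by simp
      qed
      then show "q_pow (- Lw v) * (if transl l o v = z then 1 else 0)
          = (if v = ?v then (if z 0 = l then q_pow (- Lw ?v) else 0) else 0)" by auto
    qed
    also have "\<dots> = (if ?v \<in> VV l \<and> z 0 = l then q_pow (- Lw ?v) else 0)" using finite_VV by simp
    also have "\<dots> = q_pow (- Lw ?v) * (if transl (z 0) = transl l then 1 else 0)"
    proof -
      have "transl (z 0) = transl l \<longleftrightarrow> z 0 = l" by (metis add_right_cancel transl_def)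
      then show ?thesis using v z transl_lin[of z] by (auto simp: VV_def)
    qed
    finally have "coef (kk l - k') z
        = q_pow (- Lw ?v) * (coef (kk l) (transl (z 0)) - (if transl (z 0) = transl l then 1 else 0))"
      using lead[OF z] by (simp add: lookup_minus right_diff_distrib)
    moreover have "- Lw ?v + -1 = -1 - Lw (dir z id)" using dir_id[OF Dom_We[OF z]] by simp
    ultimately show ?thesis
      using Ld_mult[OF q_pow_Ld[of "- Lw ?v"] kk_lead[OF assms, of "transl (z 0)"]] by (simp only:)
  qed
  then have "C0 \<star> (kk l - k') \<in> good (-1) id" unfolding good_def using K by blast
  moreover have "C0 \<star> k' = (\<Sum>v\<in>VV l. gterm (transl l o v) id)" unfolding k'_def mm_sum mm_scale gterm_def
  proof (intro sum.cong refl)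
    fix v assume "v \<in> VV l"
    then have "dir (transl l o v) id = v"
      using dir_id Dom_We lin_transl[OF weyl_linear, of v l] by (simp add: VV_def)
    then show "q_pow (- Lw v) \<odot> (C0 \<star> T (transl l o v)) = q_pow (- Lw (dir (transl l o v) id)) \<odot> (C0 \<star> T (transl l o v))"
      by simp
  qed
  ultimately show "C0 \<star> ch l - (\<Sum>v\<in>VV l. gterm (transl l o v) id) \<in> good (-1) id"
    using kk(3)[OF assms] by (simp add: mm_diff)
qed

text \<open>A fold that loses no degree: the direction goes down by a Bruhat cover, and the crossed
  hyperplane is as heavy as the parallel one through 0.\<close>

definition folds :: "('v => 'v) => ('v => 'v) => ('v => 'v) => bool" where
  "folds z x s \<longleftrightarrow> dir z x (cr x s) \<notin> Pos \<and> len (dir z x) = len (dir z x o reflect (cr x s)) + 1 \<and> L s = wt (cr x s) 0"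

text \<open>The fold term keeps the top degree exactly when \<open>L s\<close> equals the drop of
  \<open>Lw\<close>, which is the condition \<open>folds\<close>; otherwise, and always for the
  lower half of \<open>kap\<close>, it falls into \<open>good (-1)\<close>.\<close>

lemma gterm_step:
  assumes "z \<in> Dom" "x \<in> We" "s \<in> gens" "cr x s \<in> Pos"
  shows "gterm z x \<star> T s - ((if z o s \<in> Dom then gterm (z o s) (x o s) else 0)
    + (if folds z x s then gterm z (x o s) else 0)) \<in> good (-1) (x o s)"
proof -
  let ?b = "cr x s" and ?u = "dir z x"
  let ?r = "?u o reflect ?b"
  have z: "z \<in> We" using Dom_We assms by blast
  have u: "?u \<in> weyl" using dir_weyl z assms by blast
  have c: "cr z s = ?u ?b" using dir_cr z assms by blast
  note ds = dir_step[OF z assms(2,3)]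
  show ?thesis
  proof (cases "?u ?b \<in> Pos")
    case True
    then show ?thesis using C0_T_step(1)[OF assms(1,3)] Dom_step(1)[OF assms(1,3)] c ds(1) good_0
      by (simp add: gterm_def folds_def mm_scale)
  next
    case False
    let ?B = "C0 \<star> T z" and ?l = "q_pow (- Lw ?r)"
    have Ls: "L s \<le> wt ?b 0" "L s > 0" using L_le_wt[OF assms(2,3)] L_pos[OF assms(3)] by auto
    note Lw = Lw_reflect[OF u assms(4) False]
    have f: "folds z x s \<longleftrightarrow> Lw ?u = Lw ?r + int (wt ?b 0) \<and> L s = wt ?b 0"
      unfolding folds_def Lw(2)[symmetric] using False by simp
    have l1: "q_pow (int (L s) - Lw ?u) - (if folds z x s then ?l else 0) \<in> Ld (-1 - Lw ?r)"
    proof (cases "folds z x s")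
      case True
      then have "int (L s) - Lw ?u = - Lw ?r" using f by linarith
      then show ?thesis using True by simp
    next
      case n: False
      then have "int (L s) - Lw ?u \<le> -1 - Lw ?r" using f Lw(1) Ls by linarith
      then show ?thesis using n by (auto intro: Ld_mono[OF q_pow_Ld])
    qed
    have "- Lw ?u - int (L s) \<le> -1 - Lw ?r" using Lw(1) Ls by linarith
    then have l2: "q_pow (int (L s) - Lw ?u) - q_pow (- Lw ?u - int (L s)) - (if folds z x s then ?l else 0) \<in> Ld (-1 - Lw ?r)"
      using Ld_diff[OF l1 Ld_mono[OF q_pow_Ld[of "- Lw ?u - int (L s)"]]] by (simp add: algebra_simps)
    have G: "c \<odot> ?B \<in> good (-1) (x o s)" if "c \<in> Ld (-1 - Lw ?r)" for c
      using that ds(2) assms(1) by (intro good_T) auto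
    show ?thesis
    proof (cases "z o s \<in> Dom")
      case True
      have "gterm z x \<star> T s - (gterm (z o s) (x o s) + (if folds z x s then gterm z (x o s) else 0))
          = (q_pow (int (L s) - Lw ?u) - q_pow (- Lw ?u - int (L s)) - (if folds z x s then ?l else 0)) \<odot> ?B"
        using C0_T_step(2)[OF assms(1,3) _ True] False c ds
        by (simp add: gterm_def mm_scale hscale_simps kap_def right_diff_distrib q_pow_add)
      then show ?thesis using G[OF l2] True by (simp only: if_True)
    next
      case n: False
      have "gterm z x \<star> T s - (if folds z x s then gterm z (x o s) else 0)
          = (q_pow (int (L s) - Lw ?u) - (if folds z x s then ?l else 0)) \<odot> ?B"
        using C0_T_step(3)[OF assms(1,3) n] ds(2) by (simp add: gterm_def mm_scale hscale_simps q_pow_add)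
      then show ?thesis using G[OF l1] n by simp
    qed
  qed
qed

definition xx :: "('v => 'v) list => nat => 'v => 'v" where "xx ss k = word_prod (take k ss)"

text \<open>\<open>xx\<close> is the end of the unfolded gallery, \<open>zz\<close> the end of the
  one that starts in direction \<open>fst p\<close> and is folded at the positions in
  \<open>snd p\<close>, which count from 1. The length-0 factor \<open>a\<close> is supplied only at
  the end.\<close>

definition zz :: "'v => ('v => 'v) list => ('v => 'v) \<times> nat set => nat => 'v => 'v" where
  "zz l ss p k = transl l o fst p o word_prod (map (\<lambda>r. ss ! (r - 1)) (filter (\<lambda>r. r \<notin> snd p) [1..<Suc k]))"

lemma xx_0 [simp]: "xx ss 0 = id" and xx_Suc: "k < length ss ==> xx ss (Suc k) = xx ss k o ss ! k"
  by (simp_all add: xx_def take_Suc_conv_app_nth)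

lemma zz_0: "zz l ss p 0 = transl l o fst p" by (simp add: zz_def)

lemma zz_Suc: "zz l ss p (Suc k) = (if Suc k \<in> snd p then zz l ss p k else zz l ss p k o ss ! k)"
  by (simp add: zz_def word_prod_append comp_assoc)

lemma zz_insert: "i \<le> k ==> zz l ss (v, insert (Suc k) J) i = zz l ss (v, J) i"
proof -
  assume "i \<le> k"
  then have "filter (\<lambda>r. r \<notin> insert (Suc k) J) [1..<Suc i] = filter (\<lambda>r. r \<notin> J) [1..<Suc i]"
    by (intro filter_cong) auto
  then show ?thesis by (simp only: zz_def fst_conv snd_conv)
qed

lemma xx_We: "set ss \<subseteq> gens ==> xx ss k \<in> We" unfolding xx_def by (rule word_We) (use set_take_subset in fast)

lemma zz_We:
  assumes "l \<in> P" "fst p \<in> weyl" "set ss \<subseteq> gens" "k \<le> length ss" shows "zz l ss p k \<in> We" using assms(4)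
proof (induction k)
  case 0
  show ?case unfolding zz_0 using We_comp transl_We weyl_We assms by blast
next
  case (Suc k)
  then have "ss ! k \<in> gens" using assms(3) nth_mem[of k ss] by auto
  moreover have "zz l ss p k \<in> We" using Suc by simp
  ultimately have "zz l ss p k \<in> We" "zz l ss p k o ss ! k \<in> We" using We_comp gens_We by blast+
  then show ?case unfolding zz_Suc by (simp only: split: if_split) simp
qed

definition Gal :: "'v => ('v => 'v) list => nat => (('v => 'v) \<times> nat set) set" where
  "Gal l ss k = {p. fst p \<in> VV l \<and> snd p \<subseteq> {1..k} \<and> (\<forall>i\<in>{1..k}. zz l ss p i \<in> Dom) \<and>
     (\<forall>i\<in>snd p. folds (zz l ss p (i - 1)) (xx ss (i - 1)) (ss ! (i - 1)))}"

lemma finite_Gal: "finite (Gal l ss k)"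
  by (rule finite_subset[of _ "VV l \<times> Pow {1..k}"]) (use finite_VV in \<open>auto simp: Gal_def\<close>)

lemma Gal_Dom: "p \<in> Gal l ss k ==> zz l ss p k \<in> Dom" by (cases k) (auto simp: Gal_def zz_0 VV_def)

lemma Gal_Suc_cross:
  "Suc k \<notin> snd p ==> p \<in> Gal l ss (Suc k) \<longleftrightarrow> p \<in> Gal l ss k \<and> zz l ss p k o ss ! k \<in> Dom"
  unfolding Gal_def by (simp add: atLeastAtMostSuc_conv subset_insert zz_Suc) blast

lemma Gal_Suc_fold:
  assumes "J \<subseteq> {1..k}"
  shows "(v, insert (Suc k) J) \<in> Gal l ss (Suc k) \<longleftrightarrow>
    (v, J) \<in> Gal l ss k \<and> folds (zz l ss (v, J) k) (xx ss k) (ss ! k)"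
proof -
  have "Suc k \<notin> J" using assms by auto
  have e: "zz l ss (v, insert (Suc k) J) (i - 1) = zz l ss (v, J) (i - 1)" if "i \<in> J" for i
  proof -
    have "i \<le> k" using that assms by auto
    then show ?thesis by (intro zz_insert) simp
  qed
  have "zz l ss (v, insert (Suc k) J) (Suc k) = zz l ss (v, J) k" by (simp add: zz_Suc zz_insert)
  moreover have "(v, J) \<in> Gal l ss k ==> zz l ss (v, J) k \<in> Dom" by (rule Gal_Dom)
  moreover have "zz l ss (v, insert (Suc k) J) i = zz l ss (v, J) i" if "i \<in> {1..k}" for i
    using that by (intro zz_insert) simp
  ultimately show ?thesis
    using assms e zz_insert[of k k] unfolding Gal_def by (auto simp: atLeastAtMostSuc_conv)
qed

lemma sum_Gal_Suc:
  "(\<Sum>p\<in>Gal l ss (Suc k). f p) = (\<Sum>p\<in>Gal l ss k. (if zz l ss p k o ss ! k \<in> Dom then f p else 0)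
     + (if folds (zz l ss p k) (xx ss k) (ss ! k) then f (fst p, insert (Suc k) (snd p)) else (0::'v hecke)))"
proof -
  let ?G = "Gal l ss k" and ?G' = "Gal l ss (Suc k)"
  let ?A = "{p \<in> ?G. zz l ss p k o ss ! k \<in> Dom}" and ?B = "{p \<in> ?G. folds (zz l ss p k) (xx ss k) (ss ! k)}"
  let ?i = "\<lambda>p. (fst p, insert (Suc k) (snd p)) :: ('v => 'v) \<times> nat set"
  have J: "snd p \<subseteq> {1..k}" "Suc k \<notin> snd p" if "p \<in> ?G" for p using that unfolding Gal_def by auto
  have "?G' = ?A \<union> ?i ` ?B"
  proof (intro set_eqI iffI)
    fix p assume p: "p \<in> ?G'"
    show "p \<in> ?A \<union> ?i ` ?B"
    proof (cases "Suc k \<in> snd p")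
      case True
      let ?p = "(fst p, snd p - {Suc k})"
      have "snd p - {Suc k} \<subseteq> {1..k}" using p unfolding Gal_def by (auto simp: atLeastAtMostSuc_conv)
      moreover have eq: "p = ?i ?p" using True by (simp add: insert_absorb prod_eq_iff)
      ultimately have "?p \<in> ?B" using Gal_Suc_fold[of "snd p - {Suc k}" k "fst p"] p True by (simp add: insert_absorb)
      then show ?thesis using eq by blast
    next
      case False
      then show ?thesis using p Gal_Suc_cross by blast
    qed
  next
    fix p assume "p \<in> ?A \<union> ?i ` ?B"
    then consider "p \<in> ?A" | p' where "p' \<in> ?B" "p = ?i p'" by blast
    then show "p \<in> ?G'"
    proof cases
      case 1
      then show ?thesis using Gal_Suc_cross[OF J(2)] by blast
    next
      case 2
      then show ?thesis using Gal_Suc_fold[OF J(1), of p' "fst p'"] by simp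
    qed
  qed
  moreover have "?A \<inter> ?i ` ?B = {}" using J(2) by fastforce
  ultimately have "sum f ?G' = sum f ?A + sum f (?i ` ?B)" using finite_Gal by (simp add: sum.union_disjoint)
  also have "sum f (?i ` ?B) = (\<Sum>p\<in>?B. f (?i p))"
  proof (rule sum.reindex[unfolded comp_def])
    show "inj_on ?i ?B"
    proof (rule inj_onI)
      fix p p' assume p: "p \<in> ?B" "p' \<in> ?B" "?i p = ?i p'"
      then have "snd p = snd p'" using J(2)[of p] J(2)[of p'] by (auto simp: insert_eq_iff)
      then show "p = p'" using p(3) by (simp add: prod_eq_iff)
    qed
  qed
  finally show ?thesis unfolding sum.distrib sum.inter_filter[OF finite_Gal] .
qed

text \<open>All crossings of the unfolded gallery are positive, so each letter acts as
  \<open>Tsgn\<close>: errors in \<open>good (-1)\<close> stay there by \<open>good_step\<close>,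
  and the main terms branch according to \<open>gterm_step\<close>.\<close>

lemma gallery_expansion:
  assumes "l \<in> Pp" "set ss \<subseteq> gens" "\<And>i. i < length ss ==> xx ss i \<in> Dom \<and> cr (xx ss i) (ss ! i) \<in> Pos" "k \<le> length ss"
  shows "C0 \<star> ch l \<star> T (xx ss k) - (\<Sum>p\<in>Gal l ss k. gterm (zz l ss p k) (xx ss k)) \<in> good (-1) (xx ss k)"
  using assms(4)
proof (induction k)
  case 0
  have "Gal l ss 0 = (\<lambda>v. (v, {})) ` VV l" by (auto simp: Gal_def)
  then have "(\<Sum>p\<in>Gal l ss 0. gterm (zz l ss p 0) id) = (\<Sum>v\<in>VV l. gterm (transl l o v) id)"
    by (simp add: sum.reindex inj_on_def zz_0)
  then show ?case using start(2)[OF assms(1)] by (simp only: xx_0 mm_one(2)[OF mm_H])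
next
  case (Suc k)
  let ?x = "xx ss k" and ?s = "ss ! k" and ?z = "\<lambda>p. zz l ss p k"
  have k: "k < length ss" "?x \<in> Dom" "cr ?x ?s \<in> Pos" using Suc assms(3)[of k] by auto
  have s: "?s \<in> gens" using k assms(2) nth_mem by blast
  have x: "?x \<in> We" using Dom_We k by blast
  have Ts: "Tsgn ?x ?s = T ?s" using k by (simp add: Tsgn_def)
  have "T (xx ss (Suc k)) = T ?x \<star> T ?s"
    using T_gen(1)[OF x s] Dom_step(1)[OF k(2) s k(3)] by (simp add: xx_Suc[OF k(1)])
  then have C: "C0 \<star> ch l \<star> T (xx ss (Suc k)) = C0 \<star> ch l \<star> T ?x \<star> T ?s" by (simp add: mm_assoc)
  let ?g = "\<lambda>p. (if ?z p o ?s \<in> Dom then gterm (?z p o ?s) (?x o ?s) else 0)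
      + (if folds (?z p) ?x ?s then gterm (?z p) (?x o ?s) else 0)"
  have "(\<Sum>p\<in>Gal l ss (Suc k). gterm (zz l ss p (Suc k)) (xx ss (Suc k))) = (\<Sum>p\<in>Gal l ss k. ?g p)"
    unfolding sum_Gal_Suc
  proof (intro sum.cong refl)
    fix p assume "p \<in> Gal l ss k"
    then have "Suc k \<notin> snd p" unfolding Gal_def by auto
    then have "zz l ss p (Suc k) = ?z p o ?s" "zz l ss (fst p, insert (Suc k) (snd p)) (Suc k) = ?z p"
      using zz_insert[of k k l ss "fst p" "snd p"] by (simp_all add: zz_Suc)
    then show "(if ?z p o ?s \<in> Dom then gterm (zz l ss p (Suc k)) (xx ss (Suc k)) else 0)
      + (if folds (?z p) ?x ?s then gterm (zz l ss (fst p, insert (Suc k) (snd p)) (Suc k)) (xx ss (Suc k)) else 0) = ?g p"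
      by (simp add: xx_Suc[OF k(1)])
  qed
  then have "C0 \<star> ch l \<star> T (xx ss (Suc k)) - (\<Sum>p\<in>Gal l ss (Suc k). gterm (zz l ss p (Suc k)) (xx ss (Suc k)))
      = (C0 \<star> ch l \<star> T ?x - (\<Sum>p\<in>Gal l ss k. gterm (?z p) ?x)) \<star> T ?s
      + (\<Sum>p\<in>Gal l ss k. gterm (?z p) ?x \<star> T ?s - ?g p)" unfolding C by (simp add: mm_diff mm_sum sum_subtractf)
  also have "\<dots> \<in> good (-1) (?x o ?s)"
  proof (rule good_add)
    have "k \<le> length ss" using k by simp
    from good_step[OF Suc.IH[OF this] x s]
    show "(C0 \<star> ch l \<star> T ?x - (\<Sum>p\<in>Gal l ss k. gterm (?z p) ?x)) \<star> T ?s \<in> good (-1) (?x o ?s)" unfolding Ts .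
    show "(\<Sum>p\<in>Gal l ss k. gterm (?z p) ?x \<star> T ?s - ?g p) \<in> good (-1) (?x o ?s)"
      using gterm_step[OF Gal_Dom x s k(3)] by (intro good_sum)
  qed
  finally show ?case by (simp only: xx_Suc[OF k(1)])
qed

lemma Lw_pos: "u \<in> weyl ==> u \<noteq> id ==> Lw u > 0"
proof -
  assume u: "u \<in> weyl" "u \<noteq> id"
  then obtain a where "a \<in> inversions u" using weyl_eq_idI[OF u(1)] by (auto simp: inversions_def)
  then have "(\<Sum>a\<in>inversions u. wt a 0) > 0"
    using wt_pos pos_subset finite_inversions(1) by (intro sum_pos2[of _ a]) (auto simp: inversions_def)
  then show ?thesis by (simp add: Lw_def del: of_nat_sum)
qed

text \<open>A gallery ending in direction \<open>u\<close> contributes in degree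
  \<open>- Lw u\<close>, which is negative unless \<open>u = id\<close>.\<close>

lemma product_expansion:
  assumes "l \<in> Pp" "set ss \<subseteq> gens" "\<And>i. i < length ss ==> xx ss i \<in> Dom \<and> cr (xx ss i) (ss ! i) \<in> Pos"
    and "a \<in> We" "len a = 0"
  defines "x \<equiv> xx ss (length ss)" and "z \<equiv> \<lambda>p. zz l ss p (length ss)"
  shows "C0 \<star> ch l \<star> T (x o a) - (\<Sum>p | p \<in> Gal l ss (length ss) \<and> dir (z p) x = id. C0 \<star> T (z p o a)) \<in> neg"
proof -
  let ?G = "Gal l ss (length ss)"
  have x: "x \<in> We" "x o a \<in> We" using xx_We assms(2,4) We_comp unfolding x_def by auto
  have Ta: "h \<star> T x \<star> T a = h \<star> T (x o a)" "h \<star> T (z p) \<star> T a = h \<star> T (z p o a)" if "z p \<in> Dom" for h p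
    using T_stab(1)[OF x(1) assms(4,5)] T_stab(1)[OF Dom_We[OF that] assms(4,5)] by (simp_all add: mm_assoc)
  have "(C0 \<star> ch l \<star> T x - (\<Sum>p\<in>?G. gterm (z p) x)) \<star> T a \<in> neg"
    using good_neg[OF good_stab[OF gallery_expansion[OF assms(1-3) order_refl, folded x_def] x(1) assms(4,5)] x(2)]
    by (simp add: z_def)
  moreover have "(\<Sum>p\<in>?G. gterm (z p) x) \<star> T a - (\<Sum>p | p \<in> ?G \<and> dir (z p) x = id. C0 \<star> T (z p o a)) \<in> neg"
  proof -
    have "(\<Sum>p\<in>?G. gterm (z p) x) \<star> T a - (\<Sum>p | p \<in> ?G \<and> dir (z p) x = id. C0 \<star> T (z p o a))
        = (\<Sum>p\<in>?G. gterm (z p) x \<star> T a - (if dir (z p) x = id then C0 \<star> T (z p o a) else 0))"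
      using finite_Gal by (simp add: mm_sum sum_subtractf sum.inter_filter)
    also have "\<dots> \<in> neg"
    proof (rule neg_sum)
      fix p assume "p \<in> ?G"
      then have p: "z p \<in> Dom" using Gal_Dom unfolding z_def by blast
      show "gterm (z p) x \<star> T a - (if dir (z p) x = id then C0 \<star> T (z p o a) else 0) \<in> neg"
      proof (cases "dir (z p) x = id")
        case True
        then show ?thesis using Ta(2)[OF p] by (simp add: gterm_def mm_scale hscale_simps neg_simps)
      next
        case False
        then have "q_pow (- Lw (dir (z p) x)) \<in> Ld (-1)"
          using Lw_pos[OF dir_weyl[OF Dom_We[OF p] x(1)]] by (intro Ld_mono[OF q_pow_Ld]) simp
        then show ?thesis
          using C0_T_scaled_neg[OF Dom_stab[OF p assms(4,5)]] Ta(2)[OF p] False by (simp add: gterm_def mm_scale)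
      qed
    qed
    finally show ?thesis .
  qed
  moreover have "C0 \<star> ch l \<star> T x \<star> T a = C0 \<star> ch l \<star> T (x o a)"
    using T_stab(1)[OF x(1) assms(4,5)] by (simp add: mm_assoc)
  ultimately show ?thesis using neg_simps(2) by (fastforce simp: mm_diff)
qed

text \<open>Final direction \<open>id\<close> gives the end point the linear part of
  \<open>transl t\<close>, so it is a dominant translation and its Kazhdan-Lusztig element is
  \<open>C0\<close> times a character. Both sides are then bar invariant and agree modulo
  \<open>neg\<close>.\<close>

lemma product_formula:
  assumes "\<kappa> \<in> Pp" "t \<in> Pp" "set ss \<subseteq> gens" "\<And>i. i < length ss ==> xx ss i \<in> Dom \<and> cr (xx ss i) (ss ! i) \<in> Pos"
    and "a \<in> We" "len a = 0" "transl t = xx ss (length ss) o a"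
  shows "C0 \<star> ch \<kappa> \<star> kk t = (\<Sum>p | p \<in> Gal \<kappa> ss (length ss) \<and> dir (zz \<kappa> ss p (length ss)) (xx ss (length ss)) = id.
     KL_basis \<Phi> \<Delta> L m (w0 o (zz \<kappa> ss p (length ss) o a)))" (is "_ = sum ?K ?G")
proof -
  let ?x = "xx ss (length ss)" and ?z = "\<lambda>p. zz \<kappa> ss p (length ss)" and ?C = "C0 \<star> ch \<kappa>"
  have x: "?x \<in> We" using xx_We assms(3) by blast
  have KL: "bar (?K p) = ?K p" "?K p - C0 \<star> T (?z p o a) \<in> neg" "?K p \<in> HH" if p: "p \<in> ?G" for p
  proof -
    have z: "?z p \<in> Dom" using Gal_Dom p by blast
    have D: "?z p o a \<in> Dom" using Dom_stab[OF z assms(5,6)] .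
    have "lin (?z p o a) = lin (?z p) o lin a" "lin (?x o a) = lin ?x o lin a"
      using lin_comp_We x Dom_We[OF z] by auto
    moreover have "lin (?x o a) = id" using assms(7) lin_transl_id by metis
    moreover have "lin (?z p) = lin ?x"
    proof -
      have "dir (?z p) ?x o lin ?x = lin (?z p)" by (simp add: dir_def comp_assoc lin_inv_comp(1)[OF x])
      then show ?thesis using p by simp
    qed
    ultimately have l: "lin (?z p o a) = id" by simp
    obtain n where n: "n \<in> Pp" "?z p o a = transl n"
      using Dom_0[OF D] transl_lin[of "?z p o a"] unfolding l comp_id by metis
    have K: "?K p = C0 \<star> ch n" unfolding n(2) by (rule KL_translation[OF n(1)])
    show "?K p \<in> HH" unfolding K by simp
    show "bar (?K p) = ?K p" unfolding K using bar_mult[OF C0_H ch_H] bar_C0 bar_ch[OF n(1)] by simp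
    show "?K p - C0 \<star> T (?z p o a) \<in> neg" unfolding n(2) KL_translation[OF n(1)] by (rule chf(5)[OF n(1)])
  qed
  let ?D = "?C \<star> kk t - sum ?K ?G"
  have "?C \<star> kk t = ?C \<star> ch t" using kk(3)[OF assms(2)] ch_commute(3)[OF assms(1)] by (metis mm_assoc)
  then have "bar ?D = ?D" using bar_mult[OF mm_H ch_H] bar_mult[OF C0_H ch_H] bar_C0 bar_ch assms(1,2) KL(1)
    by (simp add: bar_diff bar_sum)
  moreover have "?D \<in> neg"
  proof -
    \<comment> \<open>The coefficients of \<open>kk t - e t\<close> have negative degree, and
      multiplying \<open>?C\<close> by a dominant \<open>T z\<close> gives coefficients of degree at
      most 0; so only the leading term \<open>e t\<close> matters.\<close>
    have "?C \<star> kk t - ?C \<star> e t = (\<Sum>z\<in>keys (kk t - e t). coef (kk t - e t) z \<odot> (?C \<star> T z))"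
      by (simp add: mm_diff(2)[symmetric]) (subst hecke_expand[of "kk t - e t"], simp add: mm_sum mm_scale)
    also have "\<dots> \<in> neg"
    proof (rule neg_sum)
      fix z assume "z \<in> keys (kk t - e t)"
      then have z: "z \<in> Dom" using keys_diff[of "kk t" "e t"] kk(2)[OF assms(2)] transl_Dom[OF assms(2)] by auto
      have "coef (kk t - e t) z \<in> Ld (-1)" using kk_lead[OF assms(2), of z] by (simp add: lookup_minus coef_hT)
      from good_scale[OF good_X[OF Dom_We[OF z] start(1)[OF assms(1)]] this]
      show "coef (kk t - e t) z \<odot> (?C \<star> T z) \<in> neg" using good_neg[OF _ Dom_We[OF z]] X_Dom[OF z] by simp
    qed
    finally have 1: "?C \<star> kk t - ?C \<star> e t \<in> neg" .
    have 2: "?C \<star> e t - (\<Sum>p\<in>?G. C0 \<star> T (?z p o a)) \<in> neg"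
      using product_expansion[OF assms(1,3-6)] assms(7) by simp
    have "(\<Sum>p\<in>?G. ?K p - C0 \<star> T (?z p o a)) \<in> neg" by (rule neg_sum) (rule KL(2))
    then have 3: "sum ?K ?G - (\<Sum>p\<in>?G. C0 \<star> T (?z p o a)) \<in> neg" by (simp only: sum_subtractf)
    show ?thesis using neg_simps(3)[OF neg_simps(2)[OF 1 2] 3] by simp
  qed
  ultimately have "?D = 0" using bar_neg_zero unfolding neg_iff by blast
  then show ?thesis by simp
qed

end

section \<open>Admissible subsets\<close>

lemma sorted_list_of_subset:
  assumes "J \<subseteq> {1..n}" shows "sorted_list_of_set J = filter (\<lambda>r. r \<in> J) [1..<Suc n]"
proof (rule sorted_list_of_set_unique[THEN iffD1])
  show "finite J" using assms finite_subset by blast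
  have "set (filter (\<lambda>r. r \<in> J) [1..<Suc n]) = J" using assms by auto
  moreover have "sorted_wrt (<) (filter (\<lambda>r. r \<in> J) [1..<Suc n])" by (rule sorted_wrt_filter[OF sorted_wrt_upt])
  ultimately show "sorted_wrt (<) (filter (\<lambda>r. r \<in> J) [1..<Suc n]) \<and> set (filter (\<lambda>r. r \<in> J) [1..<Suc n]) = J
      \<and> length (filter (\<lambda>r. r \<in> J) [1..<Suc n]) = card J" by (metis distinct_card distinct_filter distinct_upt)
qed

lemma upt_split: assumes "i \<in> {1..n}" shows "[1..<Suc n] = [1..<i] @ i # [Suc i..<Suc n]"
proof -
  have "[1..<Suc n] = [1..<i] @ [i..<Suc n]" using assms upt_add_eq_append[of 1 i "Suc n - i"] by simp
  also have "[i..<Suc n] = i # [Suc i..<Suc n]" using assms by (intro upt_conv_Cons) simp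
  finally show ?thesis .
qed

text \<open>In the decreasing enumeration of \<open>J\<close>, the entries before \<open>i\<close>
  are those greater than \<open>i\<close>. This trades the index \<open>k\<close> of the Bruhat
  chain for the position \<open>i\<close> of the fold.\<close>

lemma all_prefixes_iff:
  fixes J :: "nat set"
  assumes "J \<subseteq> {1..n}"
  shows "(\<forall>k<card J. Q (take k (rev (sorted_list_of_set J))) (take (Suc k) (rev (sorted_list_of_set J)))) \<longleftrightarrow>
    (\<forall>i\<in>J. Q (rev (filter (\<lambda>r. r \<in> J) [Suc i..<Suc n])) (rev (filter (\<lambda>r. r \<in> J) [Suc i..<Suc n]) @ [i]))"
proof -
  let ?l = "rev (filter (\<lambda>r. r \<in> J) [1..<Suc n])" and ?f = "\<lambda>i. rev (filter (\<lambda>r. r \<in> J) [Suc i..<Suc n])"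
  have d: "distinct ?l" and s: "set ?l = J" using assms by auto
  then have len: "length ?l = card J" using distinct_card by metis
  have sp: "?l = ?f i @ i # rev (filter (\<lambda>r. r \<in> J) [1..<i])" if "i \<in> J" for i
  proof -
    have "[1..<Suc n] = [1..<i] @ i # [Suc i..<Suc n]" by (rule upt_split) (use that assms in blast)
    then have "filter (\<lambda>r. r \<in> J) [1..<Suc n] = filter (\<lambda>r. r \<in> J) [1..<i] @ i # filter (\<lambda>r. r \<in> J) [Suc i..<Suc n]"
      using that by (simp only: filter_append filter.simps if_True)
    then show ?thesis by (simp only: rev_append rev.simps append_assoc append_Cons append_Nil)
  qed
  have tk: "take k ?l = ?f (?l ! k)" "take (Suc k) ?l = ?f (?l ! k) @ [?l ! k]" if k: "k < card J" for k
  proof -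
    let ?i = "?l ! k"
    have i: "?i \<in> J" using k s len nth_mem by metis
    note sp[OF i]
    moreover have "?l = take k ?l @ ?i # drop (Suc k) ?l" using id_take_nth_drop k len by metis
    ultimately have e: "take k ?l @ ?i # drop (Suc k) ?l = ?f ?i @ ?i # rev (filter (\<lambda>r. r \<in> J) [1..<?i])" by (rule_tac trans[OF sym])
    have "distinct (take k ?l @ ?i # drop (Suc k) ?l)" using d id_take_nth_drop[of k ?l] k len by simp
    then have "?i \<notin> set (take k ?l)" "?i \<notin> set (drop (Suc k) ?l)" by auto
    then show "take k ?l = ?f ?i" using e append_Cons_eq_iff[of ?i "take k ?l" "drop (Suc k) ?l"] by blast
    then show "take (Suc k) ?l = ?f ?i @ [?i]" using take_Suc_conv_app_nth k len by metis
  qed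
  have "set ?l = (\<lambda>k. ?l ! k) ` {..<length ?l}" unfolding set_conv_nth by blast
  then have J: "J = (\<lambda>k. ?l ! k) ` {..<card J}" unfolding s len .
  have ball: "(\<forall>i\<in>A. S i) \<longleftrightarrow> (\<forall>k<c. S (g k))" if "A = g ` {..<c}" for A S c and g :: "nat => nat"
    unfolding that by blast
  from ball[OF J, of "\<lambda>i. Q (?f i) (?f i @ [i])"]
  have "(\<forall>i\<in>J. Q (?f i) (?f i @ [i])) \<longleftrightarrow> (\<forall>k<card J. Q (?f (?l ! k)) (?f (?l ! k) @ [?l ! k]))" .
  moreover have "(\<forall>k<card J. Q (take k ?l) (take (Suc k) ?l)) \<longleftrightarrow> (\<forall>k<card J. Q (?f (?l ! k)) (?f (?l ! k) @ [?l ! k]))"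
    using tk by metis
  ultimately show ?thesis unfolding sorted_list_of_subset[OF assms] by blast
qed

context affine_hecke
begin

lemma word_prod_rev_involutions:
  "(\<And>s. s \<in> set l ==> s o s = id) ==> word_prod (rev l) o word_prod l = id"
proof (induction l)
  case (Cons s l)
  have "word_prod (rev (s # l)) o word_prod (s # l) = word_prod (rev l) o (s o s) o word_prod l"
    by (simp add: comp_assoc)
  also have "s o s = id" by (rule Cons.prems) simp
  finally have "word_prod (rev (s # l)) o word_prod (s # l) = word_prod (rev l) o word_prod l" by (simp only: comp_id)
  moreover have "word_prod (rev l) o word_prod l = id" by (rule Cons.IH, rule Cons.prems) simp
  ultimately have "word_prod (rev (s # l)) o word_prod (s # l) = id" by (rule trans)
  then show ?case .
qed simp

lemma basept_in_alcove: "x basept \<in> alcove \<Phi> \<Delta> x" using basept_alcove by (simp add: alcove_def)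

lemma alcove_fund_chamber: assumes "x \<in> We" shows "alcove \<Phi> \<Delta> x \<subseteq> fund_chamber \<Phi> \<Delta> \<longleftrightarrow> x \<in> Dom"
proof
  assume a: "alcove \<Phi> \<Delta> x \<subseteq> fund_chamber \<Phi> \<Delta>"
  have "lev x r \<ge> 0" if "r \<in> Pos" for r
    using a basept_in_alcove[of x] that by (fastforce simp: fund_chamber_def lev_def)
  then show "x \<in> Dom" using assms by (simp add: Dom_def)
next
  assume D: "x \<in> Dom"
  show "alcove \<Phi> \<Delta> x \<subseteq> fund_chamber \<Phi> \<Delta>" unfolding fund_chamber_def
  proof (intro subsetI CollectI ballI)
    fix y r assume y: "y \<in> alcove \<Phi> \<Delta> x" and a: "r \<in> Pos"
    have "of_int (lev x r) < y \<cdot> r" using alcove_lev(1)[OF Dom_aff[OF D] _ y] a pos_subset by blast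
    moreover have "(0::real) \<le> of_int (lev x r)" using Dom_lev[OF D a] by simp
    ultimately show "0 < y \<cdot> r" by linarith
  qed
qed

lemma crossing_eq:
  assumes "k < length ss" "set ss \<subseteq> gens" "xx ss k \<in> Dom" "cr (xx ss k) (ss ! k) \<in> Pos"
  shows "crossing \<Phi> \<Delta> ss (Suc k) = (cr (xx ss k) (ss ! k), nat (lev (xx ss k) (cr (xx ss k) (ss ! k)) + 1))"
proof -
  let ?x = "xx ss k" and ?s = "ss ! k"
  let ?b = "cr ?x ?s"
  have s: "?s \<in> gens" using assms(1,2) nth_mem by blast
  have x: "?x \<in> aff" "?x o ?s \<in> aff" using Dom_aff[OF assms(3)] aff_comp gens_aff s by auto
  have b: "?b \<in> \<Phi>" using cr(1)[OF x(1) s] .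
  have l: "lev (?x o ?s) ?b = lev ?x ?b + 1" using cr(2)[OF x(1) s] .
  \<comment> \<open>A positive step from a dominant alcove crosses a hyperplane of index at least 1,
    so the passage to \<open>nat\<close> loses nothing.\<close>
  have N: "int (nat (lev ?x ?b + 1)) = lev ?x ?b + 1" using Dom_lev[OF assms(3,4)] by simp
  show ?thesis unfolding crossing_def diff_Suc_1 xx_def[symmetric] xx_Suc[OF assms(1)]
  proof (rule the_equality)
    have "separates ?b (lev ?x ?b + 1) (alcove \<Phi> \<Delta> ?x) (alcove \<Phi> \<Delta> (?x o ?s))"
      using alcove_lev[OF x(1) b] alcove_lev[OF x(2) b] l unfolding separates_def by fastforce
    then show "fst (?b, nat (lev ?x ?b + 1)) \<in> Pos \<and> separates (fst (?b, nat (lev ?x ?b + 1)))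
      (int (snd (?b, nat (lev ?x ?b + 1)))) (alcove \<Phi> \<Delta> ?x) (alcove \<Phi> \<Delta> (?x o ?s))" using assms(4) N by simp
  next
    fix p :: "'v \<times> nat"
    assume p: "fst p \<in> Pos \<and> separates (fst p) (int (snd p)) (alcove \<Phi> \<Delta> ?x) (alcove \<Phi> \<Delta> (?x o ?s))"
    then have p\<Phi>: "fst p \<in> \<Phi>" using pos_subset by blast
    have "?x basept \<cdot> (fst p) < of_int (int (snd p)) \<and> of_int (int (snd p)) < (?x o ?s) basept \<cdot> (fst p)
      \<or> (?x o ?s) basept \<cdot> (fst p) < of_int (int (snd p)) \<and> of_int (int (snd p)) < ?x basept \<cdot> (fst p)"
      using p basept_in_alcove unfolding separates_def by blast
    then have *: "lev ?x (fst p) < int (snd p) \<and> int (snd p) \<le> lev (?x o ?s) (fst p)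
      \<or> lev (?x o ?s) (fst p) < int (snd p) \<and> int (snd p) \<le> lev ?x (fst p)"
      unfolding lev_def by (auto simp: floor_less_iff le_floor_iff)
    then have "lev (?x o ?s) (fst p) \<noteq> lev ?x (fst p)" by linarith
    then have "fst p = ?b \<or> fst p = - ?b" using cr(3)[OF x(1) s p\<Phi>] by blast
    then have f: "fst p = ?b" using p assms(4) uminus_pos_iff[OF b] by auto
    then have "int (snd p) = lev ?x ?b + 1" using * l by auto
    then show "p = (?b, nat (lev ?x ?b + 1))" using f by (simp add: prod_eq_iff)
  qed
qed

text \<open>Reducedness forces length \<open>k\<close> on the prefix of \<open>k\<close> letters.
  Read backwards from the dominant end, a prefix outside the chamber would be longer than its
  successor, which is impossible; and a lengthening step between dominant alcoves is a positive
  crossing.\<close>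

lemma reduced_exprD:
  assumes "t \<in> Pp" "reduced_expr \<Phi> \<Delta> L (transl t) ss a"
  shows "set ss \<subseteq> gens" "a \<in> We" "len a = 0" "transl t = xx ss (length ss) o a"
    "\<And>k. k < length ss ==> xx ss k \<in> Dom \<and> cr (xx ss k) (ss ! k) \<in> Pos"
proof -
  let ?n = "length ss"
  have tW: "transl t \<in> We" using transl_We Pp_P assms by blast
  show r: "set ss \<subseteq> gens" "a \<in> We" "len a = 0" "transl t = xx ss ?n o a"
    using assms(2) alcove_stab_eq unfolding reduced_expr_def xx_def by auto
  have n: "len (transl t) = ?n" using assms(2) ext_length_eq[OF tW] unfolding reduced_expr_def by simp
  have s: "ss ! k \<in> gens" if "k < ?n" for k using that r(1) nth_mem by blast
  have xW: "xx ss k \<in> We" for k using xx_We r(1) by blast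
  have up: "len (xx ss (Suc k)) \<le> Suc (len (xx ss k))" if "k < ?n" for k
    using len_le_Suc[OF We_aff[OF xW] s[OF that]] xx_Suc[OF that] by simp
  have le: "k \<le> ?n ==> len (xx ss k) \<le> k" for k
  proof (induction k)
    case (Suc k)
    then show ?case using up[of k] by simp
  qed simp
  have "len (xx ss ?n) = ?n" using n r len_comp_right[OF We_aff[OF xW] We_aff[OF r(2)] r(3)] by simp
  then have ge: "j \<le> ?n ==> len (xx ss (?n - j)) \<ge> ?n - j" for j
  proof (induction j)
    case (Suc j)
    then have "len (xx ss (?n - j)) \<le> Suc (len (xx ss (?n - Suc j)))"
      using up[of "?n - Suc j"] by (simp add: Suc_diff_Suc)
    then show ?case using Suc by simp
  qed simp
  have len: "len (xx ss k) = k" if "k \<le> ?n" for k using le[OF that] ge[of "?n - k"] that by simp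
  have "len (transl t) = len (xx ss ?n)" using len[of ?n] n by simp
  have top: "xx ss ?n \<in> Dom"
  proof -
    have "lev (xx ss ?n) \<alpha> = lev (transl t) \<alpha>" if "\<alpha> \<in> \<Phi>" for \<alpha>
      using lev_comp_right[OF We_aff[OF xW] We_aff[OF r(2)] r(3) that] r(4) by simp
    then show ?thesis using Dom_lev[OF transl_Dom[OF assms(1)]] pos_subset xW by (auto simp: Dom_def)
  qed
  have down: "xx ss k \<in> Dom" if k: "k < ?n" and D: "xx ss (Suc k) \<in> Dom" for k
  proof (rule ccontr)
    let ?y = "xx ss (Suc k)"
    have y: "?y o ss ! k = xx ss k" using gens_involution[OF s[OF k]] xx_Suc[OF k] by (simp add: comp_assoc)
    assume "xx ss k \<notin> Dom"
    then have st: "- cr ?y (ss ! k) \<in> \<Delta>" "xx ss k = reflect (- cr ?y (ss ! k)) o ?y"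
      using Dom_step(3)[OF D s[OF k]] y by auto
    have "len (xx ss k) = len (reflect (- cr ?y (ss ! k))) + len ?y"
      using len_weyl_Dom[OF reflect_weyl D] st simple_root by metis
    then show False using len[of k] len[of "Suc k"] k by simp
  qed
  have D: "j \<le> ?n ==> xx ss (?n - j) \<in> Dom" for j
  proof (induction j)
    case (Suc j)
    then show ?case using down[of "?n - Suc j"] by (simp add: Suc_diff_Suc)
  qed (use top in simp)
  have D': "xx ss k \<in> Dom" if "k \<le> ?n" for k using D[of "?n - k"] that by simp
  show "xx ss k \<in> Dom \<and> cr (xx ss k) (ss ! k) \<in> Pos" if k: "k < ?n" for k
  proof
    show "xx ss k \<in> Dom" using D' k by simp
    have "xx ss k o ss ! k \<in> Dom" using D'[of "Suc k"] k xx_Suc[OF k] by simp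
    then show "cr (xx ss k) (ss ! k) \<in> Pos"
      using Dom_step(2)[OF \<open>xx ss k \<in> Dom\<close> s[OF k]] len[of k] len[of "Suc k"] xx_Suc[OF k] k by fastforce
  qed
qed

text \<open>Crossed letters leave the direction unchanged, so only the reflections at folded
  positions accumulate, in increasing order. The final direction is therefore \<open>id\<close>
  exactly if \<open>v\<close> is their product in decreasing order.\<close>

lemma dir_zz:
  assumes "l \<in> P" "v \<in> weyl" "set ss \<subseteq> gens" "k \<le> length ss"
  shows "dir (zz l ss (v, J) k) (xx ss k)
    = v o word_prod (map (\<lambda>r. reflect (cr (xx ss (r - 1)) (ss ! (r - 1)))) (filter (\<lambda>r. r \<in> J) [1..<Suc k]))"
  using assms(4)
proof (induction k)
  case 0
  have "transl l o v \<in> We" using We_comp transl_We weyl_We assms by blast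
  then show ?case
    unfolding zz_0 xx_0 fst_conv dir_id[OF \<open>transl l o v \<in> We\<close>] lin_transl[OF weyl_linear[OF assms(2)]]
    by (simp add: comp_def)
next
  case (Suc k)
  let ?z = "zz l ss (v, J) k" and ?x = "xx ss k"
  have s: "ss ! k \<in> gens" using Suc assms(3) nth_mem[of k ss] by auto
  have "?z \<in> We" "?x \<in> We" using zz_We[OF assms(1) _ assms(3)] xx_We[OF assms(3)] Suc assms(2) by auto
  note ds = dir_step[OF this s]
  have "dir (zz l ss (v, J) (Suc k)) (xx ss (Suc k))
      = (if Suc k \<in> J then dir ?z ?x o reflect (cr ?x (ss ! k)) else dir ?z ?x)"
    unfolding zz_Suc xx_Suc[OF Suc_le_lessD[OF Suc.prems]] using ds by simp
  moreover have "dir ?z ?x = v o word_prod (map (\<lambda>r. reflect (cr (xx ss (r - 1)) (ss ! (r - 1)))) (filter (\<lambda>r. r \<in> J) [1..<Suc k]))"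
    by (rule Suc.IH[OF Suc_leD[OF Suc.prems]])
  moreover have "[1..<Suc (Suc k)] = [1..<Suc k] @ [Suc k]" by simp
  ultimately have "dir (zz l ss (v, J) (Suc k)) (xx ss (Suc k))
      = v o word_prod (map (\<lambda>r. reflect (cr (xx ss (r - 1)) (ss ! (r - 1)))) (filter (\<lambda>r. r \<in> J) [1..<Suc (Suc k)]))"
    by (simp add: word_prod_append comp_assoc del: upt_Suc comp_apply)
  then show ?case .
qed

lemma subexpr_prefix_alcove:
  assumes "a \<in> We" "len a = 0"
  shows "alcove \<Phi> \<Delta> (transl l o v o subexpr_prefix ss a J k) = alcove \<Phi> \<Delta> (zz l ss (v, J) k)"
proof -
  have "a ` A0 = A0" using assms alcove_stab_eq unfolding alcove_stab_def by blast
  then have "(if k < length ss then id else a) ` A0 = A0" by simp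
  then show ?thesis
    unfolding alcove_def zz_def subexpr_prefix_def fst_conv snd_conv image_comp[symmetric] by (simp only:)
qed

text \<open>The paths in the definition of dominance start after the first letter; the starting alcove is
  dominant as well, because the first crossing cannot leave a hyperplane through the origin.\<close>

lemma start_dominant:
  assumes "l \<in> Pp" "v \<in> weyl" "s \<in> gens" "cr id s \<in> Pos" "transl l o v o s \<in> Dom"
  shows "transl l o v \<in> Dom"
proof -
  let ?y = "transl l o v" and ?b = "cr id s"
  have l: "l \<in> P" using Pp_P assms by blast
  have y: "?y \<in> We" using We_comp transl_We weyl_We assms l by blast
  have b: "?b \<in> \<Phi>" using assms(4) pos_subset by blast
  have vb: "v ?b \<in> \<Phi>" using weyl_root assms(2) b by blast
  have c: "cr ?y s = v ?b"
    using cr(5)[OF id_aff assms(3) We_aff[OF y]] lin_transl[OF weyl_linear[OF assms(2)], of l] by simp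
  have "lev ?y r \<ge> 0" if a: "r \<in> Pos" for r
  proof -
    have a\<Phi>: "r \<in> \<Phi>" using a pos_subset by blast
    have ge: "lev (?y o s) r \<ge> 0" using Dom_lev[OF assms(5) a] .
    consider "r \<noteq> v ?b" "r \<noteq> - v ?b" | "r = - v ?b" | "r = v ?b" by blast
    then show ?thesis
    proof cases
      case 1
      then show ?thesis using cr(3)[OF We_aff[OF y] assms(3) a\<Phi>] c ge by simp
    next
      case 2
      have "lev (?y o s) (v ?b) = lev ?y (v ?b) + 1" using cr(2)[OF We_aff[OF y] assms(3)] c by simp
      then show ?thesis using ge lev_uminus[OF We_aff[OF y] vb] lev_uminus[OF Dom_aff[OF assms(5)] vb] 2 by simp
    next
      case 3
      have "lev v (v ?b) = 0" using lev_weyl_id[OF assms(2) b] lev_id_pos[OF assms(4)] by simp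
      then have "of_int (lev ?y r) = l \<cdot> r" using lev_transl[OF P_intwt[OF l] a\<Phi>, of v] 3 by simp
      moreover have "0 \<le> l \<cdot> r" using assms(1) a by (simp add: dom_weights_def)
      ultimately show ?thesis by (metis of_int_0_le_iff)
    qed
  qed
  then show ?thesis using y by (simp add: Dom_def)
qed

text \<open>Along the gallery a lossless fold goes down in the Bruhat order; read from the last fold
  backwards it is a step up of the saturated chain defining admissibility.\<close>

lemma folds_iff_covers:
  assumes "u \<in> weyl" "u = u' o reflect (cr x s)" "dir z x = u" "cr x s \<in> Pos"
  shows "folds z x s \<longleftrightarrow> bruhat_covers F u' u \<and> L s = wt (cr x s) 0"
proof -
  let ?r = "reflect (cr x s)"
  have b: "cr x s \<in> \<Phi>" using assms(4) pos_subset by blast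
  have u': "u o ?r = u'" unfolding assms(2) by (rule reflect_twice[OF b])
  have "u' \<in> weyl" using weyl_comp[OF assms(1) reflect_weyl[OF b]] unfolding u' .
  from bruhat_covers_reflect[OF this b] have "bruhat_covers F u' u \<longleftrightarrow> len u = len u' + 1"
    unfolding assms(2)[symmetric] .
  then show ?thesis using len_comp_reflect(2)[OF assms(1,4)] unfolding folds_def assms(3) u' by auto
qed

text \<open>The end condition determines \<open>v\<close> from \<open>J\<close>. For this
  \<open>v\<close> the direction just before fold \<open>i\<close> is the product of the reflections
  at the positions of \<open>J\<close> from the largest down to \<open>i\<close>, so lossless folds
  amount to admissibility together with maximality.\<close>

lemma galleries_eq_subsets:
  assumes "\<kappa> \<in> Pp" "set ss \<subseteq> gens" "a \<in> We" "len a = 0"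
    and pos: "\<And>k. k < length ss ==> xx ss k \<in> Dom \<and> cr (xx ss k) (ss ! k) \<in> Pos"
  shows "{p \<in> Gal \<kappa> ss (length ss). dir (zz \<kappa> ss p (length ss)) (xx ss (length ss)) = id}
    = (\<lambda>J. (v_elt \<Phi> \<Delta> ss J, J)) ` {J. J \<subseteq> {1..length ss} \<and> admissible \<Phi> \<Delta> ss J \<and>
        maximal_subset \<Phi> \<Delta> L ss J \<and> dominant_subset \<Phi> \<Delta> ss a \<kappa> J}"
proof -
  let ?n = "length ss"
  let ?b = "\<lambda>r. cr (xx ss (r - 1)) (ss ! (r - 1))"
  let ?f = "\<lambda>J i. filter (\<lambda>r. r \<in> J) [1..<Suc i]" and ?g = "\<lambda>J i. filter (\<lambda>r. r \<in> J) [Suc i..<Suc ?n]"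
  let ?r = "map (\<lambda>r. reflect (?b r))"
  have \<kappa>: "\<kappa> \<in> P" using Pp_P assms by blast
  have b: "?b r \<in> Pos" "?b r \<in> \<Phi>" "beta_root \<Phi> \<Delta> ss r = ?b r" if "r \<in> {1..?n}" for r
  proof -
    have k: "r - 1 < ?n" "Suc (r - 1) = r" using that by auto
    then show "?b r \<in> Pos" using pos by blast
    then show "?b r \<in> \<Phi>" using pos_subset by blast
    show "beta_root \<Phi> \<Delta> ss r = ?b r"
      using crossing_eq[OF k(1) assms(2)] pos[OF k(1)] unfolding k(2) by (simp add: beta_root_def)
  qed
  have main: "(v, J) \<in> Gal \<kappa> ss ?n \<and> dir (zz \<kappa> ss (v, J) ?n) (xx ss ?n) = id \<longleftrightarrow>
      v = v_elt \<Phi> \<Delta> ss J \<and> admissible \<Phi> \<Delta> ss J \<and> maximal_subset \<Phi> \<Delta> L ss J \<and> dominant_subset \<Phi> \<Delta> ss a \<kappa> J"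
    if J: "J \<subseteq> {1..?n}" and v: "v \<in> weyl" for v J
  proof -
    have refls: "J_refls \<Phi> \<Delta> ss J = ?r (rev (?f J ?n))"
    proof -
      have "set (rev (?f J ?n)) \<subseteq> {1..?n}" by auto
      then show ?thesis unfolding J_refls_def sorted_list_of_subset[OF J] using b(3) by (intro map_cong) auto
    qed
    have vJ: "v_elt \<Phi> \<Delta> ss J = word_prod (rev (?r (?f J ?n)))" unfolding v_elt_def refls by (simp only: rev_map)
    have inv: "s o s = id" if "s \<in> set (?r l)" "set l \<subseteq> {1..?n}" for s l using that b(2) reflect_comp by auto
    have "set (?f J ?n) \<subseteq> {1..?n}" by auto
    note W = word_prod_rev_involutions[OF inv[OF _ this]]
    have W': "word_prod (?r (?f J ?n)) o word_prod (rev (?r (?f J ?n))) = id"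
      using word_prod_rev_involutions[of "rev (?r (?f J ?n))", OF inv[OF _ \<open>set (?f J ?n) \<subseteq> {1..?n}\<close>]]
      unfolding rev_rev_ident set_rev .
    have end_iff: "dir (zz \<kappa> ss (v, J) ?n) (xx ss ?n) = id \<longleftrightarrow> v = v_elt \<Phi> \<Delta> ss J"
      unfolding dir_zz[OF \<kappa> v assms(2) order_refl] vJ
    proof
      assume "v o word_prod (?r (?f J ?n)) = id"
      from arg_cong[OF this, of "\<lambda>g. g o word_prod (rev (?r (?f J ?n)))"]
      show "v = word_prod (rev (?r (?f J ?n)))" unfolding comp_assoc W' comp_id id_comp .
    next
      assume v: "v = word_prod (rev (?r (?f J ?n)))"
      show "v o word_prod (?r (?f J ?n)) = id" unfolding v by (rule W)
    qed
    have dom_iff: "dominant_subset \<Phi> \<Delta> ss a \<kappa> J \<longleftrightarrow> (\<forall>i\<in>{1..?n}. zz \<kappa> ss (v, J) i \<in> Dom)" if "v = v_elt \<Phi> \<Delta> ss J"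
      unfolding dominant_subset_def path_in_def that[symmetric] subexpr_prefix_alcove[OF assms(3,4)]
      using alcove_fund_chamber zz_We[OF \<kappa> _ assms(2), of "(v, J)"] v by auto
    have fold_iff: "(\<forall>i\<in>J. folds (zz \<kappa> ss (v, J) (i - 1)) (xx ss (i - 1)) (ss ! (i - 1)))
        \<longleftrightarrow> admissible \<Phi> \<Delta> ss J \<and> maximal_subset \<Phi> \<Delta> L ss J" if veq: "v = v_elt \<Phi> \<Delta> ss J"
    proof -
      have "folds (zz \<kappa> ss (v, J) (i - 1)) (xx ss (i - 1)) (ss ! (i - 1)) \<longleftrightarrow>
          bruhat_covers F (word_prod (?r (rev (?g J i)))) (word_prod (?r (rev (?g J i) @ [i])))
          \<and> L (ss ! (i - 1)) = root_weight \<Phi> \<Delta> L (beta_root \<Phi> \<Delta> ss i)" if i: "i \<in> J" for i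
      proof -
        have iJ: "i \<in> {1..?n}" using i J by blast
        have "[1..<Suc ?n] = [1..<i] @ i # [Suc i..<Suc ?n]" by (rule upt_split[OF iJ])
        then have "?f J ?n = filter (\<lambda>r. r \<in> J) [1..<i] @ i # ?g J i"
          using i by (simp only: filter_append filter.simps if_True)
        moreover have Si: "Suc (i - 1) = i" using iJ by simp
        ultimately have split: "rev (?f J ?n) = (rev (?g J i) @ [i]) @ rev (?f J (i - 1))"
          by (simp only: rev_append rev.simps append_assoc append_Cons append_Nil)
        have "set (?f J (i - 1)) \<subseteq> {1..?n}" using iJ by auto
        note W1 = word_prod_rev_involutions[OF inv[OF _ this]]
        have "v = word_prod (?r (rev (?g J i) @ [i])) o word_prod (rev (?r (?f J (i - 1))))"
          unfolding veq v_elt_def refls split by (simp only: map_append word_prod_append rev_map)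
        moreover have "dir (zz \<kappa> ss (v, J) (i - 1)) (xx ss (i - 1)) = v o word_prod (?r (?f J (i - 1)))"
          using iJ by (intro dir_zz[OF \<kappa> v assms(2)]) (simp add: le_diff_conv)
        ultimately have d: "dir (zz \<kappa> ss (v, J) (i - 1)) (xx ss (i - 1)) = word_prod (?r (rev (?g J i) @ [i]))"
          using W1 by (simp only: comp_assoc comp_id)
        have "zz \<kappa> ss (v, J) (i - 1) \<in> We" "xx ss (i - 1) \<in> We"
          using zz_We[OF \<kappa> _ assms(2), of "(v, J)" "i - 1"] xx_We[OF assms(2)] v iJ by auto
        from dir_weyl[OF this] have u: "word_prod (?r (rev (?g J i) @ [i])) \<in> weyl" unfolding d .
        have "word_prod (?r (rev (?g J i) @ [i])) = word_prod (?r (rev (?g J i))) o reflect (?b i)"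
          by (simp add: word_prod_append)
        from folds_iff_covers[OF u this d b(1)[OF iJ]] show ?thesis
          unfolding b(3)[OF iJ] root_weight_eq[OF b(1)[OF iJ]] .
      qed
      then have "(\<forall>i\<in>J. folds (zz \<kappa> ss (v, J) (i - 1)) (xx ss (i - 1)) (ss ! (i - 1))) \<longleftrightarrow>
          (\<forall>i\<in>J. bruhat_covers F (word_prod (?r (rev (?g J i)))) (word_prod (?r (rev (?g J i) @ [i]))))
          \<and> maximal_subset \<Phi> \<Delta> L ss J" unfolding maximal_subset_def by blast
      also have "(\<forall>i\<in>J. bruhat_covers F (word_prod (?r (rev (?g J i)))) (word_prod (?r (rev (?g J i) @ [i]))))
          \<longleftrightarrow> admissible \<Phi> \<Delta> ss J"
        using all_prefixes_iff[OF J, of "\<lambda>l l'. bruhat_covers F (word_prod (?r l)) (word_prod (?r l'))"] J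
        unfolding admissible_def refls sorted_list_of_subset[OF J] take_map by blast
      finally show ?thesis .
    qed
    \<comment> \<open>\<open>Gal\<close> also asks for a dominant starting alcove. If the first
      letter is folded, the start is the first alcove of the path; otherwise
      \<open>start_dominant\<close> applies; for an empty word \<open>v\<close> is
      \<open>id\<close>.\<close>
    have start: "transl \<kappa> o v \<in> Dom" if "v = v_elt \<Phi> \<Delta> ss J" "\<forall>i\<in>{1..?n}. zz \<kappa> ss (v, J) i \<in> Dom"
    proof (cases "?n = 0")
      case True
      then have "v = id" using that(1) J by (simp add: v_elt_def J_refls_def)
      then show ?thesis using transl_Dom[OF assms(1)] by (simp only: comp_id)
    next
      case False
      then have "Suc 0 \<in> {1..?n}" by (simp add: Suc_le_eq)
      with that(2) have z: "zz \<kappa> ss (v, J) (Suc 0) \<in> Dom" by blast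
      show ?thesis
      proof (cases "Suc 0 \<in> J")
        case True
        then show ?thesis using z by (simp add: zz_Suc zz_0)
      next
        case J: False
        have "ss ! 0 \<in> gens" "cr id (ss ! 0) \<in> Pos" using False assms(2) pos[of 0] nth_mem[of 0 ss] by auto
        then show ?thesis using start_dominant[OF assms(1) v, of "ss ! 0"] z J by (simp add: zz_Suc zz_0)
      qed
    qed
    show ?thesis using end_iff dom_iff fold_iff start J v unfolding Gal_def VV_def by auto
  qed
  have v: "v_elt \<Phi> \<Delta> ss J \<in> weyl" if J: "J \<subseteq> {1..?n}" for J
  proof -
    have "word_prod (?r l) \<in> weyl" if "set l \<subseteq> {1..?n}" for l
      using that by (induction l) (use b(2) reflect_weyl weyl_comp in auto)
    moreover have "finite J" using J finite_subset by blast
    ultimately have "word_prod (?r (rev (sorted_list_of_set J))) \<in> weyl" using J by simp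
    moreover have "J_refls \<Phi> \<Delta> ss J = ?r (rev (sorted_list_of_set J))"
      unfolding J_refls_def using b(3) J \<open>finite J\<close> by (intro map_cong) auto
    ultimately show ?thesis by (simp add: v_elt_def)
  qed
  show ?thesis
  proof (intro set_eqI iffI)
    fix p assume p: "p \<in> {p \<in> Gal \<kappa> ss ?n. dir (zz \<kappa> ss p ?n) (xx ss ?n) = id}"
    then have "snd p \<subseteq> {1..?n}" "fst p \<in> weyl" unfolding Gal_def VV_def by auto
    from main[OF this] p show "p \<in> (\<lambda>J. (v_elt \<Phi> \<Delta> ss J, J)) ` {J. J \<subseteq> {1..?n} \<and> admissible \<Phi> \<Delta> ss J \<and>
        maximal_subset \<Phi> \<Delta> L ss J \<and> dominant_subset \<Phi> \<Delta> ss a \<kappa> J}" using \<open>snd p \<subseteq> {1..?n}\<close> by (cases p) auto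
  next
    fix p assume "p \<in> (\<lambda>J. (v_elt \<Phi> \<Delta> ss J, J)) ` {J. J \<subseteq> {1..?n} \<and> admissible \<Phi> \<Delta> ss J \<and>
        maximal_subset \<Phi> \<Delta> L ss J \<and> dominant_subset \<Phi> \<Delta> ss a \<kappa> J}"
    then obtain J where J: "p = (v_elt \<Phi> \<Delta> ss J, J)" "J \<subseteq> {1..?n}" "admissible \<Phi> \<Delta> ss J"
      "maximal_subset \<Phi> \<Delta> L ss J" "dominant_subset \<Phi> \<Delta> ss a \<kappa> J" by blast
    then show "p \<in> {p \<in> Gal \<kappa> ss ?n. dir (zz \<kappa> ss p ?n) (xx ss ?n) = id}" using main[OF J(2) v[OF J(2)]] by blast
  qed
qed

end

theorem corollary5p12:
  fixes \<Phi> \<Delta> :: "'v::euclidean_space set"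
    and L :: "('v \<Rightarrow> 'v) \<Rightarrow> nat"
    and m :: "'v hecke \<Rightarrow> 'v hecke \<Rightarrow> 'v hecke"
    and \<kappa> \<tau> :: 'v
    and ss :: "('v \<Rightarrow> 'v) list"
    and a :: "'v \<Rightarrow> 'v"
  assumes "irreducible_root_system \<Phi>"
    and "simple_roots \<Phi> \<Delta>"
    and "pos_weight_function \<Phi> \<Delta> L"
    and "0 \<in> L_weights \<Phi> \<Delta> L"
    and "hecke_mult \<Phi> \<Delta> L m"
    and "\<kappa> \<in> dom_weights \<Phi> \<Delta> L"
    and "\<tau> \<in> dom_weights \<Phi> \<Delta> L"
    and "reduced_expr \<Phi> \<Delta> L (transl \<tau>) ss a"
  shows "m (KL_basis \<Phi> \<Delta> L m (longest_elt \<Phi> \<Delta> \<circ> transl \<kappa>)) (weyl_character \<Phi> \<Delta> L m \<tau>)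
           = m (KL_basis \<Phi> \<Delta> L m (longest_elt \<Phi> \<Delta> \<circ> transl \<kappa>)) (h_elt \<Phi> \<Delta> L m \<tau>) \<and>
         m (KL_basis \<Phi> \<Delta> L m (longest_elt \<Phi> \<Delta> \<circ> transl \<kappa>)) (h_elt \<Phi> \<Delta> L m \<tau>)
           = (\<Sum>J | J \<subseteq> {1..length ss} \<and> admissible \<Phi> \<Delta> ss J \<and>
                    maximal_subset \<Phi> \<Delta> L ss J \<and> dominant_subset \<Phi> \<Delta> ss a \<kappa> J.
                KL_basis \<Phi> \<Delta> L m
                  (longest_elt \<Phi> \<Delta> \<circ> transl \<kappa> \<circ> v_elt \<Phi> \<Delta> ss J \<circ> subexpr ss a J))"
proof -
  interpret affine_hecke \<Phi> \<Delta> L m by unfold_locales (use assms in simp_all)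
  let ?C = "C0 \<star> ch \<kappa>" and ?n = "length ss"
  note r = reduced_exprD[OF assms(7,8)]
  have KL: "KL_basis \<Phi> \<Delta> L m (w0 o transl \<kappa>) = ?C" by (rule KL_translation[OF assms(6)])
  have h: "m ?C (kk \<tau>) = ?C \<star> kk \<tau>" "m ?C (ch \<tau>) = ?C \<star> ch \<tau>" by (simp_all add: mm_m kk(1)[OF assms(7)])
  \<comment> \<open>\<open>ch \<kappa>\<close> commutes with \<open>C0\<close>, so it can be moved
    to the left, where \<open>C0 \<star> ch \<tau>\<close> equals
    \<open>C0 \<star> kk \<tau>\<close>, and back again.\<close>
  have "?C \<star> ch \<tau> = ?C \<star> kk \<tau>" using kk(3)[OF assms(7)] ch_commute(3)[OF assms(6)] by (metis mm_assoc)
  moreover have "?C \<star> kk \<tau> = (\<Sum>J | J \<subseteq> {1..?n} \<and> admissible \<Phi> \<Delta> ss J \<and> maximal_subset \<Phi> \<Delta> L ss J \<and>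
      dominant_subset \<Phi> \<Delta> ss a \<kappa> J. KL_basis \<Phi> \<Delta> L m (w0 o transl \<kappa> o v_elt \<Phi> \<Delta> ss J o subexpr ss a J))"
  proof -
    have z: "w0 o (zz \<kappa> ss (v_elt \<Phi> \<Delta> ss J, J) ?n o a) = w0 o transl \<kappa> o v_elt \<Phi> \<Delta> ss J o subexpr ss a J" for J
      by (simp add: zz_def subexpr_def subexpr_prefix_def comp_assoc)
    have inj: "inj_on (\<lambda>J. (v_elt \<Phi> \<Delta> ss J, J)) A" for A by (simp add: inj_on_def)
    have G: "{p \<in> Gal \<kappa> ss ?n. dir (zz \<kappa> ss p ?n) (xx ss ?n) = id} = (\<lambda>J. (v_elt \<Phi> \<Delta> ss J, J)) `
        {J. J \<subseteq> {1..?n} \<and> admissible \<Phi> \<Delta> ss J \<and> maximal_subset \<Phi> \<Delta> L ss J \<and> dominant_subset \<Phi> \<Delta> ss a \<kappa> J}"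
      by (rule galleries_eq_subsets[OF assms(6) r(1-3)]) (rule r(5))
    show ?thesis
    proof (rule trans[OF product_formula[OF assms(6,7) r(1) _ r(2-4)]])
      show "xx ss i \<in> Dom \<and> cr (xx ss i) (ss ! i) \<in> Pos" if "i < ?n" for i by (rule r(5)[OF that])
    qed (simp only: G sum.reindex[OF inj, unfolded comp_def] z)
  qed
  ultimately show ?thesis unfolding KL weyl_character_eq[OF assms(7)] h_elt_eq[OF assms(7)] h by simp
qed

end
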